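(* Let $X_n=T^*\mathbb{F}l_n$ and consider the normalized vertex function coefficients $\mathsf V_{\mathbf p}$ of the K-theory of quasimaps to $X_n$ for all fixed points $\mathbf p$ of the maximal torus. Let $\lambda$ be a partition of $k$ of length $n$, $\lambda_1\ge\dots\ge\lambda_n$ (possibly completed by zeros). Let the equivariant parameters satisfy $$\frac{a_{i+1}}{a_i}=q^{\ell_i}\hbar,\qquad \ell_i=\lambda_{i+1}-\lambda_i,\qquad i=1,\dots,n-1.$$ Then there exists a fixed point $\mathbf q$ for which $$\mathsf V_{\mathbf q}=P_\lambda(\boldsymbol\zeta;q,\hbar),$$ the symmetric Macdonald polynomial in $\boldsymbol\zeta=(\zeta_1,\dots,\zeta_n)$ (considered up to normalization).
   Context: Parameters: $q,\hbar$ generic nonzero; $a_1,\dots,a_n$ equivariant parameters of the maximal torus of $GL(n)$; $t=q/\hbar$; quantum parameters $z_i=\zeta_i/\zeta_{i+1}$. Set $(x,q)_\infty=\prod_{i\ge0}(1-q^ix)$, $(x,q)_d=(x,q)_\infty/(q^dx,q)_\infty$ for $d\in\mathbb Z$ ($1/(q,q)_d=0$ for $d<0$), $\theta(x,q)=(x,q)_\infty(qx^{-1},q)_\infty$. A fixed point $\mathbf p$ of $X_n$ is a chain $\mathbf V_1\subset\dots\subset\mathbf V_{n-1}\subset\{a_1,\dots,a_n\}$ with $|\mathbf V_i|=i$; write $\mathbf V_i=\{x_{i,1},\dots,x_{i,i}\}$, $x_{n,k}=a_k$, $d_{n,k}=0$. The vertex coefficient is $$V^{(1)}_{\mathbf p}=\sum_{\{d_{i,j}\}\in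 C}\ \prod_{i=1}^{n-1}\left(t\frac{\zeta_i}{\zeta_{i+1}}\right)^{d_i}\prod_{j,k=1}^{i}\frac{\left(q\frac{x_{i,k}}{x_{i,j}},q\right)_{d_{i,j}-d_{i,k}}}{\left(\hbar\frac{x_{i,k}}{x_{i,j}},q\right)_{d_{i,j}-d_{i,k}}}\cdot\prod_{j=1}^{i}\prod_{k=1}^{i+1}\frac{\left(\hbar\frac{x_{i+1,k}}{x_{i,j}},q\right)_{d_{i,j}-d_{i+1,k}}}{\left(q\frac{x_{i+1,k}}{x_{i,j}},q\right)_{d_{i,j}-d_{i+1,k}}},$$ where $d_i=\sum_jd_{i,j}$ and $C$ is the set of collections of integers $d_{i,j}\ge0$ ($1\le j\le i\le n-1$) such that for each $i=1,\dots,n-2$ there are $i$ distinct indices $j_1,\dots,j_i$ with $d_{i,k}\ge d_{i+1,j_k}$ for all $k$. The normalized coefficient is $$\mathsf V_{\mathbf p}=\prod_{i=1}^n\frac{\theta(\hbar^{i-n}\zeta_i,q)}{\theta(a_i\zeta_i,q)}\cdot V^{(1)}_{\mathbf p}.$$ $P_\lambda(\boldsymbol\zeta;q,\hbar)$ is the symmetric Macdonald polynomial in $n$ variables with Macdonald parameters $(q,t_{\mathrm{Mac}}=\hbar)$: the symmetric polynomial with leading monomial symmetric function $m_\lambda$ that is a joint eigenfunction of the Macdonald operators $T_r(\boldsymbol\zeta)=\sum_{|\mathcal I|=r}\prod_{i\in\mathcal I,j\notin\mathcal I}\frac{\hbar\zeta_i-\zeta_j}{\zeta_i-\zeta_j}\prod_{i\in\mathcal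 I}p_i$, where $p_i$ shifts $\zeta_i\mapsto q\zeta_i$. The polynomial is considered up to an overall scalar normalization.
   Formalization: Signs and scale corrected: in ℓ_i the parts of λ are taken in increasing order, the weights are x_{n,k}=1/a_k instead of a_k, and V_q=c·P_λ is claimed for a_n=q^{λ_1}; for other scales an explicit quotient of theta functions appears as an extra factor. *)

theory Defs
  imports "HOL-Analysis.Analysis"
begin

subsection \<open>$q$-special functions\<close>

text \<open>$(x,q)_\infty$, for $|q| < 1$.\<close>
definition qinf :: "complex \<Rightarrow> complex \<Rightarrow> complex" where
  "qinf x q = (\<Prod>i. 1 - q ^ i * x)"

text \<open>
  $(x,q)_d$ for an integer $d$.  The quotient $(x,q)_\infty / (q^d x,q)_\infty$ is a rational
  function of $x$, but at $x = q^{-l}$ with $0 \le d \le l$ it reads $0/0$, although these are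
  ordinary points of the function.  Such $x$ do occur below, so the rational function is written
  out; lemma \<open>qpoch_eq_quotient\<close> identifies it with the quotient.
  For $d < 0$ the value $1/(q,q)_d = 0$ comes out of \<open>1 / 0 = 0\<close>.
\<close>
definition qpoch :: "complex \<Rightarrow> complex \<Rightarrow> int \<Rightarrow> complex" where
  "qpoch x q d =
     (if d \<ge> 0 then (\<Prod>i<nat d. 1 - q ^ i * x)
      else 1 / (\<Prod>i=1..nat (- d). 1 - x / q ^ i))"

definition qtheta :: "complex \<Rightarrow> complex \<Rightarrow> complex" where
  "qtheta x q = qinf x q * qinf (q / x) q"

lemma qinf_factor_convergent:
  assumes "norm q < 1"
  shows "convergent_prod (\<lambda>i. 1 - q ^ i * (x::complex))"
proof -
  have "summable (\<lambda>i. norm q ^ i * norm x)"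
    using assms by (intro summable_mult2 summable_geometric) simp
  hence "summable (\<lambda>i. norm ((1 - q ^ i * x) - 1))"
    by (simp add: norm_mult norm_power)
  hence "abs_convergent_prod (\<lambda>i. 1 - q ^ i * x)"
    by (simp add: abs_convergent_prod_conv_summable)
  thus ?thesis by (rule abs_convergent_prod_imp_convergent_prod)
qed

lemma qinf_step:
  assumes "norm q < 1"
  shows "qinf x q = (1 - x) * qinf (q * x) q"
proof -
  have "(\<lambda>n. \<Prod>i\<le>n. 1 - q ^ i * (q * x)) \<longlonglongrightarrow> qinf (q * x) q"
    unfolding qinf_def by (intro convergent_prod_LIMSEQ qinf_factor_convergent assms)
  hence "(\<lambda>n. (1 - x) * (\<Prod>i\<le>n. 1 - q ^ i * (q * x))) \<longlonglongrightarrow> (1 - x) * qinf (q * x) q"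
    by (intro tendsto_intros)
  also have "(\<lambda>n. (1 - x) * (\<Prod>i\<le>n. 1 - q ^ i * (q * x))) = (\<lambda>n. \<Prod>i\<le>Suc n. 1 - q ^ i * x)"
    by (rule ext, subst prod.atMost_Suc_shift) (simp add: mult_ac)
  finally have 1: "(\<lambda>n. \<Prod>i\<le>Suc n. 1 - q ^ i * x) \<longlonglongrightarrow> (1 - x) * qinf (q * x) q" .
  have "(\<lambda>n. \<Prod>i\<le>n. 1 - q ^ i * x) \<longlonglongrightarrow> qinf x q"
    unfolding qinf_def by (intro convergent_prod_LIMSEQ qinf_factor_convergent assms)
  hence "(\<lambda>n. \<Prod>i\<le>Suc n. 1 - q ^ i * x) \<longlonglongrightarrow> qinf x q"
    by (rule LIMSEQ_Suc)
  thus ?thesis using 1 by (rule LIMSEQ_unique)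
qed

lemma qinf_steps:
  assumes "norm q < 1"
  shows "qinf x q = (\<Prod>i<m. 1 - q ^ i * x) * qinf (q ^ m * x) q"
proof (induction m)
  case (Suc m)
  show ?case using Suc qinf_step[OF assms, of "q ^ m * x"] by (simp add: mult_ac)
qed simp

lemma qpoch_eq_quotient:
  assumes "norm q < 1" "q \<noteq> 0" "qinf (q powi d * x) q \<noteq> 0"
  shows "qpoch x q d = qinf x q / qinf (q powi d * x) q"
proof (cases "d \<ge> 0")
  case True
  then show ?thesis
    using qinf_steps[OF assms(1), of x "nat d"] assms(3) by (simp add: qpoch_def power_int_def)
next
  case False
  define m where "m = nat (- d)"
  define y where "y = x / q ^ m"
  have y: "q powi d * x = y"
    using False by (simp add: power_int_def m_def y_def field_simps)
  have "qinf y q = (\<Prod>i<m. 1 - q ^ i * y) * qinf x q"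
    using qinf_steps[OF assms(1), of y m] assms(2) by (simp add: y_def)
  also have "(\<Prod>i<m. 1 - q ^ i * y) = (\<Prod>i=1..m. 1 - x / q ^ i)"
  proof (rule prod.reindex_bij_witness[of _ "\<lambda>i. m - i" "\<lambda>i. m - i"])
    fix i assume "i \<in> {..<m}"
    hence "q ^ m = q ^ i * q ^ (m - i)" by (simp flip: power_add)
    thus "1 - x / q ^ (m - i) = 1 - q ^ i * y" using assms(2) by (simp add: y_def)
  qed auto
  finally have *: "qinf y q = (\<Prod>i=1..m. 1 - x / q ^ i) * qinf x q" .
  moreover have "qinf y q \<noteq> 0" using assms(3) y by simp
  ultimately show ?thesis
    using False y by (simp add: qpoch_def m_def field_simps)
qed

definition generic :: "complex \<Rightarrow> complex \<Rightarrow> bool" where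
  "generic q h \<longleftrightarrow> q \<noteq> 0 \<and> norm q < 1 \<and> h \<noteq> 0 \<and>
     (\<forall>i j :: int. q powi i * h powi j = 1 \<longrightarrow> i = 0 \<and> j = 0)"


subsection \<open>Vertex functions of the cotangent bundle of the flag variety\<close>

text \<open>
  Fixed points are given with a labelling: \<open>x i 1, \<dots>, x i i\<close> enumerates
  $\mathbf{V}_i$, and $\mathbf{V}_n$ is the set of framing weights.

  Sign convention: the weights are $a_k^{-1}$, that is, $a_1, \dots, a_n$ are the coordinates on
  the torus acting on the dual framing.  With this choice the theta prefactor in
  \<open>vertex_normalized\<close> turns the vertex series into an eigenfunction of the operators
  \<open>macdonald_op\<close> with eigenvalues proportional to the elementary symmetric functions in
  $a_1, \dots, a_n$, namely at the fixed point \<open>x i k = 1 / a k\<close>; the choice $x_{n,k} = a_k$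
  would require $a_i^{-1}$ in that prefactor.
\<close>
definition fixed_point :: "nat \<Rightarrow> (nat \<Rightarrow> complex) \<Rightarrow> (nat \<Rightarrow> nat \<Rightarrow> complex) \<Rightarrow> bool" where
  "fixed_point n a x \<longleftrightarrow>
     (\<forall>k\<in>{1..n}. x n k = 1 / a k) \<and>
     (\<forall>i\<in>{1..<n}. inj_on (x i) {1..i} \<and> x i ` {1..i} \<subseteq> x (Suc i) ` {1..Suc i})"

text \<open>
  The index set $C$.  Degrees are functions of both indices that vanish outside
  $1 \le j \le i \le n - 1$, so $d_{n,k} = 0$ is built in.
\<close>
definition degrees :: "nat \<Rightarrow> (nat \<Rightarrow> nat \<Rightarrow> nat) set" where
  "degrees n = {d.
     (\<forall>i j. \<not> (1 \<le> j \<and> j \<le> i \<and> i < n) \<longrightarrow> d i j = 0) \<and>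
     (\<forall>i\<in>{1..n-2}. \<exists>J. inj_on J {1..i} \<and> J ` {1..i} \<subseteq> {1..Suc i} \<and>
        (\<forall>k\<in>{1..i}. d i k \<ge> d (Suc i) (J k)))}"

text \<open>
  The coefficients are rational functions of the weights.  On the locus
  $a_{i+1}/a_i = q^{l_i} h$ with $l_i \ge 0$, a factor $(h x_{i,k}/x_{i,j},q)_d$ of a denominator
  can vanish.  At the fixed point \<open>x i k = 1 / a k\<close> every such term has more vanishing factors
  in its numerator than in its denominator, so it tends to \<open>0\<close> as generic weights approach
  the locus, which is also its value by \<open>_ / 0 = 0\<close>.
\<close>
definition vertex_term ::
  "nat \<Rightarrow> complex \<Rightarrow> complex \<Rightarrow> (nat \<Rightarrow> complex) \<Rightarrow> (nat \<Rightarrow> nat \<Rightarrow> complex) \<Rightarrow>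
     (nat \<Rightarrow> nat \<Rightarrow> nat) \<Rightarrow> complex" where
  "vertex_term n q h \<zeta> x d =
     (\<Prod>i\<in>{1..<n}.
        (q / h * (\<zeta> i / \<zeta> (Suc i))) ^ (\<Sum>j=1..i. d i j) *
        (\<Prod>j=1..i. \<Prod>k=1..i.
           qpoch (q * (x i k / x i j)) q (int (d i j) - int (d i k)) /
           qpoch (h * (x i k / x i j)) q (int (d i j) - int (d i k))) *
        (\<Prod>j=1..i. \<Prod>k=1..Suc i.
           qpoch (h * (x (Suc i) k / x i j)) q (int (d i j) - int (d (Suc i) k)) /
           qpoch (q * (x (Suc i) k / x i j)) q (int (d i j) - int (d (Suc i) k))))"

definition vertex ::
  "nat \<Rightarrow> complex \<Rightarrow> complex \<Rightarrow> (nat \<Rightarrow> complex) \<Rightarrow> (nat \<Rightarrow> nat \<Rightarrow> complex) \<Rightarrow> complex" where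
  "vertex n q h \<zeta> x = (\<Sum>\<^sub>\<infinity>d\<in>degrees n. vertex_term n q h \<zeta> x d)"

definition vertex_normalized ::
  "nat \<Rightarrow> complex \<Rightarrow> complex \<Rightarrow> (nat \<Rightarrow> complex) \<Rightarrow> (nat \<Rightarrow> nat \<Rightarrow> complex) \<Rightarrow>
     (nat \<Rightarrow> complex) \<Rightarrow> complex" where
  "vertex_normalized n q h a x \<zeta> =
     (\<Prod>i=1..n. qtheta (h powi (int i - int n) * \<zeta> i) q / qtheta (a i * \<zeta> i) q) *
     vertex n q h \<zeta> x"


subsection \<open>Macdonald polynomials in $n$ variables\<close>

text \<open>Partitions of \<open>k\<close> with \<open>n\<close> parts, zeros allowed; the parts are \<open>\<mu> 1, \<dots>, \<mu> n\<close>.\<close>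
definition is_partition :: "nat \<Rightarrow> nat \<Rightarrow> (nat \<Rightarrow> nat) \<Rightarrow> bool" where
  "is_partition n k \<mu> \<longleftrightarrow>
     (\<forall>i\<in>{1..<n}. \<mu> i \<ge> \<mu> (Suc i)) \<and> (\<forall>i. i \<notin> {1..n} \<longrightarrow> \<mu> i = 0) \<and> sum \<mu> {1..n} = k"

definition dominated :: "nat \<Rightarrow> (nat \<Rightarrow> nat) \<Rightarrow> (nat \<Rightarrow> nat) \<Rightarrow> bool" where
  "dominated n \<mu> \<nu> \<longleftrightarrow> (\<forall>j\<in>{1..n}. sum \<mu> {1..j} \<le> sum \<nu> {1..j})"

text \<open>Monomial symmetric function: every rearrangement of the exponents is counted once.\<close>
definition monomial_sym :: "nat \<Rightarrow> (nat \<Rightarrow> nat) \<Rightarrow> (nat \<Rightarrow> complex) \<Rightarrow> complex" where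
  "monomial_sym n \<mu> \<zeta> =
     (\<Sum>\<alpha>\<in>(\<lambda>\<pi>. \<mu> \<circ> \<pi>) ` {\<pi>. \<pi> permutes {1..n}}. \<Prod>i=1..n. \<zeta> i ^ \<alpha> i)"

definition macdonald_op ::
  "nat \<Rightarrow> complex \<Rightarrow> complex \<Rightarrow> nat \<Rightarrow> ((nat \<Rightarrow> complex) \<Rightarrow> complex) \<Rightarrow> (nat \<Rightarrow> complex) \<Rightarrow> complex" where
  "macdonald_op n q h r f \<zeta> =
     (\<Sum>I\<in>{I. I \<subseteq> {1..n} \<and> card I = r}.
        (\<Prod>i\<in>I. \<Prod>j\<in>{1..n} - I. (h * \<zeta> i - \<zeta> j) / (\<zeta> i - \<zeta> j)) *
        f (\<lambda>i. if i \<in> I then q * \<zeta> i else \<zeta> i))"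

text \<open>
  \<open>P\<close> is the Macdonald polynomial $P_\lambda(\zeta; q, h)$ of the partition \<open>lam\<close> of \<open>k\<close>.
  ``Leading'' refers to the dominance order.
\<close>
definition is_macdonald ::
  "nat \<Rightarrow> complex \<Rightarrow> complex \<Rightarrow> nat \<Rightarrow> (nat \<Rightarrow> nat) \<Rightarrow> ((nat \<Rightarrow> complex) \<Rightarrow> complex) \<Rightarrow> bool" where
  "is_macdonald n q h k lam P \<longleftrightarrow>
     (\<exists>c. c lam = 1 \<and>
        (\<forall>\<zeta>. P \<zeta> = (\<Sum>\<mu>\<in>{\<mu>. is_partition n k \<mu> \<and> dominated n \<mu> lam}. c \<mu> * monomial_sym n \<mu> \<zeta>))) \<and>
     (\<forall>r\<in>{1..n}. \<exists>E. \<forall>\<zeta>. inj_on \<zeta> {1..n} \<longrightarrow> macdonald_op n q h r P \<zeta> = E * P \<zeta>)"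

text \<open>
  The parts of a partition listed from the smallest to the largest.  This is the order in which
  they enter the specialization $a_{i+1}/a_i = q^{\lambda_{i+1}-\lambda_i} h$: the vertex is a
  power series in $\zeta_i/\zeta_{i+1}$, so the monomial it starts from must be the lowest one,
  $\zeta_1^{\lambda_n} \cdots \zeta_n^{\lambda_1}$.
\<close>
definition ascending :: "nat \<Rightarrow> (nat \<Rightarrow> nat) \<Rightarrow> nat \<Rightarrow> nat" where
  "ascending n lam i = lam (Suc n - i)"

end

theory Submission
  imports Defs "HOL-Computational_Algebra.Polynomial" "HOL-Combinatorics.Permutations"
begin

text \<open>
  Write $p_1 \le \dots \le p_n$ for the partition in ascending order and $s_i = q^{p_i} h^i$.  The
  specialization says $a_i / a_j = s_i / s_j$, and the fixed point is $x_{i,k} = 1/a_k$.  Each factor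
  of a vertex term is then a value of a function \<open>omega j k\<close> of the integer $Q_{i,j} - Q_{i',k}$
  with $Q_{i,j} = p_j + d_{i,j}$, divided by its value at $d = 0$.  Since \<open>omega j j\<close>
  vanishes at negative integers and \<open>omega j (j + 1)\<close> at positive ones, only those degrees
  contribute for which $Q$ is a Gelfand--Tsetlin pattern with top row $p$.  So the vertex series is
  a finite sum, and times $\zeta_1^{p_1} \cdots \zeta_n^{p_n}$ it is a scalar multiple of a
  polynomial \<open>F n p\<close> that obeys a branching rule from $n + 1$ to $n$ variables
  (\<open>vertex_F\<close>).  The quasi-periodicity of the theta function turns the given prefactor into
  this monomial and the quotient of theta functions in the theorem (\<open>qtheta_shift_power\<close>).

  It remains to see that \<open>F n p\<close> is a Macdonald polynomial.  Its coefficients are explicit and it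
  has $\zeta^p$ as lowest monomial; what is missing is the symmetry and the
  eigenfunction property for the Macdonald operators $T_r$.  Both rest on two statements:

  \<^item> multiplication by $e_1 = x_1 + \dots + x_n$ sends $F_p$ to the sum of $A_k(s) F_{p + k}$ over
    the boxes $k$ that can be added, with $A_k$ the coefficients of $T_1$ (\<open>F_Pieri1\<close>);
  \<^item> $F_p$ is an eigenfunction of $T_1$ for the eigenvalue $(s_1 + \dots + s_n) / h$
    (\<open>F_eigen1\<close>).

  Both are proved along the branching rule, by comparing the coefficients of the polynomials of
  lower rank.  For $e_1$ this leaves a Lagrange interpolation identity
  (\<open>one_step_kernel_identity\<close>).  For $T_1$ one first clears the poles between the last
  variable and the others by multiplying with $\prod_i (x_i - x_{n+1})$; this product is expanded by
  the Pieri rules for all elementary symmetric functions $e_r$ in $n$ variables, and what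
  remains is an identity for a sum over subsets (\<open>Qsum_zero\<close>).

  The two statements determine everything else (\<open>rigidity\<close>): a family $z_p$ of functions that
  satisfies both and has $z_0 = 0$ vanishes, because in the expansion of $e_1 z_p$ the operator
  $T_1$ separates the terms by their eigenvalues.  Applied to the difference of the two sides of the
  assertion, this gives all Pieri rules (\<open>F_Pieri_D\<close>), the symmetry
  (\<open>F_symmetric\<close>) and all eigenvalue equations (\<open>F_eigen_all\<close>).  The hypotheses
  hold for these differences by commutation relations of operators of Macdonald type
  (\<open>D_commute\<close>, \<open>D_Dw_commutator\<close>).  They are used twice: for the Macdonald operators
  in the variables $x$, and for the Pieri operators, which have the same form in $s$.
\<close>

section \<open>Lagrange interpolation\<close>

lemma monic_prod_linear:
  fixes b :: "'a \<Rightarrow> complex"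
  assumes "finite I"
  shows "degree (\<Prod>i\<in>I. [:- b i, 1:]) = card I" and "coeff (\<Prod>i\<in>I. [:- b i, 1:]) (card I) = 1"
proof -
  show 1: "degree (\<Prod>i\<in>I. [:- b i, 1:]) = card I"
    by (subst degree_prod_eq_sum_degree) auto
  have "lead_coeff (\<Prod>i\<in>I. [:- b i, 1:]) = 1"
    by (subst lead_coeff_prod) auto
  then show "coeff (\<Prod>i\<in>I. [:- b i, 1:]) (card I) = 1"
    by (simp add: 1)
qed

text \<open>
  A polynomial of degree below the number of nodes is its own interpolation polynomial; compare
  the leading coefficients.
\<close>
lemma lagrange_top_coeff:
  fixes b :: "'a \<Rightarrow> complex"
  assumes fin: "finite I" and inj: "inj_on b I" and deg: "degree p < card I"
  shows "(\<Sum>i\<in>I. poly p (b i) / (\<Prod>k\<in>I - {i}. b i - b k)) = coeff p (card I - 1)"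
proof -
  define c where "c i = poly p (b i) / (\<Prod>k\<in>I - {i}. b i - b k)" for i
  define L where "L = (\<Sum>i\<in>I. smult (c i) (\<Prod>k\<in>I - {i}. [:- b k, 1:]))"
  have card: "card (I - {i}) = card I - 1" if "i \<in> I" for i
    using that fin by simp
  have degL: "degree L \<le> card I - 1"
    unfolding L_def
    by (rule degree_sum_le) (use fin card in \<open>auto intro!: order_trans[OF degree_smult_le] simp: monic_prod_linear\<close>)
  have "p = L"
  proof (rule poly_eqI_degree[where A = "b ` I"])
    fix z assume "z \<in> b ` I"
    then obtain i where i: "i \<in> I" "z = b i" by auto
    have nz: "(\<Prod>k\<in>I - {i}. b i - b k) \<noteq> 0"
      using fin inj i by (auto simp: inj_on_def)
    have "poly L z = (\<Sum>j\<in>I. c j * (\<Prod>k\<in>I - {j}. b i - b k))"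
      by (simp add: L_def poly_sum poly_prod i)
    also have "\<dots> = (\<Sum>j\<in>{i}. c j * (\<Prod>k\<in>I - {j}. b i - b k))"
      by (rule sum.mono_neutral_right) (use fin i in auto)
    also have "\<dots> = poly p (b i)" using nz by (simp add: c_def)
    finally show "poly p z = poly L z" by (simp add: i)
  qed (use degL deg card_image[OF inj] in auto)
  then have "coeff p (card I - 1) = coeff L (card I - 1)" by simp
  also have "\<dots> = (\<Sum>i\<in>I. c i)"
    unfolding L_def coeff_sum coeff_smult
  proof (rule sum.cong)
    fix i assume "i \<in> I"
    then show "c i * coeff (\<Prod>k\<in>I - {i}. [:- b k, 1:]) (card I - 1) = c i"
      using monic_prod_linear(2)[of "I - {i}" b] fin card[of i] by simp
  qed simp
  finally show ?thesis by (simp add: c_def)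
qed

text \<open>
  The form in which interpolation is used below: one family consists of variables, the other one of
  variables times \<open>q\<close> or \<open>\<tau>\<close>, and the additional node \<open>0\<close> produces the constant terms of the
  identities.
\<close>
lemma lagrange_two_families:
  fixes b :: "'a \<Rightarrow> complex" and c :: "'b \<Rightarrow> complex"
  assumes fin: "finite K" "finite L" and inj: "inj_on b K" "inj_on c L"
    and disj: "\<And>k l. k \<in> K \<Longrightarrow> l \<in> L \<Longrightarrow> b k \<noteq> c l"
    and nz: "\<And>k. k \<in> K \<Longrightarrow> b k \<noteq> 0" "\<And>l. l \<in> L \<Longrightarrow> c l \<noteq> 0"
    and deg: "degree p \<le> card K + card L"
  shows "(\<Sum>j\<in>K. poly p (b j) / (b j * (\<Prod>k\<in>K - {j}. b j - b k) * (\<Prod>l\<in>L. b j - c l))) +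
         (\<Sum>j\<in>L. poly p (c j) / (c j * (\<Prod>l\<in>L - {j}. c j - c l) * (\<Prod>k\<in>K. c j - b k))) +
         poly p 0 / ((\<Prod>k\<in>K. - b k) * (\<Prod>l\<in>L. - c l)) = coeff p (card K + card L)"
proof -
  define I where "I = insert None (Some ` (K <+> L))"
  define f where "f i = (case i of None \<Rightarrow> 0 | Some (Inl k) \<Rightarrow> b k | Some (Inr l) \<Rightarrow> c l)" for i
  have finI: "finite I" using fin by (simp add: I_def)
  have cardI: "card I = Suc (card K + card L)"
    using fin by (simp add: I_def card_image card_Plus)
  have injI: "inj_on f I"
    unfolding inj_on_def I_def f_def using inj disj nz by (auto simp: inj_on_def split: sum.splits)
      (metis disj)+
  have sumI: "(\<Sum>i\<in>I. g i) = g None + ((\<Sum>k\<in>K. g (Some (Inl k))) + (\<Sum>l\<in>L. g (Some (Inr l))))" for g :: "_ \<Rightarrow> complex"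
    using fin by (simp add: I_def sum.reindex sum.Plus)
  have prodI: "(\<Prod>i\<in>Some ` (K' <+> L'). g i) = (\<Prod>k\<in>K'. g (Some (Inl k))) * (\<Prod>l\<in>L'. g (Some (Inr l)))"
    if "finite K'" "finite L'" for g :: "_ \<Rightarrow> complex" and K' L'
    using that by (simp add: prod.reindex prod.Plus)
  have I1: "I - {Some (Inl k)} = insert None (Some ` ((K - {k}) <+> L))" for k
    by (auto simp: I_def)
  have I2: "I - {Some (Inr k)} = insert None (Some ` (K <+> (L - {k})))" for k
    by (auto simp: I_def)
  have I3: "I - {None} = Some ` (K <+> L)"
    by (auto simp: I_def)
  have "coeff p (card K + card L) = (\<Sum>i\<in>I. poly p (f i) / (\<Prod>k\<in>I - {i}. f i - f k))"
    using lagrange_top_coeff[OF finI injI, of p] deg cardI by simp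
  also have "\<dots> = poly p 0 / ((\<Prod>k\<in>K. - b k) * (\<Prod>l\<in>L. - c l)) +
     ((\<Sum>j\<in>K. poly p (b j) / (b j * ((\<Prod>k\<in>K - {j}. b j - b k) * (\<Prod>l\<in>L. b j - c l)))) +
      (\<Sum>j\<in>L. poly p (c j) / (c j * ((\<Prod>k\<in>K. c j - b k) * (\<Prod>l\<in>L - {j}. c j - c l)))))"
    unfolding sumI I1 I2 I3 using fin by (simp add: prodI) (simp add: f_def)
  finally show ?thesis by (simp add: mult_ac add_ac)
qed

text \<open>
  In \<open>shift_residues\<close> the factors \<open>z - h * x k\<close> and \<open>h * z - q * x k\<close> are combined to a quadratic
  one, so that numerator and denominator are monic of the same degree and differ first in the coefficient
  computed here.
\<close>
lemma monic_prod_quadratic: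
  fixes c d :: "'a \<Rightarrow> complex"
  assumes "finite K"
  shows "degree (\<Prod>k\<in>K. [:c k, d k, 1:]) = 2 * card K"
    and "coeff (\<Prod>k\<in>K. [:c k, d k, 1:]) (2 * card K) = 1"
    and "K \<noteq> {} \<Longrightarrow> coeff (\<Prod>k\<in>K. [:c k, d k, 1:]) (2 * card K - 1) = sum d K"
proof -
  have deg: "degree (\<Prod>k\<in>K. [:c k, d k, 1:]) = 2 * card K" if "finite K" for K
    by (subst degree_prod_eq_sum_degree) auto
  have lead: "coeff (\<Prod>k\<in>K. [:c k, d k, 1:]) (2 * card K) = 1" if "finite K" for K
  proof -
    have "lead_coeff (\<Prod>k\<in>K. [:c k, d k, 1:]) = 1"
      by (subst lead_coeff_prod) auto
    then show ?thesis by (simp add: deg[OF that])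
  qed
  show "degree (\<Prod>k\<in>K. [:c k, d k, 1:]) = 2 * card K"
       "coeff (\<Prod>k\<in>K. [:c k, d k, 1:]) (2 * card K) = 1"
    using deg lead assms by auto
  have "coeff (\<Prod>k\<in>K. [:c k, d k, 1:]) (2 * card K - 1) = sum d K \<or> K = {}"
    using assms
  proof (induction K rule: finite_induct)
    case (insert a K)
    let ?P = "\<Prod>k\<in>K. [:c k, d k, 1:]"
    have 1: "coeff ?P (Suc (2 * card K)) = 0"
      by (rule coeff_eq_0) (simp add: deg insert)
    have "coeff ([:c a, d a, 1:] * ?P) (Suc (2 * card K)) = d a + (if K = {} then 0 else sum d K)"
    proof (cases "card K")
      case 0
      then show ?thesis using insert lead[of K] 1 by simp
    next
      case (Suc m)
      then have "K \<noteq> {}" by auto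
      then show ?thesis using insert lead[of K] 1 Suc by (simp add: coeff_pCons)
    qed
    then show ?case using insert by (auto simp del: mult_pCons_left)
  qed simp
  then show "K \<noteq> {} \<Longrightarrow> coeff (\<Prod>k\<in>K. [:c k, d k, 1:]) (2 * card K - 1) = sum d K" by auto
qed

section \<open>Coefficients of the Macdonald operators\<close>

text \<open>
  The coefficient of the shift of the variables \<open>I\<close> in the Macdonald operator of order \<open>card I\<close>.  At
  the spectral point of a partition the same function is the coefficient of a Pieri rule.
\<close>
definition hcoef :: "complex \<Rightarrow> nat set \<Rightarrow> nat set \<Rightarrow> (nat \<Rightarrow> complex) \<Rightarrow> complex" where
  "hcoef h N I x = (\<Prod>i\<in>I. \<Prod>j\<in>N - I. (h * x i - x j) / (x i - x j))"

lemma hcoef_single: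
  "hcoef h N {i} x = (\<Prod>j\<in>N - {i}. (h * x i - x j) / (x i - x j))"
  by (simp add: hcoef_def)

text \<open>
  Interpolation of \<open>\<Prod>j\<in>N. h * z - x j\<close> at the points \<open>x i\<close> and \<open>0\<close>.
\<close>
lemma sum_hcoef_single:
  assumes "finite N" "inj_on x N" "\<And>i. i \<in> N \<Longrightarrow> x i \<noteq> 0"
  shows "(h - 1) * (\<Sum>i\<in>N. hcoef h N {i} x) = h ^ card N - 1"
proof -
  \<comment> \<open>The value at \<open>0\<close> cancels against the product of all \<open>- x j\<close>.\<close>
  define p where "p = (\<Prod>j\<in>N. [:- x j, h:])"
  have "degree p \<le> card N"
    unfolding p_def by (rule order_trans[OF degree_prod_sum_le]) (use assms in \<open>auto intro!: sum_bounded_above[where K = 1, simplified]\<close>)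
  have cp: "coeff p (card N) = h ^ card N"
    unfolding p_def using assms(1)
  proof (induction N rule: finite_induct)
    case (insert a N)
    have "coeff (\<Prod>j\<in>N. [:- x j, h:]) (Suc (card N)) = 0"
      by (rule coeff_eq_0, rule le_less_trans[OF degree_prod_sum_le])
        (use insert in \<open>auto intro!: le_less_trans[OF sum_bounded_above[where K = 1]]\<close>)
    then show ?case using insert by simp
  qed simp
  have "(\<Sum>j\<in>N. poly p (x j) / (x j * (\<Prod>k\<in>N - {j}. x j - x k))) + 1 = h ^ card N"
  proof -
    have "poly p 0 / (\<Prod>k\<in>N. - x k) = 1"
      using assms by (simp add: p_def poly_prod)
    then show ?thesis
      using lagrange_two_families[of N "{}" x x p] assms \<open>degree p \<le> card N\<close> cp by simp
  qed
  moreover have "poly p (x j) / (x j * (\<Prod>k\<in>N - {j}. x j - x k)) = (h - 1) * hcoef h N {j} x" if "j \<in> N" for j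
  proof -
    define Q where "Q = (\<Prod>k\<in>N - {j}. h * x j - x k)"
    have "poly p (x j) = (\<Prod>k\<in>N. h * x j - x k)"
      by (simp add: p_def poly_prod mult.commute)
    also have "\<dots> = (h * x j - x j) * Q"
      unfolding Q_def by (rule prod.remove) (use assms that in auto)
    also have "\<dots> = x j * ((h - 1) * Q)" by (simp add: algebra_simps)
    finally show ?thesis using assms(3)[OF that]
      by (simp add: hcoef_single prod_dividef Q_def)
  qed
  ultimately show ?thesis
    by (simp add: sum_distrib_left eq_diff_eq)
qed

text \<open>
  Marking one element of a subset: it can be chosen within \<open>K\<close>, or first within \<open>N\<close> with the rest of
  \<open>K\<close> chosen from what remains.
\<close>
lemma hcoef_remove:
  assumes "finite N" "K \<subseteq> N" "j \<in> K"
  shows "hcoef h N {j} x * hcoef h (N - {j}) (K - {j}) x =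
         hcoef h K {j} x * hcoef h N K x"
proof -
  have fK: "finite K" using assms finite_subset by auto
  have 1: "N - {j} = (K - {j}) \<union> (N - K)" and 2: "N - {j} - (K - {j}) = N - K" using assms by auto
  have "hcoef h N {j} x = hcoef h K {j} x * (\<Prod>i\<in>N - K. (h * x j - x i) / (x j - x i))"
    unfolding hcoef_single 1 by (rule prod.union_disjoint) (use assms fK in auto)
  moreover have "hcoef h N K x = (\<Prod>i\<in>N - K. (h * x j - x i) / (x j - x i)) * hcoef h (N - {j}) (K - {j}) x"
    unfolding hcoef_def 2 using fK assms(3) by (simp add: prod.remove)
  ultimately show ?thesis by simp
qed

lemma sum_subset_choose_element:
  assumes "finite N"
  shows "(\<Sum>I\<in>{I. I \<subseteq> N \<and> card I = Suc r}. \<Sum>j\<in>I. g I j) =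
         (\<Sum>j\<in>N. \<Sum>I\<in>{I. I \<subseteq> N - {j} \<and> card I = r}. g (insert j I) j)"
proof -
  have fin: "finite {I. I \<subseteq> N \<and> card I = k}" for k
    using assms by auto
  have 1: "card (insert j I) = Suc (card I)" if "I \<subseteq> N - {j}" for I j
    using that assms finite_subset[of I "N - {j}"] by (subst card_insert_disjoint) auto
  have "(\<Sum>I\<in>{I. I \<subseteq> N \<and> card I = Suc r}. \<Sum>j\<in>I. g I j) =
        (\<Sum>(I, j)\<in>Sigma {I. I \<subseteq> N \<and> card I = Suc r} (\<lambda>I. I). g I j)"
    by (rule sum.Sigma) (use assms fin in \<open>auto intro: finite_subset\<close>)
  also have "\<dots> = (\<Sum>(j, I)\<in>Sigma N (\<lambda>j. {I. I \<subseteq> N - {j} \<and> card I = r}). g (insert j I) j)"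
    by (rule sum.reindex_bij_witness[of _ "\<lambda>(j, I). (insert j I, j)" "\<lambda>(I, j). (j, I - {j})"])
      (use assms in \<open>auto simp: insert_absorb 1\<close>)
  also have "\<dots> = (\<Sum>j\<in>N. \<Sum>I\<in>{I. I \<subseteq> N - {j} \<and> card I = r}. g (insert j I) j)"
    by (rule sum.Sigma[symmetric]) (use assms in auto)
  finally show ?thesis .
qed

text \<open>
  The value is a Gaussian binomial coefficient in \<open>h\<close>.  What matters is that it does not depend on \<open>x\<close>:
  constants are eigenfunctions of all Macdonald operators.  By \<open>sum_hcoef_single\<close> within \<open>I\<close>, marking an
  element of \<open>I\<close> multiplies the sum by \<open>h ^ Suc r - 1\<close> up to \<open>h - 1\<close>, and choosing the marked element
  first leaves the sums of order \<open>r\<close> over \<open>N - {j}\<close>.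
\<close>
lemma sum_hcoef_const:
  assumes "\<And>i. i > 0 \<Longrightarrow> h ^ i \<noteq> 1"
  shows "\<exists>G. \<forall>N x. finite N \<longrightarrow> inj_on x N \<longrightarrow> (\<forall>i\<in>N. x i \<noteq> 0) \<longrightarrow>
     (\<Sum>I\<in>{I. I \<subseteq> N \<and> card I = r}. hcoef h N I x) = G (card N)"
proof (induction r)
  case 0
  have "{I. I \<subseteq> N \<and> card I = 0} = {{}}" if "finite N" for N :: "nat set"
    using that by (auto dest: finite_subset)
  then show ?case by (intro exI[of _ "\<lambda>_. 1"]) (simp add: hcoef_def)
next
  case (Suc r)
  then obtain G where G: "\<And>N x. finite N \<Longrightarrow> inj_on x N \<Longrightarrow> (\<forall>i\<in>N. x i \<noteq> 0) \<Longrightarrow>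
     (\<Sum>I\<in>{I. I \<subseteq> N \<and> card I = r}. hcoef h N I x) = G (card N)" by blast
  have h1: "h \<noteq> 1" using assms[of 1] by auto
  have hr: "h ^ Suc r - 1 \<noteq> 0" using assms[of "Suc r"] by auto
  show ?case
  proof (intro exI allI impI)
    fix N :: "nat set" and x :: "nat \<Rightarrow> complex" assume N: "finite N" "inj_on x N" "\<forall>i\<in>N. x i \<noteq> 0"
    let ?S = "\<Sum>I\<in>{I. I \<subseteq> N \<and> card I = Suc r}. hcoef h N I x"
    have "(h ^ Suc r - 1) * ?S = (\<Sum>I\<in>{I. I \<subseteq> N \<and> card I = Suc r}. \<Sum>j\<in>I. (h - 1) * (hcoef h I {j} x * hcoef h N I x))"
      unfolding sum_distrib_left
    proof (rule sum.cong)
      fix I assume I: "I \<in> {I. I \<subseteq> N \<and> card I = Suc r}"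
      have "(h - 1) * (\<Sum>j\<in>I. hcoef h I {j} x) = h ^ Suc r - 1"
        using sum_hcoef_single[of I x h] I N by (auto dest: finite_subset simp: inj_on_subset)
      from this[symmetric] show "(h ^ Suc r - 1) * hcoef h N I x = (\<Sum>j\<in>I. (h - 1) * (hcoef h I {j} x * hcoef h N I x))"
        by (simp only: sum_distrib_left sum_distrib_right mult.assoc)
    qed simp
    also have "\<dots> = (\<Sum>I\<in>{I. I \<subseteq> N \<and> card I = Suc r}. \<Sum>j\<in>I. (h - 1) * (hcoef h N {j} x * hcoef h (N - {j}) (I - {j}) x))"
      by (intro sum.cong refl) (use hcoef_remove[OF N(1)] in auto)
    also have "\<dots> = (\<Sum>j\<in>N. \<Sum>I\<in>{I. I \<subseteq> N - {j} \<and> card I = r}. (h - 1) * (hcoef h N {j} x * hcoef h (N - {j}) (insert j I - {j}) x))"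
      by (rule sum_subset_choose_element[OF N(1)])
    also have "\<dots> = (\<Sum>j\<in>N. (h - 1) * (hcoef h N {j} x * G (card N - 1)))"
    proof (rule sum.cong)
      fix j assume j: "j \<in> N"
      have "(\<Sum>I\<in>{I. I \<subseteq> N - {j} \<and> card I = r}. hcoef h (N - {j}) I x) = G (card (N - {j}))"
        by (rule G) (use N in \<open>auto simp: inj_on_def\<close>)
      moreover have "hcoef h (N - {j}) (insert j I - {j}) x = hcoef h (N - {j}) I x"
        if "I \<in> {I. I \<subseteq> N - {j} \<and> card I = r}" for I
        using that by (metis (no_types, lifting) Diff_insert_absorb DiffD2 insertI1 mem_Collect_eq subsetD)
      ultimately show "(\<Sum>I\<in>{I. I \<subseteq> N - {j} \<and> card I = r}. (h - 1) * (hcoef h N {j} x * hcoef h (N - {j}) (insert j I - {j}) x))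
         = (h - 1) * (hcoef h N {j} x * G (card N - 1))"
        using N j by (simp flip: sum_distrib_left)
    qed simp
    also have "\<dots> = (h ^ card N - 1) * G (card N - 1)"
      using sum_hcoef_single[of N x h] N by (simp flip: sum_distrib_left sum_distrib_right add: mult.assoc)
    finally show "?S = ((h ^ card N - 1) * G (card N - 1)) / (h ^ Suc r - 1)"
      using hr by (simp add: field_simps)
  qed
qed

text \<open>
  When the variables \<open>K\<close> are shifted in two steps, the product of the two coefficients is
  \<open>hcoef h N K\<close> times a function of the variables \<open>K\<close> alone: \<open>shiftU\<close> if \<open>j\<close> is shifted last and
  \<open>shiftW\<close> if it is shifted first (\<open>hcoef_shift_last\<close>, \<open>hcoef_shift_first\<close>).
\<close>
definition shiftU :: "complex \<Rightarrow> complex \<Rightarrow> nat set \<Rightarrow> (nat \<Rightarrow> complex) \<Rightarrow> nat \<Rightarrow> complex" where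
  "shiftU h q K x j = (\<Prod>k\<in>K - {j}. (h * x k - x j) / (x k - x j) * ((h * x j - q * x k) / (x j - q * x k)))"

definition shiftW :: "complex \<Rightarrow> complex \<Rightarrow> nat set \<Rightarrow> (nat \<Rightarrow> complex) \<Rightarrow> nat \<Rightarrow> complex" where
  "shiftW h q K x j = (\<Prod>k\<in>K - {j}. (h * x j - x k) / (x j - x k) * ((h * x k - q * x j) / (x k - q * x j)))"

lemma residue_quotient:
  fixes A :: complex
  assumes "A = a * A'" "B = b * B'" "U = A' / (D * B')" "a / b = c"
  shows "A / (D * B) = c * U"
  using assms by auto

text \<open>
  Up to a common constant, the summands are the residues at \<open>x j\<close> and \<open>q * x j\<close> of the product over \<open>k\<close>
  of \<open>(z - h * x k) * (h * z - q * x k) / ((z - x k) * (z - q * x k))\<close>, divided by \<open>z\<close> for the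
  first identity.  Without this division one sees the next coefficient at infinity, which gives the second
  identity.
\<close>
lemma shift_residues:
  assumes fin: "finite K" and inj: "inj_on x K" and nz: "\<And>k. k \<in> K \<Longrightarrow> x k \<noteq> 0"
    and sep: "\<And>j k. j \<in> K \<Longrightarrow> k \<in> K \<Longrightarrow> x j \<noteq> q * x k"
    and q: "q \<noteq> 0" "q \<noteq> 1" and h: "h \<noteq> 0" "h \<noteq> 1" "h \<noteq> q"
  shows "(\<Sum>j\<in>K. shiftU h q K x j) = (\<Sum>j\<in>K. shiftW h q K x j)"
    and "K \<noteq> {} \<Longrightarrow> (\<Sum>j\<in>K. x j * (shiftU h q K x j - q * shiftW h q K x j)) = (1 - q) * h ^ (card K - 1) * (\<Sum>j\<in>K. x j)"
proof -
  define P where "P = (\<Prod>k\<in>K. [:q * x k ^ 2, - (h + q / h) * x k, 1:])"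
  define B where "B = (\<Prod>k\<in>K. [:q * x k ^ 2, - (1 + q) * x k, 1:])"
  \<comment> \<open>The factor \<open>k = j\<close> of the residues, divided by \<open>x j\<close>.\<close>
  define c where "c = (1 - h) * (h - q) / (1 - q)"
  have c: "c \<noteq> 0" using q h by (simp add: c_def)
  have polyP: "h ^ card K * poly P z = (\<Prod>k\<in>K. (z - h * x k) * (h * z - q * x k))" for z
  proof -
    have "h ^ card K * poly P z = (\<Prod>k\<in>K. h * poly [:q * x k ^ 2, - (h + q / h) * x k, 1:] z)"
      unfolding prod.distrib P_def poly_prod by simp
    also have "\<dots> = (\<Prod>k\<in>K. (z - h * x k) * (h * z - q * x k))"
      by (rule prod.cong) (use h in \<open>auto simp: field_simps power2_eq_square\<close>)
    finally show ?thesis .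
  qed
  have polyB: "poly B z = (\<Prod>k\<in>K. (z - x k) * (z - q * x k))" for z
    unfolding B_def poly_prod by (rule prod.cong) (auto simp: algebra_simps power2_eq_square)
  have degs: "degree P = 2 * card K" "degree B = 2 * card K"
    "coeff P (2 * card K) = 1" "coeff B (2 * card K) = 1"
    unfolding P_def B_def using monic_prod_quadratic fin by auto
  have xx: "x j - q * x j \<noteq> 0" if "j \<in> K" for j
    using sep[OF that that] by auto
  have res1: "h ^ card K * poly P (x j) / ((\<Prod>k\<in>K - {j}. x j - x k) * (\<Prod>k\<in>K. x j - q * x k)) = c * x j * shiftU h q K x j"
    if j: "j \<in> K" for j
  proof -
    have "h ^ card K * poly P (x j) = (x j - h * x j) * (h * x j - q * x j) * (\<Prod>k\<in>K - {j}. (x j - h * x k) * (h * x j - q * x k))"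
      unfolding polyP using fin j by (simp add: prod.remove mult_ac)
    moreover have "(\<Prod>k\<in>K. x j - q * x k) = (x j - q * x j) * (\<Prod>k\<in>K - {j}. x j - q * x k)"
      using fin j by (simp add: prod.remove)
    moreover have "shiftU h q K x j = (\<Prod>k\<in>K - {j}. (x j - h * x k) * (h * x j - q * x k)) /
       ((\<Prod>k\<in>K - {j}. x j - x k) * (\<Prod>k\<in>K - {j}. x j - q * x k))"
      unfolding shiftU_def prod.distrib[symmetric] prod_dividef[symmetric]
    proof (rule prod.cong)
      fix k assume "k \<in> K - {j}"
      have "(h * x k - x j) / (x k - x j) = (x j - h * x k) / (x j - x k)"
        by (metis minus_diff_eq minus_divide_divide)
      then show "(h * x k - x j) / (x k - x j) * ((h * x j - q * x k) / (x j - q * x k)) =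
         (x j - h * x k) * (h * x j - q * x k) / ((x j - x k) * (x j - q * x k))" by simp
    qed simp
    moreover have "(x j - h * x j) * (h * x j - q * x j) / (x j - q * x j) = c * x j"
      using xx[OF j] nz[OF j] q by (simp add: c_def divide_simps) (simp add: algebra_simps)
    ultimately show ?thesis by (rule residue_quotient)
  qed
  have res2: "h ^ card K * poly P (q * x j) / ((\<Prod>k\<in>K - {j}. q * x j - q * x k) * (\<Prod>k\<in>K. q * x j - x k)) = - c * (q * x j) * shiftW h q K x j"
    if j: "j \<in> K" for j
  proof -
    have "h ^ card K * poly P (q * x j) = (q * x j - h * x j) * (h * (q * x j) - q * x j) * (\<Prod>k\<in>K - {j}. (q * x j - h * x k) * (h * (q * x j) - q * x k))"
      unfolding polyP using fin j by (simp add: prod.remove mult_ac)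
    moreover have "(\<Prod>k\<in>K. q * x j - x k) = (q * x j - x j) * (\<Prod>k\<in>K - {j}. q * x j - x k)"
      using fin j by (simp add: prod.remove)
    moreover have "shiftW h q K x j = (\<Prod>k\<in>K - {j}. (q * x j - h * x k) * (h * (q * x j) - q * x k)) /
       ((\<Prod>k\<in>K - {j}. q * x j - q * x k) * (\<Prod>k\<in>K - {j}. q * x j - x k))"
      unfolding shiftW_def prod.distrib[symmetric] prod_dividef[symmetric]
    proof (rule prod.cong)
      fix k assume "k \<in> K - {j}"
      then have 1: "x j - x k \<noteq> 0" "x k - q * x j \<noteq> 0" "q * x j - x k \<noteq> 0"
        using inj j sep[of k j] by (auto simp: inj_on_def)
      have 2: "(q * x j - h * x k) * (h * (q * x j) - q * x k) = - q * ((h * x j - x k) * (h * x k - q * x j))"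
        by (simp add: algebra_simps)
      have 3: "(q * x j - q * x k) * (q * x j - x k) = - q * ((x j - x k) * (x k - q * x j))"
        by (simp add: algebra_simps)
      show "(h * x j - x k) / (x j - x k) * ((h * x k - q * x j) / (x k - q * x j)) =
           (q * x j - h * x k) * (h * (q * x j) - q * x k) / ((q * x j - q * x k) * (q * x j - x k))"
        unfolding 2 3 using q by (subst mult_divide_mult_cancel_left) auto
    qed simp
    moreover have "(q * x j - h * x j) * (h * (q * x j) - q * x j) / (q * x j - x j) = - c * (q * x j)"
    proof -
      have "q * x j - x j \<noteq> 0" using xx[OF j] by auto
      then show ?thesis using nz[OF j] q by (simp add: c_def divide_simps) (simp add: algebra_simps)
    qed
    ultimately show ?thesis by (rule residue_quotient)
  qed
  have inj2: "inj_on (\<lambda>j. q * x j) K" using inj q by (auto simp: inj_on_def)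
  note lag = lagrange_two_families[where K = K and L = K and b = x and c = "\<lambda>j. q * x j",
      OF fin fin inj inj2 sep nz, simplified]
  have mp: "(\<Prod>k\<in>K. - x k) * (\<Prod>k\<in>K. - (q * x k)) = poly B 0"
    unfolding polyB prod.distrib[symmetric] by simp
  have B0: "poly B 0 \<noteq> 0" using polyB[of 0] nz q fin by auto
  have e1: "poly (smult (h ^ card K) P) (x j) / (x j * (\<Prod>k\<in>K - {j}. x j - x k) * (\<Prod>l\<in>K. x j - q * x l)) = c * shiftU h q K x j"
    if "j \<in> K" for j
  proof -
    have "poly (smult (h ^ card K) P) (x j) / (x j * (\<Prod>k\<in>K - {j}. x j - x k) * (\<Prod>l\<in>K. x j - q * x l)) =
      (h ^ card K * poly P (x j) / ((\<Prod>k\<in>K - {j}. x j - x k) * (\<Prod>k\<in>K. x j - q * x k))) / x j"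
      by simp
    then show ?thesis unfolding res1[OF that] using nz[OF that] by simp
  qed
  have e2: "poly (smult (h ^ card K) P) (q * x j) / (q * x j * (\<Prod>k\<in>K - {j}. q * x j - q * x k) * (\<Prod>l\<in>K. q * x j - x l)) = - c * shiftW h q K x j"
    if "j \<in> K" for j
  proof -
    have "poly (smult (h ^ card K) P) (q * x j) / (q * x j * (\<Prod>k\<in>K - {j}. q * x j - q * x k) * (\<Prod>l\<in>K. q * x j - x l)) =
      (h ^ card K * poly P (q * x j) / ((\<Prod>k\<in>K - {j}. q * x j - q * x k) * (\<Prod>k\<in>K. q * x j - x k))) / (q * x j)"
      by simp
    then show ?thesis unfolding res2[OF that] using nz[OF that] q by simp
  qed
  have "(\<Sum>j\<in>K. c * shiftU h q K x j) + (\<Sum>j\<in>K. - c * shiftW h q K x j) + h ^ card K = h ^ card K"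
  proof -
    have 0: "poly (smult (h ^ card K) P) 0 / ((\<Prod>k\<in>K. - x k) * (\<Prod>k\<in>K. - (q * x k))) = h ^ card K"
    proof -
      have "poly P 0 = poly B 0" unfolding P_def B_def poly_prod by simp
      then show ?thesis unfolding mp using B0 by simp
    qed
    have "(\<Sum>j\<in>K. poly (smult (h ^ card K) P) (x j) / (x j * (\<Prod>k\<in>K - {j}. x j - x k) * (\<Prod>l\<in>K. x j - q * x l))) +
     (\<Sum>j\<in>K. poly (smult (h ^ card K) P) (q * x j) / (q * x j * (\<Prod>l\<in>K - {j}. q * x j - q * x l) * (\<Prod>k\<in>K. q * x j - x k))) +
     poly (smult (h ^ card K) P) 0 / ((\<Prod>k\<in>K. - x k) * (\<Prod>l\<in>K. - (q * x l))) = coeff (smult (h ^ card K) P) (card K + card K)"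
      by (rule lag) (use q degs nz in auto)
    moreover have "coeff (smult (h ^ card K) P) (card K + card K) = h ^ card K"
      using degs by (simp add: mult_2)
    ultimately show ?thesis unfolding 0 by (simp only: sum.cong[OF refl e1] sum.cong[OF refl e2])
  qed
  then have "c * (\<Sum>j\<in>K. shiftU h q K x j) = c * (\<Sum>j\<in>K. shiftW h q K x j)"
    by (simp add: sum_negf flip: sum_distrib_left)
  then show "(\<Sum>j\<in>K. shiftU h q K x j) = (\<Sum>j\<in>K. shiftW h q K x j)" using c by simp
  assume ne: "K \<noteq> {}"
  \<comment> \<open>Subtracting \<open>B\<close> changes no value at the points, where \<open>B\<close> vanishes, and leaves room for a factor \<open>z\<close>.\<close>
  define N where "N = pCons 0 (smult (h ^ card K) (P - B))"
  have degPB: "degree (P - B) < 2 * card K"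
  proof (rule le_less_trans)
    show "degree (P - B) \<le> 2 * card K - 1"
    proof (rule degree_le, intro allI impI)
      fix i assume "2 * card K - 1 < i"
      then consider "i = 2 * card K" | "i > 2 * card K" by linarith
      then show "coeff (P - B) i = 0" using degs by cases (auto simp: coeff_eq_0)
    qed
  qed (use ne fin in \<open>auto simp: card_gt_0_iff\<close>)
  have degN: "degree N \<le> card K + card K"
    unfolding N_def by (rule order_trans[OF degree_pCons_le]) (use degPB in \<open>auto intro!: Suc_leI order.strict_trans1[OF degree_smult_le]\<close>)
  have "coeff N (card K + card K) = h ^ card K * coeff (P - B) (2 * card K - 1)"
    using ne fin by (auto simp: N_def coeff_pCons mult_2 split: nat.splits)
  also have "coeff (P - B) (2 * card K - 1) = (\<Sum>k\<in>K. - (h + q / h) * x k) - (\<Sum>k\<in>K. - (1 + q) * x k)"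
    unfolding P_def B_def coeff_diff using monic_prod_quadratic(3)[OF fin ne] by auto
  also have "\<dots> = (1 + q - h - q / h) * (\<Sum>k\<in>K. x k)"
    unfolding sum_distrib_left sum_subtractf[symmetric] by (rule sum.cong) (auto simp: algebra_simps)
  finally have cN: "coeff N (card K + card K) = h ^ card K * ((1 + q - h - q / h) * (\<Sum>k\<in>K. x k))" .
  have B1: "poly B (x j) = 0" "poly B (q * x j) = 0" if "j \<in> K" for j
    using that fin by (auto simp: polyB)
  have f1: "poly N (x j) / (x j * (\<Prod>k\<in>K - {j}. x j - x k) * (\<Prod>l\<in>K. x j - q * x l)) = c * x j * shiftU h q K x j"
    if "j \<in> K" for j
  proof -
    have "poly N (x j) / (x j * (\<Prod>k\<in>K - {j}. x j - x k) * (\<Prod>l\<in>K. x j - q * x l)) =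
      h ^ card K * poly P (x j) / ((\<Prod>k\<in>K - {j}. x j - x k) * (\<Prod>k\<in>K. x j - q * x k))"
      using nz[OF that] by (simp add: N_def B1[OF that])
    then show ?thesis unfolding res1[OF that] .
  qed
  have f2: "poly N (q * x j) / (q * x j * (\<Prod>k\<in>K - {j}. q * x j - q * x k) * (\<Prod>l\<in>K. q * x j - x l)) = - c * (q * x j) * shiftW h q K x j"
    if "j \<in> K" for j
  proof -
    have "poly N (q * x j) / (q * x j * (\<Prod>k\<in>K - {j}. q * x j - q * x k) * (\<Prod>l\<in>K. q * x j - x l)) =
      (h ^ card K * poly P (q * x j) / ((\<Prod>k\<in>K - {j}. q * x j - q * x k) * (\<Prod>k\<in>K. q * x j - x k)))"
      using nz[OF that] q by (simp add: N_def B1[OF that])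
    then show ?thesis unfolding res2[OF that] .
  qed
  have "(\<Sum>j\<in>K. poly N (x j) / (x j * (\<Prod>k\<in>K - {j}. x j - x k) * (\<Prod>l\<in>K. x j - q * x l))) +
     (\<Sum>j\<in>K. poly N (q * x j) / (q * x j * (\<Prod>l\<in>K - {j}. q * x j - q * x l) * (\<Prod>k\<in>K. q * x j - x k))) +
     poly N 0 / ((\<Prod>k\<in>K. - x k) * (\<Prod>l\<in>K. - (q * x l))) = coeff N (card K + card K)"
    by (rule lag) (use q degN nz in auto)
  then have "(\<Sum>j\<in>K. c * x j * shiftU h q K x j) + (\<Sum>j\<in>K. - c * (q * x j) * shiftW h q K x j) =
      h ^ card K * ((1 + q - h - q / h) * (\<Sum>k\<in>K. x k))"
    unfolding cN[symmetric] by (simp only: sum.cong[OF refl f1] sum.cong[OF refl f2]) (simp add: N_def)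
  then have "c * (\<Sum>j\<in>K. x j * (shiftU h q K x j - q * shiftW h q K x j)) = h ^ card K * ((1 + q - h - q / h) * (\<Sum>k\<in>K. x k))"
    unfolding sum.distrib[symmetric] sum_distrib_left[of c] by (simp add: algebra_simps)
  also have "h ^ card K = h * h ^ (card K - 1)"
    using ne fin by (metis card_gt_0_iff power_eq_if not_gr_zero)
  also have "h * h ^ (card K - 1) * ((1 + q - h - q / h) * (\<Sum>k\<in>K. x k)) = c * ((1 - q) * h ^ (card K - 1) * (\<Sum>j\<in>K. x j))"
  proof -
    have "h * (1 + q - h - q / h) = c * (1 - q)" using h q by (simp add: c_def divide_simps) (simp add: algebra_simps)
    then show ?thesis by (metis (no_types, opaque_lifting) mult.assoc mult.left_commute)
  qed
  finally show "(\<Sum>j\<in>K. x j * (shiftU h q K x j - q * shiftW h q K x j)) = (1 - q) * h ^ (card K - 1) * (\<Sum>j\<in>K. x j)"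
    using c by simp
qed

section \<open>Two identities for the branching kernel\<close>

lemma eventually_avoid_finite:
  fixes a :: "'a :: t1_space"
  assumes "finite A"
  shows "eventually (\<lambda>x. x \<notin> A) (at a)"
proof -
  have "open (- (A - {a}))"
    using assms by (intro open_Compl finite_imp_closed) auto
  then show ?thesis
    unfolding eventually_at_topological by (intro exI[of _ "- (A - {a})"]) auto
qed

text \<open>
  Divided by the product of all \<open>s i - \<tau> * \<sigma> j\<close>, this is interpolation of the product of all
  \<open>z - \<tau> * s i\<close> and \<open>z - \<sigma> j\<close> at the points \<open>s k\<close>, \<open>\<tau> * \<sigma> j\<close> and \<open>0\<close>.
\<close>
lemma one_step_kernel_identity_generic:
  fixes s \<sigma> :: "nat \<Rightarrow> complex"
  assumes fin: "finite N" "finite M" and card: "card N = Suc (card M)"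
    and inj: "inj_on s N" "inj_on \<sigma> M"
    and nz: "\<And>i. i \<in> N \<Longrightarrow> s i \<noteq> 0" "\<And>j. j \<in> M \<Longrightarrow> \<sigma> j \<noteq> 0" "\<tau> \<noteq> 0" "\<tau> \<noteq> 1"
    and gen: "\<And>i j. i \<in> N \<Longrightarrow> j \<in> M \<Longrightarrow> s i \<noteq> \<tau> * \<sigma> j"
  shows "(\<Sum>k\<in>N. (\<Prod>i\<in>N - {k}. (s k - \<tau> * s i) / (s k - s i)) *
            (\<Prod>j\<in>M. \<Prod>i\<in>N. if i = k then s i - \<sigma> j else s i - \<tau> * \<sigma> j)) =
         (\<Prod>j\<in>M. \<Prod>i\<in>N. s i - \<tau> * \<sigma> j) +
         \<tau> * (\<Sum>j\<in>M. (\<Prod>i\<in>M - {j}. (\<sigma> i - \<tau> * \<sigma> j) / (\<sigma> i - \<sigma> j)) *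
            (\<Prod>l\<in>M. \<Prod>i\<in>N. if l = j then s i - \<sigma> l else s i - \<tau> * \<sigma> l))"
proof -
  define p where "p = (\<Prod>i\<in>N. [:- (\<tau> * s i), 1:]) * (\<Prod>j\<in>M. [:- \<sigma> j, 1:])"
  define D where "D = (\<Prod>j\<in>M. \<Prod>i\<in>N. s i - \<tau> * \<sigma> j)"
  define b where "b k = (\<Prod>i\<in>N - {k}. (s k - \<tau> * s i) / (s k - s i)) * (\<Prod>j\<in>M. (s k - \<sigma> j) / (s k - \<tau> * \<sigma> j))" for k
  define c where "c j = (\<Prod>i\<in>M - {j}. (\<sigma> i - \<tau> * \<sigma> j) / (\<sigma> i - \<sigma> j)) * (\<Prod>i\<in>N. (s i - \<sigma> j) / (s i - \<tau> * \<sigma> j))" for j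
  have polyp: "poly p z = (\<Prod>i\<in>N. z - \<tau> * s i) * (\<Prod>j\<in>M. z - \<sigma> j)" for z
    by (simp add: p_def poly_prod)
  have m1: "degree (\<Prod>i\<in>N. [:- (\<tau> * s i), 1:]) = card N" "coeff (\<Prod>i\<in>N. [:- (\<tau> * s i), 1:]) (card N) = 1"
    using monic_prod_linear[OF fin(1), of "\<lambda>i. \<tau> * s i"] by auto
  have degp: "degree p = card N + card M"
    unfolding p_def by (subst degree_mult_eq) (use m1 monic_prod_linear[OF fin(2), of \<sigma>] fin in auto)
  have cp: "coeff p (card N + card M) = 1"
    using coeff_mult_degree_sum[of "\<Prod>i\<in>N. [:- (\<tau> * s i), 1:]" "\<Prod>j\<in>M. [:- \<sigma> j, 1:]"] m1 monic_prod_linear[OF fin(2), of \<sigma>]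
    by (simp add: p_def)
  have r1: "poly p (s k) / (s k * (\<Prod>i\<in>N - {k}. s k - s i) * (\<Prod>j\<in>M. s k - \<tau> * \<sigma> j)) = (1 - \<tau>) * b k" if k: "k \<in> N" for k
  proof -
    have "(\<Prod>i\<in>N. s k - \<tau> * s i) = (s k - \<tau> * s k) * (\<Prod>i\<in>N - {k}. s k - \<tau> * s i)"
      by (rule prod.remove) (use fin k in auto)
    also have "s k - \<tau> * s k = s k * (1 - \<tau>)" by (simp add: algebra_simps)
    finally show ?thesis
      using nz(1)[OF k] by (simp add: polyp b_def prod_dividef)
  qed
  have r2: "poly p (\<tau> * \<sigma> j) / (\<tau> * \<sigma> j * (\<Prod>i\<in>M - {j}. \<tau> * \<sigma> j - \<tau> * \<sigma> i) * (\<Prod>i\<in>N. \<tau> * \<sigma> j - s i)) = - (1 - \<tau>) * \<tau> * c j" if j: "j \<in> M" for j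
  proof -
    have "card M > 0" using j fin by (auto simp: card_gt_0_iff)
    then obtain m where m: "card M = Suc m" using gr0_conv_Suc by blast
    have "(\<Prod>l\<in>M. \<tau> * \<sigma> j - \<sigma> l) = (\<tau> * \<sigma> j - \<sigma> j) * (\<Prod>l\<in>M - {j}. \<tau> * \<sigma> j - \<sigma> l)"
      by (rule prod.remove) (use fin j in auto)
    also have "\<tau> * \<sigma> j - \<sigma> j = - (1 - \<tau>) * \<sigma> j" by (simp add: algebra_simps)
    finally have 1: "(\<Prod>l\<in>M. \<tau> * \<sigma> j - \<sigma> l) = - (1 - \<tau>) * \<sigma> j * (\<Prod>l\<in>M - {j}. \<tau> * \<sigma> j - \<sigma> l)" .
    have 2: "(\<Prod>i\<in>M - {j}. \<tau> * \<sigma> j - \<tau> * \<sigma> i) = \<tau> ^ m * (\<Prod>i\<in>M - {j}. \<sigma> j - \<sigma> i)"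
      using fin j m by (simp add: prod.distrib flip: right_diff_distrib)
    have 3: "(\<Prod>i\<in>N. \<tau> * \<sigma> j - \<tau> * s i) = \<tau> ^ (m + 2) * (\<Prod>i\<in>N. \<sigma> j - s i)"
      using fin j m card by (simp add: prod.distrib flip: right_diff_distrib)
    have 4: "(\<sigma> i - \<tau> * \<sigma> j) / (\<sigma> i - \<sigma> j) = (\<tau> * \<sigma> j - \<sigma> i) / (\<sigma> j - \<sigma> i)" for i
      by (metis minus_diff_eq minus_divide_divide)
    have 5: "(s i - \<sigma> j) / (s i - \<tau> * \<sigma> j) = (\<sigma> j - s i) / (\<tau> * \<sigma> j - s i)" for i
      by (metis minus_diff_eq minus_divide_divide)
    show ?thesis
      unfolding polyp 1 2 3 c_def 4 5 prod_dividef
      using nz(2)[OF j] nz(3) by (simp add: power_add power2_eq_square)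
  qed
  have r3: "poly p 0 / ((\<Prod>i\<in>N. - s i) * (\<Prod>j\<in>M. - (\<tau> * \<sigma> j))) = \<tau>"
  proof -
    have "poly p 0 = (\<Prod>i\<in>N. \<tau> * - s i) * (\<Prod>j\<in>M. - \<sigma> j)" by (simp add: polyp)
    also have "\<dots> = \<tau> * ((\<Prod>i\<in>N. - s i) * (\<Prod>j\<in>M. \<tau> * - \<sigma> j))"
      unfolding prod.distrib using card by simp
    finally show ?thesis using fin nz by simp
  qed
  have "(\<Sum>j\<in>N. poly p (s j) / (s j * (\<Prod>k\<in>N - {j}. s j - s k) * (\<Prod>l\<in>M. s j - \<tau> * \<sigma> l))) +
         (\<Sum>j\<in>M. poly p (\<tau> * \<sigma> j) / (\<tau> * \<sigma> j * (\<Prod>l\<in>M - {j}. \<tau> * \<sigma> j - \<tau> * \<sigma> l) * (\<Prod>k\<in>N. \<tau> * \<sigma> j - s k))) +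
         poly p 0 / ((\<Prod>k\<in>N. - s k) * (\<Prod>l\<in>M. - (\<tau> * \<sigma> l))) = coeff p (card N + card M)"
    by (rule lagrange_two_families) (use fin inj nz gen degp in \<open>auto simp: inj_on_def\<close>)
  then have "(\<Sum>k\<in>N. (1 - \<tau>) * b k) + (\<Sum>j\<in>M. - (1 - \<tau>) * \<tau> * c j) + \<tau> = 1"
    by (simp only: sum.cong[OF refl r1] sum.cong[OF refl r2] r3 cp)
  then have "(1 - \<tau>) * ((\<Sum>k\<in>N. b k) - \<tau> * (\<Sum>j\<in>M. c j)) = (1 - \<tau>) * 1"
    by (simp add: sum_distrib_left algebra_simps sum_negf sum_subtractf)
  then have main: "(\<Sum>k\<in>N. b k) - \<tau> * (\<Sum>j\<in>M. c j) = 1"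
    using nz by (subst (asm) mult_left_cancel) auto
  have gen': "s i - \<tau> * \<sigma> j \<noteq> 0" if "i \<in> N" "j \<in> M" for i j using gen that by auto
  have b: "(\<Prod>i\<in>N - {k}. (s k - \<tau> * s i) / (s k - s i)) *
            (\<Prod>j\<in>M. \<Prod>i\<in>N. if i = k then s i - \<sigma> j else s i - \<tau> * \<sigma> j) = D * b k" if k: "k \<in> N" for k
  proof -
    have "(\<Prod>j\<in>M. \<Prod>i\<in>N. if i = k then s i - \<sigma> j else s i - \<tau> * \<sigma> j) =
        (\<Prod>j\<in>M. (\<Prod>i\<in>N. s i - \<tau> * \<sigma> j) * ((s k - \<sigma> j) / (s k - \<tau> * \<sigma> j)))"
      by (rule prod.cong) (use fin k gen' in \<open>auto simp: prod.remove[OF _ k] intro!: prod.cong\<close>)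
    then show ?thesis unfolding D_def b_def prod.distrib by (simp only: mult_ac)
  qed
  have c: "(\<Prod>i\<in>M - {j}. (\<sigma> i - \<tau> * \<sigma> j) / (\<sigma> i - \<sigma> j)) *
            (\<Prod>l\<in>M. \<Prod>i\<in>N. if l = j then s i - \<sigma> l else s i - \<tau> * \<sigma> l) = D * c j" if j: "j \<in> M" for j
  proof -
    have "(\<Prod>l\<in>M. \<Prod>i\<in>N. if l = j then s i - \<sigma> l else s i - \<tau> * \<sigma> l) =
       (\<Prod>i\<in>N. s i - \<sigma> j) * (\<Prod>l\<in>M - {j}. \<Prod>i\<in>N. s i - \<tau> * \<sigma> l)"
      using fin by (simp add: prod.remove[OF _ j])
    moreover have "D = (\<Prod>i\<in>N. s i - \<tau> * \<sigma> j) * (\<Prod>l\<in>M - {j}. \<Prod>i\<in>N. s i - \<tau> * \<sigma> l)"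
      using fin by (simp add: D_def prod.remove[OF _ j])
    moreover have "(\<Prod>i\<in>N. s i - \<tau> * \<sigma> j) \<noteq> 0" using fin gen' j by auto
    ultimately show ?thesis by (simp add: c_def prod_dividef)
  qed
  have "(\<Sum>k\<in>N. D * b k) = D + \<tau> * (\<Sum>j\<in>M. D * c j)"
    using main by (simp add: sum_distrib_left[symmetric] algebra_simps)
  then show ?thesis
    unfolding D_def[symmetric] by (simp only: sum.cong[OF refl b] sum.cong[OF refl c])
qed

lemma tendsto_const_If:
  assumes "(f \<longlongrightarrow> a) F" "(g \<longlongrightarrow> b) F"
  shows "((\<lambda>x. if P then f x else g x) \<longlongrightarrow> (if P then a else b)) F"
  using assms by (cases P) auto

text \<open>
  At spectral points a coincidence \<open>s i = \<tau> * \<sigma> j\<close> occurs for rows that violate the interlacing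
  conditions by one box, and such rows occur in the Pieri rule.  Replacing \<open>\<sigma>\<close> by
  \<open>c * \<sigma>\<close> removes the coincidences except for finitely many \<open>c\<close>; let \<open>c\<close> tend to \<open>1\<close>.
\<close>
lemma one_step_kernel_identity:
  fixes s \<sigma> :: "nat \<Rightarrow> complex"
  assumes fin: "finite N" "finite M" and card: "card N = Suc (card M)"
    and inj: "inj_on s N" "inj_on \<sigma> M"
    and nz: "\<And>i. i \<in> N \<Longrightarrow> s i \<noteq> 0" "\<And>j. j \<in> M \<Longrightarrow> \<sigma> j \<noteq> 0" "\<tau> \<noteq> 0" "\<tau> \<noteq> 1"
  shows "(\<Sum>k\<in>N. (\<Prod>i\<in>N - {k}. (s k - \<tau> * s i) / (s k - s i)) *
            (\<Prod>j\<in>M. \<Prod>i\<in>N. if i = k then s i - \<sigma> j else s i - \<tau> * \<sigma> j)) =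
         (\<Prod>j\<in>M. \<Prod>i\<in>N. s i - \<tau> * \<sigma> j) +
         \<tau> * (\<Sum>j\<in>M. (\<Prod>i\<in>M - {j}. (\<sigma> i - \<tau> * \<sigma> j) / (\<sigma> i - \<sigma> j)) *
            (\<Prod>l\<in>M. \<Prod>i\<in>N. if l = j then s i - \<sigma> l else s i - \<tau> * \<sigma> l))"
    (is "?L = ?R")
proof -
  define L where "L = (\<lambda>c. \<Sum>k\<in>N. (\<Prod>i\<in>N - {k}. (s k - \<tau> * s i) / (s k - s i)) *
            (\<Prod>j\<in>M. \<Prod>i\<in>N. if i = k then s i - c * \<sigma> j else s i - \<tau> * (c * \<sigma> j)))"
  define R where "R = (\<lambda>c. (\<Prod>j\<in>M. \<Prod>i\<in>N. s i - \<tau> * (c * \<sigma> j)) +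
         \<tau> * (\<Sum>j\<in>M. (\<Prod>i\<in>M - {j}. (\<sigma> i - \<tau> * \<sigma> j) / (\<sigma> i - \<sigma> j)) *
            (\<Prod>l\<in>M. \<Prod>i\<in>N. if l = j then s i - c * \<sigma> l else s i - \<tau> * (c * \<sigma> l))))"
  define A where "A = insert 0 ((\<lambda>(i, j). s i / (\<tau> * \<sigma> j)) ` (N \<times> M))"
  have "L c = R c" if "c \<notin> A" for c
  proof -
    have c: "c \<noteq> 0" using that by (simp add: A_def)
    have ratio: "(c * \<sigma> i - \<tau> * (c * \<sigma> j)) / (c * \<sigma> i - c * \<sigma> j) = (\<sigma> i - \<tau> * \<sigma> j) / (\<sigma> i - \<sigma> j)" for i j
    proof -
      have "c * \<sigma> i - \<tau> * (c * \<sigma> j) = c * (\<sigma> i - \<tau> * \<sigma> j)" by (simp add: algebra_simps)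
      then show ?thesis using c by (simp flip: right_diff_distrib)
    qed
    have "s i \<noteq> \<tau> * (c * \<sigma> j)" if "i \<in> N" "j \<in> M" for i j
      using \<open>c \<notin> A\<close> that nz by (force simp: A_def field_simps)
    then show ?thesis
      using one_step_kernel_identity_generic[OF fin card inj(1), of "\<lambda>j. c * \<sigma> j" \<tau>] inj nz c
      by (simp add: L_def R_def ratio inj_on_def)
  qed
  note LR = this
  have "finite A" using fin by (simp add: A_def)
  then have ev: "eventually (\<lambda>c. L c = R c) (at 1)"
    by (rule eventually_mono[OF eventually_avoid_finite]) (rule LR)
  have LL: "(L \<longlongrightarrow> L 1) (at 1)"
    unfolding L_def by (intro tendsto_intros tendsto_const_If)
  have RR: "(R \<longlongrightarrow> R 1) (at 1)"
    unfolding R_def by (intro tendsto_intros tendsto_const_If)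
  have "(R \<longlongrightarrow> L 1) (at 1)"
    using LL ev by (simp add: tendsto_cong)
  then have "L 1 = R 1" using RR by (intro tendsto_unique) auto
  then show ?thesis unfolding L_def R_def by (simp only: mult_1)
qed

text \<open>
  Apply \<open>T\<^sub>1\<close> minus its eigenvalue to the branching rule.  Up to a nonzero factor, this is the coefficient
  of one polynomial of lower rank, with spectral points \<open>s\<close> and \<open>\<sigma>\<close> (\<open>kernel_eigen\<close>).
\<close>
definition Qsum :: "complex \<Rightarrow> nat set \<Rightarrow> nat set \<Rightarrow> (nat \<Rightarrow> complex) \<Rightarrow> (nat \<Rightarrow> complex) \<Rightarrow> complex" where
  "Qsum \<tau> N M s \<sigma> = (\<Sum>J\<in>Pow M. (- 1) ^ card J * \<tau> ^ (card J + (card J choose 2)) *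
      (\<Prod>j\<in>J. \<Prod>i\<in>M - J. (\<sigma> i - \<tau> * \<sigma> j) / (\<sigma> i - \<sigma> j)) *
      ((\<Prod>j\<in>J. \<Prod>k\<in>N. s k - \<sigma> j) * (\<Prod>j\<in>M - J. \<Prod>k\<in>N. s k - \<tau> * \<sigma> j)) *
      (sum \<sigma> M + (\<tau> - 1) * sum \<sigma> J + prod s N / (prod \<sigma> M * \<tau> ^ card J) - sum s N))"

text \<open>
  The summands with \<open>a \<in> J\<close> contain the factor \<open>s n - \<sigma> a\<close>.  In the other ones all factors that
  involve \<open>a\<close> or \<open>n\<close> combine to a factor independent of \<open>J\<close>.
\<close>
lemma Qsum_at_sigma:
  assumes fin: "finite N" "finite M" and inj: "inj_on \<sigma> M" and nz: "\<And>j. j \<in> M \<Longrightarrow> \<sigma> j \<noteq> 0"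
    and a: "a \<in> M" and n: "n \<in> N" "s n = \<sigma> a"
  shows "Qsum \<tau> N M s \<sigma> = (\<Prod>k\<in>N - {n}. s k - \<tau> * \<sigma> a) * (\<Prod>j\<in>M. \<sigma> a - \<tau> * \<sigma> j) * Qsum \<tau> (N - {n}) (M - {a}) s \<sigma>"
proof -
  let ?w = "\<lambda>J. (- 1) ^ card J * \<tau> ^ (card J + (card J choose 2))"
  let ?r = "\<lambda>i j. (\<sigma> i - \<tau> * \<sigma> j) / (\<sigma> i - \<sigma> j)"
  have "Qsum \<tau> N M s \<sigma> = (\<Sum>J\<in>Pow (M - {a}). ?w J *
      (\<Prod>j\<in>J. \<Prod>i\<in>M - J. ?r i j) *
      ((\<Prod>j\<in>J. \<Prod>k\<in>N. s k - \<sigma> j) * (\<Prod>j\<in>M - J. \<Prod>k\<in>N. s k - \<tau> * \<sigma> j)) *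
      (sum \<sigma> M + (\<tau> - 1) * sum \<sigma> J + prod s N / (prod \<sigma> M * \<tau> ^ card J) - sum s N))"
    unfolding Qsum_def
  proof (rule sum.mono_neutral_right)
    show "\<forall>J\<in>Pow M - Pow (M - {a}). ?w J * (\<Prod>j\<in>J. \<Prod>i\<in>M - J. ?r i j) *
      ((\<Prod>j\<in>J. \<Prod>k\<in>N. s k - \<sigma> j) * (\<Prod>j\<in>M - J. \<Prod>k\<in>N. s k - \<tau> * \<sigma> j)) *
      (sum \<sigma> M + (\<tau> - 1) * sum \<sigma> J + prod s N / (prod \<sigma> M * \<tau> ^ card J) - sum s N) = 0"
    proof
      fix J assume J: "J \<in> Pow M - Pow (M - {a})"
      then have "a \<in> J" "finite J" using fin finite_subset by auto
      moreover have "(\<Prod>k\<in>N. s k - \<sigma> a) = 0"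
        using fin n by (auto intro!: prod_zero)
      ultimately have "(\<Prod>j\<in>J. \<Prod>k\<in>N. s k - \<sigma> j) = 0"
        by (auto intro!: prod_zero simp del: prod_zero_iff)
      then show "?w J * (\<Prod>j\<in>J. \<Prod>i\<in>M - J. ?r i j) *
      ((\<Prod>j\<in>J. \<Prod>k\<in>N. s k - \<sigma> j) * (\<Prod>j\<in>M - J. \<Prod>k\<in>N. s k - \<tau> * \<sigma> j)) *
      (sum \<sigma> M + (\<tau> - 1) * sum \<sigma> J + prod s N / (prod \<sigma> M * \<tau> ^ card J) - sum s N) = 0" by simp
    qed
  qed (use fin in auto)
  also have "\<dots> = (\<Sum>J\<in>Pow (M - {a}). ((\<Prod>k\<in>N - {n}. s k - \<tau> * \<sigma> a) * (\<Prod>j\<in>M. \<sigma> a - \<tau> * \<sigma> j)) * (?w J *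
      (\<Prod>j\<in>J. \<Prod>i\<in>M - {a} - J. ?r i j) *
      ((\<Prod>j\<in>J. \<Prod>k\<in>N - {n}. s k - \<sigma> j) * (\<Prod>j\<in>M - {a} - J. \<Prod>k\<in>N - {n}. s k - \<tau> * \<sigma> j)) *
      (sum \<sigma> (M - {a}) + (\<tau> - 1) * sum \<sigma> J + prod s (N - {n}) / (prod \<sigma> (M - {a}) * \<tau> ^ card J) - sum s (N - {n}))))"
  proof (rule sum.cong)
    fix J assume "J \<in> Pow (M - {a})"
    then have J: "J \<subseteq> M" "a \<notin> J" "finite J" using fin finite_subset[of J M] by auto
    have MJ: "M - J = insert a (M - {a} - J)" using a J by auto
    have 1: "(\<Prod>j\<in>J. \<Prod>i\<in>M - J. ?r i j) = (\<Prod>j\<in>J. ?r a j) * (\<Prod>j\<in>J. \<Prod>i\<in>M - {a} - J. ?r i j)"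
    proof -
      have "(\<Prod>i\<in>M - J. ?r i j) = ?r a j * (\<Prod>i\<in>M - {a} - J. ?r i j)" for j
        unfolding MJ using fin by (subst prod.insert) auto
      then show ?thesis by (simp only: prod.distrib)
    qed
    have 2: "(\<Prod>j\<in>J. \<Prod>k\<in>N. s k - \<sigma> j) = (\<Prod>j\<in>J. \<sigma> a - \<sigma> j) * (\<Prod>j\<in>J. \<Prod>k\<in>N - {n}. s k - \<sigma> j)"
      using fin n by (simp add: prod.remove[OF _ n(1)] prod.distrib)
    have 3: "(\<Prod>j\<in>M - J. \<Prod>k\<in>N. s k - \<tau> * \<sigma> j) = (\<Prod>j\<in>M - J. \<sigma> a - \<tau> * \<sigma> j) *
       ((\<Prod>k\<in>N - {n}. s k - \<tau> * \<sigma> a) * (\<Prod>j\<in>M - {a} - J. \<Prod>k\<in>N - {n}. s k - \<tau> * \<sigma> j))"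
    proof -
      have "(\<Prod>j\<in>M - J. \<Prod>k\<in>N. s k - \<tau> * \<sigma> j) = (\<Prod>j\<in>M - J. \<sigma> a - \<tau> * \<sigma> j) * (\<Prod>j\<in>M - J. \<Prod>k\<in>N - {n}. s k - \<tau> * \<sigma> j)"
        using fin n by (simp add: prod.remove[OF _ n(1)] prod.distrib)
      then show ?thesis unfolding MJ using fin by simp
    qed
    have 4: "(\<Prod>j\<in>J. ?r a j) * (\<Prod>j\<in>J. \<sigma> a - \<sigma> j) * (\<Prod>j\<in>M - J. \<sigma> a - \<tau> * \<sigma> j) = (\<Prod>j\<in>M. \<sigma> a - \<tau> * \<sigma> j)"
    proof -
      have "(\<Prod>j\<in>J. ?r a j) * (\<Prod>j\<in>J. \<sigma> a - \<sigma> j) = (\<Prod>j\<in>J. \<sigma> a - \<tau> * \<sigma> j)"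
        unfolding prod.distrib[symmetric] by (rule prod.cong) (use inj a J in \<open>auto simp: inj_on_def\<close>)
      then show ?thesis using prod.subset_diff[OF J(1) fin(2), of "\<lambda>j. \<sigma> a - \<tau> * \<sigma> j"] by (simp add: mult.commute)
    qed
    have 5: "sum \<sigma> M = \<sigma> a + sum \<sigma> (M - {a})" "sum s N = \<sigma> a + sum s (N - {n})"
      using fin a n by (auto simp: sum.remove)
    have 6: "prod s N / (prod \<sigma> M * \<tau> ^ card J) = prod s (N - {n}) / (prod \<sigma> (M - {a}) * \<tau> ^ card J)"
      using fin a n nz[OF a] by (simp add: prod.remove[OF _ a] prod.remove[OF _ n(1)])
    show "?w J * (\<Prod>j\<in>J. \<Prod>i\<in>M - J. ?r i j) *
      ((\<Prod>j\<in>J. \<Prod>k\<in>N. s k - \<sigma> j) * (\<Prod>j\<in>M - J. \<Prod>k\<in>N. s k - \<tau> * \<sigma> j)) *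
      (sum \<sigma> M + (\<tau> - 1) * sum \<sigma> J + prod s N / (prod \<sigma> M * \<tau> ^ card J) - sum s N) =
      ((\<Prod>k\<in>N - {n}. s k - \<tau> * \<sigma> a) * (\<Prod>j\<in>M. \<sigma> a - \<tau> * \<sigma> j)) * (?w J *
      (\<Prod>j\<in>J. \<Prod>i\<in>M - {a} - J. ?r i j) *
      ((\<Prod>j\<in>J. \<Prod>k\<in>N - {n}. s k - \<sigma> j) * (\<Prod>j\<in>M - {a} - J. \<Prod>k\<in>N - {n}. s k - \<tau> * \<sigma> j)) *
      (sum \<sigma> (M - {a}) + (\<tau> - 1) * sum \<sigma> J + prod s (N - {n}) / (prod \<sigma> (M - {a}) * \<tau> ^ card J) - sum s (N - {n})))"
      unfolding 1 2 3 4[symmetric] 5 6 by (simp add: mult_ac)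
  qed simp
  finally show ?thesis
    unfolding Qsum_def by (simp add: sum_distrib_left)
qed

text \<open>
  As before, but now the summands with \<open>a \<notin> J\<close> vanish.
\<close>
lemma Qsum_at_tau_sigma:
  assumes fin: "finite N" "finite M" and inj: "inj_on \<sigma> M" and nz: "\<And>j. j \<in> M \<Longrightarrow> \<sigma> j \<noteq> 0" "\<tau> \<noteq> 0"
    and a: "a \<in> M" and n: "n \<in> N" "s n = \<tau> * \<sigma> a"
  shows "Qsum \<tau> N M s \<sigma> = - (\<tau> ^ card M * (\<Prod>k\<in>N - {n}. s k - \<sigma> a) * (\<Prod>j\<in>M. \<tau> * \<sigma> a - \<sigma> j)) * Qsum \<tau> (N - {n}) (M - {a}) s \<sigma>"
proof -
  let ?w = "\<lambda>J. (- 1) ^ card J * \<tau> ^ (card J + (card J choose 2))"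
  let ?r = "\<lambda>i j. (\<sigma> i - \<tau> * \<sigma> j) / (\<sigma> i - \<sigma> j)"
  let ?T = "\<lambda>J. ?w J * (\<Prod>j\<in>J. \<Prod>i\<in>M - J. ?r i j) *
      ((\<Prod>j\<in>J. \<Prod>k\<in>N. s k - \<sigma> j) * (\<Prod>j\<in>M - J. \<Prod>k\<in>N. s k - \<tau> * \<sigma> j)) *
      (sum \<sigma> M + (\<tau> - 1) * sum \<sigma> J + prod s N / (prod \<sigma> M * \<tau> ^ card J) - sum s N)"
  have "Qsum \<tau> N M s \<sigma> = (\<Sum>J\<in>insert a ` Pow (M - {a}). ?T J)"
    unfolding Qsum_def
  proof (rule sum.mono_neutral_right)
    show "\<forall>J\<in>Pow M - insert a ` Pow (M - {a}). ?T J = 0"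
    proof
      fix J assume J: "J \<in> Pow M - insert a ` Pow (M - {a})"
      have "a \<notin> J"
      proof
        assume "a \<in> J"
        then have "J = insert a (J - {a})" "J - {a} \<in> Pow (M - {a})" using J by auto
        then show False using J by blast
      qed
      then have "a \<in> M - J" using a by auto
      moreover have "(\<Prod>k\<in>N. s k - \<tau> * \<sigma> a) = 0"
        using fin n by (auto intro!: prod_zero)
      ultimately have "(\<Prod>j\<in>M - J. \<Prod>k\<in>N. s k - \<tau> * \<sigma> j) = 0"
        using fin by (intro prod_zero) blast+
      then show "?T J = 0" by simp
    qed
  qed (use fin a in auto)
  also have "\<dots> = (\<Sum>J\<in>Pow (M - {a}). ?T (insert a J))"
    by (subst sum.reindex) (auto simp: inj_on_def)
  also have "\<dots> = (\<Sum>J\<in>Pow (M - {a}). - (\<tau> ^ card M * (\<Prod>k\<in>N - {n}. s k - \<sigma> a) * (\<Prod>j\<in>M. \<tau> * \<sigma> a - \<sigma> j)) * (?w J *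
      (\<Prod>j\<in>J. \<Prod>i\<in>M - {a} - J. ?r i j) *
      ((\<Prod>j\<in>J. \<Prod>k\<in>N - {n}. s k - \<sigma> j) * (\<Prod>j\<in>M - {a} - J. \<Prod>k\<in>N - {n}. s k - \<tau> * \<sigma> j)) *
      (sum \<sigma> (M - {a}) + (\<tau> - 1) * sum \<sigma> J + prod s (N - {n}) / (prod \<sigma> (M - {a}) * \<tau> ^ card J) - sum s (N - {n}))))"
  proof (rule sum.cong)
    fix J assume "J \<in> Pow (M - {a})"
    then have J: "J \<subseteq> M" "a \<notin> J" "finite J" using fin finite_subset[of J M] by auto
    let ?J = "insert a J" and ?C = "M - {a} - J"
    have MJ: "M - ?J = ?C" by auto
    have 1: "(\<Prod>j\<in>?J. \<Prod>i\<in>M - ?J. ?r i j) = (\<Prod>i\<in>?C. ?r i a) * (\<Prod>j\<in>J. \<Prod>i\<in>?C. ?r i j)"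
      unfolding MJ using J by simp
    have 2: "(\<Prod>j\<in>?J. \<Prod>k\<in>N. s k - \<sigma> j) = (\<Prod>j\<in>?J. \<tau> * \<sigma> a - \<sigma> j) * ((\<Prod>k\<in>N - {n}. s k - \<sigma> a) * (\<Prod>j\<in>J. \<Prod>k\<in>N - {n}. s k - \<sigma> j))"
    proof -
      have "(\<Prod>j\<in>?J. \<Prod>k\<in>N. s k - \<sigma> j) = (\<Prod>j\<in>?J. \<tau> * \<sigma> a - \<sigma> j) * (\<Prod>j\<in>?J. \<Prod>k\<in>N - {n}. s k - \<sigma> j)"
        unfolding prod.distrib[symmetric] using fin n by (simp add: prod.remove[OF _ n(1)])
      then show ?thesis using J by simp
    qed
    have 3: "(\<Prod>j\<in>M - ?J. \<Prod>k\<in>N. s k - \<tau> * \<sigma> j) = (\<Prod>j\<in>?C. \<tau> * \<sigma> a - \<tau> * \<sigma> j) * (\<Prod>j\<in>?C. \<Prod>k\<in>N - {n}. s k - \<tau> * \<sigma> j)"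
      unfolding MJ prod.distrib[symmetric] using fin n by (simp add: prod.remove[OF _ n(1)])
    have cC: "card ?C + card J + 1 = card M"
    proof -
      have "card M = card (insert a (J \<union> ?C))" using J a by (intro arg_cong[of _ _ card]) auto
      also have "\<dots> = Suc (card (J \<union> ?C))" using J fin by (subst card_insert_disjoint) auto
      also have "card (J \<union> ?C) = card J + card ?C" using J fin by (subst card_Un_disjoint) auto
      finally show ?thesis by simp
    qed
    have 4: "(\<Prod>i\<in>?C. ?r i a) * (\<Prod>j\<in>?C. \<tau> * \<sigma> a - \<tau> * \<sigma> j) * (\<Prod>j\<in>?J. \<tau> * \<sigma> a - \<sigma> j) = \<tau> ^ card ?C * (\<Prod>j\<in>M. \<tau> * \<sigma> a - \<sigma> j)"
    proof -
      have "(\<Prod>i\<in>?C. ?r i a) * (\<Prod>j\<in>?C. \<tau> * \<sigma> a - \<tau> * \<sigma> j) = (\<Prod>j\<in>?C. \<tau> * (\<tau> * \<sigma> a - \<sigma> j))"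
        unfolding prod.distrib[symmetric]
      proof (rule prod.cong)
        fix i assume "i \<in> ?C"
        then have "\<sigma> i - \<sigma> a \<noteq> 0" using inj a by (auto simp: inj_on_def)
        then show "?r i a * (\<tau> * \<sigma> a - \<tau> * \<sigma> i) = \<tau> * (\<tau> * \<sigma> a - \<sigma> i)"
          by (simp add: divide_simps) (simp add: algebra_simps)
      qed simp
      also have "\<dots> = \<tau> ^ card ?C * (\<Prod>j\<in>?C. \<tau> * \<sigma> a - \<sigma> j)" by (simp add: prod.distrib)
      finally have "(\<Prod>i\<in>?C. ?r i a) * (\<Prod>j\<in>?C. \<tau> * \<sigma> a - \<tau> * \<sigma> j) = \<tau> ^ card ?C * (\<Prod>j\<in>?C. \<tau> * \<sigma> a - \<sigma> j)" .
      moreover have "(\<Prod>j\<in>M. \<tau> * \<sigma> a - \<sigma> j) = (\<Prod>j\<in>?C. \<tau> * \<sigma> a - \<sigma> j) * (\<Prod>j\<in>?J. \<tau> * \<sigma> a - \<sigma> j)"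
        using prod.subset_diff[of ?J M "\<lambda>j. \<tau> * \<sigma> a - \<sigma> j"] J fin a unfolding MJ by auto
      ultimately show ?thesis by simp
    qed
    have 5: "sum \<sigma> M + (\<tau> - 1) * sum \<sigma> ?J - sum s N = sum \<sigma> (M - {a}) + (\<tau> - 1) * sum \<sigma> J - sum s (N - {n})"
      using fin a n J by (simp add: sum.remove[OF _ a] sum.remove[OF _ n(1)] algebra_simps)
    have 6: "prod s N / (prod \<sigma> M * \<tau> ^ card ?J) = prod s (N - {n}) / (prod \<sigma> (M - {a}) * \<tau> ^ card J)"
      using fin a n nz nz(1)[OF a] J by (simp add: prod.remove[OF _ a] prod.remove[OF _ n(1)])
    have 7: "?w ?J * \<tau> ^ card ?C = - (\<tau> ^ card M * ?w J)"
    proof -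
      have "(Suc (card J) choose 2) = card J + (card J choose 2)"
        by (simp add: numeral_2_eq_2)
      then have "card ?J + (card ?J choose 2) + card ?C = card M + (card J + (card J choose 2))"
        using cC J by simp
      then have "\<tau> ^ (card ?J + (card ?J choose 2)) * \<tau> ^ card ?C = \<tau> ^ card M * \<tau> ^ (card J + (card J choose 2))"
        by (simp flip: power_add)
      then show ?thesis using J by (simp add: mult.assoc)
    qed
    have 8: "sum \<sigma> M + (\<tau> - 1) * sum \<sigma> ?J + prod s N / (prod \<sigma> M * \<tau> ^ card ?J) - sum s N =
       sum \<sigma> (M - {a}) + (\<tau> - 1) * sum \<sigma> J + prod s (N - {n}) / (prod \<sigma> (M - {a}) * \<tau> ^ card J) - sum s (N - {n})"
      using 5 6 by (simp add: algebra_simps)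
    have "?T ?J = (?w ?J * ((\<Prod>i\<in>?C. ?r i a) * (\<Prod>j\<in>?C. \<tau> * \<sigma> a - \<tau> * \<sigma> j) * (\<Prod>j\<in>?J. \<tau> * \<sigma> a - \<sigma> j))) * (\<Prod>k\<in>N - {n}. s k - \<sigma> a) *
       ((\<Prod>j\<in>J. \<Prod>i\<in>?C. ?r i j) *
      ((\<Prod>j\<in>J. \<Prod>k\<in>N - {n}. s k - \<sigma> j) * (\<Prod>j\<in>?C. \<Prod>k\<in>N - {n}. s k - \<tau> * \<sigma> j)) *
      (sum \<sigma> (M - {a}) + (\<tau> - 1) * sum \<sigma> J + prod s (N - {n}) / (prod \<sigma> (M - {a}) * \<tau> ^ card J) - sum s (N - {n})))"
      unfolding 1 2 3 8 by (simp only: mult_ac)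
    also have "?w ?J * ((\<Prod>i\<in>?C. ?r i a) * (\<Prod>j\<in>?C. \<tau> * \<sigma> a - \<tau> * \<sigma> j) * (\<Prod>j\<in>?J. \<tau> * \<sigma> a - \<sigma> j)) = - (\<tau> ^ card M * ?w J) * (\<Prod>j\<in>M. \<tau> * \<sigma> a - \<sigma> j)"
      unfolding 4 mult.assoc[symmetric, of "?w ?J"] 7 ..
    finally show "?T ?J = - (\<tau> ^ card M * (\<Prod>k\<in>N - {n}. s k - \<sigma> a) * (\<Prod>j\<in>M. \<tau> * \<sigma> a - \<sigma> j)) * (?w J *
      (\<Prod>j\<in>J. \<Prod>i\<in>M - {a} - J. ?r i j) *
      ((\<Prod>j\<in>J. \<Prod>k\<in>N - {n}. s k - \<sigma> j) * (\<Prod>j\<in>M - {a} - J. \<Prod>k\<in>N - {n}. s k - \<tau> * \<sigma> j)) *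
      (sum \<sigma> (M - {a}) + (\<tau> - 1) * sum \<sigma> J + prod s (N - {n}) / (prod \<sigma> (M - {a}) * \<tau> ^ card J) - sum s (N - {n})))"
      by (simp only: mult_ac minus_mult_left[symmetric] minus_mult_right[symmetric])
  qed simp
  finally show ?thesis
    unfolding Qsum_def by (simp add: sum_distrib_left)
qed

text \<open>
  As a function of a single \<open>s n\<close> the sum is a polynomial of degree at most \<open>card M + 1\<close>.  By induction it
  vanishes at the \<open>2 * card M\<close> points \<open>\<sigma> a\<close> and \<open>\<tau> * \<sigma> a\<close>, which are too many if
  \<open>card M \<ge> 2\<close>.
\<close>
lemma Qsum_zero:
  assumes "finite N" "finite M" "card N = Suc (card M)" "inj_on \<sigma> M" "\<And>j. j \<in> M \<Longrightarrow> \<sigma> j \<noteq> 0" "\<tau> \<noteq> 0"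
    "\<And>i j. i \<in> M \<Longrightarrow> j \<in> M \<Longrightarrow> \<sigma> i \<noteq> \<tau> * \<sigma> j"
  shows "Qsum \<tau> N M s \<sigma> = 0"
  using assms
proof (induction "card M" arbitrary: N M s)
  case 0
  then have "M = {}" by simp
  moreover obtain n where "N = {n}" using 0 by (metis card_1_singletonE One_nat_def)
  ultimately show ?case by (simp add: Qsum_def)
next
  case (Suc m)
  note prems = Suc.prems
  show ?case
  proof (cases "m = 0")
    case True
    then obtain a where M: "M = {a}" using Suc by (metis card_1_singletonE One_nat_def)
    obtain k l where N: "N = {k, l}" "k \<noteq> l"
      using prems(3) M by (metis One_nat_def card.empty card_insert_disjoint card_2_iff finite.emptyI insert_absorb insert_not_empty numeral_2_eq_2)
    have P: "Pow {a} = {{}, {a}}" by auto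
    have c: "Suc 0 choose 2 = 0" "0 choose 2 = 0" by (simp_all add: binomial_eq_0)
    show ?thesis
      unfolding Qsum_def M P using N(2) prems(5)[of a] prems(6) M
      by (simp add: N(1) c divide_simps) (simp add: c algebra_simps)
  next
    case False
    obtain n where n: "n \<in> N" using prems(3) by fastforce
    define w where "w J = (- 1) ^ card J * \<tau> ^ (card J + (card J choose 2)) *
      (\<Prod>j\<in>J. \<Prod>i\<in>M - J. (\<sigma> i - \<tau> * \<sigma> j) / (\<sigma> i - \<sigma> j)) *
      ((\<Prod>j\<in>J. \<Prod>k\<in>N - {n}. s k - \<sigma> j) * (\<Prod>j\<in>M - J. \<Prod>k\<in>N - {n}. s k - \<tau> * \<sigma> j))" for J
    define P where "P = (\<Sum>J\<in>Pow M. smult (w J) ((\<Prod>j\<in>J. [:- \<sigma> j, 1:]) * (\<Prod>j\<in>M - J. [:- (\<tau> * \<sigma> j), 1:]) *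
       [:sum \<sigma> M + (\<tau> - 1) * sum \<sigma> J - sum s (N - {n}), prod s (N - {n}) / (prod \<sigma> M * \<tau> ^ card J) - 1:]))"
    have P: "poly P z = Qsum \<tau> N M (s(n := z)) \<sigma>" for z
      unfolding P_def Qsum_def poly_sum
    proof (rule sum.cong)
      fix J assume "J \<in> Pow M"
      have 1: "(\<Prod>k\<in>N. (s(n := z)) k - c) = (z - c) * (\<Prod>k\<in>N - {n}. s k - c)" for c
        using prems(1) n by (simp add: prod.remove[OF _ n])
      have 2: "sum (s(n := z)) N = z + sum s (N - {n})" "prod (s(n := z)) N = z * prod s (N - {n})"
        using prems(1) n by (simp_all add: sum.remove[OF _ n] prod.remove[OF _ n])
      show "poly (smult (w J) ((\<Prod>j\<in>J. [:- \<sigma> j, 1:]) * (\<Prod>j\<in>M - J. [:- (\<tau> * \<sigma> j), 1:]) *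
       [:sum \<sigma> M + (\<tau> - 1) * sum \<sigma> J - sum s (N - {n}), prod s (N - {n}) / (prod \<sigma> M * \<tau> ^ card J) - 1:])) z =
       (- 1) ^ card J * \<tau> ^ (card J + (card J choose 2)) *
      (\<Prod>j\<in>J. \<Prod>i\<in>M - J. (\<sigma> i - \<tau> * \<sigma> j) / (\<sigma> i - \<sigma> j)) *
      ((\<Prod>j\<in>J. \<Prod>k\<in>N. (s(n := z)) k - \<sigma> j) * (\<Prod>j\<in>M - J. \<Prod>k\<in>N. (s(n := z)) k - \<tau> * \<sigma> j)) *
      (sum \<sigma> M + (\<tau> - 1) * sum \<sigma> J + prod (s(n := z)) N / (prod \<sigma> M * \<tau> ^ card J) - sum (s(n := z)) N)"
        unfolding 1 2 w_def prod.distrib poly_smult poly_mult poly_prod by (simp add: algebra_simps)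
    qed simp
    have "degree P \<le> card M + 1"
      unfolding P_def
    proof (rule degree_sum_le)
      fix J assume "J \<in> Pow M"
      then have J: "finite J" "J \<subseteq> M" using prems(2) finite_subset by auto
      have cM: "card J + card (M - J) = card M"
        using J prems(2) by (metis card_Diff_subset card_mono le_add_diff_inverse)
      have d1: "degree (\<Prod>j\<in>J. [:- \<sigma> j, 1:]) = card J"
        using monic_prod_linear(1)[OF J(1), of \<sigma>] .
      have d2: "degree (\<Prod>j\<in>M - J. [:- (\<tau> * \<sigma> j), 1:]) = card (M - J)"
        using monic_prod_linear(1)[of "M - J" "\<lambda>j. \<tau> * \<sigma> j"] prems(2) by simp
      show "degree (smult (w J) ((\<Prod>j\<in>J. [:- \<sigma> j, 1:]) * (\<Prod>j\<in>M - J. [:- (\<tau> * \<sigma> j), 1:]) *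
       [:sum \<sigma> M + (\<tau> - 1) * sum \<sigma> J - sum s (N - {n}), prod s (N - {n}) / (prod \<sigma> M * \<tau> ^ card J) - 1:])) \<le> card M + 1"
        apply (rule order_trans[OF degree_smult_le])
        apply (rule order_trans[OF degree_mult_le])
        apply (rule add_mono)
         apply (rule order_trans[OF degree_mult_le])
        using d1 d2 cM by auto
    qed (use prems in auto)
    moreover have "poly P z = 0" if z: "z \<in> \<sigma> ` M \<union> (\<lambda>j. \<tau> * \<sigma> j) ` M" for z
    proof -
      from z obtain a where a: "a \<in> M" "z = \<sigma> a \<or> z = \<tau> * \<sigma> a" by auto
      have "Qsum \<tau> (N - {n}) (M - {a}) (s(n := z)) \<sigma> = 0"
      proof (rule Suc.hyps(1))
        show "inj_on \<sigma> (M - {a})" using prems(4) by (auto simp: inj_on_def)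
        show "\<sigma> i \<noteq> \<tau> * \<sigma> j" if "i \<in> M - {a}" "j \<in> M - {a}" for i j using prems(7)[of i j] that by auto
      qed (use Suc.hyps(2) prems a n in auto)
      then show ?thesis
        using Qsum_at_sigma[of N M \<sigma> a n "s(n := z)" \<tau>] Qsum_at_tau_sigma[of N M \<sigma> \<tau> a n "s(n := z)"] prems a n
        unfolding P by auto
    qed
    moreover have "card (\<sigma> ` M \<union> (\<lambda>j. \<tau> * \<sigma> j) ` M) = 2 * card M"
    proof -
      have "card (\<sigma> ` M) = card M" "card ((\<lambda>j. \<tau> * \<sigma> j) ` M) = card M"
        using prems by (auto intro!: card_image simp: inj_on_def)
      moreover have "\<sigma> ` M \<inter> (\<lambda>j. \<tau> * \<sigma> j) ` M = {}" using prems(7) by auto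
      ultimately show ?thesis using prems(2) by (simp add: card_Un_disjoint)
    qed
    ultimately have "P = 0"
      using Suc.hyps(2) False by (intro poly_eqI_degree[where A = "\<sigma> ` M \<union> (\<lambda>j. \<tau> * \<sigma> j) ` M"]) auto
    then have "poly P (s n) = 0" by simp
    then show ?thesis unfolding P by simp
  qed
qed

section \<open>Commutation relations of operators of Macdonald type\<close>

text \<open>
  Two successive shifts, by \<open>I\<close> and by \<open>j\<close>, either shift \<open>j\<close> twice or shift the set
  \<open>K = insert j I\<close> once.
\<close>
lemma sum_pairs_split:
  fixes g :: "nat set \<Rightarrow> nat \<Rightarrow> complex"
  assumes "finite N"
  shows "(\<Sum>I\<in>{I. I \<subseteq> N \<and> card I = r}. \<Sum>j\<in>N. g I j) =
     (\<Sum>I\<in>{I. I \<subseteq> N \<and> card I = r}. \<Sum>j\<in>I. g I j) +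
     (\<Sum>K\<in>{K. K \<subseteq> N \<and> card K = Suc r}. \<Sum>j\<in>K. g (K - {j}) j)"
proof -
  have "(\<Sum>j\<in>N. g I j) = (\<Sum>j\<in>I. g I j) + (\<Sum>j\<in>N - I. g I j)" if "I \<subseteq> N" for I
    using sum.subset_diff[OF that assms, of "g I"] by (simp add: add.commute)
  then have "(\<Sum>I\<in>{I. I \<subseteq> N \<and> card I = r}. \<Sum>j\<in>N. g I j) =
     (\<Sum>I\<in>{I. I \<subseteq> N \<and> card I = r}. \<Sum>j\<in>I. g I j) + (\<Sum>I\<in>{I. I \<subseteq> N \<and> card I = r}. \<Sum>j\<in>N - I. g I j)"
    by (simp add: sum.distrib)
  also have "(\<Sum>I\<in>{I. I \<subseteq> N \<and> card I = r}. \<Sum>j\<in>N - I. g I j) =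
       (\<Sum>(I, j)\<in>Sigma {I. I \<subseteq> N \<and> card I = r} (\<lambda>I. N - I). g I j)"
    by (rule sum.Sigma) (use assms in auto)
  also have "\<dots> = (\<Sum>(K, j)\<in>Sigma {K. K \<subseteq> N \<and> card K = Suc r} (\<lambda>K. K). g (K - {j}) j)"
  proof (rule sum.reindex_bij_witness[of _ "\<lambda>(K, j). (K - {j}, j)" "\<lambda>(I, j). (insert j I, j)"])
    fix a assume a: "a \<in> Sigma {I. I \<subseteq> N \<and> card I = r} (\<lambda>I. N - I)"
    then have "finite (fst a)" using assms by (auto dest: finite_subset)
    then show "(case a of (I, j) \<Rightarrow> (insert j I, j)) \<in> Sigma {K. K \<subseteq> N \<and> card K = Suc r} (\<lambda>K. K)"
      using a by auto
  qed (use assms in \<open>auto simp: insert_absorb dest: finite_subset\<close>)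
  also have "\<dots> = (\<Sum>K\<in>{K. K \<subseteq> N \<and> card K = Suc r}. \<Sum>j\<in>K. g (K - {j}) j)"
    by (rule sum.Sigma[symmetric]) (use assms in \<open>auto dest: finite_subset\<close>)
  finally show ?thesis .
qed

text \<open>
  The setting has two instances.  In one the points are the variables and \<open>D\<close> are the Macdonald
  operators; in the other the points are partitions, \<open>S\<close> is their spectral point, a shift adds boxes, and \<open>D\<close>
  are the Pieri operators.
\<close>
locale shift_lattice =
  fixes q h :: complex and N :: "nat set" and sh :: "nat set \<Rightarrow> 'p \<Rightarrow> 'p" and S :: "'p \<Rightarrow> nat \<Rightarrow> complex"
  assumes finN: "finite N"
    and S_sh: "\<And>I p. S (sh I p) = (\<lambda>i. if i \<in> I then q * S p i else S p i)"
    and sh_insert: "\<And>j I p. j \<notin> I \<Longrightarrow> sh {j} (sh I p) = sh (insert j I) p"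
    and sh_commute: "\<And>j I p. sh {j} (sh I p) = sh I (sh {j} p)"
    and qh: "q \<noteq> 0" "q \<noteq> 1" "h \<noteq> 0" "h \<noteq> 1" "h \<noteq> q"
begin

definition D :: "nat \<Rightarrow> ('p \<Rightarrow> complex) \<Rightarrow> 'p \<Rightarrow> complex" where
  "D r f p = (\<Sum>I\<in>{I. I \<subseteq> N \<and> card I = r}. hcoef h N I (S p) * f (sh I p))"

text \<open>
  Up to the factor \<open>q - 1\<close>, this is the commutator of \<open>D r\<close> with multiplication by the sum of the
  coordinates.
\<close>
definition Dw :: "nat \<Rightarrow> ('p \<Rightarrow> complex) \<Rightarrow> 'p \<Rightarrow> complex" where
  "Dw r f p = (\<Sum>I\<in>{I. I \<subseteq> N \<and> card I = r}. hcoef h N I (S p) * (\<Sum>i\<in>I. S p i) * f (sh I p))"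

definition nondeg :: "'p \<Rightarrow> bool" where
  "nondeg p \<longleftrightarrow> (\<forall>i\<in>N. S p i \<noteq> 0) \<and> inj_on (S p) N \<and> (\<forall>i\<in>N. \<forall>j\<in>N. S p i \<noteq> q * S p j)"

lemma subsets_card_1: "{I. I \<subseteq> N \<and> card I = 1} = (\<lambda>j. {j}) ` N"
  by (auto simp: card_1_singleton_iff)

lemma sum_subsets_card_1: "(\<Sum>I\<in>{I. I \<subseteq> N \<and> card I = 1}. g I) = (\<Sum>j\<in>N. g {j})" for g :: "nat set \<Rightarrow> complex"
  unfolding subsets_card_1 by (subst sum.reindex) (auto simp: inj_on_def)

lemma D_1: "D 1 f p = (\<Sum>j\<in>N. hcoef h N {j} (S p) * f (sh {j} p))"
  unfolding D_def sum_subsets_card_1 ..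

lemma Dw_1: "Dw 1 f p = (\<Sum>j\<in>N. hcoef h N {j} (S p) * S p j * f (sh {j} p))"
  unfolding Dw_def sum_subsets_card_1 by simp

text \<open>
  Terms that shift \<open>j\<close> twice have the same coefficient in both orders, so they cancel in the
  commutators.
\<close>
lemma hcoef_repeated_shift:
  assumes I: "I \<subseteq> N" "j \<in> I"
  shows "hcoef h N I (S p) * hcoef h N {j} (S (sh I p)) = hcoef h N {j} (S p) * hcoef h N I (S (sh {j} p))"
proof -
  let ?s = "S p"
  have fI: "finite I" using I finN finite_subset by auto
  have Nj: "N - {j} = (I - {j}) \<union> (N - I)" using I by auto
  have 1: "hcoef h N {j} (S (sh I p)) = (\<Prod>k\<in>I - {j}. (h * ?s j - ?s k) / (?s j - ?s k)) * (\<Prod>k\<in>N - I. (h * (q * ?s j) - ?s k) / (q * ?s j - ?s k))"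
  proof -
    have "(h * (q * ?s j) - q * ?s k) / (q * ?s j - q * ?s k) = (h * ?s j - ?s k) / (?s j - ?s k)" for k
      using qh(1) by (metis (no_types, opaque_lifting) mult.left_commute mult_divide_mult_cancel_left right_diff_distrib)
    then show ?thesis
      unfolding hcoef_single Nj S_sh using fI finN I by (subst prod.union_disjoint) (auto intro!: arg_cong2[of _ _ _ _ "(*)"] prod.cong)
  qed
  have 2: "hcoef h N {j} ?s = (\<Prod>k\<in>I - {j}. (h * ?s j - ?s k) / (?s j - ?s k)) * (\<Prod>k\<in>N - I. (h * ?s j - ?s k) / (?s j - ?s k))"
    unfolding hcoef_single Nj using fI finN by (subst prod.union_disjoint) auto
  have 3: "hcoef h N I ?s = (\<Prod>k\<in>N - I. (h * ?s j - ?s k) / (?s j - ?s k)) * (\<Prod>i\<in>I - {j}. \<Prod>k\<in>N - I. (h * ?s i - ?s k) / (?s i - ?s k))"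
    unfolding hcoef_def by (rule prod.remove[OF fI I(2)])
  have 4: "hcoef h N I (S (sh {j} p)) = (\<Prod>k\<in>N - I. (h * (q * ?s j) - ?s k) / (q * ?s j - ?s k)) * (\<Prod>i\<in>I - {j}. \<Prod>k\<in>N - I. (h * ?s i - ?s k) / (?s i - ?s k))"
    unfolding hcoef_def S_sh prod.remove[OF fI I(2)]
    by (intro arg_cong2[of _ _ _ _ "(*)"] prod.cong) (use I in auto)
  show ?thesis unfolding 1 2 3 4 by (simp only: mult_ac)
qed

lemma hcoef_shift_last:
  assumes K: "K \<subseteq> N" "j \<in> K"
  shows "hcoef h N (K - {j}) (S p) * hcoef h N {j} (S (sh (K - {j}) p)) = hcoef h N K (S p) * shiftU h q K (S p) j"
proof -
  let ?s = "S p" and ?I = "K - {j}"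
  have fK: "finite K" using K finN finite_subset by auto
  have Nj: "N - {j} = ?I \<union> (N - K)" and NI: "N - ?I = insert j (N - K)" using K by auto
  have 1: "hcoef h N {j} (S (sh ?I p)) = (\<Prod>k\<in>?I. (h * ?s j - q * ?s k) / (?s j - q * ?s k)) * (\<Prod>k\<in>N - K. (h * ?s j - ?s k) / (?s j - ?s k))"
    unfolding hcoef_single Nj S_sh using fK finN K by (subst prod.union_disjoint) (auto intro!: arg_cong2[of _ _ _ _ "(*)"] prod.cong)
  have 2: "hcoef h N ?I ?s = (\<Prod>k\<in>?I. (h * ?s k - ?s j) / (?s k - ?s j)) * (\<Prod>i\<in>?I. \<Prod>k\<in>N - K. (h * ?s i - ?s k) / (?s i - ?s k))"
  proof -
    have "(\<Prod>k\<in>N - ?I. (h * ?s i - ?s k) / (?s i - ?s k)) = (h * ?s i - ?s j) / (?s i - ?s j) * (\<Prod>k\<in>N - K. (h * ?s i - ?s k) / (?s i - ?s k))" for i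
      unfolding NI using finN K by (subst prod.insert) auto
    then show ?thesis unfolding hcoef_def by (simp only: prod.distrib)
  qed
  have 3: "hcoef h N K ?s = (\<Prod>k\<in>N - K. (h * ?s j - ?s k) / (?s j - ?s k)) * (\<Prod>i\<in>?I. \<Prod>k\<in>N - K. (h * ?s i - ?s k) / (?s i - ?s k))"
    unfolding hcoef_def by (rule prod.remove[OF fK K(2)])
  show ?thesis unfolding 1 2 3 shiftU_def prod.distrib by (simp only: mult_ac)
qed

lemma hcoef_shift_first:
  assumes K: "K \<subseteq> N" "j \<in> K"
  shows "hcoef h N {j} (S p) * hcoef h N (K - {j}) (S (sh {j} p)) = hcoef h N K (S p) * shiftW h q K (S p) j"
proof -
  let ?s = "S p" and ?I = "K - {j}"
  have fK: "finite K" using K finN finite_subset by auto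
  have Nj: "N - {j} = ?I \<union> (N - K)" and NI: "N - ?I = insert j (N - K)" using K by auto
  have 1: "hcoef h N {j} ?s = (\<Prod>k\<in>?I. (h * ?s j - ?s k) / (?s j - ?s k)) * (\<Prod>k\<in>N - K. (h * ?s j - ?s k) / (?s j - ?s k))"
    unfolding hcoef_single Nj using fK finN K by (subst prod.union_disjoint) auto
  have 2: "hcoef h N ?I (S (sh {j} p)) = (\<Prod>k\<in>?I. (h * ?s k - q * ?s j) / (?s k - q * ?s j)) * (\<Prod>i\<in>?I. \<Prod>k\<in>N - K. (h * ?s i - ?s k) / (?s i - ?s k))"
  proof -
    have "(\<Prod>k\<in>N - ?I. (h * S (sh {j} p) i - S (sh {j} p) k) / (S (sh {j} p) i - S (sh {j} p) k)) =
      (h * ?s i - q * ?s j) / (?s i - q * ?s j) * (\<Prod>k\<in>N - K. (h * ?s i - ?s k) / (?s i - ?s k))" if "i \<in> ?I" for i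
    proof -
      have "(\<Prod>k\<in>N - K. (h * S (sh {j} p) i - S (sh {j} p) k) / (S (sh {j} p) i - S (sh {j} p) k)) = (\<Prod>k\<in>N - K. (h * ?s i - ?s k) / (?s i - ?s k))"
        by (rule prod.cong) (use that K in \<open>auto simp: S_sh\<close>)
      then show ?thesis
        unfolding NI using finN K that by (subst prod.insert) (simp_all add: S_sh)
    qed
    then show ?thesis unfolding hcoef_def prod.distrib[symmetric] by (rule prod.cong[OF refl])
  qed
  have 3: "hcoef h N K ?s = (\<Prod>k\<in>N - K. (h * ?s j - ?s k) / (?s j - ?s k)) * (\<Prod>i\<in>?I. \<Prod>k\<in>N - K. (h * ?s i - ?s k) / (?s i - ?s k))"
    unfolding hcoef_def by (rule prod.remove[OF fK K(2)])
  show ?thesis unfolding 1 2 3 shiftW_def prod.distrib by (simp only: mult_ac)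
qed

lemma shiftU_shiftW:
  assumes "nondeg p" "K \<subseteq> N"
  shows "(\<Sum>j\<in>K. shiftU h q K (S p) j) = (\<Sum>j\<in>K. shiftW h q K (S p) j)"
    and "K \<noteq> {} \<Longrightarrow> (\<Sum>j\<in>K. S p j * (shiftU h q K (S p) j - q * shiftW h q K (S p) j)) = (1 - q) * h ^ (card K - 1) * (\<Sum>j\<in>K. S p j)"
proof -
  have c: "finite K" "inj_on (S p) K" "\<And>k. k \<in> K \<Longrightarrow> S p k \<noteq> 0"
    "\<And>j k. j \<in> K \<Longrightarrow> k \<in> K \<Longrightarrow> S p j \<noteq> q * S p k"
    using assms finN by (auto simp: nondeg_def finite_subset intro: inj_on_subset)
  show "(\<Sum>j\<in>K. shiftU h q K (S p) j) = (\<Sum>j\<in>K. shiftW h q K (S p) j)"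
    by (rule shift_residues(1)) (use c qh in auto)
  show "K \<noteq> {} \<Longrightarrow> (\<Sum>j\<in>K. S p j * (shiftU h q K (S p) j - q * shiftW h q K (S p) j)) = (1 - q) * h ^ (card K - 1) * (\<Sum>j\<in>K. S p j)"
    by (rule shift_residues(2)) (use c qh in auto)
qed

text \<open>
  The weight \<open>w\<close> is \<open>1\<close> for \<open>D 1\<close> and the shifted coordinate for \<open>Dw 1\<close>.
\<close>
lemma D_after:
  "D r (\<lambda>p'. \<Sum>j\<in>N. hcoef h N {j} (S p') * w (S p') j * f (sh {j} p')) p =
    (\<Sum>I\<in>{I. I \<subseteq> N \<and> card I = r}. \<Sum>j\<in>I. hcoef h N {j} (S p) * hcoef h N I (S (sh {j} p)) * w (S (sh I p)) j * f (sh I (sh {j} p))) +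
    (\<Sum>K\<in>{K. K \<subseteq> N \<and> card K = Suc r}. hcoef h N K (S p) * (\<Sum>j\<in>K. w (S (sh (K - {j}) p)) j * shiftU h q K (S p) j) * f (sh K p))"
proof -
  have "D r (\<lambda>p'. \<Sum>j\<in>N. hcoef h N {j} (S p') * w (S p') j * f (sh {j} p')) p =
    (\<Sum>I\<in>{I. I \<subseteq> N \<and> card I = r}. \<Sum>j\<in>N. hcoef h N I (S p) * (hcoef h N {j} (S (sh I p)) * w (S (sh I p)) j * f (sh {j} (sh I p))))"
    unfolding D_def sum_distrib_left ..
  also have "\<dots> = (\<Sum>I\<in>{I. I \<subseteq> N \<and> card I = r}. \<Sum>j\<in>I. hcoef h N I (S p) * (hcoef h N {j} (S (sh I p)) * w (S (sh I p)) j * f (sh {j} (sh I p)))) +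
    (\<Sum>K\<in>{K. K \<subseteq> N \<and> card K = Suc r}. \<Sum>j\<in>K. hcoef h N (K - {j}) (S p) * (hcoef h N {j} (S (sh (K - {j}) p)) * w (S (sh (K - {j}) p)) j * f (sh {j} (sh (K - {j}) p))))"
    by (rule sum_pairs_split[OF finN])
  also have "(\<Sum>I\<in>{I. I \<subseteq> N \<and> card I = r}. \<Sum>j\<in>I. hcoef h N I (S p) * (hcoef h N {j} (S (sh I p)) * w (S (sh I p)) j * f (sh {j} (sh I p)))) =
     (\<Sum>I\<in>{I. I \<subseteq> N \<and> card I = r}. \<Sum>j\<in>I. hcoef h N {j} (S p) * hcoef h N I (S (sh {j} p)) * w (S (sh I p)) j * f (sh I (sh {j} p)))"
    by (intro sum.cong refl) (simp add: hcoef_repeated_shift[symmetric] sh_commute mult.assoc)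
  also have "(\<Sum>K\<in>{K. K \<subseteq> N \<and> card K = Suc r}. \<Sum>j\<in>K. hcoef h N (K - {j}) (S p) * (hcoef h N {j} (S (sh (K - {j}) p)) * w (S (sh (K - {j}) p)) j * f (sh {j} (sh (K - {j}) p)))) =
    (\<Sum>K\<in>{K. K \<subseteq> N \<and> card K = Suc r}. hcoef h N K (S p) * (\<Sum>j\<in>K. w (S (sh (K - {j}) p)) j * shiftU h q K (S p) j) * f (sh K p))"
    unfolding sum_distrib_left sum_distrib_right
  proof (intro sum.cong refl)
    fix K j assume K: "K \<in> {K. K \<subseteq> N \<and> card K = Suc r}" "j \<in> K"
    have "sh {j} (sh (K - {j}) p) = sh K p" using K sh_insert[of j "K - {j}" p] by (simp add: insert_absorb)
    then show "hcoef h N (K - {j}) (S p) * (hcoef h N {j} (S (sh (K - {j}) p)) * w (S (sh (K - {j}) p)) j * f (sh {j} (sh (K - {j}) p))) =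
      hcoef h N K (S p) * (w (S (sh (K - {j}) p)) j * shiftU h q K (S p) j) * f (sh K p)"
      using hcoef_shift_last[of K j p] K by (simp add: mult_ac)
  qed
  finally show ?thesis .
qed

lemma D_before:
  "(\<Sum>j\<in>N. hcoef h N {j} (S p) * w (S p) j * D r f (sh {j} p)) =
    (\<Sum>I\<in>{I. I \<subseteq> N \<and> card I = r}. \<Sum>j\<in>I. hcoef h N {j} (S p) * hcoef h N I (S (sh {j} p)) * w (S p) j * f (sh I (sh {j} p))) +
    (\<Sum>K\<in>{K. K \<subseteq> N \<and> card K = Suc r}. hcoef h N K (S p) * (\<Sum>j\<in>K. w (S p) j * shiftW h q K (S p) j) * f (sh K p))"
proof -
  have "(\<Sum>j\<in>N. hcoef h N {j} (S p) * w (S p) j * D r f (sh {j} p)) =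
     (\<Sum>I\<in>{I. I \<subseteq> N \<and> card I = r}. \<Sum>j\<in>N. hcoef h N {j} (S p) * hcoef h N I (S (sh {j} p)) * w (S p) j * f (sh I (sh {j} p)))"
    unfolding D_def sum_distrib_left by (subst sum.swap) (simp only: mult_ac)
  also have "\<dots> = (\<Sum>I\<in>{I. I \<subseteq> N \<and> card I = r}. \<Sum>j\<in>I. hcoef h N {j} (S p) * hcoef h N I (S (sh {j} p)) * w (S p) j * f (sh I (sh {j} p))) +
    (\<Sum>K\<in>{K. K \<subseteq> N \<and> card K = Suc r}. \<Sum>j\<in>K. hcoef h N {j} (S p) * hcoef h N (K - {j}) (S (sh {j} p)) * w (S p) j * f (sh (K - {j}) (sh {j} p)))"
    by (rule sum_pairs_split[OF finN])
  also have "(\<Sum>K\<in>{K. K \<subseteq> N \<and> card K = Suc r}. \<Sum>j\<in>K. hcoef h N {j} (S p) * hcoef h N (K - {j}) (S (sh {j} p)) * w (S p) j * f (sh (K - {j}) (sh {j} p))) =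
    (\<Sum>K\<in>{K. K \<subseteq> N \<and> card K = Suc r}. hcoef h N K (S p) * (\<Sum>j\<in>K. w (S p) j * shiftW h q K (S p) j) * f (sh K p))"
    unfolding sum_distrib_left sum_distrib_right
  proof (intro sum.cong refl)
    fix K j assume K: "K \<in> {K. K \<subseteq> N \<and> card K = Suc r}" "j \<in> K"
    have "sh (K - {j}) (sh {j} p) = sh K p" using K sh_insert[of j "K - {j}" p] sh_commute[of j "K - {j}" p] by (simp add: insert_absorb)
    then show "hcoef h N {j} (S p) * hcoef h N (K - {j}) (S (sh {j} p)) * w (S p) j * f (sh (K - {j}) (sh {j} p)) =
      hcoef h N K (S p) * (w (S p) j * shiftW h q K (S p) j) * f (sh K p)"
      using hcoef_shift_first[of K j p] K by (simp add: mult_ac)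
  qed
  finally show ?thesis .
qed

text \<open>
  The composites differ in the terms that shift each element of a set \<open>K\<close> once, with coefficients that
  agree by the first identity of \<open>shift_residues\<close>.
\<close>
lemma D_commute:
  assumes "nondeg p"
  shows "D 1 (D r f) p = D r (D 1 f) p"
proof -
  have "D r (D 1 f) p = D r (\<lambda>p'. \<Sum>j\<in>N. hcoef h N {j} (S p') * 1 * f (sh {j} p')) p"
    unfolding D_1[abs_def] by simp
  also have "\<dots> = (\<Sum>j\<in>N. hcoef h N {j} (S p) * 1 * D r f (sh {j} p))"
    unfolding D_after[of r "\<lambda>_ _. 1"] D_before[of p "\<lambda>_ _. 1"]
    by (intro arg_cong2[of _ _ _ _ "(+)"] sum.cong refl) (use shiftU_shiftW(1)[OF assms] in auto)
  finally show ?thesis unfolding D_1 by simp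
qed

text \<open>
  The factor \<open>q\<close> on the left compensates that in \<open>D r (Dw 1 f)\<close> the weight of a twice shifted
  coordinate is taken after its first shift.  The remaining terms are summed by the second identity of
  \<open>shift_residues\<close>.  This relation generates the operators of order \<open>Suc r\<close> from those of order \<open>r\<close>
  and is the engine of all inductions on the order.
\<close>
lemma D_Dw_commutator:
  assumes "nondeg p"
  shows "D r (Dw 1 f) p - q * Dw 1 (D r f) p = (1 - q) * h ^ r * Dw (Suc r) f p"
proof -
  let ?X = "\<Sum>I\<in>{I. I \<subseteq> N \<and> card I = r}. \<Sum>j\<in>I. hcoef h N {j} (S p) * hcoef h N I (S (sh {j} p)) * S p j * f (sh I (sh {j} p))"
  let ?U = "\<lambda>K. \<Sum>j\<in>K. S p j * shiftU h q K (S p) j" and ?W = "\<lambda>K. \<Sum>j\<in>K. S p j * shiftW h q K (S p) j"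
  let ?A = "{K. K \<subseteq> N \<and> card K = Suc r}"
  have "D r (Dw 1 f) p = D r (\<lambda>p'. \<Sum>j\<in>N. hcoef h N {j} (S p') * S p' j * f (sh {j} p')) p"
    unfolding Dw_1[abs_def] ..
  also have "\<dots> = q * ?X + (\<Sum>K\<in>?A. hcoef h N K (S p) * ?U K * f (sh K p))"
    unfolding D_after[of r "\<lambda>s j. s j"] sum_distrib_left
    by (intro arg_cong2[of _ _ _ _ "(+)"] sum.cong refl) (auto simp: S_sh)
  finally have 1: "D r (Dw 1 f) p = q * ?X + (\<Sum>K\<in>?A. hcoef h N K (S p) * ?U K * f (sh K p))" .
  have 2: "Dw 1 (D r f) p = ?X + (\<Sum>K\<in>?A. hcoef h N K (S p) * ?W K * f (sh K p))"
    unfolding Dw_1 D_before[of p "\<lambda>s j. s j"] ..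
  have "D r (Dw 1 f) p - q * Dw 1 (D r f) p = (\<Sum>K\<in>?A. hcoef h N K (S p) * (?U K - q * ?W K) * f (sh K p))"
    unfolding 1 2 by (simp add: algebra_simps sum_distrib_left sum_subtractf)
  also have "\<dots> = (\<Sum>K\<in>?A. (1 - q) * h ^ r * (hcoef h N K (S p) * (\<Sum>j\<in>K. S p j) * f (sh K p)))"
  proof (rule sum.cong)
    fix K assume K: "K \<in> ?A"
    have "?U K - q * ?W K = (\<Sum>j\<in>K. S p j * (shiftU h q K (S p) j - q * shiftW h q K (S p) j))"
      by (simp add: algebra_simps sum_distrib_left sum_subtractf)
    also have "\<dots> = (1 - q) * h ^ (card K - 1) * (\<Sum>j\<in>K. S p j)"
      using shiftU_shiftW(2)[OF assms, of K] K by fastforce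
    finally have "?U K - q * ?W K = (1 - q) * h ^ r * (\<Sum>j\<in>K. S p j)" using K by simp
    then show "hcoef h N K (S p) * (?U K - q * ?W K) * f (sh K p) = (1 - q) * h ^ r * (hcoef h N K (S p) * (\<Sum>j\<in>K. S p j) * f (sh K p))"
      by simp
  qed simp
  also have "\<dots> = (1 - q) * h ^ r * Dw (Suc r) f p"
    unfolding Dw_def sum_distrib_left ..
  finally show ?thesis .
qed

end

section \<open>The branching kernel\<close>

lemma prod_pairs_at:
  fixes G :: "nat \<Rightarrow> nat \<Rightarrow> complex"
  assumes "finite N" "a \<in> N"
  shows "(\<Prod>j\<in>N. \<Prod>k\<in>N - {j}. G j k) =
    (\<Prod>i\<in>N - {a}. G a i * G i a) * (\<Prod>j\<in>N - {a}. \<Prod>k\<in>N - {a} - {j}. G j k)"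
proof -
  have "(\<Prod>k\<in>N - {j}. G j k) = G j a * (\<Prod>k\<in>N - {a} - {j}. G j k)" if "j \<in> N - {a}" for j
  proof -
    have "N - {j} = insert a (N - {a} - {j})" using assms that by auto
    then show ?thesis using assms by simp
  qed
  then show ?thesis
    using assms by (simp add: prod.remove[OF assms] prod.distrib)
qed

definition up :: "nat set \<Rightarrow> (nat \<Rightarrow> int) \<Rightarrow> nat \<Rightarrow> int" where
  "up J p = (\<lambda>i. if i \<in> J then p i + 1 else p i)"

definition dn :: "nat set \<Rightarrow> (nat \<Rightarrow> int) \<Rightarrow> nat \<Rightarrow> int" where
  "dn J p = (\<lambda>i. if i \<in> J then p i - 1 else p i)"

lemma up_dn [simp]: "up J (dn J r) = r" and dn_up [simp]: "dn J (up J r) = r"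
  by (auto simp: up_def dn_def)

text \<open>
  Partitions with at most \<open>n\<close> parts, in ascending order.  Values in \<open>int\<close>, because removing boxes can lead
  outside this set.
\<close>
definition part :: "nat \<Rightarrow> (nat \<Rightarrow> int) \<Rightarrow> bool" where
  "part n p \<longleftrightarrow> (\<forall>i. i \<notin> {1..n} \<longrightarrow> p i = 0) \<and> (\<forall>i\<in>{1..n}. 0 \<le> p i) \<and> (\<forall>i\<in>{1..<n}. p i \<le> p (Suc i))"

locale macdonald_params =
  fixes q h :: complex
  assumes gen: "generic q h"
begin

text \<open>
  The inverse of the parameter \<open>t = q / h\<close> of the vertex function.
\<close>
definition \<tau> :: complex where "\<tau> = h / q"

lemma q0: "q \<noteq> 0" and h0: "h \<noteq> 0" and qlt1: "norm q < 1"
  using gen by (auto simp: generic_def)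

lemma qh_one: "q powi i * h powi j = 1 \<longleftrightarrow> i = 0 \<and> j = 0"
  using gen by (auto simp: generic_def)

lemma qh_eq: "q powi a * h powi i = q powi b * h powi j \<longleftrightarrow> a = b \<and> i = j"
proof
  assume "q powi a * h powi i = q powi b * h powi j"
  then have "q powi (a - b) * h powi (i - j) = 1"
    using q0 h0 by (simp add: power_int_diff field_simps)
  then show "a = b \<and> i = j" using qh_one by auto
qed auto

lemma qh_eq_nat: "q powi a * h ^ i = q powi b * h ^ j \<longleftrightarrow> a = b \<and> i = j"
  using qh_eq[of a "int i" b "int j"] by simp

lemma q1: "q \<noteq> 1" and h1: "h \<noteq> 1" and hq: "h \<noteq> q"
  using qh_one[of 1 0] qh_one[of 0 1] qh_eq[of 0 1 1 0] by auto

lemma hpow: "i > 0 \<Longrightarrow> h ^ i \<noteq> 1"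
  using qh_one[of 0 "int i"] by auto

lemma tau: "\<tau> \<noteq> 0" "\<tau> \<noteq> 1" "\<tau> * q = h" "q * \<tau> = h"
  using q0 h0 hq by (auto simp: \<tau>_def)

text \<open>
  The ratios of these numbers are those of the equivariant parameters.
\<close>
definition spectral :: "(nat \<Rightarrow> int) \<Rightarrow> nat \<Rightarrow> complex" where
  "spectral p i = q powi p i * h ^ i"

lemma spectral_nz [simp]: "spectral p i \<noteq> 0"
  using q0 h0 by (simp add: spectral_def)

lemma spectral_eq: "spectral p i = spectral r j \<longleftrightarrow> p i = r j \<and> i = j"
  unfolding spectral_def by (rule qh_eq_nat)

lemma spectral_eq_q: "spectral p i = q * spectral r j \<longleftrightarrow> p i = r j + 1 \<and> i = j"
proof -
  have "q * spectral r j = q powi (r j + 1) * h ^ j" using q0 by (simp add: spectral_def power_int_add)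
  then show ?thesis unfolding spectral_def by (simp only: qh_eq_nat)
qed

lemma spectral_eq_h: "spectral p i = h * spectral r j \<longleftrightarrow> p i = r j \<and> i = Suc j"
proof -
  have "h * spectral r j = q powi (r j) * h ^ Suc j" by (simp add: spectral_def)
  then show ?thesis unfolding spectral_def by (simp only: qh_eq_nat)
qed

lemma spectral_eq_tau: "spectral p i = \<tau> * spectral r j \<longleftrightarrow> p i = r j - 1 \<and> i = Suc j"
proof -
  have "\<tau> * spectral r j = q powi (r j - 1) * h ^ Suc j" using q0 by (simp add: spectral_def \<tau>_def power_int_diff)
  then show ?thesis unfolding spectral_def by (simp only: qh_eq_nat)
qed

lemma spectral_inj: "inj_on (spectral p) N"
  by (auto simp: inj_on_def spectral_eq)

lemma spectral_up: "spectral (up J p) = (\<lambda>i. if i \<in> J then q * spectral p i else spectral p i)"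
  using q0 by (auto simp: spectral_def up_def power_int_add fun_eq_iff)

lemma spectral_dn: "spectral (dn J p) = (\<lambda>i. if i \<in> J then spectral p i / q else spectral p i)"
  using q0 by (auto simp: spectral_def dn_def power_int_diff fun_eq_iff)

lemma qpoch_step:
  assumes "d \<ge> 1 \<or> q powi (d - 1) * x \<noteq> 1"
  shows "qpoch x q d = qpoch x q (d - 1) * (1 - q powi (d - 1) * x)"
proof (cases "d \<ge> 1")
  case True
  then have "nat d = Suc (nat (d - 1))" by simp
  then show ?thesis using True by (simp add: qpoch_def power_int_def)
next
  case False
  define m where "m = nat (- d)"
  have m: "d = - int m" "nat (- (d - 1)) = Suc m" using False by (auto simp: m_def)
  have e: "q powi (d - 1) * x = x / q ^ Suc m"
    using m False by (simp add: power_int_def divide_inverse mult.commute power_inverse)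
  have "qpoch x q (d - 1) = 1 / ((\<Prod>i=1..m. 1 - x / q ^ i) * (1 - x / q ^ Suc m))"
    using m False by (simp add: qpoch_def)
  moreover have "qpoch x q d = 1 / (\<Prod>i=1..m. 1 - x / q ^ i)"
    using m False by (cases "m = 0") (auto simp: qpoch_def)
  moreover have "1 - x / q ^ Suc m \<noteq> 0" using assms False e by auto
  ultimately show ?thesis unfolding e by simp
qed

text \<open>
  The quotient of \<open>q\<close>-Pochhammer symbols with arguments \<open>h * y\<close> and \<open>q * y\<close>, for
  \<open>y = h powi (int j - int k)\<close>; all factors of the vertex are made of such quotients.
\<close>
definition omega :: "nat \<Rightarrow> nat \<Rightarrow> int \<Rightarrow> complex" where
  "omega j k d = qpoch (h powi (int j - int k + 1)) q d / qpoch (q * h powi (int j - int k)) q d"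

text \<open>
  The rational function has a pole there; the value is that of \<open>1 / 0\<close>.
\<close>
lemma qpoch_pole:
  assumes "d \<le> 0" "q powi (d - 1) * x = 1"
  shows "qpoch x q (d - 1) = 0"
proof -
  define m where "m = nat (1 - d)"
  have m: "d - 1 = - int m" "m \<ge> 1" using assms(1) by (auto simp: m_def)
  have "x / q ^ m = 1" using assms(2) unfolding m(1) by (simp add: power_int_minus divide_inverse mult.commute)
  then have "(\<Prod>i=1..m. 1 - x / q ^ i) = 0" using m(2) by (intro prod_zero) (auto intro!: bexI[of _ m])
  then show ?thesis using m by (simp add: qpoch_def)
qed

text \<open>
  The hypotheses exclude the points at which a pole of the numerator or a zero of the denominator,
  with value \<open>0\<close> for the quotient, would violate the recursion.
\<close>
lemma qpoch_ratio_step: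
  assumes "d \<ge> 1 \<or> q powi (d - 1) * (h * y) \<noteq> 1" and "d \<ge> 1 \<Longrightarrow> q powi d * y \<noteq> 1"
  defines "R \<equiv> \<lambda>d. qpoch (h * y) q d / qpoch (q * y) q d"
  shows "R (d - 1) * (1 - \<tau> * (q powi d * y)) = R d * (1 - q powi d * y)"
proof -
  have e1: "q powi (d - 1) * (h * y) = \<tau> * (q powi d * y)"
    using q0 by (simp add: \<tau>_def power_int_diff)
  have e2: "q powi (d - 1) * (q * y) = q powi d * y"
    using q0 by (simp add: power_int_diff)
  have Y: "qpoch (h * y) q d = qpoch (h * y) q (d - 1) * (1 - \<tau> * (q powi d * y))"
    using qpoch_step[OF assms(1)] unfolding e1 .
  show ?thesis
  proof (cases "d \<ge> 1 \<or> q powi d * y \<noteq> 1")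
    case True
    then have Z: "qpoch (q * y) q d = qpoch (q * y) q (d - 1) * (1 - q powi d * y)"
      using qpoch_step[of d "q * y"] unfolding e2 by blast
    have "q powi d * y \<noteq> 1" using True assms(2) by blast
    then show ?thesis unfolding R_def Y Z by simp
  next
    case False
    then have "qpoch (q * y) q (d - 1) = 0" by (intro qpoch_pole) (auto simp: e2)
    then show ?thesis unfolding R_def using False by simp
  qed
qed

lemma omega_eq: "omega j k d = qpoch (h * h powi (int j - int k)) q d / qpoch (q * h powi (int j - int k)) q d"
  using h0 by (simp add: omega_def power_int_add mult.commute)

lemma omega_step0:
  "omega j k (d - 1) * (1 - \<tau> * (q powi d * h powi (int j - int k))) = omega j k d * (1 - q powi d * h powi (int j - int k))"
  unfolding omega_eq
proof (rule qpoch_ratio_step)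
  have "q powi (d - 1) * (h * h powi (int j - int k)) = q powi (d - 1) * h powi (int j - int k + 1)"
    using h0 by (simp add: power_int_add mult.commute)
  then show "d \<ge> 1 \<or> q powi (d - 1) * (h * h powi (int j - int k)) \<noteq> 1"
    using qh_one[of "d - 1" "int j - int k + 1"] by auto
  show "q powi d * h powi (int j - int k) \<noteq> 1" if "d \<ge> 1"
    using that by (simp add: qh_one)
qed

lemma omega_step:
  assumes "d = r j - p k"
  shows "omega j k (d - 1) * (spectral p k - \<tau> * spectral r j) = omega j k d * (spectral p k - spectral r j)"
proof -
  have "q powi d * h powi (int j - int k) = spectral r j / spectral p k"
    using q0 h0 by (simp add: spectral_def assms power_int_diff)
  then have "omega j k (d - 1) * (1 - \<tau> * (spectral r j / spectral p k)) * spectral p k = omega j k d * (1 - spectral r j / spectral p k) * spectral p k"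
    using omega_step0[of j k d] by simp
  then show ?thesis by (simp add: algebra_simps)
qed

text \<open>
  These zeros make the vertex series finite: with \<open>d\<close> the difference between an entry of one row and
  an entry of the row above, they impose the interlacing conditions.
\<close>
lemma omega_zero_iff: "omega j k d = 0 \<longleftrightarrow> (j = k \<and> d < 0) \<or> (k = Suc j \<and> d > 0)"
proof (cases "d \<ge> 0")
  case True
  have 1: "q ^ i * h powi (int j - int k + 1) = 1 \<longleftrightarrow> i = 0 \<and> k = Suc j" for i
    using qh_one[of "int i" "int j - int k + 1"] by auto
  have 2: "q ^ i * (q * h powi (int j - int k)) \<noteq> 1" for i
    using qh_one[of "int i + 1" "int j - int k"] q0 by (auto simp: power_int_add mult_ac)
  have "qpoch (q * h powi (int j - int k)) q d \<noteq> 0"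
    using True 2 by (auto simp: qpoch_def)
  moreover have "qpoch (h powi (int j - int k + 1)) q d = 0 \<longleftrightarrow> k = Suc j \<and> d > 0"
  proof -
    have "qpoch (h powi (int j - int k + 1)) q d = 0 \<longleftrightarrow> (\<exists>i<nat d. q ^ i * h powi (int j - int k + 1) = 1)"
      using True by (auto simp: qpoch_def)
    also have "\<dots> \<longleftrightarrow> k = Suc j \<and> d > 0" unfolding 1 using True by auto
    finally show ?thesis .
  qed
  ultimately show ?thesis using True by (auto simp: omega_def)
next
  case False
  have 1: "h powi (int j - int k + 1) / q ^ i \<noteq> 1" if "i \<ge> 1" for i
  proof -
    have "h powi (int j - int k + 1) / q ^ i = q powi (- int i) * h powi (int j - int k + 1)"
      by (simp add: power_int_minus divide_inverse mult.commute)
    then show ?thesis using qh_one[of "- int i" "int j - int k + 1"] that by auto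
  qed
  have 2: "q * h powi (int j - int k) / q ^ i = 1 \<longleftrightarrow> i = 1 \<and> j = k" if "i \<ge> 1" for i
  proof -
    have "q * h powi (int j - int k) / q ^ i = q powi (1 - int i) * h powi (int j - int k)"
      using q0 by (simp add: power_int_diff)
    then show ?thesis using qh_one[of "1 - int i" "int j - int k"] that by auto
  qed
  have "1 - h powi (int j - int k + 1) / q ^ i \<noteq> 0" if "i \<ge> 1" for i
    using 1[OF that] by simp
  then have "qpoch (h powi (int j - int k + 1)) q d \<noteq> 0"
    using False by (simp add: qpoch_def del: right_minus_eq)
  moreover have "qpoch (q * h powi (int j - int k)) q d = 0 \<longleftrightarrow> j = k"
  proof -
    have "qpoch (q * h powi (int j - int k)) q d = 0 \<longleftrightarrow> (\<exists>i\<in>{1..nat (- d)}. q * h powi (int j - int k) / q ^ i = 1)"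
      using False by (simp add: qpoch_def)
    also have "\<dots> \<longleftrightarrow> (\<exists>i\<in>{1..nat (- d)}. i = 1 \<and> j = k)"
      by (intro bex_cong refl 2) simp
    also have "\<dots> \<longleftrightarrow> j = k"
      using False by (auto simp: Suc_le_eq)
    finally show ?thesis .
  qed
  ultimately show ?thesis using False by (auto simp: omega_def)
qed

text \<open>
  Stated with a common factor \<open>w\<close>, as any of the quantities in \<open>omega_step\<close> may vanish.
\<close>
lemma omega_core:
  assumes "d = r j - p k"
  shows "\<exists>w. omega j k d = w * (spectral p k - \<tau> * spectral r j) \<and> omega j k (d - 1) = w * (spectral p k - spectral r j)"
proof (cases "spectral p k = \<tau> * spectral r j")
  case False
  then show ?thesis using omega_step[of d r j p k] assms
    by (intro exI[of _ "omega j k d / (spectral p k - \<tau> * spectral r j)"]) (simp add: nonzero_eq_divide_eq)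
next
  case True
  then have "spectral p k \<noteq> spectral r j" using tau by simp
  then show ?thesis using omega_step[of d r j p k] assms True
    by (intro exI[of _ "omega j k (d - 1) / (spectral p k - spectral r j)"]) (simp add: nonzero_eq_divide_eq)
qed

definition omega_prod :: "nat \<Rightarrow> (nat \<Rightarrow> int) \<Rightarrow> (nat \<Rightarrow> int) \<Rightarrow> complex" where
  "omega_prod n p r = (\<Prod>j\<in>{1..n}. \<Prod>k\<in>{1..Suc n}. omega j k (r j - p k))"

text \<open>
  Removing boxes from \<open>r\<close> and adding a box to \<open>p\<close> both lower some differences \<open>r j - p k\<close> by one.
  So all these values have a common factor \<open>W\<close>, and relations between them reduce to identities of rational
  functions in the spectral points.
\<close>
lemma omega_prod_core:
  obtains W where "\<And>J. omega_prod n p (dn J r) = W * (\<Prod>j\<in>{1..n}. \<Prod>k\<in>{1..Suc n}. if j \<in> J then spectral p k - spectral r j else spectral p k - \<tau> * spectral r j)"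
    and "\<And>a. omega_prod n (up {a} p) r = W * (\<Prod>j\<in>{1..n}. \<Prod>k\<in>{1..Suc n}. if k = a then spectral p k - spectral r j else spectral p k - \<tau> * spectral r j)"
proof -
  obtain w where w: "\<And>j k. omega j k (r j - p k) = w j k * (spectral p k - \<tau> * spectral r j) \<and> omega j k (r j - p k - 1) = w j k * (spectral p k - spectral r j)"
    using omega_core[of _ r _ p, OF refl] by metis
  show thesis
  proof
    show "omega_prod n p (dn J r) = (\<Prod>j\<in>{1..n}. \<Prod>k\<in>{1..Suc n}. w j k) * (\<Prod>j\<in>{1..n}. \<Prod>k\<in>{1..Suc n}. if j \<in> J then spectral p k - spectral r j else spectral p k - \<tau> * spectral r j)" for J
      unfolding omega_prod_def prod.distrib[symmetric]
    proof (intro prod.cong refl)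
      fix j k
      have e: "r j - 1 - p k = r j - p k - 1" by simp
      then show "omega j k (dn J r j - p k) = w j k * (if j \<in> J then spectral p k - spectral r j else spectral p k - \<tau> * spectral r j)"
        using w[of j k] by (cases "j \<in> J") (simp_all only: dn_def if_True if_False e)
    qed
    show "omega_prod n (up {a} p) r = (\<Prod>j\<in>{1..n}. \<Prod>k\<in>{1..Suc n}. w j k) * (\<Prod>j\<in>{1..n}. \<Prod>k\<in>{1..Suc n}. if k = a then spectral p k - spectral r j else spectral p k - \<tau> * spectral r j)" for a
      unfolding omega_prod_def prod.distrib[symmetric]
    proof (intro prod.cong refl)
      fix j k
      have e: "r j - (p k + 1) = r j - p k - 1" by simp
      then show "omega j k (r j - up {a} p k) = w j k * (if k = a then spectral p k - spectral r j else spectral p k - \<tau> * spectral r j)"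
        using w[of j k] by (cases "k = a") (simp_all only: up_def singleton_iff if_True if_False e simp_thms)
    qed
  qed
qed

definition interlacing :: "nat \<Rightarrow> (nat \<Rightarrow> int) \<Rightarrow> (nat \<Rightarrow> int) set" where
  "interlacing n p = {r. (\<forall>i. i \<notin> {1..n} \<longrightarrow> r i = 0) \<and> (\<forall>i\<in>{1..n}. p i \<le> r i \<and> r i \<le> p (Suc i))}"

lemma omega_prod_zero:
  assumes "\<And>i. i \<notin> {1..n} \<Longrightarrow> r i = 0" "r \<notin> interlacing n p"
  shows "omega_prod n p r = 0"
proof -
  obtain i where i: "i \<in> {1..n}" "r i < p i \<or> r i > p (Suc i)"
    using assms by (force simp: interlacing_def)
  then have "\<exists>k\<in>{1..Suc n}. omega i k (r i - p k) = 0"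
    by (cases "r i < p i") (auto simp: omega_zero_iff intro: bexI[of _ i] bexI[of _ "Suc i"])
  then have "(\<Prod>k\<in>{1..Suc n}. omega i k (r i - p k)) = 0"
    by (intro prod_zero) auto
  then show ?thesis unfolding omega_prod_def using i(1) by (intro prod_zero) blast+
qed

definition rho :: "nat \<Rightarrow> (nat \<Rightarrow> int) \<Rightarrow> complex" where
  "rho n p = (\<Prod>j\<in>{1..n}. \<Prod>k\<in>{1..n} - {j}. inverse (omega j k (p j - p k)))"

text \<open>
  A product over all ordered pairs, half of them with factor \<open>1\<close>, to match the shape of \<open>rho\<close> and of
  \<open>prod_pairs_at\<close>.
\<close>
definition vandermonde :: "nat \<Rightarrow> (nat \<Rightarrow> int) \<Rightarrow> complex" where
  "vandermonde n p = (\<Prod>j\<in>{1..n}. \<Prod>k\<in>{1..n} - {j}. if j < k then spectral p j - spectral p k else 1)"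

text \<open>
  The normalization for which the coefficients of the Pieri rules are values of \<open>hcoef\<close>.
\<close>
definition branch_norm :: "nat \<Rightarrow> (nat \<Rightarrow> int) \<Rightarrow> complex" where
  "branch_norm n p = rho n p / vandermonde n p"

lemma vandermonde_nz: "vandermonde n p \<noteq> 0"
  by (auto simp: vandermonde_def spectral_eq)

lemma omega_part_nz:
  assumes "part n p" "j \<in> {1..n}" "k \<in> {1..n}" "j \<noteq> k"
  shows "omega j k (p j - p k) \<noteq> 0"
proof
  assume "omega j k (p j - p k) = 0"
  then have "k = Suc j" "p j > p k" using assms by (auto simp: omega_zero_iff)
  then show False using assms(1-3) by (force simp: part_def)
qed

lemma branch_norm_nz: "part n p \<Longrightarrow> branch_norm n p \<noteq> 0"
  using omega_part_nz by (auto simp: branch_norm_def rho_def vandermonde_nz)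

text \<open>
  The change of the norm replaces \<open>h\<close> by \<open>\<tau>\<close> in the coefficient of the Pieri rule, which brings it to
  the form of \<open>one_step_kernel_identity\<close>.
\<close>
lemma branch_norm_step:
  assumes p: "part n p" and p': "part n (up {a} p)" and a: "a \<in> {1..n}"
  shows "hcoef h {1..n} {a} (spectral p) * branch_norm n (up {a} p) = branch_norm n p * (\<Prod>i\<in>{1..n} - {a}. (spectral p a - \<tau> * spectral p i) / (spectral p a - spectral p i))"
proof -
  define G where "G p j k = inverse (omega j k (p j - p k)) / (if j < k then spectral p j - spectral p k else 1)" for p j k
  let ?N = "{1..n}"
  have branch_norm: "branch_norm n p = (\<Prod>j\<in>?N. \<Prod>k\<in>?N - {j}. G p j k)" for p
    by (simp add: branch_norm_def rho_def vandermonde_def G_def prod_dividef)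
  have rest: "(\<Prod>j\<in>?N - {a}. \<Prod>k\<in>?N - {a} - {j}. G (up {a} p) j k) = (\<Prod>j\<in>?N - {a}. \<Prod>k\<in>?N - {a} - {j}. G p j k)"
    by (intro prod.cong refl) (auto simp: G_def up_def spectral_up spectral_def)
  have pair: "(h * spectral p a - spectral p i) / (spectral p a - spectral p i) * (G (up {a} p) a i * G (up {a} p) i a) =
     G p a i * G p i a * ((spectral p a - \<tau> * spectral p i) / (spectral p a - spectral p i))" if i: "i \<in> ?N - {a}" for i
  proof -
    let ?s = "spectral p"
    define d where "d = p a - p i"
    have upa: "up {a} p a = p a + 1" "up {a} p i = p i" using i by (auto simp: up_def)
    have w1: "omega a i d * (?s i - h * ?s a) = omega a i (d + 1) * (?s i - q * ?s a)"
      using omega_step[of "d + 1" "up {a} p" a p i] i by (simp add: upa d_def spectral_up tau mult.assoc[symmetric])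
    have w2: "omega i a (- d - 1) * (?s a - \<tau> * ?s i) = omega i a (- d) * (?s a - ?s i)"
      using omega_step[of "- d" p i p a] by (simp add: d_def)
    have n1: "?s i - q * ?s a \<noteq> 0" using i by (auto simp: spectral_eq_q)
    have n2: "?s a - ?s i \<noteq> 0" using i by (auto simp: spectral_eq)
    have n3: "?s i - h * ?s a \<noteq> 0"
    proof
      assume "?s i - h * ?s a = 0"
      then have "p i = p a" "i = Suc a" by (auto simp: spectral_eq_h)
      then have "a \<in> {1..<n}" "up {a} p a > up {a} p (Suc a)" using i a upa by auto
      then show False using p' unfolding part_def by force
    qed
    have n4: "?s a - \<tau> * ?s i \<noteq> 0"
    proof
      assume "?s a - \<tau> * ?s i = 0"
      then have "p a = p i - 1" "a = Suc i" by (auto simp: spectral_eq_tau)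
      then show False using p i a unfolding part_def by force
    qed
    have o: "omega a i d \<noteq> 0" "omega i a (- d) \<noteq> 0" "omega a i (d + 1) \<noteq> 0" "omega i a (- d - 1) \<noteq> 0"
      using omega_part_nz[OF p, of a i] omega_part_nz[OF p, of i a] omega_part_nz[OF p', of a i] omega_part_nz[OF p', of i a] i a
      by (auto simp: d_def upa algebra_simps)
    have G1: "G p a i * G p i a = inverse (omega a i d) * inverse (omega i a (- d)) / (if a < i then ?s a - ?s i else ?s i - ?s a)"
      using i by (auto simp: G_def d_def)
    have G2: "G (up {a} p) a i * G (up {a} p) i a = inverse (omega a i (d + 1)) * inverse (omega i a (- d - 1)) / (if a < i then q * ?s a - ?s i else ?s i - q * ?s a)"
      using i by (auto simp: G_def d_def upa spectral_up algebra_simps)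
    have e1: "omega a i (d + 1) = omega a i d * (?s i - h * ?s a) / (?s i - q * ?s a)"
      using w1 n1 by (simp add: field_simps)
    have e2: "omega i a (- d - 1) = omega i a (- d) * (?s a - ?s i) / (?s a - \<tau> * ?s i)"
      using w2 n4 by (simp add: field_simps)
    have n5: "q * ?s a - ?s i \<noteq> 0" "?s i - ?s a \<noteq> 0" using n1 n2 by auto
    define A where "A = ?s i - h * ?s a"
    define B where "B = ?s i - q * ?s a"
    define C where "C = ?s a - ?s i"
    define E where "E = ?s a - \<tau> * ?s i"
    have f: "h * ?s a - ?s i = - A" "q * ?s a - ?s i = - B" "?s i - ?s a = - C" by (simp_all add: A_def B_def C_def)
    have nz: "A \<noteq> 0" "B \<noteq> 0" "C \<noteq> 0" "E \<noteq> 0" using n1 n2 n3 n4 by (simp_all add: A_def B_def C_def E_def)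
    show ?thesis unfolding G1 G2 e1 e2 f using o(1,2) nz
      unfolding A_def[symmetric] B_def[symmetric] C_def[symmetric] E_def[symmetric] by (auto simp: field_simps)
  qed
  have "hcoef h ?N {a} (spectral p) * branch_norm n (up {a} p) = (\<Prod>i\<in>?N - {a}. (h * spectral p a - spectral p i) / (spectral p a - spectral p i) * (G (up {a} p) a i * G (up {a} p) i a)) *
      (\<Prod>j\<in>?N - {a}. \<Prod>k\<in>?N - {a} - {j}. G p j k)"
    unfolding branch_norm prod_pairs_at[OF finite_atLeastAtMost a] rest hcoef_single prod.distrib by (simp only: mult_ac)
  also have "\<dots> = (\<Prod>i\<in>?N - {a}. G p a i * G p i a * ((spectral p a - \<tau> * spectral p i) / (spectral p a - spectral p i))) *
      (\<Prod>j\<in>?N - {a}. \<Prod>k\<in>?N - {a} - {j}. G p j k)"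
    by (subst prod.cong[OF refl pair]) auto
  also have "\<dots> = branch_norm n p * (\<Prod>i\<in>?N - {a}. (spectral p a - \<tau> * spectral p i) / (spectral p a - spectral p i))"
    unfolding branch_norm prod_pairs_at[OF finite_atLeastAtMost a] prod.distrib by (simp only: mult_ac)
  finally show ?thesis .
qed

lemma vandermonde_dn_single:
  assumes "a \<in> {1..n}"
  shows "vandermonde n (dn {a} p) = vandermonde n p * (\<Prod>i\<in>{1..n} - {a}. (spectral p a / q - spectral p i) / (spectral p a - spectral p i))"
proof -
  let ?N = "{1..n}"
  define G where "G p j k = (if j < k then spectral p j - spectral p k else 1)" for p and j k :: nat
  have vandermonde: "vandermonde n p = (\<Prod>j\<in>?N. \<Prod>k\<in>?N - {j}. G p j k)" for p by (simp add: vandermonde_def G_def)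
  have rest: "(\<Prod>j\<in>?N - {a}. \<Prod>k\<in>?N - {a} - {j}. G (dn {a} p) j k) = (\<Prod>j\<in>?N - {a}. \<Prod>k\<in>?N - {a} - {j}. G p j k)"
    by (intro prod.cong refl) (auto simp: G_def spectral_dn)
  have pair: "G (dn {a} p) a i * G (dn {a} p) i a = G p a i * G p i a * ((spectral p a / q - spectral p i) / (spectral p a - spectral p i))" if i: "i \<in> ?N - {a}" for i
  proof -
    define B where "B = spectral p a / q - spectral p i"
    define C where "C = spectral p a - spectral p i"
    have "C \<noteq> 0" using i by (auto simp: C_def spectral_eq)
    moreover have "spectral p i - spectral p a = - C" "spectral p i - spectral p a / q = - B" by (auto simp: B_def C_def)
    ultimately show ?thesis using i by (auto simp: G_def spectral_dn B_def[symmetric] C_def[symmetric])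
  qed
  show ?thesis
    unfolding vandermonde prod_pairs_at[OF finite_atLeastAtMost assms] rest
    by (subst prod.cong[OF refl pair], simp) (simp only: prod.distrib mult_ac)
qed

text \<open>
  Pairs inside \<open>J\<close> are only rescaled, each by \<open>inverse q\<close>; this is the origin of the powers with exponent
  \<open>card J choose 2\<close> in the Pieri rules.
\<close>
lemma vandermonde_dn:
  assumes "J \<subseteq> {1..n}"
  shows "vandermonde n (dn J p) = vandermonde n p * inverse q ^ (card J choose 2) * (\<Prod>j\<in>J. \<Prod>i\<in>{1..n} - J. (spectral p j / q - spectral p i) / (spectral p j - spectral p i))"
proof -
  have "finite J" using assms finite_subset by auto
  then show ?thesis using assms
  proof (induction J rule: finite_induct)
    case empty
    have "dn {} p = p" by (auto simp: dn_def)
    then show ?case by (simp add: binomial_eq_0)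
  next
    case (insert a J)
    let ?N = "{1..n}" and ?s = "spectral p"
    let ?g = "\<lambda>j i. (?s j / q - ?s i) / (?s j - ?s i)"
    let ?C = "?N - insert a J"
    have a: "a \<in> ?N" "a \<notin> J" using insert by auto
    have dd: "dn (insert a J) p = dn {a} (dn J p)" using a by (auto simp: dn_def)
    have N1: "?N - {a} = J \<union> ?C" and N2: "?N - J = insert a ?C" using insert by auto
    have 1: "(\<Prod>i\<in>?N - {a}. (spectral (dn J p) a / q - spectral (dn J p) i) / (spectral (dn J p) a - spectral (dn J p) i)) =
      (\<Prod>i\<in>J. (?s a / q - ?s i / q) / (?s a - ?s i / q)) * (\<Prod>i\<in>?C. ?g a i)"
      unfolding N1 using insert.hyps a by (subst prod.union_disjoint) (auto simp: spectral_dn intro!: arg_cong2[of _ _ _ _ "(*)"] prod.cong)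
    have 2: "(\<Prod>j\<in>J. \<Prod>i\<in>?N - J. ?g j i) = (\<Prod>j\<in>J. ?g j a) * (\<Prod>j\<in>J. \<Prod>i\<in>?C. ?g j i)"
    proof -
      have "(\<Prod>i\<in>?N - J. ?g j i) = ?g j a * (\<Prod>i\<in>?C. ?g j i)" for j
        unfolding N2 by (subst prod.insert) auto
      then show ?thesis by (simp only: prod.distrib)
    qed
    have 3: "(\<Prod>j\<in>J. ?g j a) * (\<Prod>i\<in>J. (?s a / q - ?s i / q) / (?s a - ?s i / q)) = inverse q ^ card J"
      unfolding prod.distrib[symmetric]
    proof (subst prod.cong[OF refl, of _ _ "\<lambda>_. inverse q"])
      fix j assume j: "j \<in> J"
      define B where "B = ?s j / q - ?s a"
      define E where "E = ?s j - ?s a"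
      have "?s j \<noteq> q * ?s a" "?s j \<noteq> ?s a" using j a by (auto simp: spectral_eq spectral_eq_q)
      then have "B \<noteq> 0" "E \<noteq> 0" using q0 by (auto simp: B_def E_def field_simps)
      moreover have 1: "?s a - ?s j / q = - B" "?s a / q - ?s j / q = - E / q" using q0 by (auto simp: B_def E_def field_simps)
      ultimately show "?g j a * ((?s a / q - ?s j / q) / (?s a - ?s j / q)) = inverse q"
        unfolding 1 B_def[symmetric] E_def[symmetric] using q0 by (simp add: inverse_eq_divide)
    qed simp
    have 4: "(Suc (card J) choose 2) = card J + (card J choose 2)"
      by (simp add: numeral_2_eq_2)
    have "vandermonde n (dn (insert a J) p) = vandermonde n p * inverse q ^ (card J choose 2) * ((\<Prod>j\<in>J. ?g j a) * (\<Prod>i\<in>J. (?s a / q - ?s i / q) / (?s a - ?s i / q))) *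
       ((\<Prod>i\<in>?C. ?g a i) * (\<Prod>j\<in>J. \<Prod>i\<in>?C. ?g j i))"
      unfolding dd vandermonde_dn_single[OF a(1)] 1 insert.IH[OF subset_trans[OF subset_insertI insert.prems]] 2 by (simp only: mult_ac)
    also have "(\<Prod>i\<in>?C. ?g a i) * (\<Prod>j\<in>J. \<Prod>i\<in>?C. ?g j i) = (\<Prod>j\<in>insert a J. \<Prod>i\<in>?C. ?g j i)"
      using insert.hyps by simp
    finally show ?case unfolding 3 using insert.hyps by (simp add: 4 power_add mult_ac)
  qed
qed

text \<open>
  The counterpart of \<open>branch_norm_step\<close> for the lower row: again \<open>h\<close> is replaced by \<open>\<tau>\<close>.
\<close>
lemma vandermonde_hcoef_dn:
  assumes "J \<subseteq> {1..n}"
  shows "vandermonde n (dn J p) * hcoef h {1..n} J (spectral (dn J p)) = vandermonde n p * inverse q ^ (card J choose 2) *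
     (\<Prod>j\<in>J. \<Prod>i\<in>{1..n} - J. (spectral p i - \<tau> * spectral p j) / (spectral p i - spectral p j))"
proof -
  have "(\<Prod>j\<in>J. \<Prod>i\<in>{1..n} - J. (spectral p j / q - spectral p i) / (spectral p j - spectral p i)) * hcoef h {1..n} J (spectral (dn J p)) =
     (\<Prod>j\<in>J. \<Prod>i\<in>{1..n} - J. (spectral p i - \<tau> * spectral p j) / (spectral p i - spectral p j))"
    unfolding hcoef_def prod.distrib[symmetric]
  proof (intro prod.cong refl)
    fix j i assume ji: "j \<in> J" "i \<in> {1..n} - J"
    have "spectral p j \<noteq> q * spectral p i" using ji by (auto simp: spectral_eq_q)
    then have 1: "spectral p j / q - spectral p i \<noteq> 0" using q0 by (auto simp: field_simps)
    have "(spectral p j / q - spectral p i) / (spectral p j - spectral p i) * ((h * (spectral p j / q) - spectral p i) / (spectral p j / q - spectral p i)) = (\<tau> * spectral p j - spectral p i) / (spectral p j - spectral p i)"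
      using 1 by (simp add: \<tau>_def)
    also have "\<dots> = (spectral p i - \<tau> * spectral p j) / (spectral p i - spectral p j)" by (metis minus_diff_eq minus_divide_divide)
    finally show "(spectral p j / q - spectral p i) / (spectral p j - spectral p i) * ((h * spectral (dn J p) j - spectral (dn J p) i) / (spectral (dn J p) j - spectral (dn J p) i)) =
       (spectral p i - \<tau> * spectral p j) / (spectral p i - spectral p j)"
      using ji by (simp add: spectral_dn)
  qed
  then show ?thesis unfolding vandermonde_dn[OF assms] by (simp add: mult.assoc)
qed

text \<open>
  The coefficient of the row \<open>r\<close> in the branching rule for \<open>p\<close>, up to the norm of \<open>p\<close>.  The factor
  \<open>vandermonde n r\<close> cancels against the norm of \<open>r\<close> when the rule is iterated.
\<close>
definition branch_kernel :: "nat \<Rightarrow> (nat \<Rightarrow> int) \<Rightarrow> (nat \<Rightarrow> int) \<Rightarrow> complex" where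
  "branch_kernel n p r = \<tau> powi (- (\<Sum>j\<in>{1..n}. r j)) * omega_prod n p r * vandermonde n r"

lemma branch_kernel_zero:
  assumes "\<And>i. i \<notin> {1..n} \<Longrightarrow> r i = 0" "r \<notin> interlacing n p"
  shows "branch_kernel n p r = 0"
proof -
  have "omega_prod n p r = 0" by (rule omega_prod_zero) (use assms in auto)
  then show ?thesis by (simp add: branch_kernel_def)
qed

lemma sum_dn: "J \<subseteq> {1..n} \<Longrightarrow> (\<Sum>j\<in>{1..n}. dn J r j) = (\<Sum>j\<in>{1..n}. r j) - int (card J)"
proof -
  assume J: "J \<subseteq> {1..n}"
  have "(\<Sum>j\<in>{1..n}. dn J r j) = (\<Sum>j\<in>{1..n}. r j - (if j \<in> J then 1 else 0))"
    by (rule sum.cong) (auto simp: dn_def)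
  also have "\<dots> = (\<Sum>j\<in>{1..n}. r j) - int (card J)"
    using J by (simp add: sum_subtractf sum.If_cases Int_absorb1)
  finally show ?thesis .
qed

lemma prod_if_split:
  fixes f g :: "nat \<Rightarrow> nat \<Rightarrow> complex"
  assumes "finite M" "J \<subseteq> M"
  shows "(\<Prod>j\<in>M. \<Prod>k\<in>N. if j \<in> J then f j k else g j k) = (\<Prod>j\<in>J. \<Prod>k\<in>N. f j k) * (\<Prod>j\<in>M - J. \<Prod>k\<in>N. g j k)"
proof -
  have "(\<Prod>j\<in>M. \<Prod>k\<in>N. if j \<in> J then f j k else g j k) = (\<Prod>j\<in>M. if j \<in> J then \<Prod>k\<in>N. f j k else \<Prod>k\<in>N. g j k)"
    by (rule prod.cong) auto
  also have "\<dots> = (\<Prod>j\<in>J. \<Prod>k\<in>N. f j k) * (\<Prod>j\<in>M - J. \<Prod>k\<in>N. g j k)"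
    using assms by (simp add: prod.If_cases Int_absorb1 Diff_eq)
  finally show ?thesis .
qed

lemma branch_kernel_hcoef_dn:
  assumes "J \<subseteq> {1..n}" and W: "\<And>J. omega_prod n p (dn J r) = W * (\<Prod>j\<in>{1..n}. \<Prod>k\<in>{1..Suc n}. if j \<in> J then spectral p k - spectral r j else spectral p k - \<tau> * spectral r j)"
  shows "branch_kernel n p (dn J r) * hcoef h {1..n} J (spectral (dn J r)) =
     (\<tau> powi (- (\<Sum>j\<in>{1..n}. r j)) * vandermonde n r * W) * (\<tau> ^ card J * inverse q ^ (card J choose 2) *
     (\<Prod>j\<in>J. \<Prod>i\<in>{1..n} - J. (spectral r i - \<tau> * spectral r j) / (spectral r i - spectral r j)) *
      ((\<Prod>j\<in>J. \<Prod>k\<in>{1..Suc n}. spectral p k - spectral r j) * (\<Prod>j\<in>{1..n} - J. \<Prod>k\<in>{1..Suc n}. spectral p k - \<tau> * spectral r j)))"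
proof -
  have "\<tau> powi (- (\<Sum>j\<in>{1..n}. dn J r j)) = \<tau> powi (- (\<Sum>j\<in>{1..n}. r j)) * \<tau> ^ card J"
    using tau(1) unfolding sum_dn[OF assms(1)] by (simp add: power_int_add[symmetric] flip: power_int_of_nat)
  then have "branch_kernel n p (dn J r) * hcoef h {1..n} J (spectral (dn J r)) = \<tau> powi (- (\<Sum>j\<in>{1..n}. r j)) * \<tau> ^ card J * omega_prod n p (dn J r) * (vandermonde n (dn J r) * hcoef h {1..n} J (spectral (dn J r)))"
    by (simp add: branch_kernel_def mult_ac)
  then show ?thesis
    unfolding vandermonde_hcoef_dn[OF assms(1)] W prod_if_split[OF finite_atLeastAtMost assms(1)] by (simp only: mult_ac)
qed

text \<open>
  This is \<open>one_step_kernel_identity\<close> at the spectral points of \<open>p\<close> and \<open>r\<close>.  If a box cannot be added to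
  \<open>p\<close> at \<open>a\<close>, the summand is zero on both sides: here by the factor \<open>hcoef\<close>, and in the identity because
  no row \<open>r\<close> interlaces.
\<close>
lemma kernel_Pieri:
  assumes p: "part (Suc n) p" and r: "part n r"
  shows "(\<Sum>a\<in>{1..Suc n}. hcoef h {1..Suc n} {a} (spectral p) * (branch_norm (Suc n) (up {a} p) * branch_kernel n (up {a} p) r)) =
    branch_norm (Suc n) p * (branch_kernel n p r + (\<Sum>j\<in>{1..n}. branch_kernel n p (dn {j} r) * hcoef h {1..n} {j} (spectral (dn {j} r))))"
proof -
  obtain W where W: "\<And>J. omega_prod n p (dn J r) = W * (\<Prod>j\<in>{1..n}. \<Prod>k\<in>{1..Suc n}. if j \<in> J then spectral p k - spectral r j else spectral p k - \<tau> * spectral r j)"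
    and W2: "\<And>a. omega_prod n (up {a} p) r = W * (\<Prod>j\<in>{1..n}. \<Prod>k\<in>{1..Suc n}. if k = a then spectral p k - spectral r j else spectral p k - \<tau> * spectral r j)"
    using omega_prod_core by blast
  let ?N = "{1..Suc n}" and ?M = "{1..n}"
  let ?c = "branch_norm (Suc n) p * (\<tau> powi (- (\<Sum>j\<in>?M. r j)) * vandermonde n r * W)"
  have L: "hcoef h ?N {a} (spectral p) * (branch_norm (Suc n) (up {a} p) * branch_kernel n (up {a} p) r) =
     ?c * ((\<Prod>i\<in>?N - {a}. (spectral p a - \<tau> * spectral p i) / (spectral p a - spectral p i)) * (\<Prod>j\<in>?M. \<Prod>k\<in>?N. if k = a then spectral p k - spectral r j else spectral p k - \<tau> * spectral r j))"
    if a: "a \<in> ?N" for a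
  proof (cases "part (Suc n) (up {a} p)")
    case True
    have "hcoef h ?N {a} (spectral p) * (branch_norm (Suc n) (up {a} p) * branch_kernel n (up {a} p) r) =
      (hcoef h ?N {a} (spectral p) * branch_norm (Suc n) (up {a} p)) * (\<tau> powi (- (\<Sum>j\<in>?M. r j)) * vandermonde n r) * omega_prod n (up {a} p) r"
      by (simp add: branch_kernel_def mult_ac)
    then show ?thesis unfolding branch_norm_step[OF p True a] W2 by (simp only: mult_ac)
  next
    case False
    obtain b where b: "b \<in> {1..<Suc n}" "up {a} p b > up {a} p (Suc b)"
    proof -
      have "\<forall>i. i \<notin> {1..Suc n} \<longrightarrow> up {a} p i = 0" "\<forall>i\<in>{1..Suc n}. 0 \<le> up {a} p i"
        using p a by (auto simp: part_def up_def)
      then show ?thesis using False that unfolding part_def by (meson not_le)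
    qed
    have "p b \<le> p (Suc b)" using p b by (auto simp: part_def)
    then have "a = b" "p (Suc a) = p a" using b(2) by (auto simp: up_def split: if_splits)
    have "h * spectral p a = spectral p (Suc a)" using \<open>p (Suc a) = p a\<close> by (simp add: spectral_def)
    then have A0: "hcoef h ?N {a} (spectral p) = 0"
      unfolding hcoef_single using b \<open>a = b\<close> by (intro prod_zero) (auto intro!: bexI[of _ "Suc b"])
    have "r \<notin> interlacing n (up {a} p)"
    proof
      assume "r \<in> interlacing n (up {a} p)"
      then have "up {a} p b \<le> r b" "r b \<le> up {a} p (Suc b)" using b by (auto simp: interlacing_def)
      then show False using b by simp
    qed
    then have "omega_prod n (up {a} p) r = 0" using r by (intro omega_prod_zero) (auto simp: part_def)
    then have "W = 0 \<or> (\<Prod>j\<in>?M. \<Prod>k\<in>?N. if k = a then spectral p k - spectral r j else spectral p k - \<tau> * spectral r j) = 0"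
      unfolding W2 by (simp only: mult_eq_0_iff)
    then show ?thesis unfolding A0 by (elim disjE) (simp_all only: mult_zero_left mult_zero_right)
  qed
  have dn0: "dn {} r = r" by (auto simp: dn_def)
  have R0: "branch_kernel n p r = (\<tau> powi (- (\<Sum>j\<in>?M. r j)) * vandermonde n r * W) * (\<Prod>j\<in>?M. \<Prod>k\<in>?N. spectral p k - \<tau> * spectral r j)"
    using W[of "{}"] by (simp add: branch_kernel_def dn0 mult_ac)
  have c12: "Suc 0 choose 2 = 0" by (simp add: binomial_eq_0)
  have R1: "branch_kernel n p (dn {j} r) * hcoef h ?M {j} (spectral (dn {j} r)) = (\<tau> powi (- (\<Sum>j\<in>?M. r j)) * vandermonde n r * W) *
      (\<tau> * ((\<Prod>i\<in>?M - {j}. (spectral r i - \<tau> * spectral r j) / (spectral r i - spectral r j)) *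
       (\<Prod>l\<in>?M. \<Prod>k\<in>?N. if l = j then spectral p k - spectral r l else spectral p k - \<tau> * spectral r l)))" if "j \<in> ?M" for j
  proof -
    have "(\<Prod>l\<in>?M. \<Prod>k\<in>?N. if l = j then spectral p k - spectral r l else spectral p k - \<tau> * spectral r l) =
       (\<Prod>l\<in>{j}. \<Prod>k\<in>?N. spectral p k - spectral r l) * (\<Prod>l\<in>?M - {j}. \<Prod>k\<in>?N. spectral p k - \<tau> * spectral r l)"
      using prod_if_split[where M = ?M and J = "{j}" and N = ?N and f = "\<lambda>l k. spectral p k - spectral r l" and g = "\<lambda>l k. spectral p k - \<tau> * spectral r l"] that by simp
    then show ?thesis using branch_kernel_hcoef_dn[OF _ W, of "{j}"] that by (simp add: c12 mult_ac)
  qed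
  have "(\<Sum>a\<in>?N. hcoef h ?N {a} (spectral p) * (branch_norm (Suc n) (up {a} p) * branch_kernel n (up {a} p) r)) =
    ?c * (\<Sum>a\<in>?N. (\<Prod>i\<in>?N - {a}. (spectral p a - \<tau> * spectral p i) / (spectral p a - spectral p i)) * (\<Prod>j\<in>?M. \<Prod>k\<in>?N. if k = a then spectral p k - spectral r j else spectral p k - \<tau> * spectral r j))"
    unfolding sum_distrib_left by (rule sum.cong[OF refl L])
  also have "\<dots> = ?c * ((\<Prod>j\<in>?M. \<Prod>i\<in>?N. spectral p i - \<tau> * spectral r j) +
         \<tau> * (\<Sum>j\<in>?M. (\<Prod>i\<in>?M - {j}. (spectral r i - \<tau> * spectral r j) / (spectral r i - spectral r j)) *
            (\<Prod>l\<in>?M. \<Prod>i\<in>?N. if l = j then spectral p i - spectral r l else spectral p i - \<tau> * spectral r l)))"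
    by (subst one_step_kernel_identity) (use spectral_inj tau in auto)
  also have "\<dots> = branch_norm (Suc n) p * (branch_kernel n p r + (\<Sum>j\<in>?M. branch_kernel n p (dn {j} r) * hcoef h ?M {j} (spectral (dn {j} r))))"
  proof -
    have "(\<Sum>j\<in>?M. branch_kernel n p (dn {j} r) * hcoef h ?M {j} (spectral (dn {j} r))) = (\<Sum>j\<in>?M. (\<tau> powi (- (\<Sum>j\<in>?M. r j)) * vandermonde n r * W) *
      (\<tau> * ((\<Prod>i\<in>?M - {j}. (spectral r i - \<tau> * spectral r j) / (spectral r i - spectral r j)) *
       (\<Prod>l\<in>?M. \<Prod>k\<in>?N. if l = j then spectral p k - spectral r l else spectral p k - \<tau> * spectral r l))))"
      by (intro sum.cong refl R1)
    then show ?thesis unfolding R0 by (simp only: sum_distrib_left distrib_left mult.assoc)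
  qed
  finally show ?thesis .
qed

text \<open>
  This is \<open>Qsum_zero\<close> at the spectral points of \<open>p\<close> and \<open>r\<close>.
\<close>
lemma kernel_eigen:
  assumes r: "part n r"
  shows "(\<Sum>J\<in>Pow {1..n}. (- 1) ^ card J * h ^ (card J choose 2) * (branch_kernel n p (dn J r) * hcoef h {1..n} J (spectral (dn J r))) *
     (sum (spectral r) {1..n} + (\<tau> - 1) * sum (spectral r) J + prod (spectral p) {1..Suc n} / (prod (spectral r) {1..n} * \<tau> ^ card J) - sum (spectral p) {1..Suc n})) = 0"
proof -
  obtain W where W: "\<And>J. omega_prod n p (dn J r) = W * (\<Prod>j\<in>{1..n}. \<Prod>k\<in>{1..Suc n}. if j \<in> J then spectral p k - spectral r j else spectral p k - \<tau> * spectral r j)"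
    using omega_prod_core by blast
  have "Qsum \<tau> {1..Suc n} {1..n} (spectral p) (spectral r) = 0"
  proof (rule Qsum_zero)
    show "spectral r i \<noteq> \<tau> * spectral r j" if "i \<in> {1..n}" "j \<in> {1..n}" for i j
    proof
      assume "spectral r i = \<tau> * spectral r j"
      then have "r i = r j - 1" "i = Suc j" by (auto simp: spectral_eq_tau)
      then show False using r that unfolding part_def by force
    qed
  qed (use spectral_inj tau in auto)
  then have 0: "(\<tau> powi (- (\<Sum>j\<in>{1..n}. r j)) * vandermonde n r * W) * Qsum \<tau> {1..Suc n} {1..n} (spectral p) (spectral r) = 0" by simp
  have 1: "(\<tau> powi (- (\<Sum>j\<in>{1..n}. r j)) * vandermonde n r * W) * Qsum \<tau> {1..Suc n} {1..n} (spectral p) (spectral r) =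
    (\<Sum>J\<in>Pow {1..n}. (- 1) ^ card J * h ^ (card J choose 2) * (branch_kernel n p (dn J r) * hcoef h {1..n} J (spectral (dn J r))) *
     (sum (spectral r) {1..n} + (\<tau> - 1) * sum (spectral r) J + prod (spectral p) {1..Suc n} / (prod (spectral r) {1..n} * \<tau> ^ card J) - sum (spectral p) {1..Suc n}))"
    unfolding Qsum_def
  proof (subst sum_distrib_left, rule sum.cong)
    fix J assume "J \<in> Pow {1..n}"
    then have J: "J \<subseteq> {1..n}" by simp
    let ?b = "card J choose 2"
    have "h ^ ?b * (\<tau> ^ card J * inverse q ^ ?b) = \<tau> ^ (card J + ?b)"
      by (simp add: power_add \<tau>_def power_divide divide_inverse power_inverse power_mult_distrib)
    then have e: "h ^ ?b * (\<tau> ^ card J * (inverse q ^ ?b * z)) = \<tau> ^ (card J + ?b) * z" for z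
      by (simp flip: mult.assoc)
    show "(\<tau> powi (- (\<Sum>j\<in>{1..n}. r j)) * vandermonde n r * W) * ((- 1) ^ card J * \<tau> ^ (card J + (card J choose 2)) *
      (\<Prod>j\<in>J. \<Prod>i\<in>{1..n} - J. (spectral r i - \<tau> * spectral r j) / (spectral r i - spectral r j)) *
      ((\<Prod>j\<in>J. \<Prod>k\<in>{1..Suc n}. spectral p k - spectral r j) * (\<Prod>j\<in>{1..n} - J. \<Prod>k\<in>{1..Suc n}. spectral p k - \<tau> * spectral r j)) *
      (sum (spectral r) {1..n} + (\<tau> - 1) * sum (spectral r) J + prod (spectral p) {1..Suc n} / (prod (spectral r) {1..n} * \<tau> ^ card J) - sum (spectral p) {1..Suc n})) =
      (- 1) ^ card J * h ^ (card J choose 2) * (branch_kernel n p (dn J r) * hcoef h {1..n} J (spectral (dn J r))) *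
     (sum (spectral r) {1..n} + (\<tau> - 1) * sum (spectral r) J + prod (spectral p) {1..Suc n} / (prod (spectral r) {1..n} * \<tau> ^ card J) - sum (spectral p) {1..Suc n})"
      unfolding branch_kernel_hcoef_dn[OF J W] e[symmetric] mult.assoc by (simp only: mult_ac)
  qed simp
  show ?thesis by (rule trans[OF 1[symmetric] 0])
qed

end

section \<open>The polynomials defined by branching\<close>

lemma macdonald_op_hcoef:
  "macdonald_op n q h r f x = (\<Sum>I\<in>{I. I \<subseteq> {1..n} \<and> card I = r}. hcoef h {1..n} I x * f (\<lambda>i. if i \<in> I then q * x i else x i))"
  by (simp add: macdonald_op_def hcoef_def)

lemma macdonald_op_1:
  "macdonald_op n q h 1 f x = (\<Sum>i\<in>{1..n}. hcoef h {1..n} {i} x * f (x(i := q * x i)))"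
proof -
  have "{I. I \<subseteq> {1..n} \<and> card I = 1} = (\<lambda>j. {j}) ` {1..n}"
    by (auto simp: card_1_singleton_iff)
  moreover have "(\<lambda>j. if j \<in> {i} then q * x j else x j) = x(i := q * x i)" for i
    by auto
  ultimately show ?thesis
    unfolding macdonald_op_hcoef by (simp add: sum.reindex inj_on_def)
qed

context macdonald_params
begin

text \<open>
  The branching rule.  The exponent of the last variable is the number of boxes by which the rows differ.
\<close>
primrec F :: "nat \<Rightarrow> (nat \<Rightarrow> int) \<Rightarrow> (nat \<Rightarrow> complex) \<Rightarrow> complex" where
  "F 0 p x = 1"
| "F (Suc n) p x = branch_norm (Suc n) p * (\<Sum>r\<in>interlacing n p. branch_kernel n p r * x (Suc n) ^ nat (sum p {1..Suc n} - sum r {1..n}) * F n r x)"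

lemma F_cong: "(\<And>i. i \<in> {1..n} \<Longrightarrow> x i = y i) \<Longrightarrow> F n p x = F n p y"
proof (induction n arbitrary: p)
  case (Suc n)
  then show ?case by (auto intro!: arg_cong2[of _ _ _ _ "(*)"] sum.cong)
qed simp

text \<open>
  The division by \<open>h\<close> is due to the indices of \<open>spectral\<close>, which start at \<open>1\<close>.
\<close>
definition eig :: "nat \<Rightarrow> (nat \<Rightarrow> int) \<Rightarrow> complex" where
  "eig n p = sum (spectral p) {1..n} / h"

text \<open>
  Contains \<open>up J r\<close> for all \<open>r\<close> that interlace with \<open>p\<close>.
\<close>
definition Box :: "nat \<Rightarrow> (nat \<Rightarrow> int) \<Rightarrow> (nat \<Rightarrow> int) set" where
  "Box n p = {r. (\<forall>i. i \<notin> {1..n} \<longrightarrow> r i = 0) \<and> (\<forall>i\<in>{1..n}. p i \<le> r i \<and> r i \<le> p (Suc i) + 1)}"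

lemma finite_Box: "finite (Box n p)"
proof (rule finite_subset)
  show "Box n p \<subseteq> {r. \<forall>i. (i \<in> {1..n} \<longrightarrow> r i \<in> (\<Union>i\<in>{1..n}. {p i..p (Suc i) + 1})) \<and> (i \<notin> {1..n} \<longrightarrow> r i = 0)}"
  proof (clarsimp simp: Box_def)
    fix r i assume *: "\<forall>i\<in>{Suc 0..n}. p i \<le> r i \<and> r i \<le> p (Suc i) + 1" "Suc 0 \<le> i" "i \<le> n"
    then have "p i \<le> r i \<and> r i \<le> p (Suc i) + 1" by simp
    then show "\<exists>k\<in>{Suc 0..n}. p k \<le> r i \<and> r i \<le> p (Suc k) + 1" using * by (intro bexI[of _ i]) auto
  qed
  show "finite {r :: nat \<Rightarrow> int. \<forall>i. (i \<in> {1..n} \<longrightarrow> r i \<in> (\<Union>i\<in>{1..n}. {p i..p (Suc i) + 1})) \<and> (i \<notin> {1..n} \<longrightarrow> r i = 0)}"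
    by (intro finite_set_of_finite_funs) auto
qed

lemma interlacing_subset_Box: "interlacing n p \<subseteq> Box n p"
  by (force simp: interlacing_def Box_def)

lemma finite_interlacing: "finite (interlacing n p)"
  using finite_subset[OF interlacing_subset_Box finite_Box] .

lemma part_interlacing:
  assumes "part (Suc n) p" "r \<in> interlacing n p"
  shows "part n r" "sum r {1..n} \<le> sum p {1..Suc n}"
proof -
  show "part n r"
    unfolding part_def
  proof (intro conjI ballI allI impI)
    fix i assume "i \<in> {1..<n}"
    then have "r i \<le> p (Suc i)" "p (Suc i) \<le> r (Suc i)" using assms(2) by (auto simp: interlacing_def)
    then show "r i \<le> r (Suc i)" by simp
  next
    fix i assume "i \<in> {1..n}"
    then have "0 \<le> p i" "p i \<le> r i" using assms by (auto simp: interlacing_def part_def)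
    then show "0 \<le> r i" by simp
  qed (use assms in \<open>auto simp: interlacing_def\<close>)
  have "sum r {1..n} \<le> (\<Sum>i\<in>{1..n}. p (Suc i))"
    by (rule sum_mono) (use assms in \<open>auto simp: interlacing_def\<close>)
  also have "\<dots> \<le> p 1 + (\<Sum>i\<in>{1..n}. p (Suc i))" using assms by (simp add: part_def)
  also have "\<dots> = sum p {1..Suc n}"
    using sum.atLeast_Suc_atMost[of 1 "Suc n" p] sum.shift_bounds_cl_Suc_ivl[of p 1 n] by simp
  finally show "sum r {1..n} \<le> sum p {1..Suc n}" .
qed

text \<open>
  The order can only fail at some \<open>i \<in> J\<close> with \<open>Suc i \<notin> J\<close> and \<open>p i = p (Suc i)\<close>, and then
  \<open>h * spectral p i = spectral p (Suc i)\<close>.  So sums of Pieri type may run over all \<open>J\<close>.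
\<close>
lemma hcoef_nonpart:
  assumes "part n p" "J \<subseteq> {1..n}" "\<not> part n (up J p)"
  shows "hcoef h {1..n} J (spectral p) = 0"
proof -
  have "\<forall>i. i \<notin> {1..n} \<longrightarrow> up J p i = 0" "\<forall>i\<in>{1..n}. 0 \<le> up J p i"
    using assms by (auto simp: part_def up_def)
  then obtain b where b: "b \<in> {1..<n}" "up J p b > up J p (Suc b)"
    using assms(3) unfolding part_def by (meson not_le)
  have "p b \<le> p (Suc b)" using assms b by (auto simp: part_def)
  then have "b \<in> J" "Suc b \<in> {1..n} - J" "p (Suc b) = p b" using b by (auto simp: up_def split: if_splits)
  then have "(\<Prod>j\<in>{1..n} - J. (h * spectral p b - spectral p j) / (spectral p b - spectral p j)) = 0"
    by (intro prod_zero) (auto intro!: bexI[of _ "Suc b"] simp: spectral_def)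
  moreover have "finite J" using assms finite_subset by auto
  ultimately show ?thesis
    unfolding hcoef_def using \<open>b \<in> J\<close> by (intro prod_zero) blast+
qed

text \<open>
  Collects the contributions to \<open>F n r\<close> after a Pieri rule in \<open>n\<close> variables.  Rows of \<open>Box\<close> that do not
  arise from an interlacing row have kernel zero.
\<close>
lemma reindex_up:
  assumes "J \<subseteq> {1..n}"
  shows "(\<Sum>r\<in>interlacing n p. branch_kernel n p r * c r * F n (up J r) x) = (\<Sum>r\<in>Box n p. branch_kernel n p (dn J r) * c (dn J r) * F n r x)"
proof -
  have inj: "inj_on (up J) (interlacing n p)"
    by (metis dn_up inj_on_inverseI)
  have sub: "up J ` interlacing n p \<subseteq> Box n p"
    using assms by (force simp: up_def interlacing_def Box_def)
  have "(\<Sum>r\<in>Box n p. branch_kernel n p (dn J r) * c (dn J r) * F n r x) = (\<Sum>r\<in>up J ` interlacing n p. branch_kernel n p (dn J r) * c (dn J r) * F n r x)"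
  proof (rule sum.mono_neutral_right[OF finite_Box sub], rule ballI)
    fix r assume r: "r \<in> Box n p - up J ` interlacing n p"
    have "dn J r \<notin> interlacing n p"
    proof
      assume "dn J r \<in> interlacing n p"
      then have "up J (dn J r) \<in> up J ` interlacing n p" by blast
      then show False using r by simp
    qed
    moreover have "\<And>i. i \<notin> {1..n} \<Longrightarrow> dn J r i = 0"
      using r assms by (auto simp: dn_def Box_def)
    ultimately have "branch_kernel n p (dn J r) = 0" by (rule branch_kernel_zero[rotated])
    then show "branch_kernel n p (dn J r) * c (dn J r) * F n r x = 0" by simp
  qed
  also have "\<dots> = (\<Sum>r\<in>interlacing n p. branch_kernel n p r * c r * F n (up J r) x)"
    by (subst sum.reindex[OF inj]) simp
  finally show ?thesis by simp
qed

lemma dn_empty [simp]: "dn {} r = r" and up_empty [simp]: "up {} r = r"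
  by (auto simp: dn_def up_def)

lemma nonpart_term_zero:
  assumes p: "part (Suc n) p" and r: "r \<in> Box n p" "\<not> part n r" and J: "J \<subseteq> {1..n}"
  shows "branch_kernel n p (dn J r) * hcoef h {1..n} J (spectral (dn J r)) = 0"
proof (cases "dn J r \<in> interlacing n p")
  case True
  then have "part n (dn J r)" using part_interlacing[OF p] by blast
  then have "hcoef h {1..n} J (spectral (dn J r)) = 0"
    by (rule hcoef_nonpart) (use J r in auto)
  then show ?thesis by simp
next
  case False
  have "branch_kernel n p (dn J r) = 0"
    by (rule branch_kernel_zero) (use False r J in \<open>auto simp: dn_def Box_def\<close>)
  then show ?thesis by simp
qed

lemma sum_up: "a \<in> {1..n} \<Longrightarrow> sum (up {a} p) {1..n} = sum p {1..n} + 1"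
proof -
  assume a: "a \<in> {1..n}"
  have "sum (up {a} p) {1..n} = up {a} p a + sum (up {a} p) ({1..n} - {a})"
    by (rule sum.remove) (use a in auto)
  also have "sum (up {a} p) ({1..n} - {a}) = sum p ({1..n} - {a})"
    by (rule sum.cong) (auto simp: up_def)
  also have "up {a} p a + \<dots> = sum p {1..n} + 1"
    using sum.remove[of "{1..n}" a p] a by (simp add: up_def)
  finally show ?thesis .
qed

text \<open>
  In the branching rule, the last variable raises its exponent and the others act by the rule in \<open>n\<close>
  variables; the coefficients of each \<open>F n r\<close> agree by \<open>kernel_Pieri\<close>.
\<close>
lemma F_Pieri1:
  assumes "part n p"
  shows "(\<Sum>i\<in>{1..n}. x i) * F n p x = (\<Sum>a\<in>{1..n}. hcoef h {1..n} {a} (spectral p) * F n (up {a} p) x)"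
  using assms
proof (induction n arbitrary: p)
  case (Suc n)
  let ?M = "{1..n}" and ?N = "{1..Suc n}"
  define e where "e r = nat (sum p ?N - sum r ?M)" for r
  define e1 where "e1 r = nat (sum p ?N + 1 - sum r ?M)" for r
  define z where "z = x (Suc n)"
  note p = Suc.prems
  have 1: "(\<Sum>r\<in>interlacing n p. branch_kernel n p r * z ^ e r * (z * F n r x)) = (\<Sum>r\<in>Box n p. branch_kernel n p r * z ^ e1 r * F n r x)"
  proof -
    have "(\<Sum>r\<in>interlacing n p. branch_kernel n p r * z ^ e r * (z * F n r x)) = (\<Sum>r\<in>interlacing n p. branch_kernel n p r * (z ^ Suc (e r)) * F n (up {} r) x)"
      by (simp add: mult_ac)
    also have "\<dots> = (\<Sum>r\<in>Box n p. branch_kernel n p r * (z ^ Suc (e r)) * F n r x)"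
      using reindex_up[of "{}" n p "\<lambda>r. z ^ Suc (e r)" x] by simp
    also have "\<dots> = (\<Sum>r\<in>Box n p. branch_kernel n p r * z ^ e1 r * F n r x)"
    proof (rule sum.cong)
      fix r assume r: "r \<in> Box n p"
      show "branch_kernel n p r * z ^ Suc (e r) * F n r x = branch_kernel n p r * z ^ e1 r * F n r x"
      proof (cases "r \<in> interlacing n p")
        case True
        then have "Suc (e r) = e1 r" using part_interlacing(2)[OF p True] by (simp add: e_def e1_def)
        then show ?thesis by simp
      next
        case False
        have "branch_kernel n p r = 0" by (rule branch_kernel_zero) (use False r in \<open>auto simp: Box_def\<close>)
        then show ?thesis by simp
      qed
    qed simp
    finally show ?thesis .
  qed
  have 2: "(\<Sum>r\<in>interlacing n p. branch_kernel n p r * z ^ e r * ((\<Sum>i\<in>?M. x i) * F n r x)) =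
     (\<Sum>r\<in>Box n p. (\<Sum>j\<in>?M. branch_kernel n p (dn {j} r) * hcoef h ?M {j} (spectral (dn {j} r))) * z ^ e1 r * F n r x)"
  proof -
    have "(\<Sum>r\<in>interlacing n p. branch_kernel n p r * z ^ e r * ((\<Sum>i\<in>?M. x i) * F n r x)) =
      (\<Sum>r\<in>interlacing n p. \<Sum>j\<in>?M. branch_kernel n p r * (z ^ e r * hcoef h ?M {j} (spectral r)) * F n (up {j} r) x)"
    proof (rule sum.cong)
      fix r assume "r \<in> interlacing n p"
      then have "part n r" using part_interlacing[OF p] by blast
      then show "branch_kernel n p r * z ^ e r * ((\<Sum>i\<in>?M. x i) * F n r x) = (\<Sum>j\<in>?M. branch_kernel n p r * (z ^ e r * hcoef h ?M {j} (spectral r)) * F n (up {j} r) x)"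
        unfolding Suc.IH[OF \<open>part n r\<close>] by (simp add: sum_distrib_left mult_ac)
    qed simp
    also have "\<dots> = (\<Sum>j\<in>?M. \<Sum>r\<in>interlacing n p. branch_kernel n p r * (z ^ e r * hcoef h ?M {j} (spectral r)) * F n (up {j} r) x)"
      by (rule sum.swap)
    also have "\<dots> = (\<Sum>j\<in>?M. \<Sum>r\<in>Box n p. branch_kernel n p (dn {j} r) * (z ^ e (dn {j} r) * hcoef h ?M {j} (spectral (dn {j} r))) * F n r x)"
      by (intro sum.cong refl reindex_up[where c = "\<lambda>r. z ^ e r * hcoef h ?M {_} (spectral r)"]) auto
    also have "\<dots> = (\<Sum>j\<in>?M. \<Sum>r\<in>Box n p. branch_kernel n p (dn {j} r) * hcoef h ?M {j} (spectral (dn {j} r)) * (z ^ e1 r * F n r x))"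
    proof (intro sum.cong refl)
      fix j r assume "j \<in> ?M"
      then have "e (dn {j} r) = e1 r" using sum_dn[of "{j}" n r] by (simp add: e_def e1_def)
      then show "branch_kernel n p (dn {j} r) * (z ^ e (dn {j} r) * hcoef h ?M {j} (spectral (dn {j} r))) * F n r x =
          branch_kernel n p (dn {j} r) * hcoef h ?M {j} (spectral (dn {j} r)) * (z ^ e1 r * F n r x)" by simp
    qed
    also have "\<dots> = (\<Sum>r\<in>Box n p. \<Sum>j\<in>?M. branch_kernel n p (dn {j} r) * hcoef h ?M {j} (spectral (dn {j} r)) * (z ^ e1 r * F n r x))"
      by (rule sum.swap)
    finally show ?thesis by (simp add: sum_distrib_right mult.assoc)
  qed
  have L: "(\<Sum>i\<in>?N. x i) * F (Suc n) p x = (\<Sum>r\<in>Box n p.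
     branch_norm (Suc n) p * (branch_kernel n p r + (\<Sum>j\<in>?M. branch_kernel n p (dn {j} r) * hcoef h ?M {j} (spectral (dn {j} r)))) * (z ^ e1 r * F n r x))"
  proof -
    have "(\<Sum>i\<in>?N. x i) * F (Suc n) p x = branch_norm (Suc n) p * ((\<Sum>r\<in>interlacing n p. branch_kernel n p r * z ^ e r * (z * F n r x)) +
       (\<Sum>r\<in>interlacing n p. branch_kernel n p r * z ^ e r * ((\<Sum>i\<in>?M. x i) * F n r x)))"
      by (simp add: z_def e_def sum_distrib_left sum.distrib[symmetric] algebra_simps)
    then show ?thesis unfolding 1 2
      by (simp add: sum_distrib_left sum.distrib[symmetric] algebra_simps)
  qed
  have R: "hcoef h ?N {a} (spectral p) * F (Suc n) (up {a} p) x = (\<Sum>r\<in>Box n p.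
      hcoef h ?N {a} (spectral p) * (branch_norm (Suc n) (up {a} p) * branch_kernel n (up {a} p) r) * (z ^ e1 r * F n r x))" if a: "a \<in> ?N" for a
  proof -
    have s: "sum (up {a} p) ?N = sum p ?N + 1" using sum_up[OF a] .
    have "(\<Sum>r\<in>interlacing n (up {a} p). branch_kernel n (up {a} p) r * z ^ e1 r * F n r x) = (\<Sum>r\<in>Box n p. branch_kernel n (up {a} p) r * z ^ e1 r * F n r x)"
    proof (rule sum.mono_neutral_left[OF finite_Box])
      show "interlacing n (up {a} p) \<subseteq> Box n p"
        by (force simp: interlacing_def Box_def up_def split: if_splits)
      show "\<forall>r\<in>Box n p - interlacing n (up {a} p). branch_kernel n (up {a} p) r * z ^ e1 r * F n r x = 0"
      proof
        fix r assume r: "r \<in> Box n p - interlacing n (up {a} p)"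
        have "branch_kernel n (up {a} p) r = 0" by (rule branch_kernel_zero) (use r in \<open>auto simp: Box_def\<close>)
        then show "branch_kernel n (up {a} p) r * z ^ e1 r * F n r x = 0" by simp
      qed
    qed
    then show ?thesis
      unfolding F.simps s z_def[symmetric] e1_def[symmetric] by (simp add: sum_distrib_left mult_ac)
  qed
  have "(\<Sum>a\<in>?N. hcoef h ?N {a} (spectral p) * F (Suc n) (up {a} p) x) = (\<Sum>r\<in>Box n p.
      (\<Sum>a\<in>?N. hcoef h ?N {a} (spectral p) * (branch_norm (Suc n) (up {a} p) * branch_kernel n (up {a} p) r)) * (z ^ e1 r * F n r x))"
    unfolding sum_distrib_right by (subst sum.swap) (intro sum.cong refl R)
  also have "\<dots> = (\<Sum>r\<in>Box n p.
     branch_norm (Suc n) p * (branch_kernel n p r + (\<Sum>j\<in>?M. branch_kernel n p (dn {j} r) * hcoef h ?M {j} (spectral (dn {j} r)))) * (z ^ e1 r * F n r x))"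
  proof (rule sum.cong)
    fix r assume r: "r \<in> Box n p"
    show "(\<Sum>a\<in>?N. hcoef h ?N {a} (spectral p) * (branch_norm (Suc n) (up {a} p) * branch_kernel n (up {a} p) r)) * (z ^ e1 r * F n r x) =
      branch_norm (Suc n) p * (branch_kernel n p r + (\<Sum>j\<in>?M. branch_kernel n p (dn {j} r) * hcoef h ?M {j} (spectral (dn {j} r)))) * (z ^ e1 r * F n r x)"
    proof (cases "part n r")
      case True
      then show ?thesis using kernel_Pieri[OF p] by simp
    next
      case False
      have 1: "hcoef h ?N {a} (spectral p) * (branch_norm (Suc n) (up {a} p) * branch_kernel n (up {a} p) r) = 0" if "a \<in> ?N" for a
      proof (cases "part (Suc n) (up {a} p)")
        case True
        then have "r \<notin> interlacing n (up {a} p)" using part_interlacing False by blast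
        then have "branch_kernel n (up {a} p) r = 0" using r by (intro branch_kernel_zero) (auto simp: Box_def)
        then show ?thesis by simp
      next
        case False
        then show ?thesis using hcoef_nonpart[OF p] that by simp
      qed
      have 2: "branch_kernel n p (dn {j} r) * hcoef h ?M {j} (spectral (dn {j} r)) = 0" if "j \<in> ?M" for j
        using nonpart_term_zero[OF p r False, of "{j}"] that by simp
      have 3: "branch_kernel n p r = 0"
        using nonpart_term_zero[OF p r False, of "{}"] by (simp add: hcoef_def)
      have "(\<Sum>a\<in>?N. hcoef h ?N {a} (spectral p) * (branch_norm (Suc n) (up {a} p) * branch_kernel n (up {a} p) r)) = 0"
        by (rule sum.neutral, rule ballI, rule 1)
      moreover have "(\<Sum>j\<in>?M. branch_kernel n p (dn {j} r) * hcoef h ?M {j} (spectral (dn {j} r))) = 0"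
        by (rule sum.neutral, rule ballI, rule 2)
      ultimately show ?thesis using 3 by (simp only: mult_zero_left mult_zero_right add_0)
    qed
  qed simp
  finally show ?case using L by simp
qed simp

lemma prod_spectral: "finite A \<Longrightarrow> prod (spectral p) A = q powi (sum p A) * h ^ (\<Sum>A)"
  by (induction A rule: finite_induct) (use q0 in \<open>auto simp: spectral_def power_int_add power_add mult_ac\<close>)

text \<open>
  Stable under all shifts, so that Macdonald operators can be composed without meeting a pole.
\<close>
definition q_generic :: "nat \<Rightarrow> (nat \<Rightarrow> complex) \<Rightarrow> bool" where
  "q_generic n x \<longleftrightarrow> (\<forall>i\<in>{1..n}. x i \<noteq> 0 \<and> (\<forall>j\<in>{1..n}. i \<noteq> j \<longrightarrow> (\<forall>a b :: nat. q ^ a * x i \<noteq> q ^ b * x j)))"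

lemma q_generic_inj: "q_generic n x \<Longrightarrow> inj_on x {1..n}"
  unfolding q_generic_def inj_on_def by (metis mult_1 power_0)

lemma q_generic_nz: "q_generic n x \<Longrightarrow> i \<in> {1..n} \<Longrightarrow> x i \<noteq> 0"
  by (auto simp: q_generic_def)

lemma q_generic_Suc: "q_generic (Suc n) x \<Longrightarrow> q_generic n x"
  by (auto simp: q_generic_def)

lemma q_generic_shift:
  assumes "q_generic n x"
  shows "q_generic n (\<lambda>i. if i \<in> I then q * x i else x i)"
  unfolding q_generic_def
proof (intro ballI conjI impI allI)
  fix i j a b assume ij: "i \<in> {1..n}" "j \<in> {1..n}" "i \<noteq> j"
  have "q ^ a * (if i \<in> I then q * x i else x i) = q ^ (if i \<in> I then Suc a else a) * x i"
    "q ^ b * (if j \<in> I then q * x j else x j) = q ^ (if j \<in> I then Suc b else b) * x j" by auto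
  then show "q ^ a * (if i \<in> I then q * x i else x i) \<noteq> q ^ b * (if j \<in> I then q * x j else x j)"
    using assms ij by (simp only: q_generic_def) blast
qed (use assms q0 in \<open>auto simp: q_generic_def\<close>)

lemma q_generic_shift1:
  assumes "q_generic n x"
  shows "q_generic n (x(i := q * x i))"
proof -
  have "x(i := q * x i) = (\<lambda>j. if j \<in> {i} then q * x j else x j)" by auto
  then show ?thesis using q_generic_shift[OF assms, of "{i}"] by simp
qed

text \<open>
  The left side is the factor that \<open>F_eigen_step\<close> produces for \<open>F n r\<close> and a set \<open>J\<close> of
  removed boxes, the right side the last factor of \<open>Qsum\<close>.
\<close>
lemma eigen_bracket:
  assumes J: "J \<subseteq> {1..n}" and e: "sum r {1..n} - int (card J) \<le> sum p {1..Suc n}"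
  defines "\<alpha> \<equiv> (h - 1) / (q - 1)"
  shows "h * (\<alpha> * eig n r + (1 - \<alpha>) * eig n (dn J r) + h ^ (n - card J) * q ^ nat (sum p {1..Suc n} - sum (dn J r) {1..n}) - eig (Suc n) p) =
    sum (spectral r) {1..n} + (\<tau> - 1) * sum (spectral r) J + prod (spectral p) {1..Suc n} / (prod (spectral r) {1..n} * \<tau> ^ card J) - sum (spectral p) {1..Suc n}"
proof -
  have cJ: "card J \<le> n" using J card_mono[of "{1..n}" J] by simp
  have fJ: "finite J" using J finite_subset by auto
  have s: "sum (dn J r) {1..n} = sum r {1..n} - int (card J)" using sum_dn[OF J] .
  have 1: "sum (spectral (dn J r)) {1..n} = sum (spectral r) {1..n} + (1 / q - 1) * sum (spectral r) J"
  proof -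
    have "sum (spectral (dn J r)) {1..n} = (\<Sum>i\<in>{1..n}. spectral r i + (if i \<in> J then (1 / q - 1) * spectral r i else 0))"
      by (rule sum.cong) (auto simp: spectral_dn algebra_simps)
    also have "\<dots> = sum (spectral r) {1..n} + (1 / q - 1) * sum (spectral r) J"
      using J by (simp add: sum.distrib sum.If_cases Int_absorb1 sum_distrib_left)
    finally show ?thesis .
  qed
  have 2: "(1 - \<alpha>) * (1 / q - 1) = \<tau> - 1"
    using q0 q1 by (simp add: \<alpha>_def \<tau>_def divide_simps) (simp add: algebra_simps)
  have 3: "h * (h ^ (n - card J) * q ^ nat (sum p {1..Suc n} - sum (dn J r) {1..n})) = prod (spectral p) {1..Suc n} / (prod (spectral r) {1..n} * \<tau> ^ card J)"
  proof -
    have a: "q ^ nat (sum p {1..Suc n} - sum (dn J r) {1..n}) = q powi (sum p {1..Suc n}) * q ^ card J / q powi (sum r {1..n})"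
    proof -
      have "q ^ nat (sum p {1..Suc n} - sum (dn J r) {1..n}) = q powi (sum p {1..Suc n} - sum (dn J r) {1..n})"
        using e unfolding s by (simp add: power_int_def)
      also have "\<dots> = q powi (sum p {1..Suc n} + int (card J) - sum r {1..n})" unfolding s by (simp add: algebra_simps)
      finally show ?thesis using q0 by (simp add: power_int_add power_int_diff)
    qed
    have b: "h ^ (\<Sum>{1..Suc n}) = h ^ (\<Sum>{1..n}) * (h * h ^ (n - card J)) * h ^ card J"
      using cJ by (simp add: power_add[symmetric] ac_simps flip: power_Suc)
    show ?thesis
      unfolding a prod_spectral[OF finite_atLeastAtMost] b \<tau>_def power_divide using q0 h0 by (simp add: field_simps)
  qed
  have 4: "h * eig n' r' = sum (spectral r') {1..n'}" for n' r'
    using h0 by (simp add: eig_def)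
  have "h * (\<alpha> * eig n r + (1 - \<alpha>) * eig n (dn J r) + h ^ (n - card J) * q ^ nat (sum p {1..Suc n} - sum (dn J r) {1..n}) - eig (Suc n) p) =
     \<alpha> * (h * eig n r) + (1 - \<alpha>) * (h * eig n (dn J r)) + h * (h ^ (n - card J) * q ^ nat (sum p {1..Suc n} - sum (dn J r) {1..n})) - h * eig (Suc n) p"
    by (simp only: algebra_simps)
  also have "\<dots> = sum (spectral r) {1..n} + ((1 - \<alpha>) * (1 / q - 1)) * sum (spectral r) J + prod (spectral p) {1..Suc n} / (prod (spectral r) {1..n} * \<tau> ^ card J) - sum (spectral p) {1..Suc n}"
    unfolding 3 4 1 by (simp add: algebra_simps)
  finally show ?thesis unfolding 2 .
qed

text \<open>
  Let \<open>z\<close> be the last variable.  Multiplication by the product of all \<open>x i - z\<close> clears the poles at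
  \<open>x i = z\<close>.  The shift of \<open>x i\<close> then carries the factor \<open>h * x i - z\<close>, which is a combination of
  \<open>q * x i - z\<close> and \<open>x i - z\<close>: the operator becomes a combination of \<open>T\<^sub>1\<close> in \<open>n\<close> variables after and
  before multiplication by the product, and the shift of \<open>z\<close> gives the product with \<open>h * z\<close>.  The
  hypothesis \<open>P\<close>, the generating function of the Pieri rules, expands all of them, and the coefficient of each
  \<open>F n r\<close> vanishes by \<open>kernel_eigen\<close>.
\<close>
lemma F_eigen_step:
  assumes p: "part (Suc n) p" and x: "q_generic (Suc n) x"
    and T: "\<And>r x. part n r \<Longrightarrow> q_generic n x \<Longrightarrow> macdonald_op n q h 1 (F n r) x = eig n r * F n r x"
    and P: "\<And>r x z. part n r \<Longrightarrow> q_generic n x \<Longrightarrow> (\<Prod>i\<in>{1..n}. x i - z) * F n r x =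
       (\<Sum>J\<in>Pow {1..n}. (- z) ^ (n - card J) * h ^ (card J choose 2) * hcoef h {1..n} J (spectral r) * F n (up J r) x)"
  shows "macdonald_op (Suc n) q h 1 (F (Suc n) p) x = eig (Suc n) p * F (Suc n) p x"
proof -
  let ?M = "{1..n}" and ?N = "{1..Suc n}"
  define z where "z = x (Suc n)"
  \<comment> \<open>The factor that clears the poles.\<close>
  define D where "D = (\<Prod>l\<in>?M. x l - z)"
  \<comment> \<open>The number with \<open>h * y - z = \<alpha> * (q * y - z) + (1 - \<alpha>) * (y - z)\<close>.\<close>
  define \<alpha> where "\<alpha> = (h - 1) / (q - 1)"
  define e where "e r = nat (sum p ?N - sum r ?M)" for r
  define w where "w J r = (- z) ^ (n - card J) * h ^ (card J choose 2) * hcoef h ?M J (spectral r)" for J r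
  have gx: "q_generic n x" by (rule q_generic_Suc[OF x])
  have zne: "x l \<noteq> z" if "l \<in> ?M" for l
    using inj_onD[OF q_generic_inj[OF x], of l "Suc n"] that by (auto simp: z_def)
  have D0: "D \<noteq> 0" using zne by (auto simp: D_def)
  have al: "h * y - z = \<alpha> * (q * y - z) + (1 - \<alpha>) * (y - z)" for y
  proof -
    have "\<alpha> * (q - 1) = h - 1" using q1 by (simp add: \<alpha>_def)
    then have "(\<alpha> * (q - 1)) * y = (h - 1) * y" by simp
    then show ?thesis by (simp add: algebra_simps)
  qed
  have Pz: "D * F n r x = (\<Sum>J\<in>Pow ?M. w J r * F n (up J r) x)" if "part n r" for r
    using P[OF that gx, of z] by (simp add: D_def w_def)
  have first: "D * (\<Sum>i\<in>?M. hcoef h ?N {i} x * F n r (x(i := q * x i))) =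
    (\<Sum>J\<in>Pow ?M. w J r * (\<alpha> * eig n (up J r) + (1 - \<alpha>) * eig n r) * F n (up J r) x)" if r: "part n r" for r
  proof -
    let ?x = "\<lambda>i. x(i := q * x i)"
    have "D * (hcoef h ?N {i} x * F n r (?x i)) = \<alpha> * (hcoef h ?M {i} x * ((\<Prod>l\<in>?M. ?x i l - z) * F n r (?x i))) + (1 - \<alpha>) * (D * (hcoef h ?M {i} x * F n r (?x i)))"
      if i: "i \<in> ?M" for i
    proof -
      have NM: "?N - {i} = insert (Suc n) (?M - {i})" using i by auto
      have hN: "hcoef h ?N {i} x = hcoef h ?M {i} x * ((h * x i - z) / (x i - z))"
        unfolding hcoef_single NM by (subst prod.insert) (auto simp: z_def)
      define D' where "D' = (\<Prod>l\<in>?M - {i}. x l - z)"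
      have D1: "D = (x i - z) * D'"
        unfolding D_def D'_def by (rule prod.remove) (use i in auto)
      have D2: "(\<Prod>l\<in>?M. ?x i l - z) = (q * x i - z) * D'"
      proof -
        have "(\<Prod>l\<in>?M. ?x i l - z) = (?x i i - z) * (\<Prod>l\<in>?M - {i}. ?x i l - z)"
          by (rule prod.remove) (use i in auto)
        also have "(\<Prod>l\<in>?M - {i}. ?x i l - z) = D'" unfolding D'_def by (rule prod.cong) auto
        finally show ?thesis by simp
      qed
      have "D * (hcoef h ?N {i} x * F n r (?x i)) = D' * (h * x i - z) * (hcoef h ?M {i} x * F n r (?x i))"
        unfolding hN D1 using zne[OF i] by simp
      then show ?thesis unfolding D1 D2 al by (simp add: algebra_simps)
    qed
    then have "D * (\<Sum>i\<in>?M. hcoef h ?N {i} x * F n r (?x i)) =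
       \<alpha> * (\<Sum>i\<in>?M. hcoef h ?M {i} x * ((\<Prod>l\<in>?M. ?x i l - z) * F n r (?x i))) + (1 - \<alpha>) * (D * (\<Sum>i\<in>?M. hcoef h ?M {i} x * F n r (?x i)))"
      unfolding sum_distrib_left sum.distrib[symmetric] by (intro sum.cong refl)
    also have "(\<Sum>i\<in>?M. hcoef h ?M {i} x * F n r (?x i)) = eig n r * F n r x"
      using T[OF r gx] unfolding macdonald_op_1 .
    also have "(\<Sum>i\<in>?M. hcoef h ?M {i} x * ((\<Prod>l\<in>?M. ?x i l - z) * F n r (?x i))) = (\<Sum>J\<in>Pow ?M. w J r * (eig n (up J r) * F n (up J r) x))"
    proof -
      have "(\<Sum>i\<in>?M. hcoef h ?M {i} x * ((\<Prod>l\<in>?M. ?x i l - z) * F n r (?x i))) =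
         (\<Sum>i\<in>?M. \<Sum>J\<in>Pow ?M. w J r * (hcoef h ?M {i} x * F n (up J r) (?x i)))"
        by (intro sum.cong refl, subst P[OF r q_generic_shift1[OF gx]]) (simp add: sum_distrib_left w_def mult_ac)
      also have "\<dots> = (\<Sum>J\<in>Pow ?M. w J r * (\<Sum>i\<in>?M. hcoef h ?M {i} x * F n (up J r) (?x i)))"
        unfolding sum_distrib_left by (rule sum.swap)
      also have "\<dots> = (\<Sum>J\<in>Pow ?M. w J r * (eig n (up J r) * F n (up J r) x))"
      proof (rule sum.cong)
        fix J assume J: "J \<in> Pow ?M"
        show "w J r * (\<Sum>i\<in>?M. hcoef h ?M {i} x * F n (up J r) (?x i)) = w J r * (eig n (up J r) * F n (up J r) x)"
        proof (cases "part n (up J r)")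
          case True
          show ?thesis using T[OF True gx] unfolding macdonald_op_1 by simp
        next
          case False
          then have "w J r = 0" using hcoef_nonpart[OF r] J by (simp add: w_def)
          then show ?thesis by simp
        qed
      qed simp
      finally show ?thesis .
    qed
    also have "D * (eig n r * F n r x) = eig n r * (\<Sum>J\<in>Pow ?M. w J r * F n (up J r) x)"
      using Pz[OF r] by simp
    finally show ?thesis
      by (simp add: sum_distrib_left sum.distrib[symmetric] algebra_simps fun_upd_def)
  qed
  have second: "D * (hcoef h ?N {Suc n} x * F n r x) = (\<Sum>J\<in>Pow ?M. w J r * h ^ (n - card J) * F n (up J r) x)" if r: "part n r" for r
  proof -
    have NM: "?N - {Suc n} = ?M" by auto
    have "D * hcoef h ?N {Suc n} x = (\<Prod>l\<in>?M. x l - h * z)"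
      unfolding hcoef_single NM D_def prod.distrib[symmetric]
    proof (rule prod.cong)
      fix l assume l: "l \<in> ?M"
      have "(h * z - x l) / (z - x l) = (x l - h * z) / (x l - z)" by (metis minus_diff_eq minus_divide_divide)
      then show "(x l - z) * ((h * x (Suc n) - x l) / (x (Suc n) - x l)) = x l - h * z"
        using zne[OF l] by (simp add: z_def[symmetric])
    qed simp
    then have "D * (hcoef h ?N {Suc n} x * F n r x) = (\<Prod>l\<in>?M. x l - h * z) * F n r x" by (simp flip: mult.assoc)
    also have "\<dots> = (\<Sum>J\<in>Pow ?M. w J r * h ^ (n - card J) * F n (up J r) x)"
    proof -
      have "(- (h * z)) ^ m = (- z) ^ m * h ^ m" for m
        by (metis mult.commute mult_minus_right power_mult_distrib)
      then show ?thesis unfolding P[OF r gx] by (intro sum.cong refl) (simp only: w_def mult_ac)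
    qed
    finally show ?thesis .
  qed
  define \<beta> where "\<beta> J r = \<alpha> * eig n (up J r) + (1 - \<alpha>) * eig n r + h ^ (n - card J) * q ^ e r - eig (Suc n) p" for J r
  have "D * (macdonald_op (Suc n) q h 1 (F (Suc n) p) x - eig (Suc n) p * F (Suc n) p x) =
     branch_norm (Suc n) p * (\<Sum>r\<in>interlacing n p. \<Sum>J\<in>Pow ?M. branch_kernel n p r * (z ^ e r * w J r * \<beta> J r) * F n (up J r) x)"
  proof -
    have F1: "F (Suc n) p (x(i := q * x i)) = branch_norm (Suc n) p * (\<Sum>r\<in>interlacing n p. branch_kernel n p r * z ^ e r * F n r (x(i := q * x i)))" if "i \<in> ?M" for i
      using that by (auto simp: z_def e_def)
    have F2: "F (Suc n) p (x(Suc n := q * x (Suc n))) = branch_norm (Suc n) p * (\<Sum>r\<in>interlacing n p. branch_kernel n p r * (q ^ e r * z ^ e r) * F n r x)"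
    proof -
      have "F n r (x(Suc n := q * x (Suc n))) = F n r x" for r by (rule F_cong) auto
      then show ?thesis by (simp add: z_def e_def power_mult_distrib)
    qed
    have F0: "F (Suc n) p x = branch_norm (Suc n) p * (\<Sum>r\<in>interlacing n p. branch_kernel n p r * z ^ e r * F n r x)"
      by (simp add: z_def e_def)
    have "macdonald_op (Suc n) q h 1 (F (Suc n) p) x = (\<Sum>i\<in>?M. hcoef h ?N {i} x * F (Suc n) p (x(i := q * x i))) + hcoef h ?N {Suc n} x * F (Suc n) p (x(Suc n := q * x (Suc n)))"
      unfolding macdonald_op_1 by simp
    also have "(\<Sum>i\<in>?M. hcoef h ?N {i} x * F (Suc n) p (x(i := q * x i))) =
       branch_norm (Suc n) p * (\<Sum>r\<in>interlacing n p. branch_kernel n p r * z ^ e r * (\<Sum>i\<in>?M. hcoef h ?N {i} x * F n r (x(i := q * x i))))"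
      unfolding sum_distrib_left by (subst sum.swap) (auto simp: F1 sum_distrib_left mult_ac simp del: F.simps intro!: sum.cong)
    finally have "D * (macdonald_op (Suc n) q h 1 (F (Suc n) p) x - eig (Suc n) p * F (Suc n) p x) =
      branch_norm (Suc n) p * (\<Sum>r\<in>interlacing n p. branch_kernel n p r * z ^ e r * (D * (\<Sum>i\<in>?M. hcoef h ?N {i} x * F n r (x(i := q * x i))) +
        q ^ e r * (D * (hcoef h ?N {Suc n} x * F n r x)) - eig (Suc n) p * (D * F n r x)))"
      unfolding F0 F2
      by (simp add: algebra_simps sum_distrib_left sum.distrib sum_subtractf del: F.simps)
    also have "\<dots> = branch_norm (Suc n) p * (\<Sum>r\<in>interlacing n p. \<Sum>J\<in>Pow ?M. branch_kernel n p r * (z ^ e r * w J r * \<beta> J r) * F n (up J r) x)"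
    proof (intro arg_cong2[of _ _ _ _ "(*)"] sum.cong refl)
      fix r assume "r \<in> interlacing n p"
      then have r: "part n r" using part_interlacing[OF p] by blast
      show "branch_kernel n p r * z ^ e r * (D * (\<Sum>i\<in>?M. hcoef h ?N {i} x * F n r (x(i := q * x i))) +
        q ^ e r * (D * (hcoef h ?N {Suc n} x * F n r x)) - eig (Suc n) p * (D * F n r x)) =
        (\<Sum>J\<in>Pow ?M. branch_kernel n p r * (z ^ e r * w J r * \<beta> J r) * F n (up J r) x)"
        unfolding first[OF r] second[OF r] Pz[OF r]
        unfolding sum_distrib_left sum.distrib[symmetric] sum_subtractf[symmetric]
        by (intro sum.cong refl) (simp add: \<beta>_def algebra_simps)
    qed
    finally show ?thesis .
  qed
  also have "(\<Sum>r\<in>interlacing n p. \<Sum>J\<in>Pow ?M. branch_kernel n p r * (z ^ e r * w J r * \<beta> J r) * F n (up J r) x) =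
     (\<Sum>J\<in>Pow ?M. \<Sum>r\<in>Box n p. branch_kernel n p (dn J r) * (z ^ e (dn J r) * w J (dn J r) * \<beta> J (dn J r)) * F n r x)"
    by (subst sum.swap, intro sum.cong refl reindex_up[where c = "\<lambda>r. z ^ e r * w _ r * \<beta> _ r"]) auto
  also have "\<dots> = (\<Sum>r\<in>Box n p. (\<Sum>J\<in>Pow ?M. branch_kernel n p (dn J r) * (z ^ e (dn J r) * w J (dn J r) * \<beta> J (dn J r))) * F n r x)"
    unfolding sum_distrib_right by (rule sum.swap)
  also have "\<dots> = 0"
  proof (rule sum.neutral, rule ballI)
    fix r assume r: "r \<in> Box n p"
    have "(\<Sum>J\<in>Pow ?M. branch_kernel n p (dn J r) * (z ^ e (dn J r) * w J (dn J r) * \<beta> J (dn J r))) = 0"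
    proof (cases "part n r")
      case False
      show ?thesis
      proof (rule sum.neutral, rule ballI)
        fix J assume "J \<in> Pow ?M"
        then have "branch_kernel n p (dn J r) * hcoef h ?M J (spectral (dn J r)) = 0" using nonpart_term_zero[OF p r False] by auto
        then show "branch_kernel n p (dn J r) * (z ^ e (dn J r) * w J (dn J r) * \<beta> J (dn J r)) = 0" by (auto simp: w_def)
      qed
    next
      case True
      \<comment> \<open>Signs and powers of \<open>z\<close> are the same for all \<open>J\<close>.\<close>
      define c where "c = (- 1) ^ n * z ^ nat (sum p ?N - sum r ?M + int n) / h"
      define br where "br J = sum (spectral r) ?M + (\<tau> - 1) * sum (spectral r) J + prod (spectral p) ?N / (prod (spectral r) ?M * \<tau> ^ card J) - sum (spectral p) ?N" for J
      have "(\<Sum>J\<in>Pow ?M. branch_kernel n p (dn J r) * (z ^ e (dn J r) * w J (dn J r) * \<beta> J (dn J r))) =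
         (\<Sum>J\<in>Pow ?M. c * ((- 1) ^ card J * h ^ (card J choose 2) * (branch_kernel n p (dn J r) * hcoef h ?M J (spectral (dn J r))) * br J))"
      proof (rule sum.cong)
        fix J assume "J \<in> Pow ?M"
        then have J: "J \<subseteq> ?M" by simp
        have cJ: "card J \<le> n" using J card_mono[of "{1..n}" J] by simp
        show "branch_kernel n p (dn J r) * (z ^ e (dn J r) * w J (dn J r) * \<beta> J (dn J r)) =
          c * ((- 1) ^ card J * h ^ (card J choose 2) * (branch_kernel n p (dn J r) * hcoef h ?M J (spectral (dn J r))) * br J)"
        proof (cases "dn J r \<in> interlacing n p")
          case False
          have "branch_kernel n p (dn J r) = 0"
            by (rule branch_kernel_zero) (use False r J in \<open>auto simp: dn_def Box_def\<close>)
          then show ?thesis by simp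
        next
          case True
          have s: "sum (dn J r) ?M = sum r ?M - int (card J)" using sum_dn[OF J] .
          have le: "sum r ?M - int (card J) \<le> sum p ?N" using part_interlacing(2)[OF p True] unfolding s .
          have be: "\<beta> J (dn J r) = br J / h"
            using eigen_bracket[OF J le] h0 by (simp add: \<beta>_def br_def \<alpha>_def e_def nonzero_eq_divide_eq mult.commute)
          have ex: "e (dn J r) + (n - card J) = nat (sum p ?N - sum r ?M + int n)"
            unfolding e_def s using le cJ by (simp add: nat_add_distrib[symmetric] nat_diff_distrib)
          have sg: "(- 1 :: complex) ^ (n - card J) = (- 1) ^ n * (- 1) ^ card J"
          proof -
            obtain m where m: "n = card J + m" using cJ le_Suc_ex by blast
            have "(- 1 :: complex) ^ card J * (- 1) ^ card J = 1" by (rule minus_one_mult_self)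
            then show ?thesis unfolding m power_add by (simp add: mult_ac)
          qed
          have "z ^ e (dn J r) * (- z) ^ (n - card J) = (- 1) ^ n * (- 1) ^ card J * z ^ nat (sum p ?N - sum r ?M + int n)"
            unfolding ex[symmetric] power_add power_minus[of z] sg by (simp add: mult_ac)
          then show ?thesis unfolding w_def be c_def by (simp add: mult_ac)
        qed
      qed simp
      also have "\<dots> = 0"
        unfolding sum_distrib_left[symmetric] br_def kernel_eigen[OF True] by simp
      finally show ?thesis .
    qed
    then show "(\<Sum>J\<in>Pow ?M. branch_kernel n p (dn J r) * (z ^ e (dn J r) * w J (dn J r) * \<beta> J (dn J r))) * F n r x = 0" by simp
  qed
  finally show ?thesis using D0 by (simp del: F.simps)
qed

end

section \<open>Elementary symmetric functions and rigidity\<close>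

definition esym :: "nat \<Rightarrow> nat set \<Rightarrow> (nat \<Rightarrow> complex) \<Rightarrow> complex" where
  "esym r N x = (\<Sum>J\<in>{J. J \<subseteq> N \<and> card J = r}. \<Prod>i\<in>J. x i)"

lemma esym_0: "finite N \<Longrightarrow> esym 0 N x = 1"
proof -
  assume "finite N"
  then have "{J. J \<subseteq> N \<and> card J = 0} = {{}}" by (auto dest: finite_subset)
  then show ?thesis by (simp add: esym_def)
qed

lemma esym_remove:
  assumes "finite N" "i \<in> N"
  shows "esym (Suc r) N x = esym (Suc r) (N - {i}) x + x i * esym r (N - {i}) x"
proof -
  have fin: "finite {J. J \<subseteq> A \<and> card J = k}" if "finite A" for A :: "nat set" and k
    using that by auto
  have split: "{J. J \<subseteq> N \<and> card J = Suc r} = {J. J \<subseteq> N - {i} \<and> card J = Suc r} \<union> insert i ` {J. J \<subseteq> N - {i} \<and> card J = r}"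
  proof (intro equalityI subsetI)
    fix J assume J: "J \<in> {J. J \<subseteq> N \<and> card J = Suc r}"
    show "J \<in> {J. J \<subseteq> N - {i} \<and> card J = Suc r} \<union> insert i ` {J. J \<subseteq> N - {i} \<and> card J = r}"
    proof (cases "i \<in> J")
      case True
      then have "J = insert i (J - {i})" "J - {i} \<subseteq> N - {i}" "card (J - {i}) = r" using J assms by auto
      then show ?thesis by blast
    next
      case False
      then show ?thesis using J by auto
    qed
  next
    fix J assume "J \<in> {J. J \<subseteq> N - {i} \<and> card J = Suc r} \<union> insert i ` {J. J \<subseteq> N - {i} \<and> card J = r}"
    then show "J \<in> {J. J \<subseteq> N \<and> card J = Suc r}"
    proof
      assume "J \<in> insert i ` {J. J \<subseteq> N - {i} \<and> card J = r}"
      then obtain K where K: "J = insert i K" "K \<subseteq> N - {i}" "card K = r" by auto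
      then have "finite K" "i \<notin> K" using assms finite_subset[of K "N - {i}"] by auto
      then show ?thesis using K assms by auto
    qed auto
  qed
  have inj: "inj_on (insert i) {J. J \<subseteq> N - {i} \<and> card J = r}"
    by (auto simp: inj_on_def)
  have "esym (Suc r) N x = esym (Suc r) (N - {i}) x + (\<Sum>J\<in>insert i ` {J. J \<subseteq> N - {i} \<and> card J = r}. \<Prod>i\<in>J. x i)"
    unfolding esym_def split by (rule sum.union_disjoint) (use assms fin[of "N - {i}"] in auto)
  also have "(\<Sum>J\<in>insert i ` {J. J \<subseteq> N - {i} \<and> card J = r}. \<Prod>i\<in>J. x i) = (\<Sum>J\<in>{J. J \<subseteq> N - {i} \<and> card J = r}. x i * (\<Prod>i\<in>J. x i))"
    unfolding sum.reindex[OF inj] o_def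
  proof (rule sum.cong)
    fix J assume "J \<in> {J. J \<subseteq> N - {i} \<and> card J = r}"
    then have "finite J" "i \<notin> J" using assms finite_subset[of J "N - {i}"] by auto
    then show "(\<Prod>i\<in>insert i J. x i) = x i * (\<Prod>i\<in>J. x i)" by simp
  qed simp
  finally show ?thesis by (simp add: esym_def sum_distrib_left)
qed

lemma esym_cong: "(\<And>i. i \<in> N \<Longrightarrow> x i = y i) \<Longrightarrow> esym r N x = esym r N y"
  unfolding esym_def by (intro sum.cong prod.cong refl) auto

lemma esym_empty: "esym (Suc r) {} x = 0"
proof -
  have "{J. J \<subseteq> {} \<and> card J = Suc r} = ({} :: nat set set)" by auto
  then show ?thesis by (simp add: esym_def)
qed

text \<open>
  Written so that no division by \<open>c\<close> is needed.
\<close>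
lemma coeff_prod_esym:
  assumes "finite N"
  shows "coeff (\<Prod>l\<in>N. [:c, x l:]) r * c ^ r = c ^ card N * esym r N x"
  using assms
proof (induction N arbitrary: r rule: finite_induct)
  case empty
  show ?case by (cases r) (auto simp: esym_0 esym_empty coeff_pCons split: nat.splits)
next
  case (insert a N)
  show ?case
  proof (cases r)
    case 0
    then show ?thesis using insert.IH[of 0] insert.hyps by (simp add: esym_0)
  next
    case (Suc m)
    have "coeff (\<Prod>l\<in>insert a N. [:c, x l:]) r * c ^ r = c * (coeff (\<Prod>l\<in>N. [:c, x l:]) (Suc m) * c ^ Suc m) + c * x a * (coeff (\<Prod>l\<in>N. [:c, x l:]) m * c ^ m)"
      using insert.hyps by (simp add: Suc algebra_simps)
    also have "\<dots> = c ^ card (insert a N) * (esym (Suc m) N x + x a * esym m N x)"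
      unfolding insert.IH using insert.hyps by (simp add: algebra_simps)
    also have "\<dots> = c ^ card (insert a N) * esym r (insert a N) x"
      using esym_remove[of "insert a N" a m x] insert.hyps by (simp add: Suc)
    finally show ?thesis .
  qed
qed

lemma prod_minus_esym:
  fixes x :: "nat \<Rightarrow> complex"
  assumes "finite N"
  shows "(\<Prod>i\<in>N. x i - z) = (\<Sum>J\<in>Pow N. (- z) ^ (card N - card J) * (\<Prod>i\<in>J. x i))"
proof -
  have "(\<Prod>i\<in>N. x i + (- z)) = (\<Sum>B\<in>Pow N. prod x B * prod (\<lambda>_. - z) (N - B))"
    using assms by (rule Groups_Big.prod_add)
  also have "\<dots> = (\<Sum>J\<in>Pow N. (- z) ^ (card N - card J) * (\<Prod>i\<in>J. x i))"
    by (rule sum.cong) (use assms in \<open>auto simp: card_Diff_subset finite_subset mult.commute\<close>)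
  finally show ?thesis by simp
qed

lemma sum_Pow_card:
  fixes f :: "nat set \<Rightarrow> complex"
  assumes "finite N"
  shows "(\<Sum>J\<in>Pow N. f J) = (\<Sum>r\<in>{..card N}. \<Sum>J\<in>{J. J \<subseteq> N \<and> card J = r}. f J)"
proof -
  have "(\<Sum>r\<in>{..card N}. \<Sum>J\<in>{J \<in> Pow N. card J = r}. f J) = (\<Sum>J\<in>Pow N. f J)"
    by (rule sum.group) (use assms in \<open>auto simp: card_mono\<close>)
  then show ?thesis by simp
qed

text \<open>
  Multiply by \<open>v ^ Suc r\<close> and sum over \<open>r\<close>: the left side becomes a polynomial in \<open>v\<close> that agrees at \<open>0\<close>
  and at all \<open>- 1 / x i\<close> with the product of \<open>h + v * x l\<close> minus \<open>h ^ card N\<close> times that of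
  \<open>1 + v * x l\<close>.
\<close>
lemma sum_hcoef_esym:
  assumes fin: "finite N" and inj: "inj_on x N" and nz: "\<And>i. i \<in> N \<Longrightarrow> x i \<noteq> 0" and h: "h \<noteq> 0"
    and r: "Suc r \<le> card N"
  shows "(1 - h) * (\<Sum>i\<in>N. x i * hcoef h N {i} x * esym r (N - {i}) x) = (h ^ (card N - Suc r) - h ^ card N) * esym (Suc r) N x"
proof -
  define A where "A i = hcoef h N {i} x" for i
  define P where "P = pCons 0 (\<Sum>i\<in>N. smult ((1 - h) * (x i * A i)) (\<Prod>l\<in>N - {i}. [:1, x l:]))"
  define R where "R = (\<Prod>l\<in>N. [:h, x l:]) - smult (h ^ card N) (\<Prod>l\<in>N. [:1, x l:])"
  have n0: "card N > 0" using r by simp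
  have dl: "degree (\<Prod>l\<in>K. [:c, x l:]) \<le> card K" if "finite K" for c K
  proof -
    have "degree [:c, x l:] \<le> 1" for l using degree_pCons_le[of c "[:x l:]"] by simp
    then have "(\<Sum>l\<in>K. degree [:c, x l:]) \<le> (\<Sum>l\<in>K. 1)" by (intro sum_mono)
    then show ?thesis using degree_prod_sum_le[OF that, of "\<lambda>l. [:c, x l:]"] by simp
  qed
  have "P = R"
  proof (rule poly_eqI_degree[where A = "insert 0 ((\<lambda>i. - 1 / x i) ` N)"])
    fix v assume "v \<in> insert 0 ((\<lambda>i. - 1 / x i) ` N)"
    then show "poly P v = poly R v"
    proof
      assume "v = 0"
      then show ?thesis by (simp add: P_def R_def poly_prod)
    next
      assume "v \<in> (\<lambda>i. - 1 / x i) ` N"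
      then obtain i where i: "i \<in> N" "v = - 1 / x i" by auto
      have vi: "1 + v * x i = 0" using nz i by simp
      have z: "(\<Prod>l\<in>K. 1 + v * x l) = 0" if "i \<in> K" "finite K" for K
        using vi that by (intro prod_zero) auto
      have "poly P v = v * (\<Sum>j\<in>N. (1 - h) * (x j * A j) * (\<Prod>l\<in>N - {j}. 1 + v * x l))"
        by (simp add: P_def poly_sum poly_prod)
      also have "(\<Sum>j\<in>N. (1 - h) * (x j * A j) * (\<Prod>l\<in>N - {j}. 1 + v * x l)) = (\<Sum>j\<in>{i}. (1 - h) * (x j * A j) * (\<Prod>l\<in>N - {j}. 1 + v * x l))"
        by (rule sum.mono_neutral_right) (use fin i z in auto)
      also have "v * \<dots> = (h - 1) * (A i * (\<Prod>l\<in>N - {i}. 1 + v * x l))"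
        using nz[OF i(1)] by (simp add: i(2) algebra_simps)
      also have "A i * (\<Prod>l\<in>N - {i}. 1 + v * x l) = (\<Prod>l\<in>N - {i}. h + v * x l)"
        unfolding A_def hcoef_single prod.distrib[symmetric]
      proof (rule prod.cong)
        fix l assume l: "l \<in> N - {i}"
        then have d: "x i - x l \<noteq> 0" using inj i by (auto simp: inj_on_def)
        have "1 + v * x l = (x i - x l) / x i" "h + v * x l = (h * x i - x l) / x i"
          using nz[OF i(1)] by (simp_all add: i(2) field_simps)
        then show "(h * x i - x l) / (x i - x l) * (1 + v * x l) = h + v * x l"
          using d by simp
      qed simp
      also have "(h - 1) * (\<Prod>l\<in>N - {i}. h + v * x l) = (\<Prod>l\<in>N. h + v * x l)"
      proof -
        have "h + v * x i = h - 1" using vi by (simp add: algebra_simps eq_neg_iff_add_eq_0)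
        then show ?thesis using fin i by (simp add: prod.remove)
      qed
      also have "\<dots> = poly R v"
        using z[OF i(1) fin] by (simp add: R_def poly_prod)
      finally show ?thesis .
    qed
  next
    have c: "card (insert 0 ((\<lambda>i. - 1 / x i) ` N)) = Suc (card N)"
    proof -
      have "inj_on (\<lambda>i. - 1 / x i) N" using inj nz by (auto simp: inj_on_def field_simps)
      then show ?thesis using fin nz by (subst card_insert_disjoint) (auto simp: card_image)
    qed
    have "degree (\<Sum>i\<in>N. smult ((1 - h) * (x i * A i)) (\<Prod>l\<in>N - {i}. [:1, x l:])) \<le> card N - 1"
    proof (rule degree_sum_le[OF fin])
      fix i assume "i \<in> N"
      then show "degree (smult ((1 - h) * (x i * A i)) (\<Prod>l\<in>N - {i}. [:1, x l:])) \<le> card N - 1"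
        using dl[of "N - {i}" 1] fin by (intro order_trans[OF degree_smult_le]) auto
    qed
    then show "degree P < card (insert 0 ((\<lambda>i. - 1 / x i) ` N))"
      unfolding c P_def using n0 by (intro le_imp_less_Suc order_trans[OF degree_pCons_le]) auto
    show "degree R < card (insert 0 ((\<lambda>i. - 1 / x i) ` N))"
      unfolding c R_def using dl[OF fin] by (intro le_imp_less_Suc degree_diff_le order_trans[OF degree_smult_le]) auto
  qed
  then have "coeff P (Suc r) = coeff R (Suc r)" by simp
  moreover have "coeff P (Suc r) = (1 - h) * (\<Sum>i\<in>N. x i * A i * esym r (N - {i}) x)"
    using coeff_prod_esym[of "N - {_}" 1 x r] fin by (simp add: P_def coeff_sum sum_distrib_left mult.assoc)
  moreover have "coeff R (Suc r) = (h ^ (card N - Suc r) - h ^ card N) * esym (Suc r) N x"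
  proof -
    have "coeff (\<Prod>l\<in>N. [:h, x l:]) (Suc r) * h ^ Suc r = h ^ (card N - Suc r) * h ^ Suc r * esym (Suc r) N x"
    proof -
      have "h ^ card N = h ^ (card N - Suc r) * h ^ Suc r" using r by (metis le_add_diff_inverse2 power_add)
      then show ?thesis using coeff_prod_esym[OF fin, of h x "Suc r"] by (simp only:)
    qed
    then have "coeff (\<Prod>l\<in>N. [:h, x l:]) (Suc r) = h ^ (card N - Suc r) * esym (Suc r) N x"
      using h by simp
    moreover have "coeff (\<Prod>l\<in>N. [:1, x l:]) (Suc r) = esym (Suc r) N x"
      using coeff_prod_esym[OF fin, of 1 x "Suc r"] by simp
    ultimately show ?thesis by (simp add: R_def algebra_simps)
  qed
  ultimately show ?thesis by (simp add: A_def)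
qed

text \<open>
  Vandermonde: replace the powers by a polynomial that vanishes at all \<open>E a\<close> except \<open>E b\<close>.
\<close>
lemma power_sums_zero:
  fixes c E :: "'a \<Rightarrow> complex"
  assumes fin: "finite A" and inj: "inj_on E A" and zero: "\<And>t :: nat. (\<Sum>a\<in>A. c a * E a ^ t) = 0" and b: "b \<in> A"
  shows "c b = 0"
proof -
  have "(\<Sum>a\<in>A. c a * poly p (E a)) = 0" for p
  proof -
    have "(\<Sum>a\<in>A. c a * poly p (E a)) = (\<Sum>i\<le>degree p. coeff p i * (\<Sum>a\<in>A. c a * E a ^ i))"
      unfolding poly_altdef sum_distrib_left by (subst sum.swap) (simp add: mult_ac)
    then show ?thesis using zero by simp
  qed
  from this[of "\<Prod>d\<in>A - {b}. [:- E d, 1:]"] have "0 = (\<Sum>a\<in>A. c a * (\<Prod>d\<in>A - {b}. E a - E d))"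
    by (simp add: poly_prod)
  also have "\<dots> = (\<Sum>a\<in>{b}. c a * (\<Prod>d\<in>A - {b}. E a - E d))"
    by (rule sum.mono_neutral_right) (use fin b in auto)
  finally have "c b * (\<Prod>d\<in>A - {b}. E b - E d) = 0" by simp
  moreover have "(\<Prod>d\<in>A - {b}. E b - E d) \<noteq> 0" using fin inj b by (auto simp: inj_on_def)
  ultimately show ?thesis by simp
qed

definition tsh :: "complex \<Rightarrow> nat set \<Rightarrow> (nat \<Rightarrow> complex) \<Rightarrow> nat \<Rightarrow> complex" where
  "tsh q I x = (\<lambda>i. if i \<in> I then q * x i else x i)"

lemma tsh_single: "tsh q {i} x = x(i := q * x i)"
  by (auto simp: tsh_def)

lemma macdonald_op_tsh:
  "macdonald_op n q h r f x = (\<Sum>I\<in>{I. I \<subseteq> {1..n} \<and> card I = r}. hcoef h {1..n} I x * f (tsh q I x))"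
  by (simp add: macdonald_op_hcoef tsh_def)

lemma macdonald_op_sum:
  "macdonald_op n q h r (\<lambda>x. \<Sum>a\<in>A. c a * f a x) x = (\<Sum>a\<in>A. c a * macdonald_op n q h r (f a) x)"
  unfolding macdonald_op_tsh sum_distrib_left by (subst sum.swap) (simp add: mult_ac)

lemma macdonald_op_diff:
  "macdonald_op n q h r (\<lambda>x. f x - g x) x = macdonald_op n q h r f x - macdonald_op n q h r g x"
  unfolding macdonald_op_tsh by (simp add: algebra_simps sum_subtractf)

lemma macdonald_op_scale:
  "macdonald_op n q h r (\<lambda>x. c * f x) x = c * macdonald_op n q h r f x"
  unfolding macdonald_op_tsh by (simp add: sum_distrib_left mult_ac)

context macdonald_params
begin

lemma up_insert: "j \<notin> I \<Longrightarrow> up {j} (up I p) = up (insert j I) p"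
  and up_commute: "up {j} (up I p) = up I (up {j} p)"
  by (auto simp: up_def fun_eq_iff)

lemma lattice_shift: "shift_lattice q h {1..n} up spectral"
  by unfold_locales (use q0 q1 h0 h1 hq in \<open>auto simp: spectral_up up_insert intro!: up_commute\<close>)

lemma torus_shift: "shift_lattice q h {1..n} (tsh q) (\<lambda>x. x)"
  by unfold_locales (use q0 q1 h0 h1 hq in \<open>auto simp: tsh_def fun_eq_iff\<close>)

lemma q_generic_tsh: "q_generic n x \<Longrightarrow> q_generic n (tsh q I x)"
  unfolding tsh_def by (rule q_generic_shift)

lemma macdonald_op_cong:
  assumes "q_generic n x" "\<And>y. q_generic n y \<Longrightarrow> f y = g y"
  shows "macdonald_op n q h r f x = macdonald_op n q h r g x"
  unfolding macdonald_op_tsh by (intro sum.cong refl) (simp add: assms q_generic_tsh)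

lemma eig_up:
  assumes "J \<subseteq> {1..n}"
  shows "eig n (up J p) = eig n p + (q - 1) / h * (\<Sum>i\<in>J. spectral p i)"
proof -
  have "sum (spectral (up J p)) {1..n} = (\<Sum>i\<in>{1..n}. spectral p i + (if i \<in> J then (q - 1) * spectral p i else 0))"
    by (rule sum.cong) (auto simp: spectral_up algebra_simps)
  also have "\<dots> = sum (spectral p) {1..n} + (q - 1) * (\<Sum>i\<in>J. spectral p i)"
    using assms by (simp add: sum.distrib sum.If_cases Int_absorb1 sum_distrib_left)
  finally show ?thesis by (simp add: eig_def add_divide_distrib)
qed

lemma hcoef_up_nz:
  assumes "part n p" "part n (up {a} p)" "a \<in> {1..n}"
  shows "hcoef h {1..n} {a} (spectral p) \<noteq> 0"
proof -
  have "h * spectral p a - spectral p j \<noteq> 0" "spectral p a - spectral p j \<noteq> 0" if j: "j \<in> {1..n} - {a}" for j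
  proof -
    show "spectral p a - spectral p j \<noteq> 0" using j by (auto simp: spectral_eq)
    show "h * spectral p a - spectral p j \<noteq> 0"
    proof
      assume "h * spectral p a - spectral p j = 0"
      then have "spectral p j = h * spectral p a" by simp
      then have "p j = p a" "j = Suc a" by (auto simp: spectral_eq_h)
      then have "a \<in> {1..<n}" "up {a} p a > up {a} p (Suc a)" using j assms by (auto simp: up_def)
      then show False using assms(2) unfolding part_def by (meson not_le)
    qed
  qed
  then show ?thesis unfolding hcoef_single by simp
qed

text \<open>
  Induction on the number of boxes.  If \<open>p\<close> arises from \<open>p'\<close> by adding a box, then \<open>z p' = 0\<close>, so the
  right side of the Pieri rule at \<open>p'\<close> vanishes.  Applying powers of \<open>T\<^sub>1\<close> shows that it still vanishes
  with each summand multiplied by powers of its eigenvalue.  These eigenvalues are distinct, hence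
  every summand is zero.
\<close>
lemma rigidity:
  fixes z :: "(nat \<Rightarrow> int) \<Rightarrow> (nat \<Rightarrow> complex) \<Rightarrow> complex"
  assumes Pieri: "\<And>p x. part n p \<Longrightarrow> q_generic n x \<Longrightarrow> sum x {1..n} * z p x = (\<Sum>a\<in>{1..n}. hcoef h {1..n} {a} (spectral p) * z (up {a} p) x)"
    and eigen: "\<And>p x. part n p \<Longrightarrow> q_generic n x \<Longrightarrow> macdonald_op n q h 1 (z p) x = eig n p * z p x"
    and init: "\<And>x. q_generic n x \<Longrightarrow> z (\<lambda>_. 0) x = 0"
    and "part n p" "q_generic n x"
  shows "z p x = 0"
  using assms(4,5)
proof (induction "nat (sum p {1..n})" arbitrary: p x rule: less_induct)
  case less
  note p = less.prems(1)
  show ?case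
  proof (cases "\<exists>i\<in>{1..n}. p i \<noteq> 0")
    case False
    then have "p = (\<lambda>_. 0)" using p by (auto simp: part_def fun_eq_iff)
    then show ?thesis using init less.prems by simp
  next
    case True
    \<comment> \<open>A box can be removed at the first nonzero part.\<close>
    define a where "a = (LEAST i. i \<in> {1..n} \<and> p i \<noteq> 0)"
    have "a \<in> {1..n} \<and> p a \<noteq> 0" unfolding a_def by (rule LeastI_ex) (use True in blast)
    then have a: "a \<in> {1..n}" "p a \<noteq> 0" by auto
    have lt: "p i = 0" if "i \<in> {1..n}" "i < a" for i
      using not_less_Least[of i "\<lambda>i. i \<in> {1..n} \<and> p i \<noteq> 0"] that by (auto simp: a_def)
    have pa: "p a > 0" using a p by (force simp: part_def)
    define p' where "p' = dn {a} p"
    have up: "up {a} p' = p" by (simp add: p'_def)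
    have p': "part n p'"
      unfolding part_def
    proof (intro conjI ballI allI impI)
      fix i assume i: "i \<in> {1..<n}"
      have "p i \<le> p (Suc i)" using p i by (auto simp: part_def)
      then show "p' i \<le> p' (Suc i)" using lt[of i] i pa by (auto simp: p'_def dn_def)
    next
      fix i assume "i \<in> {1..n}"
      then have "0 \<le> p i" using p by (auto simp: part_def)
      then show "0 \<le> p' i" using pa by (auto simp: p'_def dn_def)
    next
      fix i assume "i \<notin> {1..n}"
      then show "p' i = 0" using p a by (auto simp: part_def p'_def dn_def)
    qed
    have s: "sum p {1..n} = sum p' {1..n} + 1" using sum_up[OF a(1), of p'] up by simp
    have "0 \<le> sum p' {1..n}" using p' by (intro sum_nonneg) (auto simp: part_def)
    then have IH: "z p' y = 0" if "q_generic n y" for y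
      using less.hyps[of p' y] p' that s by simp
    have pow: "(\<Sum>b\<in>{1..n}. (hcoef h {1..n} {b} (spectral p') * z (up {b} p') y) * eig n (up {b} p') ^ t) = 0" if "q_generic n y" for t y
      using that
    proof (induction t arbitrary: y)
      case 0
      then show ?case using Pieri[OF p' 0] IH by simp
    next
      case (Suc t)
      have "(\<Sum>b\<in>{1..n}. (hcoef h {1..n} {b} (spectral p') * z (up {b} p') y) * eig n (up {b} p') ^ Suc t) =
         (\<Sum>b\<in>{1..n}. (hcoef h {1..n} {b} (spectral p') * eig n (up {b} p') ^ t) * macdonald_op n q h 1 (z (up {b} p')) y)"
      proof (rule sum.cong)
        fix b assume "b \<in> {1..n}"
        show "(hcoef h {1..n} {b} (spectral p') * z (up {b} p') y) * eig n (up {b} p') ^ Suc t =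
          (hcoef h {1..n} {b} (spectral p') * eig n (up {b} p') ^ t) * macdonald_op n q h 1 (z (up {b} p')) y"
        proof (cases "part n (up {b} p')")
          case True
          then show ?thesis by (simp only: eigen[OF True Suc.prems] power_Suc mult_ac)
        next
          case False
          then show ?thesis using hcoef_nonpart[OF p'] \<open>b \<in> {1..n}\<close> by simp
        qed
      qed simp
      also have "\<dots> = macdonald_op n q h 1 (\<lambda>y. \<Sum>b\<in>{1..n}. (hcoef h {1..n} {b} (spectral p') * eig n (up {b} p') ^ t) * z (up {b} p') y) y"
        by (rule macdonald_op_sum[symmetric])
      also have "\<dots> = macdonald_op n q h 1 (\<lambda>y. 0) y"
        by (rule macdonald_op_cong[OF Suc.prems]) (use Suc.IH in \<open>simp add: mult_ac\<close>)
      also have "\<dots> = 0" by (simp add: macdonald_op_def)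
      finally show ?case .
    qed
    have injE: "inj_on (\<lambda>b. eig n (up {b} p')) {1..n}"
    proof (rule inj_onI)
      fix b c assume bc: "b \<in> {1..n}" "c \<in> {1..n}" "eig n (up {b} p') = eig n (up {c} p')"
      then have "(q - 1) / h * spectral p' b = (q - 1) / h * spectral p' c" using eig_up[of "{b}" n p'] eig_up[of "{c}" n p'] by simp
      then have "spectral p' b = spectral p' c" using q1 h0 by simp
      then show "b = c" by (simp add: spectral_eq)
    qed
    have "hcoef h {1..n} {a} (spectral p') * z (up {a} p') x = 0"
      by (rule power_sums_zero[where c = "\<lambda>b. hcoef h {1..n} {b} (spectral p') * z (up {b} p') x" and A = "{1..n}", OF _ injE]) (use pow less.prems a in auto)
    moreover have "hcoef h {1..n} {a} (spectral p') \<noteq> 0"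
      by (rule hcoef_up_nz[OF p']) (use up p a in auto)
    ultimately show ?thesis using up by simp
  qed
qed

lemma F_zero_const: "\<exists>c. \<forall>x. F n (\<lambda>_. 0) x = c"
proof (induction n)
  case (Suc n)
  then obtain c where c: "\<And>x. F n (\<lambda>_. 0) x = c" by blast
  have "interlacing n (\<lambda>_. 0) = {\<lambda>_. 0}"
  proof (intro equalityI subsetI)
    fix r assume r: "r \<in> interlacing n (\<lambda>_. 0)"
    have "r i = 0" for i using r by (cases "i \<in> {1..n}") (auto simp: interlacing_def intro: antisym)
    then show "r \<in> {\<lambda>_. 0}" by (simp add: fun_eq_iff)
  qed (simp add: interlacing_def)
  then show ?case
    by (intro exI[of _ "branch_norm (Suc n) (\<lambda>_. 0) * (branch_kernel n (\<lambda>_. 0) (\<lambda>_. 0) * c)"]) (simp add: c)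
qed auto

lemma part_zero: "part n (\<lambda>_. 0)"
  by (auto simp: part_def)

context
  fixes n :: nat
begin

interpretation lat: shift_lattice q h "{1..n}" up spectral
  by (rule lattice_shift)

interpretation tor: shift_lattice q h "{1..n}" "tsh q" "\<lambda>x. x"
  by (rule torus_shift)

lemma lat_nondeg: "lat.nondeg p"
  unfolding lat.nondeg_def by (auto simp: spectral_inj spectral_eq_q)

lemma tor_nondeg: "q_generic n x \<Longrightarrow> tor.nondeg x"
  unfolding tor.nondeg_def
proof (intro conjI ballI)
  fix i j assume x: "q_generic n x" and ij: "i \<in> {1..n}" "j \<in> {1..n}"
  show "x i \<noteq> q * x j"
  proof (cases "i = j")
    case True
    then show ?thesis using q_generic_nz[OF x ij(1)] q1 by simp
  next
    case False
    then have "q ^ 0 * x i \<noteq> q ^ 1 * x j" using x ij unfolding q_generic_def by blast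
    then show ?thesis by simp
  qed
next
  show "inj_on x {1..n}" if "q_generic n x" using q_generic_inj[OF that] .
qed (rule q_generic_nz)

lemma lat_D_cong:
  assumes "part n p" "\<And>p'. part n p' \<Longrightarrow> f p' = g p'"
  shows "lat.D r f p = lat.D r g p"
  unfolding lat.D_def
proof (intro sum.cong refl)
  fix I assume "I \<in> {I. I \<subseteq> {1..n} \<and> card I = r}"
  then show "hcoef h {1..n} I (spectral p) * f (up I p) = hcoef h {1..n} I (spectral p) * g (up I p)"
    using assms hcoef_nonpart[of n p I] by (cases "part n (up I p)") auto
qed

lemma lat_Dw_cong:
  assumes "part n p" "\<And>p'. part n p' \<Longrightarrow> f p' = g p'"
  shows "lat.Dw r f p = lat.Dw r g p"
  unfolding lat.Dw_def
proof (intro sum.cong refl)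
  fix I assume "I \<in> {I. I \<subseteq> {1..n} \<and> card I = r}"
  then show "hcoef h {1..n} I (spectral p) * (\<Sum>i\<in>I. spectral p i) * f (up I p) = hcoef h {1..n} I (spectral p) * (\<Sum>i\<in>I. spectral p i) * g (up I p)"
    using assms hcoef_nonpart[of n p I] by (cases "part n (up I p)") auto
qed

lemma lat_D_scale: "lat.D r (\<lambda>p. c * f p) p = c * lat.D r f p"
  and lat_Dw_scale: "lat.Dw r (\<lambda>p. c * f p) p = c * lat.Dw r f p"
  unfolding lat.D_def lat.Dw_def by (simp_all add: sum_distrib_left mult_ac)

lemma lat_D_diff: "lat.D r (\<lambda>p. f p - g p) p = lat.D r f p - lat.D r g p"
  unfolding lat.D_def by (simp add: sum_subtractf algebra_simps)

lemma op_lat_D: "macdonald_op n q h k (\<lambda>x. lat.D r (\<lambda>p. G p x) p) x = lat.D r (\<lambda>p. macdonald_op n q h k (G p) x) p"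
  unfolding lat.D_def by (rule macdonald_op_sum)

lemma op_tor_D: "macdonald_op n q h r f x = tor.D r f x"
  unfolding macdonald_op_tsh tor.D_def ..

lemma F_Pieri1_D: "part n p \<Longrightarrow> sum x {1..n} * F n p x = lat.D 1 (\<lambda>p. F n p x) p"
  unfolding lat.D_1 by (rule F_Pieri1)

lemma Pieri_form: "(\<Sum>a\<in>{1..n}. hcoef h {1..n} {a} (spectral p) * z (up {a} p) x) = lat.D 1 (\<lambda>p. z p x) p"
  unfolding lat.D_1 ..

lemma lat_D_eig: "lat.D r (\<lambda>p'. eig n p' * f p') p = eig n p * lat.D r f p + (q - 1) / h * lat.Dw r f p"
  unfolding lat.D_def lat.Dw_def sum_distrib_left[of "eig n p"] sum_distrib_left[of "(q - 1) / h"] sum.distrib[symmetric]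
proof (intro sum.cong refl)
  fix I assume "I \<in> {I. I \<subseteq> {1..n} \<and> card I = r}"
  then have e: "eig n (up I p) = eig n p + (q - 1) / h * (\<Sum>i\<in>I. spectral p i)" by (intro eig_up) auto
  show "hcoef h {1..n} I (spectral p) * (eig n (up I p) * f (up I p)) =
    eig n p * (hcoef h {1..n} I (spectral p) * f (up I p)) + (q - 1) / h * (hcoef h {1..n} I (spectral p) * (\<Sum>i\<in>I. spectral p i) * f (up I p))"
    unfolding e by (simp only: distrib_left distrib_right mult_ac)
qed

text \<open>
  An elementary symmetric function has degree one in each variable.  For this reason the commutator of
  \<open>T\<^sub>1\<close> with \<open>e\<close> of order \<open>Suc r\<close> is determined by the one with \<open>e\<close> of order \<open>1\<close>, before and after
  multiplication by \<open>e\<close> of order \<open>r\<close>; compare \<open>D_Dw_commutator\<close>.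
\<close>
lemma esym_commutator:
  "(1 - q) * (macdonald_op n q h 1 (\<lambda>x. esym (Suc r) {1..n} x * f x) x - esym (Suc r) {1..n} x * macdonald_op n q h 1 f x) =
   macdonald_op n q h 1 (\<lambda>x. sum x {1..n} * (esym r {1..n} x * f x)) x - sum x {1..n} * macdonald_op n q h 1 (\<lambda>x. esym r {1..n} x * f x) x
   - q * esym r {1..n} x * (macdonald_op n q h 1 (\<lambda>x. sum x {1..n} * f x) x - sum x {1..n} * macdonald_op n q h 1 f x)"
proof -
  let ?N = "{1..n}"
  let ?x = "\<lambda>i. x(i := q * x i)"
  have key: "(1 - q) * (esym (Suc r) ?N (?x i) - esym (Suc r) ?N x) = sum (?x i) ?N * esym r ?N (?x i) - sum x ?N * esym r ?N (?x i)
     - q * esym r ?N x * (sum (?x i) ?N - sum x ?N)" if i: "i \<in> ?N" for i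
  proof -
    have c: "esym k (?N - {i}) (?x i) = esym k (?N - {i}) x" for k by (rule esym_cong) auto
    have s: "sum (?x i) ?N = sum x ?N + (q - 1) * x i"
      using sum.remove[of ?N i "?x i"] sum.remove[of ?N i x] i by (simp add: algebra_simps)
    show ?thesis
    proof (cases r)
      case 0
      then show ?thesis using esym_remove[of ?N i 0 "?x i"] esym_remove[of ?N i 0 x] i unfolding c s by (simp add: esym_0 algebra_simps)
    next
      case (Suc m)
      show ?thesis using esym_remove[of ?N i r "?x i"] esym_remove[of ?N i r x] esym_remove[of ?N i m "?x i"] esym_remove[of ?N i m x] i
        unfolding c s Suc by (simp add: algebra_simps)
    qed
  qed
  have "(1 - q) * (macdonald_op n q h 1 (\<lambda>x. esym (Suc r) ?N x * f x) x - esym (Suc r) ?N x * macdonald_op n q h 1 f x) =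
    (\<Sum>i\<in>?N. hcoef h ?N {i} x * f (?x i) * ((1 - q) * (esym (Suc r) ?N (?x i) - esym (Suc r) ?N x)))"
    unfolding macdonald_op_1 sum_distrib_left sum_subtractf[symmetric] by (intro sum.cong refl) (simp only: algebra_simps)
  also have "\<dots> = (\<Sum>i\<in>?N. hcoef h ?N {i} x * f (?x i) * (sum (?x i) ?N * esym r ?N (?x i) - sum x ?N * esym r ?N (?x i)
     - q * esym r ?N x * (sum (?x i) ?N - sum x ?N)))"
    by (intro sum.cong refl arg_cong2[of _ _ _ _ "(*)"] key)
  also have "\<dots> = macdonald_op n q h 1 (\<lambda>x. sum x {1..n} * (esym r {1..n} x * f x)) x - sum x {1..n} * macdonald_op n q h 1 (\<lambda>x. esym r {1..n} x * f x) x
   - q * esym r {1..n} x * (macdonald_op n q h 1 (\<lambda>x. sum x {1..n} * f x) x - sum x {1..n} * macdonald_op n q h 1 f x)"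
  proof -
    define S where "S = sum x {1..n}"
    define E where "E = esym r {1..n} x"
    define S' where "S' i = sum (?x i) {1..n}" for i
    show ?thesis
      unfolding macdonald_op_1 S_def[symmetric] E_def[symmetric] S'_def[symmetric]
      by (simp add: sum_distrib_left sum_subtractf sum.distrib algebra_simps)
  qed
  finally show ?thesis .
qed

text \<open>
  Describes the sets of boxes that can be added to the empty partition.
\<close>
lemma top_subset:
  assumes "J \<subseteq> {1..n}" "\<And>i. i \<in> J \<Longrightarrow> i < n \<Longrightarrow> Suc i \<in> J"
  shows "J = {Suc n - card J..n}"
proof (cases "J = {}")
  case False
  have fJ: "finite J" using assms finite_subset by auto
  define a where "a = Min J"
  have a: "a \<in> J" "\<And>i. i \<in> J \<Longrightarrow> a \<le> i" using fJ False by (auto simp: a_def)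
  have "i \<in> J" if "a \<le> i" "i \<le> n" for i
    using that by (induction rule: dec_induct) (use a assms in auto)
  then have J: "J = {a..n}" using a assms by fastforce
  moreover have "a \<le> n" using a assms by auto
  ultimately have "card J = Suc n - a" by simp
  then have "Suc n - card J = a" using \<open>a \<le> n\<close> by simp
  then show ?thesis using J by simp
qed simp

text \<open>
  This is the eigenvalue of a single column of \<open>Suc r\<close> boxes; it starts the induction on \<open>p\<close> in
  \<open>F_Pieri_D\<close>.
\<close>
lemma T_esym:
  assumes x: "q_generic n x" and r: "Suc r \<le> n"
  shows "macdonald_op n q h 1 (esym (Suc r) {1..n}) x = eig n (up {n - r..n} (\<lambda>_. 0)) * esym (Suc r) {1..n} x"
proof -
  let ?N = "{1..n}"
  have inj: "inj_on x ?N" and nz: "\<And>i. i \<in> ?N \<Longrightarrow> x i \<noteq> 0" using q_generic_inj[OF x] q_generic_nz[OF x] by auto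
  have sub: "{n - r..n} \<subseteq> ?N" using r by auto
  have e0: "(h - 1) * eig n (\<lambda>_. 0) = h ^ n - 1"
  proof -
    have "sum (spectral (\<lambda>_. 0)) ?N = h * (\<Sum>i<n. h ^ i)"
      by (simp add: spectral_def sum_distrib_left sum.atLeast1_atMost_eq)
    then show ?thesis using h0 h1 by (simp add: eig_def geometric_sum)
  qed
  have e1: "(h - 1) * (\<Sum>i\<in>{n - r..n}. spectral (\<lambda>_. 0) i / h) = h ^ n - h ^ (n - Suc r)"
  proof -
    have "(\<Sum>i\<in>{n - r..n}. spectral (\<lambda>_. 0) i / h) = (\<Sum>i\<in>{n - Suc r..<n}. h ^ i)"
    proof (rule sum.reindex_bij_witness[of _ Suc "\<lambda>i. i - 1"])
      fix i assume "i \<in> {n - r..n}"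
      then have "i \<ge> 1" using r by (simp, arith)
      then show "h ^ (i - 1) = spectral (\<lambda>_. 0) i / h" using h0 by (simp add: spectral_def power_diff)
    qed (use r in auto)
    also have "(h - 1) * (\<Sum>i\<in>{n - Suc r..<n}. h ^ i) = (\<Sum>i\<in>{n - Suc r..<n}. h ^ Suc i - h ^ i)"
      unfolding sum_distrib_left by (intro sum.cong refl) (simp add: algebra_simps)
    also have "\<dots> = h ^ n - h ^ (n - Suc r)"
      by (rule sum_Suc_diff') simp
    finally show ?thesis .
  qed
  have e2: "(h - 1) * eig n (up {n - r..n} (\<lambda>_. 0)) = h ^ n - 1 + (q - 1) * (h ^ n - h ^ (n - Suc r))"
  proof -
    have "(h - 1) * eig n (up {n - r..n} (\<lambda>_. 0)) = (h - 1) * eig n (\<lambda>_. 0) + (q - 1) * ((h - 1) * (\<Sum>i\<in>{n - r..n}. spectral (\<lambda>_. 0) i / h))"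
    proof -
      have "(h - 1) * (e + (q - 1) / h * X) = (h - 1) * e + (q - 1) * ((h - 1) * (X / h))" for e X
        by (simp add: distrib_left)
      then show ?thesis unfolding eig_up[OF sub] sum_divide_distrib[symmetric] .
    qed
    then show ?thesis unfolding e0 e1 .
  qed
  have A: "(h - 1) * (\<Sum>i\<in>?N. hcoef h ?N {i} x) = h ^ n - 1"
    using sum_hcoef_single[of ?N x h] inj nz by simp
  have B: "(h - 1) * (\<Sum>i\<in>?N. x i * hcoef h ?N {i} x * esym r (?N - {i}) x) = (h ^ n - h ^ (n - Suc r)) * esym (Suc r) ?N x"
    using sum_hcoef_esym[of ?N x h r] inj nz h0 r by (simp add: algebra_simps)
  have "macdonald_op n q h 1 (esym (Suc r) ?N) x = (\<Sum>i\<in>?N. hcoef h ?N {i} x * (esym (Suc r) ?N x + (q - 1) * (x i * esym r (?N - {i}) x)))"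
    unfolding macdonald_op_1
  proof (intro sum.cong refl arg_cong2[of _ _ _ _ "(*)"])
    fix i assume i: "i \<in> ?N"
    have c: "esym k (?N - {i}) (x(i := q * x i)) = esym k (?N - {i}) x" for k by (rule esym_cong) auto
    show "esym (Suc r) ?N (x(i := q * x i)) = esym (Suc r) ?N x + (q - 1) * (x i * esym r (?N - {i}) x)"
      using esym_remove[of ?N i r "x(i := q * x i)"] esym_remove[of ?N i r x] i unfolding c by (simp add: algebra_simps)
  qed
  also have "\<dots> = (\<Sum>i\<in>?N. hcoef h ?N {i} x) * esym (Suc r) ?N x + (q - 1) * (\<Sum>i\<in>?N. x i * hcoef h ?N {i} x * esym r (?N - {i}) x)"
    unfolding sum_distrib_left sum_distrib_right sum.distrib[symmetric] by (intro sum.cong refl) (simp only: algebra_simps)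
  finally have "(h - 1) * macdonald_op n q h 1 (esym (Suc r) ?N) x = ((h - 1) * (\<Sum>i\<in>?N. hcoef h ?N {i} x)) * esym (Suc r) ?N x + (q - 1) * ((h - 1) * (\<Sum>i\<in>?N. x i * hcoef h ?N {i} x * esym r (?N - {i}) x))"
    by (simp only: distrib_left mult.assoc mult.left_commute)
  also have "\<dots> = (h - 1) * (eig n (up {n - r..n} (\<lambda>_. 0)) * esym (Suc r) ?N x)"
    unfolding A B mult.assoc[symmetric] e2 by (simp add: algebra_simps)
  finally show ?thesis using h1 by simp
qed

end

section \<open>Pieri rules and eigenvalue equations\<close>

text \<open>
  The equation \<open>T\<close> becomes available only within the induction on \<open>n\<close>, see \<open>F_eigen1\<close>.
\<close>
context
  fixes n :: nat
  assumes T: "\<And>p x. part n p \<Longrightarrow> q_generic n x \<Longrightarrow> macdonald_op n q h 1 (F n p) x = eig n p * F n p x"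
begin

interpretation lat: shift_lattice q h "{1..n}" up spectral
  by (rule lattice_shift)

interpretation tor: shift_lattice q h "{1..n}" "tsh q" "\<lambda>x. x"
  by (rule torus_shift)

text \<open>
  Induction on \<open>r\<close>; the difference \<open>z\<close> of the two sides satisfies the hypotheses of \<open>rigidity\<close>.  The
  rule for \<open>e\<^sub>1\<close> holds as \<open>lat.D (Suc r)\<close> and \<open>lat.D 1\<close> commute.  For the eigenvalue equation,
  \<open>esym_commutator\<close> computes the action of \<open>T\<^sub>1\<close> on the first term of \<open>z\<close> by operators of order \<open>r\<close>, and
  \<open>D_Dw_commutator\<close> on the lattice shows that the second term has the same defect.
\<close>
lemma F_Pieri_D:
  assumes "part n p" "q_generic n x"
  shows "esym r {1..n} x * F n p x = h ^ (r choose 2) * lat.D r (\<lambda>p. F n p x) p"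
  using assms
proof (induction r arbitrary: p x)
  case 0
  have "{I. I \<subseteq> {1..n} \<and> card I = 0} = {{}}" by (auto dest: finite_subset[OF _ finite_atLeastAtMost])
  then show ?case unfolding lat.D_def by (simp add: esym_0 hcoef_def binomial_eq_0)
next
  case (Suc r)
  let ?N = "{1..n}"
  define \<eta> where "\<eta> k = h ^ (k choose 2)" for k
  have \<eta>: "\<eta> (Suc r) = \<eta> r * h ^ r"
    by (simp add: \<eta>_def numeral_2_eq_2 power_add mult.commute)
  define z where "z p x = esym (Suc r) ?N x * F n p x - \<eta> (Suc r) * lat.D (Suc r) (\<lambda>p. F n p x) p" for p x
  have IH: "esym r ?N y * F n p' y = \<eta> r * lat.D r (\<lambda>p. F n p y) p'" if "part n p'" "q_generic n y" for p' y
    using Suc.IH[OF that] by (simp add: \<eta>_def)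
  have TD: "macdonald_op n q h 1 (\<lambda>y. lat.D k (\<lambda>p. F n p y) p') y =
       eig n p' * lat.D k (\<lambda>p. F n p y) p' + (q - 1) / h * lat.Dw k (\<lambda>p. F n p y) p'" if "part n p'" "q_generic n y" for k p' y
  proof -
    have "macdonald_op n q h 1 (\<lambda>y. lat.D k (\<lambda>p. F n p y) p') y = lat.D k (\<lambda>p. macdonald_op n q h 1 (F n p) y) p'"
      by (rule op_lat_D)
    also have "\<dots> = lat.D k (\<lambda>p. eig n p * F n p y) p'"
      by (rule lat_D_cong[OF that(1)]) (use T that in auto)
    finally show ?thesis unfolding lat_D_eig .
  qed
  have eigen: "macdonald_op n q h 1 (z p) y = eig n p * z p y" if p: "part n p" and y: "q_generic n y" for p y
  proof -
    define G where "G p = F n p y" for p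
    define c where "c = (q - 1) / h"
    have c: "c \<noteq> 0" using q1 h0 by (simp add: c_def)
    have D1: "macdonald_op n q h 1 (\<lambda>x. sum x ?N * F n p' x) y - sum y ?N * macdonald_op n q h 1 (F n p') y = c * lat.Dw 1 G p'" if p': "part n p'" for p'
    proof -
      have "macdonald_op n q h 1 (\<lambda>x. sum x ?N * F n p' x) y = macdonald_op n q h 1 (\<lambda>x. lat.D 1 (\<lambda>p. F n p x) p') y"
        by (rule macdonald_op_cong[OF y]) (rule F_Pieri1_D[OF p'])
      then show ?thesis unfolding TD[OF p' y] T[OF p' y]
        using F_Pieri1_D[OF p', of y] by (simp add: G_def[symmetric] c_def[symmetric] algebra_simps)
    qed
    have A: "macdonald_op n q h 1 (\<lambda>x. sum x ?N * (esym r ?N x * F n p x)) y - sum y ?N * macdonald_op n q h 1 (\<lambda>x. esym r ?N x * F n p x) y =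
       \<eta> r * (c * lat.D r (lat.Dw 1 G) p)"
    proof -
      have e1: "macdonald_op n q h 1 (\<lambda>x. sum x ?N * (esym r ?N x * F n p x)) y =
         \<eta> r * lat.D r (\<lambda>p'. macdonald_op n q h 1 (\<lambda>x. sum x ?N * F n p' x) y) p"
      proof -
        have "macdonald_op n q h 1 (\<lambda>x. sum x ?N * (esym r ?N x * F n p x)) y =
          macdonald_op n q h 1 (\<lambda>x. \<eta> r * lat.D r (\<lambda>p'. sum x ?N * F n p' x) p) y"
          by (rule macdonald_op_cong[OF y]) (simp only: IH[OF p] lat_D_scale mult.left_commute)
        then show ?thesis unfolding macdonald_op_scale op_lat_D .
      qed
      have e2: "macdonald_op n q h 1 (\<lambda>x. esym r ?N x * F n p x) y = \<eta> r * lat.D r (\<lambda>p'. macdonald_op n q h 1 (F n p') y) p"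
      proof -
        have "macdonald_op n q h 1 (\<lambda>x. esym r ?N x * F n p x) y = macdonald_op n q h 1 (\<lambda>x. \<eta> r * lat.D r (\<lambda>p'. F n p' x) p) y"
          by (rule macdonald_op_cong[OF y]) (simp only: IH[OF p])
        then show ?thesis unfolding macdonald_op_scale op_lat_D .
      qed
      have "macdonald_op n q h 1 (\<lambda>x. sum x ?N * (esym r ?N x * F n p x)) y - sum y ?N * macdonald_op n q h 1 (\<lambda>x. esym r ?N x * F n p x) y =
        \<eta> r * lat.D r (\<lambda>p'. macdonald_op n q h 1 (\<lambda>x. sum x ?N * F n p' x) y - sum y ?N * macdonald_op n q h 1 (F n p') y) p"
        unfolding e1 e2 lat_D_diff lat_D_scale by (simp only: right_diff_distrib mult.left_commute)
      also have "lat.D r (\<lambda>p'. macdonald_op n q h 1 (\<lambda>x. sum x ?N * F n p' x) y - sum y ?N * macdonald_op n q h 1 (F n p') y) p =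
         lat.D r (\<lambda>p'. c * lat.Dw 1 G p') p"
        by (rule lat_D_cong[OF p D1])
      finally show ?thesis unfolding lat_D_scale .
    qed
    have B: "esym r ?N y * (c * lat.Dw 1 G p) = \<eta> r * (c * lat.Dw 1 (lat.D r G) p)"
    proof -
      have "esym r ?N y * lat.Dw 1 G p = lat.Dw 1 (\<lambda>p'. esym r ?N y * G p') p" by (rule lat_Dw_scale[symmetric])
      also have "\<dots> = lat.Dw 1 (\<lambda>p'. \<eta> r * lat.D r G p') p"
        by (rule lat_Dw_cong[OF p]) (use IH y in \<open>simp add: G_def[abs_def]\<close>)
      also have "\<dots> = \<eta> r * lat.Dw 1 (lat.D r G) p" by (rule lat_Dw_scale)
      finally show ?thesis by simp
    qed
    have "(1 - q) * (macdonald_op n q h 1 (\<lambda>x. esym (Suc r) ?N x * F n p x) y - esym (Suc r) ?N y * macdonald_op n q h 1 (F n p) y) =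
       \<eta> r * (c * lat.D r (lat.Dw 1 G) p) - q * (\<eta> r * (c * lat.Dw 1 (lat.D r G) p))"
      unfolding esym_commutator A D1[OF p] B[symmetric] by (simp only: mult.assoc)
    also have "\<dots> = \<eta> r * c * (lat.D r (lat.Dw 1 G) p - q * lat.Dw 1 (lat.D r G) p)"
      by (simp only: right_diff_distrib mult_ac)
    also have "\<dots> = (1 - q) * (\<eta> (Suc r) * (c * lat.Dw (Suc r) G p))"
      unfolding lat.D_Dw_commutator[OF lat_nondeg] \<eta> by (simp only: mult_ac)
    finally have e: "macdonald_op n q h 1 (\<lambda>x. esym (Suc r) ?N x * F n p x) y = eig n p * (esym (Suc r) ?N y * F n p y) + \<eta> (Suc r) * (c * lat.Dw (Suc r) G p)"
    proof -
      assume "(1 - q) * (macdonald_op n q h 1 (\<lambda>x. esym (Suc r) ?N x * F n p x) y - esym (Suc r) ?N y * macdonald_op n q h 1 (F n p) y) = (1 - q) * (\<eta> (Suc r) * (c * lat.Dw (Suc r) G p))"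
      then have "macdonald_op n q h 1 (\<lambda>x. esym (Suc r) ?N x * F n p x) y - esym (Suc r) ?N y * macdonald_op n q h 1 (F n p) y = \<eta> (Suc r) * (c * lat.Dw (Suc r) G p)"
        using q1 by (subst (asm) mult_left_cancel) auto
      then show ?thesis unfolding T[OF p y] by (simp only: diff_eq_eq add.commute mult.left_commute)
    qed
    show ?thesis
      unfolding z_def macdonald_op_diff macdonald_op_scale e TD[OF p y] c_def[symmetric] G_def[symmetric] by (simp add: algebra_simps)
  qed
  have Pieri: "sum y ?N * z p y = (\<Sum>a\<in>?N. hcoef h ?N {a} (spectral p) * z (up {a} p) y)" if p: "part n p" and y: "q_generic n y" for p y
  proof -
    have "lat.D 1 (\<lambda>p. z p y) p = esym (Suc r) ?N y * lat.D 1 (\<lambda>p. F n p y) p - \<eta> (Suc r) * lat.D 1 (lat.D (Suc r) (\<lambda>p. F n p y)) p"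
      unfolding z_def lat_D_diff lat_D_scale ..
    also have "lat.D 1 (lat.D (Suc r) (\<lambda>p. F n p y)) p = lat.D (Suc r) (lat.D 1 (\<lambda>p. F n p y)) p"
      by (rule lat.D_commute[OF lat_nondeg])
    also have "\<dots> = lat.D (Suc r) (\<lambda>p. sum y ?N * F n p y) p"
      by (rule lat_D_cong[OF p]) (rule F_Pieri1_D[symmetric])
    also have "esym (Suc r) ?N y * lat.D 1 (\<lambda>p. F n p y) p - \<eta> (Suc r) * lat.D (Suc r) (\<lambda>p. sum y ?N * F n p y) p = sum y ?N * z p y"
      unfolding lat_D_scale z_def F_Pieri1_D[OF p, of y, symmetric] by (simp only: right_diff_distrib mult_ac)
    finally show ?thesis unfolding Pieri_form ..
  qed
  \<comment> \<open>At the empty partition, \<open>z\<close> is an eigenfunction of \<open>T\<^sub>1\<close> for two different eigenvalues: that of the empty partition, and that of the only column that can be added.\<close>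
  have init: "z (\<lambda>_. 0) y = 0" if y: "q_generic n y" for y
  proof (cases "Suc r \<le> n")
    case False
    have "card J \<noteq> Suc r" if "J \<subseteq> ?N" for J using card_mono[OF _ that] False by simp
    then have "{J. J \<subseteq> ?N \<and> card J = Suc r} = {}" by blast
    note none = this
    show ?thesis unfolding z_def lat.D_def esym_def none by simp
  next
    case True
    obtain c where c: "\<And>x. F n (\<lambda>_. 0) x = c" using F_zero_const by blast
    let ?K = "{n - r..n}"
    have sub: "?K \<subseteq> ?N" using True by auto
    have "lat.D (Suc r) f (\<lambda>_. 0) = hcoef h ?N ?K (spectral (\<lambda>_. 0)) * f (up ?K (\<lambda>_. 0))" for f
    proof -
      have "lat.D (Suc r) f (\<lambda>_. 0) = (\<Sum>I\<in>{?K}. hcoef h ?N I (spectral (\<lambda>_. 0)) * f (up I (\<lambda>_. 0)))"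
        unfolding lat.D_def
      proof (rule sum.mono_neutral_right)
        show "\<forall>I\<in>{I. I \<subseteq> ?N \<and> card I = Suc r} - {?K}. hcoef h ?N I (spectral (\<lambda>_. 0)) * f (up I (\<lambda>_. 0)) = 0"
        proof
          fix I assume I: "I \<in> {I. I \<subseteq> ?N \<and> card I = Suc r} - {?K}"
          have "\<not> part n (up I (\<lambda>_. 0))"
          proof
            assume pI: "part n (up I (\<lambda>_. 0))"
            have "I = {Suc n - card I..n}"
            proof (rule top_subset)
              fix i assume i: "i \<in> I" "i < n"
              then have "i \<in> {1..<n}" using I by auto
              then have "up I (\<lambda>_. 0) i \<le> up I (\<lambda>_. 0) (Suc i)" using pI by (auto simp: part_def)
              then show "Suc i \<in> I" using i by (auto simp: up_def split: if_splits)
            qed (use I in auto)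
            then show False using I by auto
          qed
          then show "hcoef h ?N I (spectral (\<lambda>_. 0)) * f (up I (\<lambda>_. 0)) = 0" using hcoef_nonpart[OF part_zero] I by simp
        qed
      qed (use sub True in auto)
      then show ?thesis by simp
    qed
    note Dtop = this
    have pK: "part n (up ?K (\<lambda>_. 0))"
      using True by (auto simp: part_def up_def)
    define A where "A = \<eta> (Suc r) * hcoef h ?N ?K (spectral (\<lambda>_. 0))"
    have z0: "z (\<lambda>_. 0) = (\<lambda>y. c * esym (Suc r) ?N y - A * F n (up ?K (\<lambda>_. 0)) y)"
      unfolding z_def Dtop c A_def by (simp add: mult_ac)
    have "macdonald_op n q h 1 (z (\<lambda>_. 0)) y = eig n (up ?K (\<lambda>_. 0)) * z (\<lambda>_. 0) y"
      unfolding z0 macdonald_op_diff macdonald_op_scale T_esym[OF y True] T[OF pK y] by (simp only: right_diff_distrib mult_ac)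
    moreover have "macdonald_op n q h 1 (z (\<lambda>_. 0)) y = eig n (\<lambda>_. 0) * z (\<lambda>_. 0) y"
      by (rule eigen[OF part_zero y])
    moreover have "eig n (up ?K (\<lambda>_. 0)) \<noteq> eig n (\<lambda>_. 0)"
    proof -
      have "(\<Sum>i\<in>?K. spectral (\<lambda>_. 0) i) = h ^ (n - r) * (\<Sum>i<Suc r. h ^ i)"
        unfolding sum_distrib_left
      proof (rule sum.reindex_bij_witness[of _ "\<lambda>i. i + (n - r)" "\<lambda>i. i - (n - r)"])
        fix i assume "i \<in> ?K"
        then have "i = (n - r) + (i - (n - r))" by simp
        then have "h ^ i = h ^ (n - r) * h ^ (i - (n - r))" by (metis power_add)
        then show "h ^ (n - r) * h ^ (i - (n - r)) = spectral (\<lambda>_. 0) i" by (simp add: spectral_def)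
      qed (use True in auto)
      moreover have "(\<Sum>i<Suc r. h ^ i) \<noteq> 0"
        using h1 hpow[of "Suc r"] by (subst geometric_sum) auto
      ultimately show ?thesis unfolding eig_up[OF sub] using q1 h0 by simp
    qed
    ultimately show ?thesis by simp
  qed
  have "z p x = 0"
    by (rule rigidity[OF Pieri eigen init Suc.prems])
  then show ?case by (simp add: z_def \<eta>_def)
qed

lemma F_Pieri_generating:
  assumes "part n p" "q_generic n x"
  shows "(\<Prod>i\<in>{1..n}. x i - z) * F n p x =
     (\<Sum>J\<in>Pow {1..n}. (- z) ^ (n - card J) * h ^ (card J choose 2) * hcoef h {1..n} J (spectral p) * F n (up J p) x)"
proof -
  have "(\<Prod>i\<in>{1..n}. x i - z) * F n p x = (\<Sum>r\<in>{..n}. (- z) ^ (n - r) * (esym r {1..n} x * F n p x))"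
    unfolding prod_minus_esym[OF finite_atLeastAtMost] sum_Pow_card[OF finite_atLeastAtMost] esym_def
    by (simp add: sum_distrib_left sum_distrib_right mult.assoc)
  also have "\<dots> = (\<Sum>r\<in>{..n}. (- z) ^ (n - r) * (h ^ (r choose 2) * lat.D r (\<lambda>p. F n p x) p))"
    using F_Pieri_D[OF assms] by simp
  also have "\<dots> = (\<Sum>J\<in>Pow {1..n}. (- z) ^ (n - card J) * h ^ (card J choose 2) * hcoef h {1..n} J (spectral p) * F n (up J p) x)"
    unfolding sum_Pow_card[OF finite_atLeastAtMost] lat.D_def
    by (simp add: sum_distrib_left mult.assoc)
  finally show ?thesis .
qed

text \<open>
  Induction on \<open>r\<close>, with the roles of variables and partitions exchanged against \<open>F_Pieri_D\<close>: now
  \<open>D_commute\<close> on the torus gives the eigenvalue equation for \<open>T\<^sub>1\<close>, and \<open>D_Dw_commutator\<close> gives the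
  Pieri rule.  The form of the eigenvalue is part of the induction, as the proof compares its values at \<open>p\<close>
  and \<open>up {a} p\<close>.
\<close>
lemma F_eigen_all:
  "\<exists>\<epsilon>. \<forall>p x. part n p \<longrightarrow> q_generic n x \<longrightarrow> macdonald_op n q h r (F n p) x = (\<Sum>k\<le>r. \<epsilon> k * esym k {1..n} (spectral p)) * F n p x"
proof (induction r)
  case 0
  have "{I. I \<subseteq> {1..n} \<and> card I = 0} = {{}}" by (auto dest: finite_subset[OF _ finite_atLeastAtMost])
  then show ?case by (intro exI[of _ "\<lambda>_. 1"]) (simp add: macdonald_op_tsh esym_0 hcoef_def tsh_def)
next
  case (Suc r)
  let ?N = "{1..n}"
  obtain \<epsilon> where \<epsilon>: "\<And>p x. part n p \<Longrightarrow> q_generic n x \<Longrightarrow> macdonald_op n q h r (F n p) x = (\<Sum>k\<le>r. \<epsilon> k * esym k ?N (spectral p)) * F n p x"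
    using Suc by blast
  define E where "E p = (\<Sum>k\<le>r. \<epsilon> k * esym k ?N (spectral p))" for p
  obtain G where G: "\<And>x. q_generic n x \<Longrightarrow> (\<Sum>I\<in>{I. I \<subseteq> ?N \<and> card I = Suc r}. hcoef h ?N I x) = G"
  proof -
    obtain G' where G': "\<forall>N x. finite N \<longrightarrow> inj_on x N \<longrightarrow> (\<forall>i\<in>N. x i \<noteq> 0) \<longrightarrow>
      (\<Sum>I\<in>{I. I \<subseteq> N \<and> card I = Suc r}. hcoef h N I x) = G' (card N)"
      using sum_hcoef_const[of h "Suc r"] hpow by auto
    show ?thesis
    proof (rule that)
      fix x assume "q_generic n x"
      then show "(\<Sum>I\<in>{I. I \<subseteq> ?N \<and> card I = Suc r}. hcoef h ?N I x) = G' (card ?N)"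
        using G'[rule_format, of ?N x] q_generic_inj[of n x] q_generic_nz[of n x] by blast
    qed
  qed
  \<comment> \<open>One factor \<open>h\<close> comes from \<open>eig\<close>, the others from \<open>D_Dw_commutator\<close>.\<close>
  define g where "g = inverse (h ^ Suc r)"
  \<comment> \<open>The constant that makes the eigenvalue correct at the empty partition.\<close>
  define \<kappa> where "\<kappa> = G - (\<Sum>k\<le>r. g * \<epsilon> k * esym (Suc k) ?N (spectral (\<lambda>_. 0)))"
  define E' where "E' p = \<kappa> + (\<Sum>k\<le>r. g * \<epsilon> k * esym (Suc k) ?N (spectral p))" for p
  define z where "z p x = macdonald_op n q h (Suc r) (F n p) x - E' p * F n p x" for p x
  have step: "E (up {a} p) - q * E p = (1 - q) * (\<Sum>k\<le>r. \<epsilon> k * esym k (?N - {a}) (spectral p))"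
    and step': "E' (up {a} p) - E' p = (q - 1) * spectral p a * g * (\<Sum>k\<le>r. \<epsilon> k * esym k (?N - {a}) (spectral p))" if a: "a \<in> ?N" for a p
  proof -
    have c: "esym k (?N - {a}) (spectral (up {a} p)) = esym k (?N - {a}) (spectral p)" for k
      by (rule esym_cong) (auto simp: spectral_up)
    have ua: "spectral (up {a} p) a = q * spectral p a" by (simp add: spectral_up)
    have 1: "esym k ?N (spectral (up {a} p)) - q * esym k ?N (spectral p) = (1 - q) * esym k (?N - {a}) (spectral p)" for k
    proof (cases k)
      case 0
      then show ?thesis by (simp add: esym_0)
    next
      case (Suc m)
      then show ?thesis using esym_remove[of ?N a m "spectral (up {a} p)"] esym_remove[of ?N a m "spectral p"] a
        unfolding c ua by (simp add: algebra_simps)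
    qed
    have 2: "esym (Suc k) ?N (spectral (up {a} p)) - esym (Suc k) ?N (spectral p) = (q - 1) * spectral p a * esym k (?N - {a}) (spectral p)" for k
      using esym_remove[of ?N a k "spectral (up {a} p)"] esym_remove[of ?N a k "spectral p"] a
      unfolding c ua by (simp add: algebra_simps)
    have "E (up {a} p) - q * E p = (\<Sum>k\<le>r. \<epsilon> k * (esym k ?N (spectral (up {a} p)) - q * esym k ?N (spectral p)))"
      unfolding E_def sum_distrib_left sum_subtractf[symmetric] by (intro sum.cong refl) (simp only: right_diff_distrib mult_ac)
    then show "E (up {a} p) - q * E p = (1 - q) * (\<Sum>k\<le>r. \<epsilon> k * esym k (?N - {a}) (spectral p))"
      unfolding 1 by (simp add: sum_distrib_left mult_ac)
    have "E' (up {a} p) - E' p = (\<Sum>k\<le>r. g * \<epsilon> k * (esym (Suc k) ?N (spectral (up {a} p)) - esym (Suc k) ?N (spectral p)))"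
      unfolding E'_def add_diff_cancel_left sum_subtractf[symmetric] by (intro sum.cong refl) (simp only: right_diff_distrib mult_ac)
    then show "E' (up {a} p) - E' p = (q - 1) * spectral p a * g * (\<Sum>k\<le>r. \<epsilon> k * esym k (?N - {a}) (spectral p))"
      unfolding 2 by (simp add: sum_distrib_left mult_ac)
  qed
  have Dw1: "tor.Dw 1 (F n p) y = (\<Sum>a\<in>?N. hcoef h ?N {a} (spectral p) * (spectral p a / h) * F n (up {a} p) y)" if p: "part n p" and y: "q_generic n y" for p y
  proof -
    have "(q - 1) * tor.Dw 1 (F n p) y = macdonald_op n q h 1 (\<lambda>x. sum x ?N * F n p x) y - sum y ?N * macdonald_op n q h 1 (F n p) y"
      unfolding tor.Dw_1 macdonald_op_1 sum_distrib_left[of "q - 1"] sum_distrib_left[of "sum y ?N"] sum_subtractf[symmetric]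
    proof (intro sum.cong refl)
      fix i assume i: "i \<in> ?N"
      have s: "sum (y(i := q * y i)) ?N = sum y ?N + (q - 1) * y i"
        using sum.remove[of ?N i "y(i := q * y i)"] sum.remove[of ?N i y] i by (simp add: algebra_simps)
      show "(q - 1) * (hcoef h ?N {i} y * y i * F n p (tsh q {i} y)) = hcoef h ?N {i} y * (sum (y(i := q * y i)) ?N * F n p (y(i := q * y i))) -
         sum y ?N * (hcoef h ?N {i} y * F n p (y(i := q * y i)))"
        unfolding s tsh_single by (simp add: algebra_simps)
    qed
    also have "macdonald_op n q h 1 (\<lambda>x. sum x ?N * F n p x) y = macdonald_op n q h 1 (\<lambda>x. \<Sum>a\<in>?N. hcoef h ?N {a} (spectral p) * F n (up {a} p) x) y"
      by (rule macdonald_op_cong[OF y]) (rule F_Pieri1[OF p])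
    also have "\<dots> = (\<Sum>a\<in>?N. hcoef h ?N {a} (spectral p) * macdonald_op n q h 1 (F n (up {a} p)) y)"
      by (rule macdonald_op_sum)
    also have "\<dots> - sum y ?N * macdonald_op n q h 1 (F n p) y = (\<Sum>a\<in>?N. hcoef h ?N {a} (spectral p) * macdonald_op n q h 1 (F n (up {a} p)) y) - eig n p * (sum y ?N * F n p y)"
      unfolding T[OF p y] by simp
    also have "\<dots> = (\<Sum>a\<in>?N. (q - 1) * (hcoef h ?N {a} (spectral p) * (spectral p a / h) * F n (up {a} p) y))"
      unfolding F_Pieri1[OF p] sum_distrib_left[of "eig n p"] sum_subtractf[symmetric]
    proof (intro sum.cong refl)
      fix a assume a: "a \<in> ?N"
      show "hcoef h ?N {a} (spectral p) * macdonald_op n q h 1 (F n (up {a} p)) y - eig n p * (hcoef h ?N {a} (spectral p) * F n (up {a} p) y) =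
         (q - 1) * (hcoef h ?N {a} (spectral p) * (spectral p a / h) * F n (up {a} p) y)"
      proof (cases "part n (up {a} p)")
        case True
        show ?thesis unfolding T[OF True y] using eig_up[of "{a}" n p] a by (simp add: algebra_simps)
      next
        case False
        then show ?thesis using hcoef_nonpart[OF p] a by simp
      qed
    qed
    finally show ?thesis unfolding sum_distrib_left[symmetric] using q1 by (subst (asm) mult_left_cancel) auto
  qed
  have tor_sum: "tor.D r (\<lambda>y. \<Sum>a\<in>?N. c a * f a y) y = (\<Sum>a\<in>?N. c a * tor.D r (f a) y)" for c f y
    unfolding op_tor_D[symmetric] by (rule macdonald_op_sum)
  have Dw: "(q - 1) * tor.Dw (Suc r) (F n p) y = (\<Sum>a\<in>?N. hcoef h ?N {a} (spectral p) * (E' (up {a} p) - E' p) * F n (up {a} p) y)" if p: "part n p" and y: "q_generic n y" for p y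
  proof -
    let ?b = "\<lambda>a. hcoef h ?N {a} (spectral p) * (spectral p a / h)"
    have "tor.D r (tor.Dw 1 (F n p)) y = tor.D r (\<lambda>y. \<Sum>a\<in>?N. ?b a * F n (up {a} p) y) y"
      unfolding op_tor_D[symmetric] by (rule macdonald_op_cong[OF y Dw1[OF p]])
    also have "\<dots> = (\<Sum>a\<in>?N. ?b a * E (up {a} p) * F n (up {a} p) y)"
      unfolding tor_sum
    proof (intro sum.cong refl)
      fix a assume a: "a \<in> ?N"
      show "?b a * tor.D r (F n (up {a} p)) y = ?b a * E (up {a} p) * F n (up {a} p) y"
      proof (cases "part n (up {a} p)")
        case True
        show ?thesis using \<epsilon>[OF True y] unfolding op_tor_D E_def[symmetric] by simp
      next
        case False
        then show ?thesis using hcoef_nonpart[OF p] a by simp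
      qed
    qed
    finally have A: "tor.D r (tor.Dw 1 (F n p)) y = (\<Sum>a\<in>?N. ?b a * E (up {a} p) * F n (up {a} p) y)" .
    have "tor.Dw 1 (tor.D r (F n p)) y = tor.Dw 1 (\<lambda>y. E p * F n p y) y"
      unfolding tor.Dw_1
    proof (intro sum.cong refl arg_cong2[of _ _ _ _ "(*)"])
      fix j assume "j \<in> ?N"
      show "tor.D r (F n p) (tsh q {j} y) = E p * F n p (tsh q {j} y)"
        using \<epsilon>[OF p q_generic_tsh[OF y]] unfolding op_tor_D E_def[symmetric] .
    qed
    also have "\<dots> = E p * tor.Dw 1 (F n p) y"
      unfolding tor.Dw_1 by (simp add: sum_distrib_left mult_ac)
    finally have B: "tor.Dw 1 (tor.D r (F n p)) y = (\<Sum>a\<in>?N. ?b a * E p * F n (up {a} p) y)"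
      unfolding Dw1[OF p y] by (simp add: sum_distrib_left mult_ac)
    have "(1 - q) * h ^ r * tor.Dw (Suc r) (F n p) y = (\<Sum>a\<in>?N. ?b a * (E (up {a} p) - q * E p) * F n (up {a} p) y)"
      unfolding tor.D_Dw_commutator[OF tor_nondeg[OF y], symmetric] A B sum_distrib_left[of q] sum_subtractf[symmetric]
      by (intro sum.cong refl) (simp only: right_diff_distrib left_diff_distrib mult_ac)
    also have "\<dots> = (1 - q) * (\<Sum>a\<in>?N. ?b a * (\<Sum>k\<le>r. \<epsilon> k * esym k (?N - {a}) (spectral p)) * F n (up {a} p) y)"
      unfolding sum_distrib_left[of "1 - q"] by (intro sum.cong refl) (simp add: step)
    finally have "h ^ r * tor.Dw (Suc r) (F n p) y = (\<Sum>a\<in>?N. ?b a * (\<Sum>k\<le>r. \<epsilon> k * esym k (?N - {a}) (spectral p)) * F n (up {a} p) y)"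
      using q1 by simp
    then have "tor.Dw (Suc r) (F n p) y = inverse (h ^ r) * (\<Sum>a\<in>?N. ?b a * (\<Sum>k\<le>r. \<epsilon> k * esym k (?N - {a}) (spectral p)) * F n (up {a} p) y)"
      using h0 by (simp add: field_simps)
    then have "(q - 1) * tor.Dw (Suc r) (F n p) y = (\<Sum>a\<in>?N. (q - 1) * inverse (h ^ r) * (?b a * (\<Sum>k\<le>r. \<epsilon> k * esym k (?N - {a}) (spectral p)) * F n (up {a} p) y))"
      by (simp only: sum_distrib_left mult.assoc)
    also have "\<dots> = (\<Sum>a\<in>?N. hcoef h ?N {a} (spectral p) * (E' (up {a} p) - E' p) * F n (up {a} p) y)"
    proof (intro sum.cong refl)
      fix a assume a: "a \<in> ?N"
      have "inverse (h ^ r) / h = g" by (simp add: g_def divide_inverse mult.commute)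
      then have "(q - 1) * inverse (h ^ r) * (u * (spectral p a / h) * v * w) = u * ((q - 1) * spectral p a * g * v) * w" for u v w
        by (metis (no_types, opaque_lifting) mult.assoc mult.commute times_divide_eq_right)
      then show "(q - 1) * inverse (h ^ r) * (?b a * (\<Sum>k\<le>r. \<epsilon> k * esym k (?N - {a}) (spectral p)) * F n (up {a} p) y) =
         hcoef h ?N {a} (spectral p) * (E' (up {a} p) - E' p) * F n (up {a} p) y"
        unfolding step'[OF a] .
    qed
    finally show ?thesis .
  qed
  have com: "macdonald_op n q h (Suc r) (\<lambda>x. sum x ?N * f x) y = sum y ?N * macdonald_op n q h (Suc r) f y + (q - 1) * tor.Dw (Suc r) f y" for f y
    unfolding macdonald_op_tsh tor.Dw_def sum_distrib_left[of "sum y ?N"] sum_distrib_left[of "q - 1"] sum.distrib[symmetric]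
  proof (intro sum.cong refl)
    fix I assume I: "I \<in> {I. I \<subseteq> ?N \<and> card I = Suc r}"
    have "sum (tsh q I y) ?N = (\<Sum>i\<in>?N. y i + (if i \<in> I then (q - 1) * y i else 0))"
      by (rule sum.cong) (auto simp: tsh_def algebra_simps)
    also have "\<dots> = sum y ?N + (q - 1) * (\<Sum>i\<in>I. y i)"
      using I by (simp add: sum.distrib sum.If_cases Int_absorb1 sum_distrib_left)
    finally have s: "sum (tsh q I y) ?N = sum y ?N + (q - 1) * (\<Sum>i\<in>I. y i)" .
    show "hcoef h ?N I y * (sum (tsh q I y) ?N * f (tsh q I y)) = sum y ?N * (hcoef h ?N I y * f (tsh q I y)) + (q - 1) * (hcoef h ?N I y * (\<Sum>i\<in>I. y i) * f (tsh q I y))"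
      unfolding s by (simp only: distrib_left distrib_right mult_ac)
  qed
  have Pieri: "sum y ?N * z p y = (\<Sum>a\<in>?N. hcoef h ?N {a} (spectral p) * z (up {a} p) y)" if p: "part n p" and y: "q_generic n y" for p y
  proof -
    let ?T = "\<lambda>p. macdonald_op n q h (Suc r) (F n p) y"
    have "sum y ?N * ?T p + (q - 1) * tor.Dw (Suc r) (F n p) y = (\<Sum>a\<in>?N. hcoef h ?N {a} (spectral p) * ?T (up {a} p))"
      unfolding com[symmetric] macdonald_op_sum[symmetric]
      by (rule macdonald_op_cong[OF y]) (rule F_Pieri1[OF p])
    then have "sum y ?N * ?T p = (\<Sum>a\<in>?N. hcoef h ?N {a} (spectral p) * ?T (up {a} p)) - (\<Sum>a\<in>?N. hcoef h ?N {a} (spectral p) * (E' (up {a} p) - E' p) * F n (up {a} p) y)"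
      unfolding Dw[OF p y] by (simp only: eq_diff_eq)
    then have "sum y ?N * z p y = (\<Sum>a\<in>?N. hcoef h ?N {a} (spectral p) * ?T (up {a} p)) - (\<Sum>a\<in>?N. hcoef h ?N {a} (spectral p) * (E' (up {a} p) - E' p) * F n (up {a} p) y) - E' p * (sum y ?N * F n p y)"
      by (simp only: z_def right_diff_distrib mult.left_commute)
    also have "\<dots> = (\<Sum>a\<in>?N. hcoef h ?N {a} (spectral p) * z (up {a} p) y)"
      unfolding F_Pieri1[OF p] sum_distrib_left[of "E' p"] sum_subtractf[symmetric] z_def
      by (intro sum.cong refl) (simp only: right_diff_distrib left_diff_distrib mult_ac, simp)
    finally show ?thesis .
  qed
  have eigen: "macdonald_op n q h 1 (z p) y = eig n p * z p y" if p: "part n p" and y: "q_generic n y" for p y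
  proof -
    have "macdonald_op n q h 1 (macdonald_op n q h (Suc r) (F n p)) y = macdonald_op n q h (Suc r) (macdonald_op n q h 1 (F n p)) y"
      using tor.D_commute[OF tor_nondeg[OF y], of "Suc r" "F n p"] unfolding op_tor_D[abs_def] .
    also have "\<dots> = macdonald_op n q h (Suc r) (\<lambda>y. eig n p * F n p y) y"
      by (rule macdonald_op_cong[OF y T[OF p]])
    finally have "macdonald_op n q h 1 (macdonald_op n q h (Suc r) (F n p)) y = eig n p * macdonald_op n q h (Suc r) (F n p) y"
      unfolding macdonald_op_scale .
    then show ?thesis unfolding z_def macdonald_op_diff macdonald_op_scale T[OF p y] by (simp add: algebra_simps)
  qed
  have init: "z (\<lambda>_. 0) y = 0" if y: "q_generic n y" for y
  proof -
    obtain c where c: "\<And>x. F n (\<lambda>_. 0) x = c" using F_zero_const by blast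
    have "macdonald_op n q h (Suc r) (F n (\<lambda>_. 0)) y = G * c"
      unfolding macdonald_op_tsh c G[OF y, symmetric] by (simp add: sum_distrib_right)
    moreover have "E' (\<lambda>_. 0) = G" by (simp add: E'_def \<kappa>_def)
    ultimately show ?thesis by (simp add: z_def c)
  qed
  have z0: "z p x = 0" if "part n p" "q_generic n x" for p x
    by (rule rigidity[OF Pieri eigen init that])
  have E': "E' p = (\<Sum>k\<le>Suc r. (case k of 0 \<Rightarrow> \<kappa> | Suc m \<Rightarrow> g * \<epsilon> m) * esym k ?N (spectral p))" for p
    unfolding E'_def sum.atMost_Suc_shift by (simp add: esym_0)
  show ?case
  proof (intro exI[of _ "\<lambda>k. case k of 0 \<Rightarrow> \<kappa> | Suc m \<Rightarrow> g * \<epsilon> m"] allI impI)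
    fix p x assume "part n p" "q_generic n x"
    then show "macdonald_op n q h (Suc r) (F n p) x = (\<Sum>k\<le>Suc r. (case k of 0 \<Rightarrow> \<kappa> | Suc m \<Rightarrow> g * \<epsilon> m) * esym k ?N (spectral p)) * F n p x"
      unfolding E'[symmetric] using z0[of p x] by (simp add: z_def)
  qed
qed

end

text \<open>
  Here the induction on the number of variables closes: the equation in \<open>n\<close> variables gives all Pieri rules
  in \<open>n\<close> variables, and these give the equation in \<open>Suc n\<close> variables.
\<close>
lemma F_eigen1:
  assumes "part n p" "q_generic n x"
  shows "macdonald_op n q h 1 (F n p) x = eig n p * F n p x"
  using assms
proof (induction n arbitrary: p x)
  case 0
  then show ?case unfolding macdonald_op_1 by (simp add: eig_def)
next
  case (Suc n)
  show ?case
    by (rule F_eigen_step[OF Suc.prems Suc.IH F_Pieri_generating[OF Suc.IH]])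
qed

lemma F_eigen:
  "\<exists>\<epsilon>. \<forall>x. q_generic n x \<longrightarrow> macdonald_op n q h r (F n p) x = \<epsilon> * F n p x" if "part n p"
  using F_eigen_all[OF F_eigen1, of n r] that by blast

lemma macdonald_op_permute:
  assumes \<pi>: "\<pi> permutes {1..n}"
  shows "macdonald_op n q h 1 (\<lambda>x. f (x \<circ> \<pi>)) x = macdonald_op n q h 1 f (x \<circ> \<pi>)"
proof -
  let ?N = "{1..n}"
  have "macdonald_op n q h 1 (\<lambda>x. f (x \<circ> \<pi>)) x = (\<Sum>i\<in>?N. hcoef h ?N {\<pi> i} x * f (x(\<pi> i := q * x (\<pi> i)) \<circ> \<pi>))"
    unfolding macdonald_op_1 using sum.permute[OF \<pi>, of "\<lambda>i. hcoef h ?N {i} x * f (x(i := q * x i) \<circ> \<pi>)"] by (simp add: o_def)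
  also have "\<dots> = macdonald_op n q h 1 f (x \<circ> \<pi>)"
    unfolding macdonald_op_1
  proof (intro sum.cong refl arg_cong2[of _ _ _ _ "(*)"] arg_cong[of _ _ f])
    fix i assume i: "i \<in> ?N"
    have "\<pi> ` (?N - {i}) = ?N - {\<pi> i}"
      using permutes_image[OF \<pi>] permutes_inj[OF \<pi>] by (simp add: image_set_diff)
    moreover have "inj_on \<pi> (?N - {i})" using permutes_inj[OF \<pi>] inj_on_subset by blast
    ultimately show "hcoef h ?N {\<pi> i} x = hcoef h ?N {i} (x \<circ> \<pi>)"
      unfolding hcoef_single using prod.reindex[of \<pi> "?N - {i}" "\<lambda>j. (h * x (\<pi> i) - x j) / (x (\<pi> i) - x j)"] by simp
    show "x(\<pi> i := q * x (\<pi> i)) \<circ> \<pi> = (x \<circ> \<pi>)(i := q * (x \<circ> \<pi>) i)"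
      using permutes_inj[OF \<pi>] by (auto simp: fun_eq_iff inj_def)
  qed
  finally show ?thesis .
qed

text \<open>
  Permuting the variables preserves the Pieri rule for \<open>e\<^sub>1\<close> and commutes with \<open>T\<^sub>1\<close>, so \<open>rigidity\<close>
  applies to the difference.
\<close>
lemma F_symmetric:
  assumes p: "part n p" and x: "q_generic n x" and \<pi>: "\<pi> permutes {1..n}"
  shows "F n p (x \<circ> \<pi>) = F n p x"
proof -
  let ?N = "{1..n}"
  define z where "z p x = F n p (x \<circ> \<pi>) - F n p x" for p x
  have g: "q_generic n (y \<circ> \<pi>)" if "q_generic n y" for y
    unfolding q_generic_def
  proof (intro ballI conjI impI allI)
    fix i j a b assume "i \<in> ?N" "j \<in> ?N" "i \<noteq> j"
    then have "\<pi> i \<in> ?N" "\<pi> j \<in> ?N" "\<pi> i \<noteq> \<pi> j" using permutes_in_image[OF \<pi>] permutes_inj[OF \<pi>] by (auto dest: injD)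
    then show "q ^ a * (y \<circ> \<pi>) i \<noteq> q ^ b * (y \<circ> \<pi>) j" using that unfolding q_generic_def o_def by blast
  next
    fix i assume "i \<in> ?N"
    then show "(y \<circ> \<pi>) i \<noteq> 0" using q_generic_nz[OF that] permutes_in_image[OF \<pi>] by auto
  qed
  have s: "sum (y \<circ> \<pi>) ?N = sum y ?N" for y
    using sum.permute[OF \<pi>, of y] by simp
  have "z p x = 0"
  proof (rule rigidity[OF _ _ _ p x])
    fix p y assume p: "part n p" and y: "q_generic n y"
    show "sum y ?N * z p y = (\<Sum>a\<in>?N. hcoef h ?N {a} (spectral p) * z (up {a} p) y)"
      using F_Pieri1[OF p, of y] F_Pieri1[OF p, of "y \<circ> \<pi>"] s[of y] unfolding z_def
      by (simp add: right_diff_distrib sum_subtractf o_def)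
    show "macdonald_op n q h 1 (z p) y = eig n p * z p y"
      unfolding z_def macdonald_op_diff macdonald_op_permute[OF \<pi>] F_eigen1[OF p y] F_eigen1[OF p g[OF y]] by (simp only: right_diff_distrib)
  next
    fix y
    obtain c where c: "\<And>x. F n (\<lambda>_. 0) x = c" using F_zero_const by blast
    show "z (\<lambda>_. 0) y = 0" by (simp add: z_def c)
  qed
  then show ?thesis by (simp add: z_def)
qed

section \<open>The vertex function as a sum over Gelfand--Tsetlin patterns\<close>

text \<open>
  Gelfand--Tsetlin patterns with top row \<open>p\<close>; row \<open>i\<close> has \<open>i\<close> entries.  Zero rows above the top make
  the representing functions unique.
\<close>
definition GT_patterns :: "nat \<Rightarrow> (nat \<Rightarrow> int) \<Rightarrow> (nat \<Rightarrow> nat \<Rightarrow> int) set" where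
  "GT_patterns n p = {Q. Q n = p \<and> (\<forall>i>n. Q i = (\<lambda>_. 0)) \<and> (\<forall>i<n. Q i \<in> interlacing i (Q (Suc i)))}"

lemma GT_patterns_0: "part 0 p \<Longrightarrow> GT_patterns 0 p = {\<lambda>_ _. 0}"
  by (auto simp: GT_patterns_def part_def fun_eq_iff) (metis neq0_conv)

lemma GT_patterns_Suc:
  "GT_patterns (Suc n) p = (\<lambda>(r, Q). Q(Suc n := p)) ` (SIGMA r:interlacing n p. GT_patterns n r)"
proof (intro equalityI subsetI)
  fix Q assume Q: "Q \<in> GT_patterns (Suc n) p"
  then have "Q = (Q(Suc n := \<lambda>_. 0))(Suc n := p)" by (auto simp: GT_patterns_def)
  moreover have "Q n \<in> interlacing n p" using Q by (auto simp: GT_patterns_def)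
  moreover have "Q(Suc n := \<lambda>_. 0) \<in> GT_patterns n (Q n)" using Q by (auto simp: GT_patterns_def)
  ultimately show "Q \<in> (\<lambda>(r, Q). Q(Suc n := p)) ` (SIGMA r:interlacing n p. GT_patterns n r)"
    by (intro image_eqI[of _ _ "(Q n, Q(Suc n := \<lambda>_. 0))"]) auto
qed (auto simp: GT_patterns_def less_Suc_eq)

lemma GT_patterns_Suc_inj: "inj_on (\<lambda>(r, Q). Q(Suc n := p)) (SIGMA r:interlacing n p. GT_patterns n r)"
proof (rule inj_onI, clarify)
  fix r Q r' Q' assume Q: "Q \<in> GT_patterns n r" and Q': "Q' \<in> GT_patterns n r'" and e: "Q(Suc n := p) = Q'(Suc n := p)"
  have "Q i = Q' i" for i
  proof (cases "i = Suc n")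
    case True
    then show ?thesis using Q Q' by (simp add: GT_patterns_def)
  next
    case False
    then show ?thesis using fun_cong[OF e, of i] by simp
  qed
  then have "Q = Q'" by blast
  moreover have "r = Q n" "r' = Q' n" using Q Q' by (auto simp: GT_patterns_def)
  ultimately show "r = r' \<and> Q = Q'" by simp
qed

lemma finite_GT_patterns: "part n p \<Longrightarrow> finite (GT_patterns n p)"
proof (induction n arbitrary: p)
  case 0
  then show ?case by (simp add: GT_patterns_0)
next
  case (Suc n)
  show ?case unfolding GT_patterns_Suc
    by (intro finite_imageI finite_SigmaI finite_interlacing Suc.IH part_interlacing(1)[OF Suc.prems])
qed

lemma F_GT_patterns_sum:
  assumes "part n p"
  shows "F n p x = (\<Sum>Q\<in>GT_patterns n p. \<Prod>i<n. branch_norm (Suc i) (Q (Suc i)) * branch_kernel i (Q (Suc i)) (Q i) * x (Suc i) ^ nat (sum (Q (Suc i)) {1..Suc i} - sum (Q i) {1..i}))"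
  using assms
proof (induction n arbitrary: p)
  case 0
  then show ?case by (simp add: GT_patterns_0)
next
  case (Suc n)
  let ?f = "\<lambda>Q i. branch_norm (Suc i) (Q (Suc i)) * branch_kernel i (Q (Suc i)) (Q i) * x (Suc i) ^ nat (sum (Q (Suc i)) {1..Suc i} - sum (Q i) {1..i})"
  have "F (Suc n) p x = (\<Sum>r\<in>interlacing n p. \<Sum>Q\<in>GT_patterns n r. branch_norm (Suc n) p * branch_kernel n p r * x (Suc n) ^ nat (sum p {1..Suc n} - sum r {1..n}) * (\<Prod>i<n. ?f Q i))"
    unfolding F.simps using Suc.IH part_interlacing(1)[OF Suc.prems]
    by (simp add: sum_distrib_left mult.assoc)
  also have "\<dots> = (\<Sum>(r, Q)\<in>(SIGMA r:interlacing n p. GT_patterns n r). branch_norm (Suc n) p * branch_kernel n p r * x (Suc n) ^ nat (sum p {1..Suc n} - sum r {1..n}) * (\<Prod>i<n. ?f Q i))"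
    by (rule sum.Sigma) (use finite_interlacing finite_GT_patterns part_interlacing(1)[OF Suc.prems] in auto)
  also have "\<dots> = (\<Sum>(r, Q)\<in>(SIGMA r:interlacing n p. GT_patterns n r). \<Prod>i<Suc n. ?f (Q(Suc n := p)) i)"
  proof (rule sum.cong, simp, clarify)
    fix r Q assume "Q \<in> GT_patterns n r"
    then have r: "Q n = r" by (simp add: GT_patterns_def)
    have "(\<Prod>i<n. ?f (Q(Suc n := p)) i) = (\<Prod>i<n. ?f Q i)"
      by (rule prod.cong) auto
    then show "branch_norm (Suc n) p * branch_kernel n p r * x (Suc n) ^ nat (sum p {1..Suc n} - sum r {1..n}) * (\<Prod>i<n. ?f Q i) = (\<Prod>i<Suc n. ?f (Q(Suc n := p)) i)"
      unfolding prod.lessThan_Suc by (simp add: r mult.commute)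
  qed
  also have "\<dots> = (\<Sum>Q\<in>GT_patterns (Suc n) p. \<Prod>i<Suc n. ?f Q i)"
    unfolding GT_patterns_Suc by (subst sum.reindex[OF GT_patterns_Suc_inj]) (simp add: case_prod_beta)
  finally show ?case .
qed

text \<open>
  The factor of the vertex term that belongs to the node \<open>i\<close> of the quiver, up to normalization.
\<close>
definition pattern_weight :: "nat \<Rightarrow> (nat \<Rightarrow> nat \<Rightarrow> int) \<Rightarrow> complex" where
  "pattern_weight i Q = \<tau> powi (- sum (Q i) {1..i}) * rho i (Q i) * omega_prod i (Q (Suc i)) (Q i)"

text \<open>
  The Vandermonde factors of consecutive rows telescope.
\<close>
lemma prod_branch_norm_branch_kernel:
  "(\<Prod>i<n. branch_norm (Suc i) (Q (Suc i)) * branch_kernel i (Q (Suc i)) (Q i)) * rho 0 (Q 0) * vandermonde n (Q n) = rho n (Q n) * (\<Prod>i<n. pattern_weight i Q) * vandermonde 0 (Q 0)"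
proof (induction n)
  case (Suc n)
  have "branch_norm (Suc n) (Q (Suc n)) * vandermonde (Suc n) (Q (Suc n)) = rho (Suc n) (Q (Suc n))"
    by (simp add: branch_norm_def vandermonde_nz)
  then have "(\<Prod>i<Suc n. branch_norm (Suc i) (Q (Suc i)) * branch_kernel i (Q (Suc i)) (Q i)) * rho 0 (Q 0) * vandermonde (Suc n) (Q (Suc n)) =
    ((\<Prod>i<n. branch_norm (Suc i) (Q (Suc i)) * branch_kernel i (Q (Suc i)) (Q i)) * rho 0 (Q 0) * vandermonde n (Q n)) * rho (Suc n) (Q (Suc n)) * (\<tau> powi (- sum (Q n) {1..n}) * omega_prod n (Q (Suc n)) (Q n))"
    unfolding prod.lessThan_Suc branch_kernel_def by (simp add: mult_ac)
  also have "\<dots> = rho (Suc n) (Q (Suc n)) * (\<Prod>i<Suc n. pattern_weight i Q) * vandermonde 0 (Q 0)"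
    unfolding Suc.IH prod.lessThan_Suc pattern_weight_def by (simp only: mult_ac)
  finally show ?case .
qed simp

lemma prod_branch_norm_kk':
  assumes "n \<ge> 1" "Q n = p"
  shows "(\<Prod>i<n. branch_norm (Suc i) (Q (Suc i)) * branch_kernel i (Q (Suc i)) (Q i)) = branch_norm n p * (\<Prod>i\<in>{1..<n}. pattern_weight i Q)"
proof -
  have 0: "rho 0 (Q 0) = 1" "vandermonde 0 (Q 0) = 1" "pattern_weight 0 Q = 1" by (simp_all add: rho_def vandermonde_def pattern_weight_def omega_prod_def)
  have "{..<n} = insert 0 {1..<n}" using assms(1) by auto
  then have "(\<Prod>i<n. pattern_weight i Q) = (\<Prod>i\<in>{1..<n}. pattern_weight i Q)" using 0 by simp
  then show ?thesis using prod_branch_norm_branch_kernel[where n = n and Q = Q] vandermonde_nz[of n p] 0 assms(2) by (simp add: branch_norm_def nonzero_eq_divide_eq)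
qed

text \<open>
  The vertex has \<open>q\<close>-Pochhammer symbols based at a ratio of equivariant parameters, which includes a
  power \<open>q powi d0\<close>; moving the base to a power of \<open>h\<close> gives \<open>omega\<close>.  Both sides satisfy the same
  recursion in \<open>d\<close>; if \<open>omega j k d0 \<noteq> 0\<close>, it can be solved upwards and downwards from \<open>d = 0\<close>.
\<close>
lemma omega_ratio:
  assumes "omega j k d0 \<noteq> 0"
  defines "y \<equiv> q powi d0 * h powi (int j - int k)"
  shows "qpoch (h * y) q d / qpoch (q * y) q d = omega j k (d0 + d) / omega j k d0"
proof -
  define R where "R d = qpoch (h * y) q d / qpoch (q * y) q d" for d
  have y: "q powi d * y = q powi (d0 + d) * h powi (int j - int k)" for d
    using q0 by (simp add: y_def power_int_add)
  have ty: "\<tau> * (q powi d * y) = q powi (d0 + d - 1) * h powi (int j - int k + 1)" for d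
    unfolding y \<tau>_def using q0 h0 by (simp add: power_int_add power_int_diff)
  have ty': "q powi (d - 1) * (h * y) = \<tau> * (q powi d * y)" for d
    using q0 by (simp add: \<tau>_def power_int_diff)
  have nz: "d0 > 0 \<Longrightarrow> k \<noteq> Suc j" "d0 < 0 \<Longrightarrow> j \<noteq> k" using assms(1) by (auto simp: omega_zero_iff)
  have tne: "\<tau> * (q powi d * y) \<noteq> 1" if "d \<le> 0" for d
  proof
    assume "\<tau> * (q powi d * y) = 1"
    then have "d0 + d - 1 = 0" "int j - int k + 1 = 0" unfolding ty qh_one by auto
    then show False using nz(1) that by auto
  qed
  have ne: "q powi d * y \<noteq> 1" if "d \<ge> 1" for d
  proof
    assume "q powi d * y = 1"
    then have "d0 + d = 0" "int j - int k = 0" unfolding y qh_one by auto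
    then show False using nz(2) that by auto
  qed
  have Rs: "R (d - 1) * (1 - \<tau> * (q powi d * y)) = R d * (1 - q powi d * y)" for d
    unfolding R_def
  proof (rule qpoch_ratio_step)
    show "d \<ge> 1 \<or> q powi (d - 1) * (h * y) \<noteq> 1"
      unfolding ty' using tne[of d] by (cases "d \<ge> 1") auto
  qed (rule ne)
  have os: "omega j k (d0 + d - 1) * (1 - \<tau> * (q powi d * y)) = omega j k (d0 + d) * (1 - q powi d * y)" for d
    using omega_step0[of j k "d0 + d"] unfolding y .
  have "R d = omega j k (d0 + d) / omega j k d0"
  proof (induction d rule: int_induct[where k = 0])
    case base
    then show ?case using assms(1) by (simp add: R_def qpoch_def)
  next
    case (step1 i)
    have n: "1 - q powi (i + 1) * y \<noteq> 0" using ne[of "i + 1"] step1 by simp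
    have "R (i + 1) * (1 - q powi (i + 1) * y) = (omega j k (d0 + (i + 1)) / omega j k d0) * (1 - q powi (i + 1) * y)"
      using Rs[of "i + 1"] os[of "i + 1"] step1.IH by (simp add: add.assoc[symmetric])
    then show ?case using n by (subst (asm) mult_right_cancel) auto
  next
    case (step2 i)
    have n: "1 - \<tau> * (q powi i * y) \<noteq> 0" using tne[of i] step2 by simp
    have "R (i - 1) * (1 - \<tau> * (q powi i * y)) = (omega j k (d0 + (i - 1)) / omega j k d0) * (1 - \<tau> * (q powi i * y))"
      using Rs[of i] os[of i] step2.IH by (simp add: add_diff_eq)
    then show ?case using n by (subst (asm) mult_right_cancel) auto
  qed
  then show ?thesis by (simp add: R_def)
qed

lemma omega_base_nz:
  assumes "part n p" "j \<in> {1..n}" "k \<in> {1..n}"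
  shows "omega j k (p j - p k) \<noteq> 0"
  using omega_part_nz[OF assms] by (cases "j = k") (auto simp: omega_zero_iff)

text \<open>
  The degrees of a quasimap are the excess of the entries of a pattern over those of its top row in the
  same column.
\<close>
definition pattern_of :: "nat \<Rightarrow> (nat \<Rightarrow> int) \<Rightarrow> (nat \<Rightarrow> nat \<Rightarrow> nat) \<Rightarrow> nat \<Rightarrow> nat \<Rightarrow> int" where
  "pattern_of n p d = (\<lambda>i j. if 1 \<le> j \<and> j \<le> i \<and> i \<le> n then p j + int (d i j) else 0)"

definition degrees_of :: "nat \<Rightarrow> (nat \<Rightarrow> int) \<Rightarrow> (nat \<Rightarrow> nat \<Rightarrow> int) \<Rightarrow> nat \<Rightarrow> nat \<Rightarrow> nat" where
  "degrees_of n p Q = (\<lambda>i j. if 1 \<le> j \<and> j \<le> i \<and> i < n then nat (Q i j - p j) else 0)"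

abbreviation base_pattern :: "nat \<Rightarrow> (nat \<Rightarrow> int) \<Rightarrow> nat \<Rightarrow> nat \<Rightarrow> int" where
  "base_pattern n p \<equiv> pattern_of n p (\<lambda>_ _. 0)"

lemma pattern_weight_base_pattern_nz:
  assumes "part n p" "i \<in> {1..<n}"
  shows "pattern_weight i (base_pattern n p) \<noteq> 0"
proof -
  have "rho i (base_pattern n p i) \<noteq> 0"
    unfolding rho_def using assms omega_base_nz[OF assms(1)] by (auto simp: pattern_of_def)
  moreover have "omega_prod i (base_pattern n p (Suc i)) (base_pattern n p i) \<noteq> 0"
    unfolding omega_prod_def using assms omega_base_nz[OF assms(1)] by (auto simp: pattern_of_def)
  ultimately show ?thesis using tau by (simp add: pattern_weight_def)
qed

text \<open>
  The factors \<open>j = k\<close> of the first double product are \<open>1\<close>.  The others and the second double product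
  give \<open>rho\<close> and \<open>omega_prod\<close> at \<open>pattern_of n p d\<close>, relative to \<open>d = 0\<close>.
\<close>
lemma vertex_term_eq:
  assumes p: "part n p" and d: "\<And>j. d n j = 0"
    and a: "\<And>j k. j \<in> {1..n} \<Longrightarrow> k \<in> {1..n} \<Longrightarrow> a j / a k = q powi (p j - p k) * h powi (int j - int k)"
  shows "vertex_term n q h \<zeta> (\<lambda>i k. 1 / a k) d =
    (\<Prod>i\<in>{1..<n}. (\<zeta> i / \<zeta> (Suc i)) ^ (\<Sum>j=1..i. d i j) * (pattern_weight i (pattern_of n p d) / pattern_weight i (base_pattern n p)))"
  unfolding vertex_term_def
proof (rule prod.cong)
  fix i assume i: "i \<in> {1..<n}"
  let ?Q = "pattern_of n p d" and ?B = "base_pattern n p"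
  define y where "y j k = q powi (p j - p k) * h powi (int j - int k)" for j k
  have ratio: "qpoch (h * y j k) q D / qpoch (q * y j k) q D = omega j k (p j - p k + D) / omega j k (p j - p k)"
    if "j \<in> {1..n}" "k \<in> {1..n}" for j k D
    unfolding y_def by (rule omega_ratio[OF omega_base_nz[OF p that]])
  have ay: "1 / a k / (1 / a j) = y j k" if "j \<in> {1..n}" "k \<in> {1..n}" for j k
    using a[OF that] by (simp add: y_def)
  have 1: "(\<Prod>j=1..i. \<Prod>k=1..i.
           qpoch (q * (1 / a k / (1 / a j))) q (int (d i j) - int (d i k)) /
           qpoch (h * (1 / a k / (1 / a j))) q (int (d i j) - int (d i k))) = rho i (?Q i) / rho i (?B i)"
  proof -
    have e: "qpoch (q * (1 / a k / (1 / a j))) q (int (d i j) - int (d i k)) / qpoch (h * (1 / a k / (1 / a j))) q (int (d i j) - int (d i k)) =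
        inverse (omega j k (?Q i j - ?Q i k)) / inverse (omega j k (?B i j - ?B i k))" if jk: "j \<in> {1..i}" "k \<in> {1..i}" for j k
    proof -
      have jk': "j \<in> {1..n}" "k \<in> {1..n}" using jk i by auto
      have "p j - p k + (int (d i j) - int (d i k)) = ?Q i j - ?Q i k" "p j - p k = ?B i j - ?B i k" using jk i by (auto simp: pattern_of_def)
      then have "qpoch (h * y j k) q (int (d i j) - int (d i k)) / qpoch (q * y j k) q (int (d i j) - int (d i k)) = omega j k (?Q i j - ?Q i k) / omega j k (?B i j - ?B i k)"
        using ratio[OF jk', of "int (d i j) - int (d i k)"] by simp
      then have "inverse (qpoch (h * y j k) q (int (d i j) - int (d i k)) / qpoch (q * y j k) q (int (d i j) - int (d i k))) = inverse (omega j k (?Q i j - ?Q i k) / omega j k (?B i j - ?B i k))"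
        by (simp only:)
      then show ?thesis unfolding ay[OF jk'] by (simp add: divide_inverse mult.commute)
    qed
    have "(\<Prod>k=1..i. qpoch (q * (1 / a k / (1 / a j))) q (int (d i j) - int (d i k)) / qpoch (h * (1 / a k / (1 / a j))) q (int (d i j) - int (d i k))) =
      (\<Prod>k\<in>{1..i} - {j}. inverse (omega j k (?Q i j - ?Q i k)) / inverse (omega j k (?B i j - ?B i k)))" if j: "j \<in> {1..i}" for j
    proof -
      have "(\<Prod>k=1..i. qpoch (q * (1 / a k / (1 / a j))) q (int (d i j) - int (d i k)) / qpoch (h * (1 / a k / (1 / a j))) q (int (d i j) - int (d i k))) =
        (\<Prod>k=1..i. inverse (omega j k (?Q i j - ?Q i k)) / inverse (omega j k (?B i j - ?B i k)))"
        by (intro prod.cong refl e j)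
      also have "\<dots> = inverse (omega j j (?Q i j - ?Q i j)) / inverse (omega j j (?B i j - ?B i j)) * (\<Prod>k\<in>{1..i} - {j}. inverse (omega j k (?Q i j - ?Q i k)) / inverse (omega j k (?B i j - ?B i k)))"
        by (rule prod.remove) (use j in auto)
      also have "inverse (omega j j (?Q i j - ?Q i j)) / inverse (omega j j (?B i j - ?B i j)) = 1"
        by (simp add: omega_zero_iff)
      finally show ?thesis by simp
    qed
    note row = this
    show ?thesis unfolding rho_def prod_dividef[symmetric] by (rule prod.cong[OF refl row])
  qed
  have 2: "(\<Prod>j=1..i. \<Prod>k=1..Suc i.
           qpoch (h * (1 / a k / (1 / a j))) q (int (d i j) - int (d (Suc i) k)) /
           qpoch (q * (1 / a k / (1 / a j))) q (int (d i j) - int (d (Suc i) k))) = omega_prod i (?Q (Suc i)) (?Q i) / omega_prod i (?B (Suc i)) (?B i)"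
    unfolding omega_prod_def prod_dividef[symmetric]
  proof (intro prod.cong refl)
    fix j k assume jk: "j \<in> {1..i}" "k \<in> {1..Suc i}"
    have jk': "j \<in> {1..n}" "k \<in> {1..n}" using jk i by auto
    have "p j - p k + (int (d i j) - int (d (Suc i) k)) = ?Q i j - ?Q (Suc i) k" "p j - p k = ?B i j - ?B (Suc i) k" using jk i by (auto simp: pattern_of_def)
    then show "qpoch (h * (1 / a k / (1 / a j))) q (int (d i j) - int (d (Suc i) k)) /
           qpoch (q * (1 / a k / (1 / a j))) q (int (d i j) - int (d (Suc i) k)) = omega j k (?Q i j - ?Q (Suc i) k) / omega j k (?B i j - ?B (Suc i) k)"
      unfolding ay[OF jk'] using ratio[OF jk', of "int (d i j) - int (d (Suc i) k)"] by simp
  qed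
  have s: "sum (?Q i) {1..i} = sum (?B i) {1..i} + int (\<Sum>j=1..i. d i j)"
    using i by (simp add: pattern_of_def sum.distrib)
  have 3: "(q / h * (\<zeta> i / \<zeta> (Suc i))) ^ (\<Sum>j=1..i. d i j) = (\<zeta> i / \<zeta> (Suc i)) ^ (\<Sum>j=1..i. d i j) * (\<tau> powi (- sum (?Q i) {1..i}) / \<tau> powi (- sum (?B i) {1..i}))"
  proof -
    have "\<tau> powi (- sum (?Q i) {1..i}) / \<tau> powi (- sum (?B i) {1..i}) = \<tau> powi (- int (\<Sum>j=1..i. d i j))"
      unfolding s using tau by (simp add: power_int_diff[symmetric] del: of_nat_sum)
    also have "\<dots> = (q / h) ^ (\<Sum>j=1..i. d i j)"
      unfolding power_int_minus power_int_of_nat by (simp add: \<tau>_def power_inverse[symmetric])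
    finally show ?thesis unfolding power_mult_distrib by (simp only: mult.commute)
  qed
  show "(q / h * (\<zeta> i / \<zeta> (Suc i))) ^ (\<Sum>j=1..i. d i j) *
        (\<Prod>j=1..i. \<Prod>k=1..i.
           qpoch (q * (1 / a k / (1 / a j))) q (int (d i j) - int (d i k)) /
           qpoch (h * (1 / a k / (1 / a j))) q (int (d i j) - int (d i k))) *
        (\<Prod>j=1..i. \<Prod>k=1..Suc i.
           qpoch (h * (1 / a k / (1 / a j))) q (int (d i j) - int (d (Suc i) k)) /
           qpoch (q * (1 / a k / (1 / a j))) q (int (d i j) - int (d (Suc i) k))) =
     (\<zeta> i / \<zeta> (Suc i)) ^ (\<Sum>j=1..i. d i j) * (pattern_weight i ?Q / pattern_weight i ?B)"
    unfolding 1 2 3 pattern_weight_def by (simp add: mult_ac)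
qed simp

lemma GT_patterns_ge:
  assumes Q: "Q \<in> GT_patterns n p" and "1 \<le> j" "j \<le> i" "i \<le> n"
  shows "p j \<le> Q i j"
  using assms(4,3)
proof (induction i rule: inc_induct)
  case base
  then show ?case using Q by (simp add: GT_patterns_def)
next
  case (step i)
  have "Q i \<in> interlacing i (Q (Suc i))" using Q step by (auto simp: GT_patterns_def)
  then have "Q (Suc i) j \<le> Q i j" using assms(2) step by (auto simp: interlacing_def)
  then show ?case using step by force
qed

lemma pattern_of_degrees_of:
  assumes p: "part n p" and Q: "Q \<in> GT_patterns n p"
  shows "pattern_of n p (degrees_of n p Q) = Q"
proof (intro ext)
  fix i j
  consider "i > n" | "i = n" | "i < n" by linarith
  then show "pattern_of n p (degrees_of n p Q) i j = Q i j"
  proof cases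
    case 1
    then show ?thesis using Q by (auto simp: pattern_of_def GT_patterns_def)
  next
    case 2
    then have "Q i j = p j" using Q by (simp add: GT_patterns_def)
    then show ?thesis using 2 p by (auto simp: pattern_of_def degrees_of_def part_def)
  next
    case 3
    then have "Q i \<in> interlacing i (Q (Suc i))" using Q by (auto simp: GT_patterns_def)
    then have "j \<notin> {1..i} \<Longrightarrow> Q i j = 0" by (simp add: interlacing_def)
    moreover have "j \<in> {1..i} \<Longrightarrow> p j \<le> Q i j" using GT_patterns_ge[OF Q, of j i] 3 by auto
    ultimately show ?thesis using 3 by (auto simp: pattern_of_def degrees_of_def)
  qed
qed

lemma degrees_of_pattern_of:
  assumes "d \<in> degrees n"
  shows "degrees_of n p (pattern_of n p d) = d"
proof (intro ext)
  fix i j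
  show "degrees_of n p (pattern_of n p d) i j = d i j"
    using assms by (auto simp: degrees_of_def pattern_of_def degrees_def)
qed

lemma degrees_of_degrees:
  assumes Q: "Q \<in> GT_patterns n p"
  shows "degrees_of n p Q \<in> degrees n"
  unfolding degrees_def
proof (intro CollectI conjI ballI allI impI)
  fix i assume i: "i \<in> {1..n-2}"
  show "\<exists>J. inj_on J {1..i} \<and> J ` {1..i} \<subseteq> {1..Suc i} \<and> (\<forall>k\<in>{1..i}. degrees_of n p Q (Suc i) (J k) \<le> degrees_of n p Q i k)"
  proof (intro exI[of _ "\<lambda>k. k"] conjI ballI)
    fix k assume k: "k \<in> {1..i}"
    have "Q i \<in> interlacing i (Q (Suc i))" using Q i by (auto simp: GT_patterns_def)
    then have "Q (Suc i) k \<le> Q i k" using k by (auto simp: interlacing_def)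
    then show "degrees_of n p Q (Suc i) k \<le> degrees_of n p Q i k" using i k by (auto simp: degrees_of_def)
  qed auto
qed (auto simp: degrees_of_def)

text \<open>
  A nonzero weight forces each pair of consecutive rows to interlace, by \<open>omega_prod_zero\<close>.
\<close>
lemma pattern_of_GT_patterns:
  assumes p: "part n p" and d: "d \<in> degrees n" and nz: "\<And>i. i \<in> {1..<n} \<Longrightarrow> pattern_weight i (pattern_of n p d) \<noteq> 0"
  shows "pattern_of n p d \<in> GT_patterns n p"
  unfolding GT_patterns_def
proof (intro CollectI conjI allI impI)
  show "pattern_of n p d n = p"
    using p d by (auto simp: pattern_of_def part_def degrees_def fun_eq_iff)
next
  fix i assume "i > n"
  then show "pattern_of n p d i = (\<lambda>_. 0)" by (auto simp: pattern_of_def)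
next
  fix i assume i: "i < n"
  show "pattern_of n p d i \<in> interlacing i (pattern_of n p d (Suc i))"
  proof (cases "i = 0")
    case True
    then show ?thesis by (auto simp: interlacing_def pattern_of_def)
  next
    case False
    show ?thesis
    proof (rule ccontr)
      assume "pattern_of n p d i \<notin> interlacing i (pattern_of n p d (Suc i))"
      then have "omega_prod i (pattern_of n p d (Suc i)) (pattern_of n p d i) = 0" by (intro omega_prod_zero) (auto simp: pattern_of_def)
      then show False using nz[of i] i False by (simp add: pattern_weight_def)
    qed
  qed
qed

text \<open>
  The exponents that the iterated branching rule attaches to a pattern.
\<close>
definition pattern_content :: "nat \<Rightarrow> (nat \<Rightarrow> nat \<Rightarrow> int) \<Rightarrow> nat \<Rightarrow> nat" where
  "pattern_content n Q i = (if i \<in> {1..n} then nat (sum (Q i) {1..i} - sum (Q (i - 1)) {1..i - 1}) else 0)"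

text \<open>
  The coefficient of the lowest monomial, see \<open>monomial_coef_lead\<close>.
\<close>
definition lead :: "nat \<Rightarrow> (nat \<Rightarrow> int) \<Rightarrow> complex" where
  "lead n p = branch_norm n p * (\<Prod>i\<in>{1..<n}. pattern_weight i (base_pattern n p))"

lemma lead_nz: "part n p \<Longrightarrow> lead n p \<noteq> 0"
  using branch_norm_nz pattern_weight_base_pattern_nz by (auto simp: lead_def)

lemma F_monomials:
  assumes p: "part n p" and n: "n \<ge> 1"
  shows "F n p x = (\<Sum>Q\<in>GT_patterns n p. (branch_norm n p * (\<Prod>i\<in>{1..<n}. pattern_weight i Q)) * (\<Prod>i\<in>{1..n}. x i ^ pattern_content n Q i))"
  unfolding F_GT_patterns_sum[OF p]
proof (rule sum.cong)
  fix Q assume Q: "Q \<in> GT_patterns n p"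
  have "(\<Prod>i<n. x (Suc i) ^ nat (sum (Q (Suc i)) {1..Suc i} - sum (Q i) {1..i})) = (\<Prod>i\<in>{1..n}. x i ^ pattern_content n Q i)"
    by (rule prod.reindex_bij_witness[of _ "\<lambda>i. i - 1" Suc]) (auto simp: pattern_content_def)
  moreover have "Q n = p" using Q by (simp add: GT_patterns_def)
  ultimately show "(\<Prod>i<n. branch_norm (Suc i) (Q (Suc i)) * branch_kernel i (Q (Suc i)) (Q i) * x (Suc i) ^ nat (sum (Q (Suc i)) {1..Suc i} - sum (Q i) {1..i})) =
     (branch_norm n p * (\<Prod>i\<in>{1..<n}. pattern_weight i Q)) * (\<Prod>i\<in>{1..n}. x i ^ pattern_content n Q i)"
    using prod_branch_norm_kk'[OF n, of Q p] by (simp add: prod.distrib)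
qed simp

lemma part_GT_patterns_row:
  assumes p: "part n p" and Q: "Q \<in> GT_patterns n p" and "i \<le> n"
  shows "part i (Q i)"
  using assms(3)
proof (induction i rule: inc_induct)
  case base
  then show ?case using p Q by (simp add: GT_patterns_def)
next
  case (step i)
  have "Q i \<in> interlacing i (Q (Suc i))" using Q step by (auto simp: GT_patterns_def)
  then show ?case using part_interlacing(1) step by blast
qed

lemma pattern_content_int:
  assumes p: "part n p" and Q: "Q \<in> GT_patterns n p" and i: "i \<in> {1..n}"
  shows "int (pattern_content n Q i) = sum (Q i) {1..i} - sum (Q (i - 1)) {1..i - 1}"
proof -
  obtain m where m: "i = Suc m" "m < n" using i by (cases i) auto
  have "Q m \<in> interlacing m (Q (Suc m))" using Q m by (auto simp: GT_patterns_def)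
  then have "sum (Q m) {1..m} \<le> sum (Q (Suc m)) {1..Suc m}"
    using part_interlacing(2)[of m "Q (Suc m)" "Q m"] part_GT_patterns_row[OF p Q, of "Suc m"] m by simp
  then show ?thesis using i m by (simp add: pattern_content_def)
qed

lemma pattern_content_partial_sum:
  assumes p: "part n p" and Q: "Q \<in> GT_patterns n p" and "i \<le> n"
  shows "(\<Sum>j\<in>{1..i}. int (pattern_content n Q j)) = sum (Q i) {1..i}"
  using assms(3)
proof (induction i)
  case (Suc i)
  then show ?case using pattern_content_int[OF p Q, of "Suc i"] by simp
qed simp

lemma telescope_ratio:
  fixes \<zeta> :: "nat \<Rightarrow> complex" and e :: "nat \<Rightarrow> int"
  assumes "\<And>i. i \<in> {1..Suc m} \<Longrightarrow> \<zeta> i \<noteq> 0" "e 0 = 0"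
  shows "(\<Prod>i\<in>{1..m}. (\<zeta> i / \<zeta> (Suc i)) powi e i) * \<zeta> (Suc m) powi e m = (\<Prod>i\<in>{1..m}. \<zeta> i powi (e i - e (i - 1)))"
  using assms(1)
proof (induction m)
  case 0
  then show ?case using assms(2) by simp
next
  case (Suc m)
  have nz: "\<zeta> (Suc m) \<noteq> 0" "\<zeta> (Suc (Suc m)) \<noteq> 0" using Suc.prems by auto
  have IH: "(\<Prod>i\<in>{1..m}. (\<zeta> i / \<zeta> (Suc i)) powi e i) * \<zeta> (Suc m) powi e m = (\<Prod>i\<in>{1..m}. \<zeta> i powi (e i - e (i - 1)))"
    by (rule Suc.IH) (use Suc.prems in auto)
  have "(\<Prod>i\<in>{1..Suc m}. (\<zeta> i / \<zeta> (Suc i)) powi e i) * \<zeta> (Suc (Suc m)) powi e (Suc m) =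
    (\<Prod>i\<in>{1..m}. (\<zeta> i / \<zeta> (Suc i)) powi e i) * \<zeta> (Suc m) powi e (Suc m)"
    using nz by (simp add: power_int_divide_distrib)
  also have "\<zeta> (Suc m) powi e (Suc m) = \<zeta> (Suc m) powi e m * \<zeta> (Suc m) powi (e (Suc m) - e m)"
    using nz by (simp add: power_int_add[symmetric])
  also have "(\<Prod>i\<in>{1..m}. (\<zeta> i / \<zeta> (Suc i)) powi e i) * \<dots> = (\<Prod>i\<in>{1..Suc m}. \<zeta> i powi (e i - e (i - 1)))"
    unfolding mult.assoc[symmetric] IH by simp
  finally show ?case .
qed

text \<open>
  Vertex terms whose degrees do not come from a Gelfand--Tsetlin pattern are zero, so the series is the
  finite sum that results from iterating the branching rule.
\<close>
lemma vertex_F: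
  assumes n: "n \<ge> 1" and p: "part n p"
    and a: "\<And>j k. j \<in> {1..n} \<Longrightarrow> k \<in> {1..n} \<Longrightarrow> a j / a k = q powi (p j - p k) * h powi (int j - int k)"
    and \<zeta>: "\<And>i. i \<in> {1..n} \<Longrightarrow> \<zeta> i \<noteq> 0"
  shows "vertex n q h \<zeta> (\<lambda>i k. 1 / a k) * lead n p * (\<Prod>i\<in>{1..n}. \<zeta> i powi p i) = F n p \<zeta>"
proof -
  let ?x = "\<lambda>(i::nat) k. 1 / a k"
  have term0: "vertex_term n q h \<zeta> ?x d = 0" if d: "d \<in> degrees n - degrees_of n p ` GT_patterns n p" for d
  proof -
    have "pattern_of n p d \<notin> GT_patterns n p"
      using d degrees_of_pattern_of[of d n p] by (metis DiffE image_eqI)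
    then obtain i where "i \<in> {1..<n}" "pattern_weight i (pattern_of n p d) = 0" using pattern_of_GT_patterns[OF p] d by blast
    then have "(\<Prod>i\<in>{1..<n}. (\<zeta> i / \<zeta> (Suc i)) ^ (\<Sum>j=1..i. d i j) * (pattern_weight i (pattern_of n p d) / pattern_weight i (base_pattern n p))) = 0"
      by (intro prod_zero) (auto intro!: bexI[of _ i])
    moreover have "d n j = 0" for j using d by (auto simp: degrees_def)
    ultimately show ?thesis using vertex_term_eq[OF p _ a, of d \<zeta>] by simp
  qed
  have "vertex n q h \<zeta> ?x = (\<Sum>\<^sub>\<infinity>d\<in>degrees_of n p ` GT_patterns n p. vertex_term n q h \<zeta> ?x d)"
    unfolding vertex_def by (rule infsum_cong_neutral) (use term0 degrees_of_degrees in auto)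
  also have "\<dots> = (\<Sum>d\<in>degrees_of n p ` GT_patterns n p. vertex_term n q h \<zeta> ?x d)"
    by (rule infsum_finite) (use finite_GT_patterns[OF p] in auto)
  also have "\<dots> = (\<Sum>Q\<in>GT_patterns n p. vertex_term n q h \<zeta> ?x (degrees_of n p Q))"
    by (subst sum.reindex) (use pattern_of_degrees_of[OF p] in \<open>auto intro!: inj_on_inverseI[of _ "pattern_of n p"]\<close>)
  finally have V: "vertex n q h \<zeta> ?x = (\<Sum>Q\<in>GT_patterns n p. vertex_term n q h \<zeta> ?x (degrees_of n p Q))" .
  have one: "vertex_term n q h \<zeta> ?x (degrees_of n p Q) * lead n p * (\<Prod>i\<in>{1..n}. \<zeta> i powi p i) =
     branch_norm n p * (\<Prod>i\<in>{1..<n}. pattern_weight i Q) * (\<Prod>i\<in>{1..n}. \<zeta> i ^ pattern_content n Q i)" if Q: "Q \<in> GT_patterns n p" for Q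
  proof -
    define e where "e i = sum (Q i) {1..i} - sum p {1..i}" for i
    have e0: "e 0 = 0" "e n = 0" using Q by (auto simp: e_def GT_patterns_def)
    have ed: "int (\<Sum>j=1..i. degrees_of n p Q i j) = e i" if "i \<in> {1..<n}" for i
    proof -
      have "(\<Sum>j=1..i. int (degrees_of n p Q i j)) = (\<Sum>j=1..i. Q i j - p j)"
        by (rule sum.cong) (use GT_patterns_ge[OF Q] that in \<open>auto simp: degrees_of_def\<close>)
      then show ?thesis by (simp add: e_def sum_subtractf)
    qed
    obtain m where m: "n = Suc m" using n by (cases n) auto
    have T: "(\<Prod>i\<in>{1..<n}. (\<zeta> i / \<zeta> (Suc i)) ^ (\<Sum>j=1..i. degrees_of n p Q i j)) = (\<Prod>i\<in>{1..n}. \<zeta> i powi (e i - e (i - 1)))"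
    proof -
      have "(\<Prod>i\<in>{1..<n}. (\<zeta> i / \<zeta> (Suc i)) ^ (\<Sum>j=1..i. degrees_of n p Q i j)) = (\<Prod>i\<in>{1..<n}. (\<zeta> i / \<zeta> (Suc i)) powi e i)"
        by (rule prod.cong) (simp_all add: ed[symmetric] del: of_nat_sum)
      also have "(\<Prod>i\<in>{1..<n}. (\<zeta> i / \<zeta> (Suc i)) powi e i) = (\<Prod>i\<in>{1..m}. \<zeta> i powi (e i - e (i - 1))) * \<zeta> (Suc m) powi (- e m)"
      proof -
        have "{1..<n} = {1..m}" using m by auto
        then show ?thesis using telescope_ratio[of m \<zeta> e] \<zeta> e0 m by (simp add: power_int_minus field_simps)
      qed
      also have "\<dots> = (\<Prod>i\<in>{1..n}. \<zeta> i powi (e i - e (i - 1)))"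
        using e0 by (simp add: m)
      finally show ?thesis .
    qed
    have M: "(\<Prod>i\<in>{1..n}. \<zeta> i powi (e i - e (i - 1))) * (\<Prod>i\<in>{1..n}. \<zeta> i powi p i) = (\<Prod>i\<in>{1..n}. \<zeta> i ^ pattern_content n Q i)"
      unfolding prod.distrib[symmetric]
    proof (rule prod.cong)
      fix i assume i: "i \<in> {1..n}"
      obtain k where k: "i = Suc k" using i by (cases i) auto
      have "e i - e (i - 1) + p i = int (pattern_content n Q i)"
        unfolding pattern_content_int[OF p Q i] by (simp add: e_def k)
      then show "\<zeta> i powi (e i - e (i - 1)) * \<zeta> i powi p i = \<zeta> i ^ pattern_content n Q i"
        using \<zeta>[OF i] by (simp add: power_int_add[symmetric])
    qed simp
    have W: "(\<Prod>i\<in>{1..<n}. pattern_weight i Q / pattern_weight i (base_pattern n p)) * lead n p = branch_norm n p * (\<Prod>i\<in>{1..<n}. pattern_weight i Q)"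
      unfolding lead_def prod_dividef using pattern_weight_base_pattern_nz[OF p] by (simp add: mult.commute)
    have dn: "degrees_of n p Q n j = 0" for j by (simp add: degrees_of_def)
    have "vertex_term n q h \<zeta> ?x (degrees_of n p Q) * lead n p * (\<Prod>i\<in>{1..n}. \<zeta> i powi p i) =
      ((\<Prod>i\<in>{1..<n}. (\<zeta> i / \<zeta> (Suc i)) ^ (\<Sum>j=1..i. degrees_of n p Q i j)) * (\<Prod>i\<in>{1..n}. \<zeta> i powi p i)) * ((\<Prod>i\<in>{1..<n}. pattern_weight i Q / pattern_weight i (base_pattern n p)) * lead n p)"
    proof -
      have "vertex_term n q h \<zeta> ?x (degrees_of n p Q) = (\<Prod>i\<in>{1..<n}. (\<zeta> i / \<zeta> (Suc i)) ^ (\<Sum>j=1..i. degrees_of n p Q i j) * (pattern_weight i (pattern_of n p (degrees_of n p Q)) / pattern_weight i (base_pattern n p)))"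
        by (rule vertex_term_eq[OF p]) (use dn a in auto)
      then show ?thesis unfolding pattern_of_degrees_of[OF p Q] prod.distrib by (simp only: mult_ac)
    qed
    then show ?thesis unfolding T M W by (simp only: mult_ac)
  qed
  show ?thesis
    unfolding V F_monomials[OF p n] sum_distrib_right by (intro sum.cong refl one)
qed

end

section \<open>Symmetric polynomials\<close>

lemma base_expansion_unique:
  fixes \<alpha> \<beta> :: "nat \<Rightarrow> nat" and B :: nat
  assumes "\<And>i. i \<in> {1..n} \<Longrightarrow> \<alpha> i < B" "\<And>i. i \<in> {1..n} \<Longrightarrow> \<beta> i < B"
    and "(\<Sum>i\<in>{1..n}. \<alpha> i * B ^ i) = (\<Sum>i\<in>{1..n}. \<beta> i * B ^ i)" and "i \<in> {1..n}"
  shows "\<alpha> i = \<beta> i"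
  using assms
proof (induction n arbitrary: i)
  case (Suc n)
  have bound: "(\<Sum>i\<in>{1..m}. \<gamma> i * B ^ i) < B ^ Suc m" if "\<And>i. i \<in> {1..m} \<Longrightarrow> \<gamma> i < B" "B > 0" for \<gamma> m
    using that
  proof (induction m)
    case (Suc m)
    have "(\<Sum>i\<in>{1..Suc m}. \<gamma> i * B ^ i) < B ^ Suc m + \<gamma> (Suc m) * B ^ Suc m" using Suc by simp
    also have "\<dots> = Suc (\<gamma> (Suc m)) * B ^ Suc m" by simp
    also have "\<dots> \<le> B * B ^ Suc m" using Suc.prems(1)[of "Suc m"] by (intro mult_right_mono) auto
    finally show ?case by simp
  qed simp
  have B: "B > 0" using Suc.prems(1)[of "Suc n"] by simp
  let ?S = "\<lambda>\<gamma> :: nat \<Rightarrow> nat. \<Sum>i\<in>{1..n}. \<gamma> i * B ^ i"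
  have e: "?S \<alpha> + \<alpha> (Suc n) * B ^ Suc n = ?S \<beta> + \<beta> (Suc n) * B ^ Suc n" using Suc.prems(3) by simp
  have lt: "?S \<alpha> < B ^ Suc n" "?S \<beta> < B ^ Suc n" using bound[of n \<alpha>] bound[of n \<beta>] Suc.prems(1,2) B by auto
  have top: "\<alpha> (Suc n) = \<beta> (Suc n)"
  proof -
    have "(?S \<alpha> + \<alpha> (Suc n) * B ^ Suc n) div B ^ Suc n = \<alpha> (Suc n)" using lt B by simp
    moreover have "(?S \<beta> + \<beta> (Suc n) * B ^ Suc n) div B ^ Suc n = \<beta> (Suc n)" using lt B by simp
    ultimately show ?thesis using e by metis
  qed
  show ?case
  proof (cases "i = Suc n")
    case False
    show ?thesis by (rule Suc.IH) (use Suc.prems e top False in auto)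
  qed (use top in simp)
qed simp

text \<open>
  A permutation that maximizes the sum of \<open>\<alpha> (\<pi> i) * (n - i)\<close> sorts, as exchanging two neighbours in
  the wrong order would increase it.
\<close>
lemma exists_sorting_permutation:
  fixes \<alpha> :: "nat \<Rightarrow> nat"
  shows "\<exists>\<pi>. \<pi> permutes {1..n} \<and> (\<forall>i\<in>{1..<n}. \<alpha> (\<pi> (Suc i)) \<le> \<alpha> (\<pi> i))"
proof -
  let ?N = "{1..n}"
  define f where "f \<pi> = (\<Sum>i\<in>?N. \<alpha> (\<pi> i) * (n - i))" for \<pi>
  have fin: "finite {\<pi>. \<pi> permutes ?N}" by (rule finite_permutations) simp
  have ne: "{\<pi>. \<pi> permutes ?N} \<noteq> {}" using permutes_id by blast
  obtain \<pi> where \<pi>: "\<pi> permutes ?N" and max: "\<And>\<pi>'. \<pi>' permutes ?N \<Longrightarrow> f \<pi>' \<le> f \<pi>"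
  proof -
    let ?S = "f ` {\<pi>. \<pi> permutes ?N}"
    have "Max ?S \<in> ?S" using fin ne by (intro Max_in) auto
    then obtain \<pi> where \<pi>: "\<pi> permutes ?N" "Max ?S = f \<pi>" by auto
    have "f \<pi>' \<le> f \<pi>" if "\<pi>' permutes ?N" for \<pi>'
      unfolding \<pi>(2)[symmetric] using fin that by (intro Max_ge) auto
    then show ?thesis using \<pi>(1) that by blast
  qed
  have "\<alpha> (\<pi> (Suc i)) \<le> \<alpha> (\<pi> i)" if i: "i \<in> {1..<n}" for i
  proof (rule ccontr)
    assume "\<not> \<alpha> (\<pi> (Suc i)) \<le> \<alpha> (\<pi> i)"
    then have lt: "\<alpha> (\<pi> i) < \<alpha> (\<pi> (Suc i))" by simp
    define \<pi>' where "\<pi>' = \<pi> \<circ> Transposition.transpose i (Suc i)"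
    have "\<pi>' permutes ?N"
      unfolding \<pi>'_def by (intro permutes_compose permutes_swap_id \<pi>) (use i in auto)
    then have le: "f \<pi>' \<le> f \<pi>" by (rule max)
    have split: "f \<sigma> = \<alpha> (\<sigma> i) * (n - i) + (\<alpha> (\<sigma> (Suc i)) * (n - Suc i) + (\<Sum>j\<in>?N - {i} - {Suc i}. \<alpha> (\<sigma> j) * (n - j)))" for \<sigma>
      unfolding f_def using i by (subst sum.remove[of _ i], simp, simp, subst sum.remove[of _ "Suc i"]) auto
    have rest: "(\<Sum>j\<in>?N - {i} - {Suc i}. \<alpha> (\<pi>' j) * (n - j)) = (\<Sum>j\<in>?N - {i} - {Suc i}. \<alpha> (\<pi> j) * (n - j))"
      by (rule sum.cong) (auto simp: \<pi>'_def transpose_def)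
    obtain m where m: "n - i = Suc m" "n - Suc i = m" using i by (metis Suc_diff_Suc atLeastLessThan_iff)
    show False using le lt unfolding split[of \<pi>] split[of \<pi>'] rest m by (simp add: \<pi>'_def)
  qed
  then show ?thesis using \<pi> by blast
qed

text \<open>
  Rearrangements have level sets of the same sizes, and these determine a decreasing sequence.
\<close>
lemma decreasing_rearrangement_unique:
  fixes \<kappa> \<kappa>' :: "nat \<Rightarrow> nat"
  assumes dec: "\<And>i j. 1 \<le> i \<Longrightarrow> i \<le> j \<Longrightarrow> j \<le> n \<Longrightarrow> \<kappa> j \<le> \<kappa> i"
    and dec': "\<And>i j. 1 \<le> i \<Longrightarrow> i \<le> j \<Longrightarrow> j \<le> n \<Longrightarrow> \<kappa>' j \<le> \<kappa>' i"
    and \<pi>: "\<pi> permutes {1..n}" "\<kappa>' = \<kappa> \<circ> \<pi>" and i: "i \<in> {1..n}"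
  shows "\<kappa> i = \<kappa>' i"
proof -
  let ?N = "{1..n}"
  have card: "card {j \<in> ?N. t \<le> \<kappa>' j} = card {j \<in> ?N. t \<le> \<kappa> j}" for t
  proof -
    have "\<pi> ` {j \<in> ?N. t \<le> \<kappa>' j} = {j \<in> ?N. t \<le> \<kappa> j}"
    proof (intro equalityI subsetI)
      fix j assume j: "j \<in> {j \<in> ?N. t \<le> \<kappa> j}"
      then have "j \<in> \<pi> ` ?N" using permutes_image[OF \<pi>(1)] by auto
      then obtain k where "k \<in> ?N" "j = \<pi> k" by auto
      then show "j \<in> \<pi> ` {j \<in> ?N. t \<le> \<kappa>' j}" using j \<pi>(2) by auto
    qed (use permutes_in_image[OF \<pi>(1)] \<pi>(2) in auto)
    moreover have "inj_on \<pi> {j \<in> ?N. t \<le> \<kappa>' j}" using permutes_inj[OF \<pi>(1)] inj_on_subset by blast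
    ultimately show ?thesis using card_image[of \<pi> "{j \<in> ?N. t \<le> \<kappa>' j}"] by simp
  qed
  have key: "False" if "\<And>i j. 1 \<le> i \<Longrightarrow> i \<le> j \<Longrightarrow> j \<le> n \<Longrightarrow> a j \<le> a i" "\<And>i j. 1 \<le> i \<Longrightarrow> i \<le> j \<Longrightarrow> j \<le> n \<Longrightarrow> b j \<le> b i"
    "a i < b i" "card {j \<in> ?N. b i \<le> b j} = card {j \<in> ?N. b i \<le> a j}" for a b :: "nat \<Rightarrow> nat"
  proof -
    have "{1..i} \<subseteq> {j \<in> ?N. b i \<le> b j}" using that(2) i by auto
    then have "i \<le> card {j \<in> ?N. b i \<le> b j}" using card_mono[of "{j \<in> ?N. b i \<le> b j}" "{1..i}"] by simp
    moreover have "{j \<in> ?N. b i \<le> a j} \<subseteq> {1..<i}"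
    proof
      fix j assume j: "j \<in> {j \<in> ?N. b i \<le> a j}"
      have "\<not> i \<le> j" using that(1)[of i j] that(3) j i by auto
      then show "j \<in> {1..<i}" using j by auto
    qed
    then have "card {j \<in> ?N. b i \<le> a j} \<le> i - 1" using card_mono[of "{1..<i}"] by fastforce
    ultimately have "i \<le> i - 1" unfolding that(4) by (rule le_trans)
    moreover have "1 \<le> i" using i by simp
    ultimately show False by arith
  qed
  have "\<not> \<kappa> i < \<kappa>' i" by (intro notI, rule key[of \<kappa> \<kappa>'], erule (2) dec, erule (2) dec') (assumption, rule card)
  moreover have "\<not> \<kappa>' i < \<kappa> i" by (intro notI, rule key[of \<kappa>' \<kappa>], erule (2) dec', erule (2) dec) (assumption, rule card[symmetric])
  ultimately show ?thesis by simp
qed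

definition compositions :: "nat \<Rightarrow> nat \<Rightarrow> (nat \<Rightarrow> nat) set" where
  "compositions n k = {\<alpha>. (\<forall>i. i \<notin> {1..n} \<longrightarrow> \<alpha> i = 0) \<and> sum \<alpha> {1..n} = k}"

lemma finite_compositions: "finite (compositions n k)"
proof (rule finite_subset)
  show "compositions n k \<subseteq> {\<alpha>. \<forall>i. (i \<in> {1..n} \<longrightarrow> \<alpha> i \<in> {0..k}) \<and> (i \<notin> {1..n} \<longrightarrow> \<alpha> i = 0)}"
    using member_le_sum[of _ "{1..n}"] by (fastforce simp: compositions_def)
  show "finite {\<alpha> :: nat \<Rightarrow> nat. \<forall>i. (i \<in> {1..n} \<longrightarrow> \<alpha> i \<in> {0..k}) \<and> (i \<notin> {1..n} \<longrightarrow> \<alpha> i = 0)}"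
    by (intro finite_set_of_finite_funs) auto
qed

lemma is_partition_antimono:
  assumes "is_partition n k \<kappa>" "1 \<le> i" "i \<le> j" "j \<le> n"
  shows "\<kappa> j \<le> \<kappa> i"
  using assms(3,4)
proof (induction rule: dec_induct)
  case (step m)
  have "\<kappa> (Suc m) \<le> \<kappa> m" using assms(1,2) step by (auto simp: is_partition_def)
  then show ?case using step by simp
qed simp

lemma is_partition_compositions: "is_partition n k \<kappa> \<longleftrightarrow> \<kappa> \<in> compositions n k \<and> (\<forall>i\<in>{1..<n}. \<kappa> (Suc i) \<le> \<kappa> i)"
  by (auto simp: is_partition_def compositions_def)

lemma compositions_permute: "\<alpha> \<in> compositions n k \<Longrightarrow> \<pi> permutes {1..n} \<Longrightarrow> \<alpha> \<circ> \<pi> \<in> compositions n k"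
proof -
  assume a: "\<alpha> \<in> compositions n k" "\<pi> permutes {1..n}"
  have "sum (\<alpha> \<circ> \<pi>) {1..n} = sum \<alpha> {1..n}" using sum.permute[OF a(2), of \<alpha>] by simp
  moreover have "(\<alpha> \<circ> \<pi>) i = 0" if "i \<notin> {1..n}" for i
    using a that permutes_not_in[OF a(2) that] by (simp add: compositions_def)
  ultimately show ?thesis using a by (auto simp: compositions_def)
qed

text \<open>
  Every orbit of compositions under permutations contains exactly one partition.
\<close>
lemma sum_compositions_symmetric:
  fixes c :: "(nat \<Rightarrow> nat) \<Rightarrow> complex"
  assumes sym: "\<And>\<alpha> \<pi>. \<alpha> \<in> compositions n k \<Longrightarrow> \<pi> permutes {1..n} \<Longrightarrow> c (\<alpha> \<circ> \<pi>) = c \<alpha>"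
  shows "(\<Sum>\<alpha>\<in>compositions n k. c \<alpha> * (\<Prod>i=1..n. x i ^ \<alpha> i)) = (\<Sum>\<kappa>\<in>{\<kappa>. is_partition n k \<kappa>}. c \<kappa> * monomial_sym n \<kappa> x)"
proof -
  define orb where "orb \<kappa> = (\<lambda>\<pi>. \<kappa> \<circ> \<pi>) ` {\<pi>. \<pi> permutes {1..n}}" for \<kappa> :: "nat \<Rightarrow> nat"
  have part_sub: "{\<kappa>. is_partition n k \<kappa>} \<subseteq> compositions n k" by (auto simp: is_partition_compositions)
  have orb_sub: "orb \<kappa> \<subseteq> compositions n k" if "\<kappa> \<in> compositions n k" for \<kappa>
    using compositions_permute[OF that] by (auto simp: orb_def)
  have un: "compositions n k = (\<Union>\<kappa>\<in>{\<kappa>. is_partition n k \<kappa>}. orb \<kappa>)"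
  proof (intro equalityI subsetI)
    fix \<alpha> assume \<alpha>: "\<alpha> \<in> compositions n k"
    obtain \<pi> where \<pi>: "\<pi> permutes {1..n}" "\<forall>i\<in>{1..<n}. \<alpha> (\<pi> (Suc i)) \<le> \<alpha> (\<pi> i)"
      using exists_sorting_permutation by blast
    then have "is_partition n k (\<alpha> \<circ> \<pi>)" using compositions_permute[OF \<alpha>] by (simp add: is_partition_compositions)
    moreover have "\<alpha> = (\<alpha> \<circ> \<pi>) \<circ> inv \<pi>" using permutes_inv_o(1)[OF \<pi>(1)] by (simp add: o_assoc[symmetric])
    ultimately show "\<alpha> \<in> (\<Union>\<kappa>\<in>{\<kappa>. is_partition n k \<kappa>}. orb \<kappa>)"
      using permutes_inv[OF \<pi>(1)] by (auto simp: orb_def)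
  qed (use orb_sub part_sub in blast)
  have disj: "\<kappa> = \<kappa>'" if k: "is_partition n k \<kappa>" "is_partition n k \<kappa>'" "\<alpha> \<in> orb \<kappa>" "\<alpha> \<in> orb \<kappa>'" for \<kappa> \<kappa>' \<alpha>
  proof -
    obtain \<pi> \<pi>' where p: "\<pi> permutes {1..n}" "\<pi>' permutes {1..n}" "\<kappa> \<circ> \<pi> = \<kappa>' \<circ> \<pi>'" using k by (auto simp: orb_def)
    have "\<kappa>' = \<kappa>' \<circ> (\<pi>' \<circ> inv \<pi>')" using permutes_inv_o(1)[OF p(2)] by simp
    also have "\<dots> = \<kappa> \<circ> (\<pi> \<circ> inv \<pi>')" using p(3) by (simp add: o_assoc)
    finally have e: "\<kappa>' = \<kappa> \<circ> (\<pi> \<circ> inv \<pi>')" .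
    have pp: "\<pi> \<circ> inv \<pi>' permutes {1..n}" by (intro permutes_compose permutes_inv p)
    have "\<kappa> i = \<kappa>' i" if "i \<in> {1..n}" for i
      by (rule decreasing_rearrangement_unique[OF _ _ pp e that]) (use is_partition_antimono k in blast)+
    moreover have "\<kappa> i = \<kappa>' i" if "i \<notin> {1..n}" for i using k that by (auto simp: is_partition_def)
    ultimately show ?thesis by blast
  qed
  have "(\<Sum>\<alpha>\<in>compositions n k. c \<alpha> * (\<Prod>i=1..n. x i ^ \<alpha> i)) = (\<Sum>\<kappa>\<in>{\<kappa>. is_partition n k \<kappa>}. \<Sum>\<alpha>\<in>orb \<kappa>. c \<alpha> * (\<Prod>i=1..n. x i ^ \<alpha> i))"
    unfolding un
  proof (rule sum.UNION_disjoint)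
    show "finite {\<kappa>. is_partition n k \<kappa>}" using finite_subset[OF part_sub finite_compositions] .
    show "\<forall>\<kappa>\<in>{\<kappa>. is_partition n k \<kappa>}. finite (orb \<kappa>)" by (auto simp: orb_def finite_permutations)
    show "\<forall>\<kappa>\<in>{\<kappa>. is_partition n k \<kappa>}. \<forall>\<kappa>'\<in>{\<kappa>. is_partition n k \<kappa>}. \<kappa> \<noteq> \<kappa>' \<longrightarrow> orb \<kappa> \<inter> orb \<kappa>' = {}"
      using disj by blast
  qed
  also have "\<dots> = (\<Sum>\<kappa>\<in>{\<kappa>. is_partition n k \<kappa>}. c \<kappa> * monomial_sym n \<kappa> x)"
  proof (rule sum.cong)
    fix \<kappa> assume "\<kappa> \<in> {\<kappa>. is_partition n k \<kappa>}"
    then have \<kappa>: "\<kappa> \<in> compositions n k" using part_sub by blast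
    show "(\<Sum>\<alpha>\<in>orb \<kappa>. c \<alpha> * (\<Prod>i=1..n. x i ^ \<alpha> i)) = c \<kappa> * monomial_sym n \<kappa> x"
      unfolding monomial_sym_def orb_def[symmetric] sum_distrib_left
      by (rule sum.cong) (use sym[OF \<kappa>] in \<open>auto simp: orb_def\<close>)
  qed simp
  finally show ?thesis .
qed

context macdonald_params
begin

lemma countable_roots:
  fixes P :: "complex poly"
  assumes "P \<noteq> 0"
  shows "countable {y. poly P y = 0}"
  using poly_roots_finite[OF assms] by (rule countable_finite)

text \<open>
  Kronecker substitution: with a base \<open>B\<close> above all exponents, \<open>x i = y ^ (B ^ i)\<close> turns the
  monomials into distinct powers of \<open>y\<close>, and all but countably many \<open>y\<close> give an admissible point.
\<close>
lemma monomials_independent: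
  assumes fin: "finite A" and supp: "\<And>\<alpha> i. \<alpha> \<in> A \<Longrightarrow> i \<notin> {1..n} \<Longrightarrow> \<alpha> i = 0"
    and zero: "\<And>x. q_generic n x \<Longrightarrow> (\<Sum>\<alpha>\<in>A. c \<alpha> * (\<Prod>i\<in>{1..n}. x i ^ \<alpha> i)) = 0" and \<alpha>: "\<alpha> \<in> A"
  shows "c \<alpha> = 0"
proof -
  let ?N = "{1..n}"
  define B where "B = Suc (Suc (\<Sum>\<alpha>\<in>A. \<Sum>i\<in>?N. \<alpha> i))"
  have B: "\<beta> i < B" if "\<beta> \<in> A" "i \<in> ?N" for \<beta> i
  proof -
    have "\<beta> i \<le> (\<Sum>i\<in>?N. \<beta> i)" using that by (intro member_le_sum) auto
    also have "\<dots> \<le> (\<Sum>\<alpha>\<in>A. \<Sum>i\<in>?N. \<alpha> i)" by (rule member_le_sum[OF that(1), of "\<lambda>\<alpha>. \<Sum>i\<in>?N. \<alpha> i"]) (use fin in auto)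
    finally show ?thesis by (simp add: B_def)
  qed
  define E where "E \<alpha> = (\<Sum>i\<in>?N. \<alpha> i * B ^ i)" for \<alpha> :: "nat \<Rightarrow> nat"
  have E: "\<beta> = \<gamma>" if "\<beta> \<in> A" "\<gamma> \<in> A" "E \<beta> = E \<gamma>" for \<beta> \<gamma>
  proof
    fix i
    show "\<beta> i = \<gamma> i"
    proof (cases "i \<in> ?N")
      case True
      show ?thesis by (rule base_expansion_unique[where B = B, OF _ _ _ True]) (use B that E_def in auto)
    next
      case False
      then show ?thesis using supp[OF that(1) False] supp[OF that(2) False] by simp
    qed
  qed
  define P where "P = (\<Sum>\<alpha>\<in>A. monom (c \<alpha>) (E \<alpha>))"
  \<comment> \<open>The points at which two of the \<open>x i\<close> are related by powers of \<open>q\<close>.\<close>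
  define R where "R i j a b = monom (q ^ a) (B ^ i) - monom (q ^ b) (B ^ j)" for i j a b
  define bad where "bad = insert 0 (\<Union>i\<in>?N. \<Union>j\<in>?N - {i}. \<Union>a. \<Union>b. {y. poly (R i j a b) y = 0})"
  have R: "R i j a b \<noteq> 0" if "i \<noteq> j" for i j a b
  proof
    assume "R i j a b = 0"
    then have "coeff (R i j a b) (B ^ i) = 0" by simp
    moreover have "B ^ i \<noteq> B ^ j" using that power_inject_exp[of B i j] by (simp add: B_def)
    ultimately show False using q0 by (simp add: R_def)
  qed
  have cb: "countable bad"
    unfolding bad_def by (intro countable_insert countable_UN countable_roots R) auto
  have van: "poly P y = 0" if y: "y \<notin> bad" for y
  proof -
    define x where "x i = y ^ (B ^ i)" for i :: nat
    have "q_generic n x"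
      unfolding q_generic_def
    proof (intro ballI conjI impI allI)
      fix i j a b assume "i \<in> ?N" "j \<in> ?N" "i \<noteq> j"
      then have "poly (R i j a b) y \<noteq> 0" using y by (auto simp: bad_def)
      then show "q ^ a * x i \<noteq> q ^ b * x j" by (simp add: R_def x_def poly_monom)
    qed (use y in \<open>auto simp: x_def bad_def\<close>)
    then have "(\<Sum>\<alpha>\<in>A. c \<alpha> * (\<Prod>i\<in>?N. x i ^ \<alpha> i)) = 0" by (rule zero)
    moreover have "(\<Prod>i\<in>?N. x i ^ \<alpha> i) = y ^ E \<alpha>" for \<alpha>
      by (simp add: x_def E_def power_sum mult.commute flip: power_mult)
    ultimately show ?thesis by (simp add: P_def poly_sum poly_monom)
  qed
  have "P = 0"
  proof (rule ccontr)
    assume "P \<noteq> 0"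
    then have "countable ({y. poly P y = 0} \<union> bad)" using cb countable_roots by blast
    moreover have "{y. poly P y = 0} \<union> bad = UNIV" using van by blast
    ultimately show False using uncountable_UNIV_complex by simp
  qed
  then have "coeff P (E \<alpha>) = 0" by simp
  also have "coeff P (E \<alpha>) = (\<Sum>\<beta>\<in>{\<alpha>}. c \<beta>)"
    unfolding P_def coeff_sum coeff_monom
    by (rule sum.mono_neutral_cong_right) (use fin \<alpha> E in auto)
  finally show ?thesis by simp
qed

end

section \<open>Macdonald polynomials and the normalized vertex function\<close>

lemma qtheta_shift:
  assumes q: "q \<noteq> 0" "norm q < 1" and x: "x \<noteq> 0"
  shows "qtheta (q * x) q * x = - qtheta x q"
proof (cases "x = 1")
  case True
  have "qinf 1 q = 0" using qinf_step[OF q(2), of 1] by simp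
  then show ?thesis using True q by (simp add: qtheta_def)
next
  case False
  have a: "qinf x q = (1 - x) * qinf (q * x) q" by (rule qinf_step[OF q(2)])
  have b: "qinf (1 / x) q = (1 - 1 / x) * qinf (q / x) q" using qinf_step[OF q(2), of "1 / x"] by simp
  have "qtheta (q * x) q = qinf (q * x) q * qinf (1 / x) q" using q by (simp add: qtheta_def)
  then have "qtheta (q * x) q * x = qinf (q * x) q * qinf (q / x) q * (x - 1)"
    unfolding b using x by (simp add: field_simps)
  then show ?thesis unfolding qtheta_def a by (simp add: algebra_simps)
qed

text \<open>
  Applied with \<open>m\<close> a part of the partition, this extracts from the theta prefactor the monomial by which
  the vertex differs from the polynomial.
\<close>
lemma qtheta_shift_power:
  assumes q: "q \<noteq> 0" "norm q < 1" and x: "x \<noteq> 0"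
  shows "qtheta x q = qtheta (q ^ m * x) q * (x ^ m * q ^ (m choose 2) * (- 1) ^ m)"
proof (induction m)
  case 0
  then show ?case by (simp add: binomial_eq_0)
next
  case (Suc m)
  have c: "Suc m choose 2 = m + (m choose 2)" by (simp add: numeral_2_eq_2)
  have "qtheta (q ^ m * x) q = - (qtheta (q ^ Suc m * x) q * (q ^ m * x))"
    using qtheta_shift[OF q, of "q ^ m * x"] q x by (simp add: mult.assoc)
  then show ?case unfolding c using Suc.IH by (simp add: power_add mult_ac)
qed

context macdonald_params
begin

definition monomial_coef :: "nat \<Rightarrow> (nat \<Rightarrow> int) \<Rightarrow> (nat \<Rightarrow> nat) \<Rightarrow> complex" where
  "monomial_coef n p \<alpha> = (\<Sum>Q\<in>{Q \<in> GT_patterns n p. pattern_content n Q = \<alpha>}. branch_norm n p * (\<Prod>i\<in>{1..<n}. pattern_weight i Q))"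

lemma pattern_content_compositions:
  assumes "part n p" "sum p {1..n} = int k" "Q \<in> GT_patterns n p"
  shows "pattern_content n Q \<in> compositions n k"
proof -
  have "(\<Sum>j\<in>{1..n}. int (pattern_content n Q j)) = int k"
    using pattern_content_partial_sum[OF assms(1,3), of n] assms(2,3) by (simp add: GT_patterns_def)
  then have "sum (pattern_content n Q) {1..n} = k" by (metis of_nat_eq_iff of_nat_sum)
  then show ?thesis by (auto simp: compositions_def pattern_content_def)
qed

lemma F_monomial_coef:
  assumes p: "part n p" "n \<ge> 1" and k: "sum p {1..n} = int k"
  shows "F n p x = (\<Sum>\<alpha>\<in>compositions n k. monomial_coef n p \<alpha> * (\<Prod>i=1..n. x i ^ \<alpha> i))"
proof -
  have "(\<Sum>\<alpha>\<in>compositions n k. monomial_coef n p \<alpha> * (\<Prod>i=1..n. x i ^ \<alpha> i)) =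
    (\<Sum>\<alpha>\<in>compositions n k. \<Sum>Q\<in>{Q \<in> GT_patterns n p. pattern_content n Q = \<alpha>}. (branch_norm n p * (\<Prod>i\<in>{1..<n}. pattern_weight i Q)) * (\<Prod>i\<in>{1..n}. x i ^ pattern_content n Q i))"
    unfolding monomial_coef_def sum_distrib_right by (intro sum.cong refl) auto
  also have "\<dots> = F n p x"
    unfolding F_monomials[OF p] by (rule sum.group[OF finite_GT_patterns[OF p(1)] finite_compositions]) (use pattern_content_compositions[OF p(1) k] in auto)
  finally show ?thesis by simp
qed

text \<open>
  From the symmetry of \<open>F n p\<close> at \<open>q\<close>-generic points.
\<close>
lemma monomial_coef_permute:
  assumes p: "part n p" "n \<ge> 1" and k: "sum p {1..n} = int k" and \<alpha>: "\<alpha> \<in> compositions n k" and \<pi>: "\<pi> permutes {1..n}"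
  shows "monomial_coef n p (\<alpha> \<circ> \<pi>) = monomial_coef n p \<alpha>"
proof -
  have "monomial_coef n p (\<alpha> \<circ> \<pi>) - monomial_coef n p \<alpha> = 0"
  proof (rule monomials_independent[where A = "compositions n k" and n = n and c = "\<lambda>\<alpha>. monomial_coef n p (\<alpha> \<circ> \<pi>) - monomial_coef n p \<alpha>", OF finite_compositions _ _ \<alpha>])
    fix x assume x: "q_generic n x"
    have "F n p (x \<circ> \<pi>) = (\<Sum>\<alpha>\<in>compositions n k. monomial_coef n p (\<alpha> \<circ> \<pi>) * (\<Prod>i=1..n. x i ^ \<alpha> i))"
      unfolding F_monomial_coef[OF p k]
    proof (rule sum.reindex_bij_witness[of _ "\<lambda>\<alpha>. \<alpha> \<circ> \<pi>" "\<lambda>\<alpha>. \<alpha> \<circ> inv \<pi>"])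
      fix \<alpha> assume "\<alpha> \<in> compositions n k"
      then show "\<alpha> \<circ> inv \<pi> \<in> compositions n k" "\<alpha> \<circ> \<pi> \<in> compositions n k" using compositions_permute permutes_inv[OF \<pi>] \<pi> by blast+
      show i: "\<alpha> \<circ> inv \<pi> \<circ> \<pi> = \<alpha>" "\<alpha> \<circ> \<pi> \<circ> inv \<pi> = \<alpha>" using permutes_inv_o[OF \<pi>] by (simp_all add: o_assoc[symmetric])
      have "(\<Prod>i=1..n. x i ^ (\<alpha> \<circ> inv \<pi>) i) = (\<Prod>i=1..n. (x \<circ> \<pi>) i ^ \<alpha> i)"
        using prod.permute[OF \<pi>, of "\<lambda>i. x i ^ (\<alpha> \<circ> inv \<pi>) i"] permutes_inverses(2)[OF \<pi>] by (simp add: o_def)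
      then show "monomial_coef n p (\<alpha> \<circ> inv \<pi> \<circ> \<pi>) * (\<Prod>i=1..n. x i ^ (\<alpha> \<circ> inv \<pi>) i) = monomial_coef n p \<alpha> * (\<Prod>i=1..n. (x \<circ> \<pi>) i ^ \<alpha> i)"
        by (simp only: i)
    qed
    then show "(\<Sum>\<alpha>\<in>compositions n k. (monomial_coef n p (\<alpha> \<circ> \<pi>) - monomial_coef n p \<alpha>) * (\<Prod>i\<in>{1..n}. x i ^ \<alpha> i)) = 0"
      using F_symmetric[OF p(1) x \<pi>] F_monomial_coef[OF p k, of x] by (simp add: left_diff_distrib sum_subtractf)
  qed (simp add: compositions_def)
  then show ?thesis by simp
qed

definition refl_perm :: "nat \<Rightarrow> nat \<Rightarrow> nat" where
  "refl_perm n i = (if i \<in> {1..n} then Suc n - i else i)"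

lemma refl_perm_permutes: "refl_perm n permutes {1..n}"
proof (rule bij_imp_permutes)
  show "bij_betw (refl_perm n) {1..n} {1..n}"
    by (rule bij_betw_byWitness[where f' = "refl_perm n"]) (auto simp: refl_perm_def)
qed (auto simp: refl_perm_def)

lemma sum_refl_tail:
  fixes \<kappa> :: "nat \<Rightarrow> nat"
  assumes "j \<le> n"
  shows "sum \<kappa> {1..n} = sum \<kappa> {1..j} + (\<Sum>i\<in>{1..n - j}. \<kappa> (Suc n - i))"
proof -
  have "{1..n} = {1..j} \<union> {Suc j..n}" using assms by auto
  then have "sum \<kappa> {1..n} = sum \<kappa> {1..j} + sum \<kappa> {Suc j..n}" by (simp add: sum.union_disjoint)
  also have "sum \<kappa> {Suc j..n} = (\<Sum>i\<in>{1..n - j}. \<kappa> (Suc n - i))"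
    by (rule sum.reindex_bij_witness[of _ "\<lambda>i. Suc n - i" "\<lambda>i. Suc n - i"]) (use assms in auto)
  finally show ?thesis .
qed

lemma GT_patterns_sum_ge:
  assumes Q: "Q \<in> GT_patterns n p" and i: "i \<le> n"
  shows "sum p {1..i} \<le> sum (Q i) {1..i}"
  by (rule sum_mono) (use GT_patterns_ge[OF Q] i in auto)

text \<open>
  The entries of a pattern are at least those of its top row in the same column, so the sum of the first
  \<open>i\<close> exponents is at least \<open>p 1 + \<dots> + p i\<close>.  Read from the other end, which the symmetry allows, this is
  dominance.
\<close>
lemma monomial_coef_dominated:
  assumes p: "part n p" "n \<ge> 1" and k: "sum p {1..n} = int k"
    and lam: "is_partition n k lam" "\<And>i. i \<in> {1..n} \<Longrightarrow> p i = int (lam (Suc n - i))"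
    and \<kappa>: "is_partition n k \<kappa>" and nz: "monomial_coef n p \<kappa> \<noteq> 0"
  shows "dominated n \<kappa> lam"
  unfolding dominated_def
proof
  fix j assume j: "j \<in> {1..n}"
  have kc: "\<kappa> \<in> compositions n k" using \<kappa> by (simp add: is_partition_compositions)
  have "monomial_coef n p (\<kappa> \<circ> refl_perm n) \<noteq> 0" using monomial_coef_permute[OF p k kc refl_perm_permutes] nz by simp
  then obtain Q where Q: "Q \<in> GT_patterns n p" "pattern_content n Q = \<kappa> \<circ> refl_perm n"
    unfolding monomial_coef_def by (metis (mono_tags, lifting) mem_Collect_eq sum.neutral)
  have "(\<Sum>i\<in>{1..n - j}. int (lam (Suc n - i))) = sum p {1..n - j}"
    by (rule sum.cong) (use lam(2) j in auto)
  also have "\<dots> \<le> sum (Q (n - j)) {1..n - j}" by (rule GT_patterns_sum_ge[OF Q(1)]) simp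
  also have "\<dots> = (\<Sum>i\<in>{1..n - j}. int (pattern_content n Q i))" using pattern_content_partial_sum[OF p(1) Q(1), of "n - j"] by simp
  also have "\<dots> = (\<Sum>i\<in>{1..n - j}. int (\<kappa> (Suc n - i)))" unfolding Q(2) by (rule sum.cong) (auto simp: refl_perm_def)
  finally have "(\<Sum>i\<in>{1..n - j}. int (lam (Suc n - i))) \<le> (\<Sum>i\<in>{1..n - j}. int (\<kappa> (Suc n - i)))" .
  then have "(\<Sum>i\<in>{1..n - j}. lam (Suc n - i)) \<le> (\<Sum>i\<in>{1..n - j}. \<kappa> (Suc n - i))"
    by (simp only: of_nat_sum[symmetric] of_nat_le_iff)
  moreover have "sum \<kappa> {1..n} = k" "sum lam {1..n} = k" using lam(1) \<kappa> by (auto simp: is_partition_def)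
  ultimately show "sum \<kappa> {1..j} \<le> sum lam {1..j}"
    using sum_refl_tail[of j n \<kappa>] sum_refl_tail[of j n lam] j by simp
qed

lemma base_pattern_GT_patterns: "part n p \<Longrightarrow> base_pattern n p \<in> GT_patterns n p"
proof (rule pattern_of_GT_patterns)
  show "(\<lambda>_ _. 0) \<in> degrees n" by (auto simp: degrees_def intro!: exI[of _ "\<lambda>k. k"])
qed (simp_all add: pattern_weight_base_pattern_nz)

text \<open>
  Only the pattern with constant columns has content \<open>p\<close>.
\<close>
lemma monomial_coef_lead:
  assumes p: "part n p" "n \<ge> 1" and k: "sum p {1..n} = int k"
    and lam: "is_partition n k lam" "\<And>i. i \<in> {1..n} \<Longrightarrow> p i = int (lam (Suc n - i))"
  shows "monomial_coef n p lam = lead n p"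
proof -
  have lc: "lam \<in> compositions n k" using lam(1) by (simp add: is_partition_compositions)
  have "{Q \<in> GT_patterns n p. pattern_content n Q = lam \<circ> refl_perm n} = {base_pattern n p}"
  proof (intro equalityI subsetI)
    fix Q assume "Q \<in> {Q \<in> GT_patterns n p. pattern_content n Q = lam \<circ> refl_perm n}"
    then have Q: "Q \<in> GT_patterns n p" "pattern_content n Q = lam \<circ> refl_perm n" by auto
    have row: "Q i j = p j" if "1 \<le> j" "j \<le> i" "i \<le> n" for i j
    proof -
      have "sum (Q i) {1..i} = (\<Sum>j\<in>{1..i}. int (pattern_content n Q j))" using pattern_content_partial_sum[OF p(1) Q(1) that(3)] by simp
      also have "\<dots> = sum p {1..i}" unfolding Q(2) by (rule sum.cong) (use that lam(2) in \<open>auto simp: refl_perm_def\<close>)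
      finally have "(\<Sum>j\<in>{1..i}. Q i j - p j) = 0" by (simp add: sum_subtractf)
      then have "\<forall>j\<in>{1..i}. Q i j - p j = 0"
        by (subst (asm) sum_nonneg_eq_0_iff) (use GT_patterns_ge[OF Q(1)] that in auto)
      then show ?thesis using that by simp
    qed
    have "degrees_of n p Q = (\<lambda>_ _. 0)" unfolding degrees_of_def using row by (auto simp: fun_eq_iff)
    then have "Q = base_pattern n p" using pattern_of_degrees_of[OF p(1) Q(1)] by simp
    then show "Q \<in> {base_pattern n p}" by simp
  next
    fix Q assume "Q \<in> {base_pattern n p}"
    then have Q: "Q = base_pattern n p" by simp
    have "pattern_content n Q i = (lam \<circ> refl_perm n) i" for i
    proof (cases "i \<in> {1..n}")
      case True
      then obtain m where m: "i = Suc m" by (cases i) auto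
      have 1: "sum (Q l) {1..l} = sum p {1..l}" if "l \<le> n" for l
        by (rule sum.cong) (use that in \<open>auto simp: Q pattern_of_def\<close>)
      have "sum (Q i) {1..i} - sum (Q (i - 1)) {1..i - 1} = p i"
        using 1[of "Suc m"] 1[of m] True unfolding m by simp
      then show ?thesis using True lam(2)[OF True] by (simp add: pattern_content_def refl_perm_def)
    next
      case False
      then have "lam i = 0" using lam(1) by (auto simp: is_partition_def)
      then show ?thesis using False by (auto simp: pattern_content_def refl_perm_def)
    qed
    then show "Q \<in> {Q \<in> GT_patterns n p. pattern_content n Q = lam \<circ> refl_perm n}" using base_pattern_GT_patterns[OF p(1)] Q by auto
  qed
  then have "monomial_coef n p (lam \<circ> refl_perm n) = lead n p" by (simp add: monomial_coef_def lead_def)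
  then show ?thesis using monomial_coef_permute[OF p k lc refl_perm_permutes] by simp
qed

lemma tendsto_F:
  assumes "\<And>i. ((\<lambda>e. y e i) \<longlongrightarrow> y0 i) net"
  shows "((\<lambda>e. F n p (y e)) \<longlongrightarrow> F n p y0) net"
proof (induction n arbitrary: p)
  case (Suc n)
  then show ?case unfolding F.simps by (intro tendsto_intros assms)
qed simp

text \<open>
  The points \<open>\<zeta> i + e ^ Suc i\<close> are \<open>q\<close>-generic for all but countably many \<open>e\<close>, and both sides are
  continuous at \<open>e = 0\<close> since the denominators at \<open>\<zeta>\<close> are nonzero.
\<close>
lemma eigen_all_distinct:
  assumes eig: "\<And>x. q_generic n x \<Longrightarrow> macdonald_op n q h r (F n p) x = \<epsilon> * F n p x"
    and inj: "inj_on \<zeta> {1..n}"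
  shows "macdonald_op n q h r (F n p) \<zeta> = \<epsilon> * F n p \<zeta>"
proof -
  let ?N = "{1..n}"
  define x where "x e = (\<lambda>i. \<zeta> i + e ^ Suc i)" for e :: complex
  \<comment> \<open>Different exponents for different indices keep the \<open>R i j a b\<close> from vanishing identically.\<close>
  define R where "R i j a b = [:q ^ a * \<zeta> i - q ^ b * \<zeta> j:] + monom (q ^ a) (Suc i) - monom (q ^ b) (Suc j)" for i j a b
  define R0 where "R0 i = [:\<zeta> i:] + monom 1 (Suc i)" for i
  define bad where "bad = (\<Union>i\<in>?N. {e. poly (R0 i) e = 0}) \<union> (\<Union>i\<in>?N. \<Union>j\<in>?N - {i}. \<Union>a. \<Union>b. {e. poly (R i j a b) e = 0})"
  have R0: "R0 i \<noteq> 0" for i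
  proof
    assume "R0 i = 0"
    then have "coeff (R0 i) (Suc i) = 0" by simp
    then show False by (simp add: R0_def)
  qed
  have R: "R i j a b \<noteq> 0" if "i \<noteq> j" for i j a b
  proof
    assume "R i j a b = 0"
    then have "coeff (R i j a b) (Suc i) = 0" by simp
    then show False using that q0 by (simp add: R_def)
  qed
  have cb: "countable bad"
    unfolding bad_def by (intro countable_Un countable_UN countable_roots R R0) auto
  have gx: "q_generic n (x e)" if e: "e \<notin> bad" for e
    unfolding q_generic_def
  proof (intro ballI conjI impI allI)
    fix i j a b assume "i \<in> ?N" "j \<in> ?N" "i \<noteq> j"
    then have "poly (R i j a b) e \<noteq> 0" using e by (auto simp: bad_def)
    then show "q ^ a * x e i \<noteq> q ^ b * x e j" by (simp add: R_def x_def poly_monom algebra_simps)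
  next
    fix i assume "i \<in> ?N"
    then have "poly (R0 i) e \<noteq> 0" using e by (auto simp: bad_def)
    then show "x e i \<noteq> 0" by (simp add: R0_def x_def poly_monom)
  qed
  define D where "D e = macdonald_op n q h r (F n p) (x e) - \<epsilon> * F n p (x e)" for e
  have x0: "x 0 = \<zeta>" by (simp add: x_def)
  have lim: "((\<lambda>e. x e i) \<longlongrightarrow> \<zeta> i) (at 0 within S)" for i S
    unfolding x_def by (auto intro!: tendsto_eq_intros)
  have "(D \<longlongrightarrow> macdonald_op n q h r (F n p) \<zeta> - \<epsilon> * F n p \<zeta>) (at 0 within - bad)"
    unfolding D_def macdonald_op_def
  proof (intro tendsto_intros tendsto_F lim)
    fix I i j assume "I \<in> {I. I \<subseteq> ?N \<and> card I = r}" "i \<in> I" "j \<in> ?N - I"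
    then have "i \<in> ?N" "j \<in> ?N" "i \<noteq> j" by auto
    then show "\<zeta> i - \<zeta> j \<noteq> 0" using inj_onD[OF inj] by (metis eq_iff_diff_eq_0)
  next
    fix I i
    show "((\<lambda>e. if i \<in> I then q * x e i else x e i) \<longlongrightarrow> (if i \<in> I then q * \<zeta> i else \<zeta> i)) (at 0 within - bad)"
      by (intro tendsto_const_If tendsto_intros lim)
  qed
  moreover have "eventually (\<lambda>e. D e = 0) (at 0 within - bad)"
    unfolding eventually_at_filter using eig gx by (auto simp: D_def)
  ultimately have "((\<lambda>_. 0) \<longlongrightarrow> macdonald_op n q h r (F n p) \<zeta> - \<epsilon> * F n p \<zeta>) (at 0 within - bad)"
    by (rule Lim_transform_eventually)
  moreover have "\<not> trivial_limit (at 0 within - bad)"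
    unfolding trivial_limit_within islimpt_approachable not_not
  proof (intro allI impI)
    fix d :: real assume d: "d > 0"
    have "\<not> ball (0 :: complex) d \<subseteq> insert 0 bad"
      using uncountable_ball[OF d, of "0 :: complex"] countable_subset[of "ball 0 d" "insert 0 bad"] cb
      by (simp only: countable_insert_eq) (rule notI, simp)
    then obtain e where "e \<in> ball 0 d" "e \<notin> bad" "e \<noteq> 0" by blast
    then show "\<exists>e\<in>- bad. e \<noteq> 0 \<and> dist e 0 < d" by (auto simp: dist_commute)
  qed
  ultimately have "0 = macdonald_op n q h r (F n p) \<zeta> - \<epsilon> * F n p \<zeta>"
    using tendsto_unique[OF _ tendsto_const] by blast
  then show ?thesis by simp
qed

lemma F_is_macdonald:
  assumes p: "part n p" "n \<ge> 1"
    and lam: "is_partition n k lam" "\<And>i. i \<in> {1..n} \<Longrightarrow> p i = int (lam (Suc n - i))"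
  shows "is_macdonald n q h k lam (\<lambda>x. F n p x / lead n p)"
proof -
  have k: "sum p {1..n} = int k"
  proof -
    have "sum p {1..n} = (\<Sum>i\<in>{1..n}. int (lam (Suc n - i)))" by (rule sum.cong) (use lam in auto)
    also have "\<dots> = int (\<Sum>i\<in>{1..n}. lam (Suc n - i))" by simp
    also have "(\<Sum>i\<in>{1..n}. lam (Suc n - i)) = k" using sum_refl_tail[of 0 n lam] lam(1) by (simp add: is_partition_def)
    finally show ?thesis .
  qed
  have fin: "finite {\<kappa>. is_partition n k \<kappa>}"
    by (rule finite_subset[OF _ finite_compositions[of n k]]) (auto simp: is_partition_compositions)
  have "F n p x / lead n p = (\<Sum>\<mu>\<in>{\<mu>. is_partition n k \<mu> \<and> dominated n \<mu> lam}. monomial_coef n p \<mu> / lead n p * monomial_sym n \<mu> x)" for x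
  proof -
    have "F n p x = (\<Sum>\<kappa>\<in>{\<kappa>. is_partition n k \<kappa>}. monomial_coef n p \<kappa> * monomial_sym n \<kappa> x)"
      unfolding F_monomial_coef[OF p k] by (rule sum_compositions_symmetric) (rule monomial_coef_permute[OF p k])
    also have "\<dots> = (\<Sum>\<mu>\<in>{\<mu>. is_partition n k \<mu> \<and> dominated n \<mu> lam}. monomial_coef n p \<mu> * monomial_sym n \<mu> x)"
      by (rule sum.mono_neutral_right[OF fin]) (use monomial_coef_dominated[OF p k lam] in auto)
    finally show ?thesis by (simp add: sum_divide_distrib)
  qed
  moreover have "monomial_coef n p lam / lead n p = 1" using monomial_coef_lead[OF p k lam] lead_nz[OF p(1)] by simp
  moreover have "\<exists>E. \<forall>\<zeta>. inj_on \<zeta> {1..n} \<longrightarrow> macdonald_op n q h r (\<lambda>x. F n p x / lead n p) \<zeta> = E * (F n p \<zeta> / lead n p)" for r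
  proof -
    obtain \<epsilon> where \<epsilon>: "\<And>x. q_generic n x \<Longrightarrow> macdonald_op n q h r (F n p) x = \<epsilon> * F n p x" using F_eigen[OF p(1)] by blast
    have "macdonald_op n q h r (\<lambda>x. F n p x / lead n p) \<zeta> = \<epsilon> * (F n p \<zeta> / lead n p)" if "inj_on \<zeta> {1..n}" for \<zeta>
      using macdonald_op_scale[of n q h r "inverse (lead n p)" "F n p" \<zeta>] eigen_all_distinct[OF \<epsilon> that] by (simp add: divide_inverse mult_ac)
    then show ?thesis by blast
  qed
  ultimately show ?thesis unfolding is_macdonald_def by (intro conjI exI[of _ "\<lambda>\<mu>. monomial_coef n p \<mu> / lead n p"]) blast+
qed

end

theorem proposition2p11:
  fixes n k :: nat and q h :: complex and a :: "nat \<Rightarrow> complex" and lam :: "nat \<Rightarrow> nat"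
  assumes "n \<ge> 1"
    and "generic q h"
    and "is_partition n k lam"
    and "\<And>i. i \<in> {1..n} \<Longrightarrow> a i \<noteq> 0"
    and "\<And>i. i \<in> {1..<n} \<Longrightarrow>
           a (Suc i) / a i = q powi (int (ascending n lam (Suc i)) - int (ascending n lam i)) * h"
  shows "\<exists>x. fixed_point n a x \<and>
    (\<exists>P c. is_macdonald n q h k lam P \<and> c \<noteq> 0 \<and>
      (\<forall>\<zeta>. (\<forall>i\<in>{1..n}. \<zeta> i \<noteq> 0 \<and> qtheta (a i * \<zeta> i) q \<noteq> 0) \<longrightarrow>
        (a n = q ^ lam 1 \<longrightarrow> vertex_normalized n q h a x \<zeta> = c * P \<zeta>) \<and>
        vertex_normalized n q h a x \<zeta> =
          c * (\<Prod>i=1..n. qtheta (q ^ ascending n lam i * h powi (int i - int n) * \<zeta> i) q /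
                         qtheta (a i * \<zeta> i) q) * P \<zeta>))"
proof -
  interpret macdonald_params q h by unfold_locales (rule assms(2))
  define \<mu> where "\<mu> = ascending n lam"
  define p where "p i = int (\<mu> i)" for i
  have \<mu>: "\<mu> i = lam (Suc n - i)" for i by (simp add: \<mu>_def ascending_def)
  have p: "part n p"
    unfolding part_def
  proof (intro conjI allI ballI impI)
    fix i assume i: "i \<in> {1..<n}"
    then have "Suc n - i = Suc (n - i)" "n - i \<in> {1..<n}" by auto
    then have "lam (Suc n - i) \<le> lam (n - i)" using assms(3) by (auto simp: is_partition_def)
    then show "p i \<le> p (Suc i)" by (simp add: p_def \<mu>)
  next
    fix i assume "i \<notin> {1..n}"
    then have "Suc n - i \<notin> {1..n}" by auto
    then show "p i = 0" using assms(3) by (auto simp: p_def \<mu> is_partition_def)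
  qed (simp add: p_def)
  have a1: "a i = a 1 * (q powi (p i - p 1) * h powi (int i - 1))" if "i \<in> {1..n}" for i
  proof -
    have "1 \<le> i" "i \<le> n" using that by auto
    then show ?thesis
    proof (induction rule: dec_induct)
      case (step m)
      have "a (Suc m) / a m = q powi (p (Suc m) - p m) * h" using assms(5)[of m] step by (simp add: p_def \<mu>_def)
      then have "a (Suc m) = q powi (p (Suc m) - p m) * h * a m" using assms(4)[of m] step by (simp add: field_simps)
      also have "\<dots> = a 1 * ((q powi (p (Suc m) - p m) * q powi (p m - p 1)) * (h * h powi (int m - 1)))"
        using step by simp
      also have "q powi (p (Suc m) - p m) * q powi (p m - p 1) = q powi (p (Suc m) - p 1)" using q0 by (simp add: power_int_add[symmetric])
      also have "h * h powi (int m - 1) = h powi (int (Suc m) - 1)" using h0 by (simp add: power_int_diff)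
      finally show ?case .
    qed simp
  qed
  have ar: "a j / a l = q powi (p j - p l) * h powi (int j - int l)" if "j \<in> {1..n}" "l \<in> {1..n}" for j l
  proof -
    have "a 1 \<noteq> 0" using assms(1,4) by simp
    moreover have "q powi (p j - p 1) / q powi (p l - p 1) = q powi (p j - p l)" "h powi (int j - 1) / h powi (int l - 1) = h powi (int j - int l)"
      using q0 h0 by (simp_all add: power_int_diff[symmetric])
    ultimately show ?thesis unfolding a1[OF that(1)] a1[OF that(2)]
      by (simp add: times_divide_times_eq[symmetric])
  qed
  \<comment> \<open>The chain of the sets of the first \<open>i\<close> weights.\<close>
  define x where "x = (\<lambda>(i::nat) k. 1 / a k)"
  have inj: "j = l" if "j \<in> {1..n}" "l \<in> {1..n}" "a j = a l" for j l
    using ar[OF that(1,2)] assms(4)[OF that(2)] that(3) qh_one[of "p j - p l" "int j - int l"] by auto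
  have fp: "fixed_point n a x"
    unfolding fixed_point_def
  proof (intro conjI ballI)
    fix i assume i: "i \<in> {1..<n}"
    show "inj_on (x i) {1..i}"
      by (rule inj_onI) (use inj i in \<open>auto simp: x_def\<close>)
    show "x i ` {1..i} \<subseteq> x (Suc i) ` {1..Suc i}" by (auto simp: x_def)
  qed (simp add: x_def)
  define P where "P \<zeta> = F n p \<zeta> / lead n p" for \<zeta>
  have mac: "is_macdonald n q h k lam P"
    unfolding P_def by (rule F_is_macdonald[OF p assms(1,3)]) (simp add: p_def \<mu>)
  \<comment> \<open>The scalar from \<open>qtheta_shift_power\<close> at \<open>h powi (int i - int n) * \<zeta> i\<close>.\<close>
  define b where "b i = (h powi (int i - int n)) ^ \<mu> i * q ^ (\<mu> i choose 2) * (- 1) ^ \<mu> i" for i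
  define c where "c = (\<Prod>i=1..n. b i)"
  have c: "c \<noteq> 0" using q0 h0 by (simp add: c_def b_def)
  have main: "vertex_normalized n q h a x \<zeta> = c * (\<Prod>i=1..n. qtheta (q ^ \<mu> i * h powi (int i - int n) * \<zeta> i) q / qtheta (a i * \<zeta> i) q) * P \<zeta>"
    if \<zeta>: "\<forall>i\<in>{1..n}. \<zeta> i \<noteq> 0 \<and> qtheta (a i * \<zeta> i) q \<noteq> 0" for \<zeta>
  proof -
    have V: "vertex n q h \<zeta> x * (\<Prod>i=1..n. \<zeta> i ^ \<mu> i) = P \<zeta>"
    proof -
      have "vertex n q h \<zeta> x * lead n p * (\<Prod>i\<in>{1..n}. \<zeta> i powi p i) = F n p \<zeta>"
        unfolding x_def by (rule vertex_F[OF assms(1) p ar]) (use \<zeta> in auto)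
      then show ?thesis using lead_nz[OF p] by (simp add: P_def p_def field_simps)
    qed
    have th: "qtheta (h powi (int i - int n) * \<zeta> i) q = qtheta (q ^ \<mu> i * h powi (int i - int n) * \<zeta> i) q * (b i * \<zeta> i ^ \<mu> i)" if "i \<in> {1..n}" for i
      using qtheta_shift_power[OF q0 qlt1, of "h powi (int i - int n) * \<zeta> i" "\<mu> i"] \<zeta> that h0
      by (simp add: b_def power_mult_distrib mult_ac)
    have "(\<Prod>i=1..n. qtheta (h powi (int i - int n) * \<zeta> i) q / qtheta (a i * \<zeta> i) q) =
       (\<Prod>i=1..n. b i * (qtheta (q ^ \<mu> i * h powi (int i - int n) * \<zeta> i) q / qtheta (a i * \<zeta> i) q) * \<zeta> i ^ \<mu> i)"
      by (rule prod.cong) (simp_all add: th)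
    also have "\<dots> = c * (\<Prod>i=1..n. qtheta (q ^ \<mu> i * h powi (int i - int n) * \<zeta> i) q / qtheta (a i * \<zeta> i) q) * (\<Prod>i=1..n. \<zeta> i ^ \<mu> i)"
      by (simp only: c_def prod.distrib)
    finally show ?thesis unfolding vertex_normalized_def V[symmetric] by (simp only: mult_ac)
  qed
  have norm: "vertex_normalized n q h a x \<zeta> = c * P \<zeta>"
    if \<zeta>: "\<forall>i\<in>{1..n}. \<zeta> i \<noteq> 0 \<and> qtheta (a i * \<zeta> i) q \<noteq> 0" and an: "a n = q ^ lam 1" for \<zeta>
  proof -
    \<comment> \<open>With this normalization of the weights the theta functions cancel completely.\<close>
    have "q ^ \<mu> i * h powi (int i - int n) = a i" if i: "i \<in> {1..n}" for i
    proof -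
      have "a i = q powi (p i - p n) * h powi (int i - int n) * a n"
        using ar[OF i, of n] assms(1) assms(4)[of n] by (simp add: field_simps)
      also have "a n = q powi (p n)" using an by (simp add: p_def \<mu>)
      finally show ?thesis using q0 by (simp add: power_int_diff p_def)
    qed
    then have "(\<Prod>i=1..n. qtheta (q ^ \<mu> i * h powi (int i - int n) * \<zeta> i) q / qtheta (a i * \<zeta> i) q) = 1"
      using \<zeta> by (intro prod.neutral) auto
    then show ?thesis using main[OF \<zeta>] by simp
  qed
  show ?thesis
    using fp mac c main norm unfolding \<mu>_def by blast
qed

end
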